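(* Let $R$ be an associative ring and let $\mathcal{L}$ be a class of left $R$-modules that is injectively coresolving and special preenveloping in $R$-Mod. Then every complex of left $R$-modules has a special $\widetilde{\mathcal{L}}$-preenvelope in the category $\mathcal{C}(R)$ of complexes of left $R$-modules.
   Context: $R$-Mod is the category of left $R$-modules and $\mathcal{C}(R)$ is the category of ($\mathbb{Z}$-indexed, unbounded) complexes of left $R$-modules with chain maps as morphisms. All classes of modules are assumed closed under isomorphisms and to contain the zero module. For a complex $(C,\delta)$, with $\delta_n: C_n\to C_{n-1}$, put $\mathrm{Z}_n(C)=\ker(\delta_n)$. An $\mathcal{L}$ complex is an exact complex $C$ with $\mathrm{Z}_i(C)\in\mathcal{L}$ for all $i\in\mathbb{Z}$; $\widetilde{\mathcal{L}}$ is the class of all $\mathcal{L}$ complexes. $\mathrm{Ext}^1$ in $\mathcal{C}(R)$ is the first right derived functor of $\mathrm{Hom}$ (chain maps) in the abelian category $\mathcal{C}(R)$. For a class $\mathcal{X}$ of objects in an abelian category, a special $\mathcal{X}$-preenvelope of an object $M$ is a monomorphism $f: M\to X$ with $X\in\mathcal{X}$ and $\mathrm{Ext}^1(\operatorname{coker} f, X')=0$ for all $X'\in\mathcal{X}$. A class $\mathcal{L}$ of modules is special preenveloping if every module has a special $\mathcal{L}$-preenvelope. A class of modules is injectively coresolving if it is closed under extensions and cokernels of injections (between modules of the class) and contains all injective modules. *)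

theory Defs
  imports "HOL-Algebra.Module" "HOL-Algebra.Elementary_Groups"
begin

unbundle cardinal_syntax

section \<open>Homological notions in a category with abelian groups of morphisms\<close>

text \<open>
  Morphisms do not record their source and target. Therefore \<open>Comp\<close> gets the source of the
  composite and \<open>Plus\<close>, \<open>Zero\<close> get source and target as arguments:
  \<open>Comp K A g f\<close> is the composite of \<open>f : A \<rightarrow> B\<close> followed by \<open>g : B \<rightarrow> C\<close>.
\<close>

record ('o, 'f) preadditive =
  Obj :: "'o set"
  Hom :: "'o \<Rightarrow> 'o \<Rightarrow> 'f set"
  Id :: "'o \<Rightarrow> 'f"
  Comp :: "'o \<Rightarrow> 'f \<Rightarrow> 'f \<Rightarrow> 'f"
  Plus :: "'o \<Rightarrow> 'o \<Rightarrow> 'f \<Rightarrow> 'f \<Rightarrow> 'f"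
  Zero :: "'o \<Rightarrow> 'o \<Rightarrow> 'f"

definition isomorphic :: "('o, 'f) preadditive \<Rightarrow> 'o \<Rightarrow> 'o \<Rightarrow> bool" where
  "isomorphic K A B \<longleftrightarrow> (\<exists>f \<in> Hom K A B. \<exists>g \<in> Hom K B A.
     Comp K A g f = Id K A \<and> Comp K B f g = Id K B)"

definition monic :: "('o, 'f) preadditive \<Rightarrow> 'o \<Rightarrow> 'o \<Rightarrow> 'f \<Rightarrow> bool" where
  "monic K A B f \<longleftrightarrow> f \<in> Hom K A B \<and>
     (\<forall>T \<in> Obj K. \<forall>u \<in> Hom K T A. \<forall>v \<in> Hom K T A. Comp K T f u = Comp K T f v \<longrightarrow> u = v)"

definition epic :: "('o, 'f) preadditive \<Rightarrow> 'o \<Rightarrow> 'o \<Rightarrow> 'f \<Rightarrow> bool" where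
  "epic K A B f \<longleftrightarrow> f \<in> Hom K A B \<and>
     (\<forall>T \<in> Obj K. \<forall>u \<in> Hom K B T. \<forall>v \<in> Hom K B T. Comp K A u f = Comp K A v f \<longrightarrow> u = v)"

definition is_kernel :: "('o, 'f) preadditive \<Rightarrow> 'o \<Rightarrow> 'o \<Rightarrow> 'f \<Rightarrow> 'o \<Rightarrow> 'f \<Rightarrow> bool" where
  "is_kernel K A B f N k \<longleftrightarrow> N \<in> Obj K \<and> k \<in> Hom K N A \<and> Comp K N f k = Zero K N B \<and>
     (\<forall>T \<in> Obj K. \<forall>u \<in> Hom K T A. Comp K T f u = Zero K T B \<longrightarrow>
        (\<exists>!w. w \<in> Hom K T N \<and> Comp K T k w = u))"

definition is_cokernel :: "('o, 'f) preadditive \<Rightarrow> 'o \<Rightarrow> 'o \<Rightarrow> 'f \<Rightarrow> 'o \<Rightarrow> 'f \<Rightarrow> bool" where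
  "is_cokernel K A B f Q q \<longleftrightarrow> Q \<in> Obj K \<and> q \<in> Hom K B Q \<and> Comp K A q f = Zero K A Q \<and>
     (\<forall>T \<in> Obj K. \<forall>u \<in> Hom K B T. Comp K A u f = Zero K A T \<longrightarrow>
        (\<exists>!w. w \<in> Hom K Q T \<and> Comp K B w q = u))"

text \<open>Exactness of \<open>A \<rightarrow> B \<rightarrow> C\<close> at \<open>B\<close>: the kernel of \<open>g\<close> is the image of \<open>f\<close>.\<close>

definition exact_at ::
    "('o, 'f) preadditive \<Rightarrow> 'o \<Rightarrow> 'f \<Rightarrow> 'o \<Rightarrow> 'f \<Rightarrow> 'o \<Rightarrow> bool" where
  "exact_at K A f B g C \<longleftrightarrow> f \<in> Hom K A B \<and> g \<in> Hom K B C \<and>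
     (\<exists>N k e. is_kernel K B C g N k \<and> epic K A N e \<and> Comp K A k e = f)"

definition short_exact ::
    "('o, 'f) preadditive \<Rightarrow> 'o \<Rightarrow> 'f \<Rightarrow> 'o \<Rightarrow> 'f \<Rightarrow> 'o \<Rightarrow> bool" where
  "short_exact K A f B g C \<longleftrightarrow> monic K A B f \<and> exact_at K A f B g C \<and> epic K B C g"

definition projective_obj :: "('o, 'f) preadditive \<Rightarrow> 'o \<Rightarrow> bool" where
  "projective_obj K P \<longleftrightarrow> P \<in> Obj K \<and>
     (\<forall>A \<in> Obj K. \<forall>B \<in> Obj K. \<forall>e f. epic K A B e \<and> f \<in> Hom K P B \<longrightarrow>
        (\<exists>g \<in> Hom K P A. Comp K P e g = f))"

definition injective_obj :: "('o, 'f) preadditive \<Rightarrow> 'o \<Rightarrow> bool" where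
  "injective_obj K I \<longleftrightarrow> I \<in> Obj K \<and>
     (\<forall>A \<in> Obj K. \<forall>B \<in> Obj K. \<forall>m f. monic K A B m \<and> f \<in> Hom K A I \<longrightarrow>
        (\<exists>g \<in> Hom K B I. Comp K A g m = f))"

text \<open>\<open>\<dots> \<rightarrow> P 2 \<rightarrow> P 1 \<rightarrow> P 0 \<rightarrow> A \<rightarrow> 0\<close> with \<open>d n : P (n + 1) \<rightarrow> P n\<close> and augmentation \<open>e\<close>.\<close>

definition projective_resolution ::
    "('o, 'f) preadditive \<Rightarrow> 'o \<Rightarrow> (nat \<Rightarrow> 'o) \<Rightarrow> (nat \<Rightarrow> 'f) \<Rightarrow> 'f \<Rightarrow> bool" where
  "projective_resolution K A P d e \<longleftrightarrow>
     (\<forall>n. projective_obj K (P n)) \<and> epic K (P 0) A e \<and>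
     exact_at K (P 1) (d 0) (P 0) e A \<and>
     (\<forall>n. exact_at K (P (Suc (Suc n))) (d (Suc n)) (P (Suc n)) (d n) (P n))"

definition hom_group :: "('o, 'f) preadditive \<Rightarrow> 'o \<Rightarrow> 'o \<Rightarrow> 'f monoid" where
  "hom_group K A B = \<lparr>carrier = Hom K A B, monoid.mult = Plus K A B, one = Zero K A B\<rparr>"

text \<open>
  The first cohomology group of the cochain complex \<open>Hom(P, B)\<close>, and the first right derived
  functor \<open>Ext1 K A B\<close> of \<open>Hom(-, B)\<close> at \<open>A\<close>, computed from a chosen projective resolution of \<open>A\<close>.
\<close>

definition hom_cocycles1 ::
    "('o, 'f) preadditive \<Rightarrow> (nat \<Rightarrow> 'o) \<Rightarrow> (nat \<Rightarrow> 'f) \<Rightarrow> 'o \<Rightarrow> 'f set" where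
  "hom_cocycles1 K P d B = {g \<in> Hom K (P 1) B. Comp K (P 2) g (d 1) = Zero K (P 2) B}"

definition hom_coboundaries1 ::
    "('o, 'f) preadditive \<Rightarrow> (nat \<Rightarrow> 'o) \<Rightarrow> (nat \<Rightarrow> 'f) \<Rightarrow> 'o \<Rightarrow> 'f set" where
  "hom_coboundaries1 K P d B = (\<lambda>h. Comp K (P 1) h (d 0)) ` Hom K (P 0) B"

definition hom_cohomology1 ::
    "('o, 'f) preadditive \<Rightarrow> (nat \<Rightarrow> 'o) \<Rightarrow> (nat \<Rightarrow> 'f) \<Rightarrow> 'o \<Rightarrow> 'f set monoid" where
  "hom_cohomology1 K P d B =
     (hom_group K (P 1) B)\<lparr>carrier := hom_cocycles1 K P d B\<rparr> Mod hom_coboundaries1 K P d B"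

definition Ext1 :: "('o, 'f) preadditive \<Rightarrow> 'o \<Rightarrow> 'o \<Rightarrow> 'f set monoid" where
  "Ext1 K A B =
     (let (P, d, e) = (SOME (P, d, e). projective_resolution K A P d e)
      in hom_cohomology1 K P d B)"

definition special_preenvelope ::
    "('o, 'f) preadditive \<Rightarrow> 'o set \<Rightarrow> 'o \<Rightarrow> 'o \<Rightarrow> 'f \<Rightarrow> bool" where
  "special_preenvelope K \<X> M X f \<longleftrightarrow> X \<in> \<X> \<and> monic K M X f \<and>
     (\<exists>Q q. is_cokernel K M X f Q q \<and> (\<forall>X' \<in> \<X>. trivial_group (Ext1 K Q X')))"

definition special_preenveloping :: "('o, 'f) preadditive \<Rightarrow> 'o set \<Rightarrow> bool" where
  "special_preenveloping K \<X> \<longleftrightarrow> (\<forall>M \<in> Obj K. \<exists>X f. special_preenvelope K \<X> M X f)"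

definition injectively_coresolving :: "('o, 'f) preadditive \<Rightarrow> 'o set \<Rightarrow> bool" where
  "injectively_coresolving K \<X> \<longleftrightarrow>
     (\<forall>A \<in> \<X>. \<forall>B \<in> Obj K. \<forall>C \<in> \<X>. \<forall>f g. short_exact K A f B g C \<longrightarrow> B \<in> \<X>) \<and>
     (\<forall>A \<in> \<X>. \<forall>B \<in> \<X>. \<forall>f Q q. monic K A B f \<and> is_cokernel K A B f Q q \<longrightarrow> Q \<in> \<X>) \<and>
     (\<forall>I. injective_obj K I \<longrightarrow> I \<in> \<X>)"


section \<open>Left modules\<close>

text \<open>
  The locale \<open>module\<close> of the library is restricted to commutative rings; only its record type is
  used. The ring fields \<open>mult\<close> and \<open>one\<close> of that record carry no meaning for a module.
\<close>

locale left_module = R?: ring R + M?: abelian_group M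
  for R :: "('r, 'x) ring_scheme" (structure) and M :: "('r, 'm) module" (structure) +
  assumes smult_closed: "\<lbrakk>a \<in> carrier R; x \<in> carrier M\<rbrakk> \<Longrightarrow> a \<odot>\<^bsub>M\<^esub> x \<in> carrier M"
    and smult_l_distr: "\<lbrakk>a \<in> carrier R; b \<in> carrier R; x \<in> carrier M\<rbrakk> \<Longrightarrow>
      (a \<oplus>\<^bsub>R\<^esub> b) \<odot>\<^bsub>M\<^esub> x = a \<odot>\<^bsub>M\<^esub> x \<oplus>\<^bsub>M\<^esub> b \<odot>\<^bsub>M\<^esub> x"
    and smult_r_distr: "\<lbrakk>a \<in> carrier R; x \<in> carrier M; y \<in> carrier M\<rbrakk> \<Longrightarrow>
      a \<odot>\<^bsub>M\<^esub> (x \<oplus>\<^bsub>M\<^esub> y) = a \<odot>\<^bsub>M\<^esub> x \<oplus>\<^bsub>M\<^esub> a \<odot>\<^bsub>M\<^esub> y"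
    and smult_assoc: "\<lbrakk>a \<in> carrier R; b \<in> carrier R; x \<in> carrier M\<rbrakk> \<Longrightarrow>
      (a \<otimes>\<^bsub>R\<^esub> b) \<odot>\<^bsub>M\<^esub> x = a \<odot>\<^bsub>M\<^esub> (b \<odot>\<^bsub>M\<^esub> x)"
    and smult_one: "x \<in> carrier M \<Longrightarrow> \<one>\<^bsub>R\<^esub> \<odot>\<^bsub>M\<^esub> x = x"

text \<open>Homomorphisms are extensional functions, so that equal homomorphisms are equal terms.\<close>

definition mod_hom ::
    "('r, 'x) ring_scheme \<Rightarrow> ('r, 'm) module \<Rightarrow> ('r, 'm) module \<Rightarrow> ('m \<Rightarrow> 'm) set" where
  "mod_hom R M N = {f \<in> carrier M \<rightarrow>\<^sub>E carrier N.
     (\<forall>x \<in> carrier M. \<forall>y \<in> carrier M. f (x \<oplus>\<^bsub>M\<^esub> y) = f x \<oplus>\<^bsub>N\<^esub> f y) \<and>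
     (\<forall>a \<in> carrier R. \<forall>x \<in> carrier M. f (a \<odot>\<^bsub>M\<^esub> x) = a \<odot>\<^bsub>N\<^esub> f x)}"

text \<open>
  The type \<open>'m\<close> is the universe of the elements of modules, and the sets of this universe are the
  subsets of \<open>'m\<close> of cardinality less than that of \<open>'m\<close>. (If \<open>'m\<close> is the type of all sets of a model
  of set theory, with its subsets as classes, these are the subsets that are sets and not proper
  classes.)
\<close>

definition small :: "'m set \<Rightarrow> bool" where
  "small A \<longleftrightarrow> |A| <o |UNIV :: 'm set|"

text \<open>
  The constructions of homological algebra need a universe that is uncountable and closed under
  unions of small families of small sets, and a ring of smaller size than the universe. Every
  uncountable successor cardinal above the size of the ring is of this form; closure under power
  sets is not required.
\<close>

definition universe_for :: "'m itself \<Rightarrow> ('r, 'x) ring_scheme \<Rightarrow> bool" where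
  "universe_for _ R \<longleftrightarrow> natLeq <o |UNIV :: 'm set| \<and> regularCard |UNIV :: 'm set| \<and>
     |carrier R| <o |UNIV :: 'm set|"

definition R_Mod :: "('r, 'x) ring_scheme \<Rightarrow> (('r, 'm) module, 'm \<Rightarrow> 'm) preadditive" where
  "R_Mod R =
    \<lparr>Obj = {M. left_module R M \<and> small (carrier M)},
     Hom = mod_hom R,
     Id = (\<lambda>M. \<lambda>x\<in>carrier M. x),
     Comp = (\<lambda>M g f. \<lambda>x\<in>carrier M. g (f x)),
     Plus = (\<lambda>M N f g. \<lambda>x\<in>carrier M. f x \<oplus>\<^bsub>N\<^esub> g x),
     Zero = (\<lambda>M N. \<lambda>x\<in>carrier M. \<zero>\<^bsub>N\<^esub>)\<rparr>"

text \<open>Classes of modules are closed under isomorphism and contain the zero module.\<close>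

definition module_class :: "('r, 'x) ring_scheme \<Rightarrow> ('r, 'm) module set \<Rightarrow> bool" where
  "module_class R \<L> \<longleftrightarrow> \<L> \<subseteq> Obj (R_Mod R) \<and>
     (\<forall>M \<in> \<L>. \<forall>N \<in> Obj (R_Mod R). isomorphic (R_Mod R) M N \<longrightarrow> N \<in> \<L>) \<and>
     (\<forall>M \<in> Obj (R_Mod R). carrier M = {\<zero>\<^bsub>M\<^esub>} \<longrightarrow> M \<in> \<L>)"


section \<open>Complexes of left modules\<close>

record ('r, 'm) mod_complex =
  cmod :: "int \<Rightarrow> ('r, 'm) module"
  cdiff :: "int \<Rightarrow> 'm \<Rightarrow> 'm"

definition is_complex :: "('r, 'x) ring_scheme \<Rightarrow> ('r, 'm) mod_complex \<Rightarrow> bool" where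
  "is_complex R C \<longleftrightarrow>
     (\<forall>n. cmod C n \<in> Obj (R_Mod R)) \<and>
     (\<forall>n. cdiff C n \<in> mod_hom R (cmod C n) (cmod C (n - 1))) \<and>
     (\<forall>n. \<forall>x \<in> carrier (cmod C n). cdiff C (n - 1) (cdiff C n x) = \<zero>\<^bsub>cmod C (n - 2)\<^esub>)"

definition chain_map ::
    "('r, 'x) ring_scheme \<Rightarrow> ('r, 'm) mod_complex \<Rightarrow> ('r, 'm) mod_complex \<Rightarrow> (int \<Rightarrow> 'm \<Rightarrow> 'm) set"
  where
  "chain_map R C D = {f. \<forall>n. f n \<in> mod_hom R (cmod C n) (cmod D n) \<and>
     (\<forall>x \<in> carrier (cmod C n). cdiff D n (f n x) = f (n - 1) (cdiff C n x))}"

definition Complexes ::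
    "('r, 'x) ring_scheme \<Rightarrow> (('r, 'm) mod_complex, int \<Rightarrow> 'm \<Rightarrow> 'm) preadditive" where
  "Complexes R =
    \<lparr>Obj = {C. is_complex R C},
     Hom = chain_map R,
     Id = (\<lambda>C n. Id (R_Mod R) (cmod C n)),
     Comp = (\<lambda>C g f n. Comp (R_Mod R) (cmod C n) (g n) (f n)),
     Plus = (\<lambda>C D f g n. Plus (R_Mod R) (cmod C n) (cmod D n) (f n) (g n)),
     Zero = (\<lambda>C D n. Zero (R_Mod R) (cmod C n) (cmod D n))\<rparr>"

definition cycles :: "('r, 'm) mod_complex \<Rightarrow> int \<Rightarrow> ('r, 'm) module" where
  "cycles C n = (cmod C n)\<lparr>carrier :=
     {x \<in> carrier (cmod C n). cdiff C n x = \<zero>\<^bsub>cmod C (n - 1)\<^esub>}\<rparr>"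

definition exact_complex :: "('r, 'm) mod_complex \<Rightarrow> bool" where
  "exact_complex C \<longleftrightarrow>
     (\<forall>n. carrier (cycles C n) = cdiff C (n + 1) ` carrier (cmod C (n + 1)))"

definition tilde ::
    "('r, 'x) ring_scheme \<Rightarrow> ('r, 'm) module set \<Rightarrow> ('r, 'm) mod_complex set" where
  "tilde R \<L> = {C. is_complex R C \<and> exact_complex C \<and> (\<forall>i. cycles C i \<in> \<L>)}"

end

theory Submission
  imports Defs "HOL-Library.Countable_Set"
begin

text \<open>
  Say that maps extend from \<open>Q\<close> to \<open>B\<close> if for every epimorphism \<open>M \<rightarrow> Q\<close> with kernel \<open>K\<close>, every map
  \<open>K \<rightarrow> B\<close> extends to \<open>M\<close>; this is the vanishing of \<open>Ext\<^sup>1(Q, B)\<close>.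

  Given a complex \<open>C\<close>, attach cells until every cycle is a boundary. This embeds \<open>C\<close> into an exact
  complex \<open>E\<close> such that \<open>E / C\<close> is semifree, so that maps extend from \<open>E / C\<close> to every exact complex.

  Choose special preenvelopes \<open>Z\<^sub>n(E) \<rightarrow> L\<^sub>n\<close> with cokernels \<open>A\<^sub>n\<close>. The extensions
  \<open>0 \<rightarrow> Z\<^sub>n(E) \<rightarrow> E\<^sub>n \<rightarrow> Z\<^sub>n\<^sub>-\<^sub>1(E) \<rightarrow> 0\<close> embed into extensions \<open>0 \<rightarrow> L\<^sub>n \<rightarrow> Y\<^sub>n \<rightarrow> L\<^sub>n\<^sub>-\<^sub>1 \<rightarrow> 0\<close>: the
  obstruction lies in \<open>Ext\<^sup>2(A\<^sub>n\<^sub>-\<^sub>1, L\<^sub>n)\<close>, and it vanishes because every module embeds into a member of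
  the class and the class is closed under cokernels of injections. The \<open>Y\<^sub>n\<close> form an exact complex
  with cycles \<open>L\<^sub>n\<close> that contains \<open>E\<close>, and \<open>Y / E\<close> is exact with cycles \<open>A\<^sub>n\<close>, so that maps extend from
  \<open>Y / E\<close> to every exact complex with cycles in the class. Hence \<open>C \<rightarrow> Y\<close> is a special preenvelope.
\<close>

section \<open>Linear maps\<close>

context ring begin

text \<open>The hypothesis on the class concerns modules, and a complex is governed by its modules
  of cycles only if it is exact. Therefore the homology of \<open>C\<close> is killed before any
  preenvelope is chosen. The two layers of \<open>Y / C\<close> need different reasons: maps extend
  from \<open>E / C\<close> because its cells are attached one after another and the target is
  exact, and from \<open>Y / E\<close> because its cycles are the \<open>A\<^sub>n\<close>. The
  property passes to \<open>Y / C\<close> since it is closed under extensions.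

  Ext is defined from one chosen projective resolution. Its vanishing is turned into the extension
  of maps once, for modules, and recovered from it once, for complexes; in between there are only
  pushouts, pullbacks and lifts of elements.

  Every object has to live on the type \<open>'m\<close>. Products, free modules and cells have
  other element types; they are carried back as quotients, possibly by zero. For this they must have
  fewer elements than \<open>'m\<close>, and here the regularity and uncountability of the universe
  enter.\<close>

lemma left_module_abelian: "left_module R M \<Longrightarrow> abelian_group M"
  by (simp add: left_module_def)

text \<open>Later proofs handle families of modules indexed by degree, for which the interpretation
  of a locale for each member would be clumsy. The laws are collected as rules that depend only on
  \<open>left_module R M\<close> and are selected by number.\<close>

lemma left_module_simps:
  assumes "left_module R M"
  shows "x \<in> carrier M \<Longrightarrow> y \<in> carrier M \<Longrightarrow> x \<oplus>\<^bsub>M\<^esub> y \<in> carrier M"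
    and "\<zero>\<^bsub>M\<^esub> \<in> carrier M"
    and "x \<in> carrier M \<Longrightarrow> \<ominus>\<^bsub>M\<^esub> x \<in> carrier M"
    and "x \<in> carrier M \<Longrightarrow> y \<in> carrier M \<Longrightarrow> x \<ominus>\<^bsub>M\<^esub> y \<in> carrier M"
    and "a \<in> carrier R \<Longrightarrow> x \<in> carrier M \<Longrightarrow> a \<odot>\<^bsub>M\<^esub> x \<in> carrier M"
    and "x \<in> carrier M \<Longrightarrow> y \<in> carrier M \<Longrightarrow> z \<in> carrier M \<Longrightarrow>
      (x \<oplus>\<^bsub>M\<^esub> y) \<oplus>\<^bsub>M\<^esub> z = x \<oplus>\<^bsub>M\<^esub> (y \<oplus>\<^bsub>M\<^esub> z)"
    and "x \<in> carrier M \<Longrightarrow> \<zero>\<^bsub>M\<^esub> \<oplus>\<^bsub>M\<^esub> x = x"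
    and "x \<in> carrier M \<Longrightarrow> x \<oplus>\<^bsub>M\<^esub> \<zero>\<^bsub>M\<^esub> = x"
    and "x \<in> carrier M \<Longrightarrow> \<ominus>\<^bsub>M\<^esub> x \<oplus>\<^bsub>M\<^esub> x = \<zero>\<^bsub>M\<^esub>"
    and "x \<in> carrier M \<Longrightarrow> x \<oplus>\<^bsub>M\<^esub> \<ominus>\<^bsub>M\<^esub> x = \<zero>\<^bsub>M\<^esub>"
    and "x \<in> carrier M \<Longrightarrow> y \<in> carrier M \<Longrightarrow> x \<oplus>\<^bsub>M\<^esub> (\<ominus>\<^bsub>M\<^esub> x \<oplus>\<^bsub>M\<^esub> y) = y"
    and "x \<in> carrier M \<Longrightarrow> y \<in> carrier M \<Longrightarrow> \<ominus>\<^bsub>M\<^esub> x \<oplus>\<^bsub>M\<^esub> (x \<oplus>\<^bsub>M\<^esub> y) = y"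
    and "x \<in> carrier M \<Longrightarrow> y \<in> carrier M \<Longrightarrow> \<ominus>\<^bsub>M\<^esub> (x \<oplus>\<^bsub>M\<^esub> y) = \<ominus>\<^bsub>M\<^esub> x \<oplus>\<^bsub>M\<^esub> \<ominus>\<^bsub>M\<^esub> y"
    and "x \<in> carrier M \<Longrightarrow> \<ominus>\<^bsub>M\<^esub> (\<ominus>\<^bsub>M\<^esub> x) = x"
    and "\<ominus>\<^bsub>M\<^esub> \<zero>\<^bsub>M\<^esub> = \<zero>\<^bsub>M\<^esub>"
    and "x \<ominus>\<^bsub>M\<^esub> y = x \<oplus>\<^bsub>M\<^esub> \<ominus>\<^bsub>M\<^esub> y"
    and "a \<in> carrier R \<Longrightarrow> x \<in> carrier M \<Longrightarrow> y \<in> carrier M \<Longrightarrow>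
      a \<odot>\<^bsub>M\<^esub> (x \<oplus>\<^bsub>M\<^esub> y) = a \<odot>\<^bsub>M\<^esub> x \<oplus>\<^bsub>M\<^esub> a \<odot>\<^bsub>M\<^esub> y"
    and "a \<in> carrier R \<Longrightarrow> a \<odot>\<^bsub>M\<^esub> \<zero>\<^bsub>M\<^esub> = \<zero>\<^bsub>M\<^esub>"
    and "a \<in> carrier R \<Longrightarrow> x \<in> carrier M \<Longrightarrow> a \<odot>\<^bsub>M\<^esub> (\<ominus>\<^bsub>M\<^esub> x) = \<ominus>\<^bsub>M\<^esub> (a \<odot>\<^bsub>M\<^esub> x)"
    and "x \<in> carrier M \<Longrightarrow> y \<in> carrier M \<Longrightarrow> x \<oplus>\<^bsub>M\<^esub> y = y \<oplus>\<^bsub>M\<^esub> x"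
    and "x \<in> carrier M \<Longrightarrow> y \<in> carrier M \<Longrightarrow> z \<in> carrier M \<Longrightarrow>
      x \<oplus>\<^bsub>M\<^esub> (y \<oplus>\<^bsub>M\<^esub> z) = y \<oplus>\<^bsub>M\<^esub> (x \<oplus>\<^bsub>M\<^esub> z)"
proof -
  interpret M: left_module R M by fact
  have ag: "abelian_group M" by (rule M.M.abelian_group_axioms)
  note ln = abelian_group.l_neg[OF ag] and me = abelian_group.minus_equality[OF ag]
  have abs: "a \<odot>\<^bsub>M\<^esub> \<zero>\<^bsub>M\<^esub> = \<zero>\<^bsub>M\<^esub>" if "a \<in> carrier R" for a
  proof -
    have "a \<odot>\<^bsub>M\<^esub> \<zero>\<^bsub>M\<^esub> \<oplus>\<^bsub>M\<^esub> a \<odot>\<^bsub>M\<^esub> \<zero>\<^bsub>M\<^esub> = a \<odot>\<^bsub>M\<^esub> \<zero>\<^bsub>M\<^esub>"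
      using that M.smult_r_distr[of a "\<zero>\<^bsub>M\<^esub>" "\<zero>\<^bsub>M\<^esub>"] by simp
    then show ?thesis using that by (simp add: M.smult_closed)
  qed
  show "a \<in> carrier R \<Longrightarrow> a \<odot>\<^bsub>M\<^esub> \<zero>\<^bsub>M\<^esub> = \<zero>\<^bsub>M\<^esub>" by (rule abs)
  show "a \<odot>\<^bsub>M\<^esub> (\<ominus>\<^bsub>M\<^esub> x) = \<ominus>\<^bsub>M\<^esub> (a \<odot>\<^bsub>M\<^esub> x)" if "a \<in> carrier R" "x \<in> carrier M"
  proof -
    have "a \<odot>\<^bsub>M\<^esub> (\<ominus>\<^bsub>M\<^esub> x) \<oplus>\<^bsub>M\<^esub> a \<odot>\<^bsub>M\<^esub> x = \<zero>\<^bsub>M\<^esub>"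
      using that M.smult_r_distr[of a "\<ominus>\<^bsub>M\<^esub> x" x] abs by (simp add: ln)
    then show ?thesis using that by (simp add: M.smult_closed me)
  qed
  show "\<ominus>\<^bsub>M\<^esub> \<zero>\<^bsub>M\<^esub> = \<zero>\<^bsub>M\<^esub>" by (rule me) simp_all
  show "x \<oplus>\<^bsub>M\<^esub> (\<ominus>\<^bsub>M\<^esub> x \<oplus>\<^bsub>M\<^esub> y) = y" "\<ominus>\<^bsub>M\<^esub> x \<oplus>\<^bsub>M\<^esub> (x \<oplus>\<^bsub>M\<^esub> y) = y"
    if "x \<in> carrier M" "y \<in> carrier M"
    using that abelian_group.r_neg1[OF ag] abelian_group.r_neg2[OF ag] by auto
qed (use left_module_abelian[OF assms] abelian_group.axioms(1)[OF left_module_abelian[OF assms]]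
      left_module.smult_closed[OF assms] left_module.smult_r_distr[OF assms] in
    \<open>simp_all add: abelian_group.l_neg abelian_group.r_neg  abelian_group.minus_add abelian_monoid.a_assoc abelian_monoid.a_comm abelian_group.minus_minus
      abelian_group.minus_closed abelian_group.a_inv_closed
      abelian_monoid.a_closed abelian_monoid.zero_closed abelian_monoid.l_zero abelian_monoid.r_zero a_minus_def
      abelian_monoid.a_lcomm\<close>)

text \<open>Declares these operations to the method \<open>algebra\<close>, so that identities
  between sums and differences follow once the module and the memberships are supplied as
  facts.\<close>

lemmas [algebra left_module "zero M" "add M" "a_inv M" "a_minus M" "smult M"] = left_module_simps

end

text \<open>Closure under negatives follows from closure under multiples, as
  \<open>\<ominus> x\<close> is the multiple of \<open>x\<close> by
  \<open>\<ominus> \<one>\<close>.\<close>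

definition submod :: "('r, 'x) ring_scheme \<Rightarrow> ('r, 'a) module \<Rightarrow> 'a set \<Rightarrow> bool" where
  "submod R M S \<longleftrightarrow> S \<subseteq> carrier M \<and> \<zero>\<^bsub>M\<^esub> \<in> S \<and> (\<forall>x \<in> S. \<forall>y \<in> S. x \<oplus>\<^bsub>M\<^esub> y \<in> S) \<and>
     (\<forall>a \<in> carrier R. \<forall>x \<in> S. a \<odot>\<^bsub>M\<^esub> x \<in> S)"

text \<open>Unlike \<open>mod_hom\<close>, this allows different types of elements for source and target, and the values
  outside \<open>S\<close> are arbitrary.\<close>

definition lin_on ::
    "('r, 'x) ring_scheme \<Rightarrow> ('r, 'a) module \<Rightarrow> 'a set \<Rightarrow> ('r, 'b) module \<Rightarrow> ('a \<Rightarrow> 'b) \<Rightarrow> bool" where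
  "lin_on R M S N f \<longleftrightarrow> left_module R M \<and> left_module R N \<and> submod R M S \<and> f \<in> S \<rightarrow> carrier N \<and>
     (\<forall>x \<in> S. \<forall>y \<in> S. f (x \<oplus>\<^bsub>M\<^esub> y) = f x \<oplus>\<^bsub>N\<^esub> f y) \<and>
     (\<forall>a \<in> carrier R. \<forall>x \<in> S. f (a \<odot>\<^bsub>M\<^esub> x) = a \<odot>\<^bsub>N\<^esub> f x)"

abbreviation lin where "lin R M \<equiv> lin_on R M (carrier M)"

context ring begin

lemma left_moduleI:
  assumes "\<And>x y. x \<in> carrier M \<Longrightarrow> y \<in> carrier M \<Longrightarrow> x \<oplus>\<^bsub>M\<^esub> y \<in> carrier M"
    and "\<zero>\<^bsub>M\<^esub> \<in> carrier M"
    and "\<And>x y z. x \<in> carrier M \<Longrightarrow> y \<in> carrier M \<Longrightarrow> z \<in> carrier M \<Longrightarrow>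
      (x \<oplus>\<^bsub>M\<^esub> y) \<oplus>\<^bsub>M\<^esub> z = x \<oplus>\<^bsub>M\<^esub> (y \<oplus>\<^bsub>M\<^esub> z)"
    and "\<And>x y. x \<in> carrier M \<Longrightarrow> y \<in> carrier M \<Longrightarrow> x \<oplus>\<^bsub>M\<^esub> y = y \<oplus>\<^bsub>M\<^esub> x"
    and "\<And>x. x \<in> carrier M \<Longrightarrow> \<zero>\<^bsub>M\<^esub> \<oplus>\<^bsub>M\<^esub> x = x"
    and "\<And>x. x \<in> carrier M \<Longrightarrow> \<exists>y \<in> carrier M. y \<oplus>\<^bsub>M\<^esub> x = \<zero>\<^bsub>M\<^esub>"
    and "\<And>a x. a \<in> carrier R \<Longrightarrow> x \<in> carrier M \<Longrightarrow> a \<odot>\<^bsub>M\<^esub> x \<in> carrier M"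
    and "\<And>a b x. a \<in> carrier R \<Longrightarrow> b \<in> carrier R \<Longrightarrow> x \<in> carrier M \<Longrightarrow>
      (a \<oplus> b) \<odot>\<^bsub>M\<^esub> x = a \<odot>\<^bsub>M\<^esub> x \<oplus>\<^bsub>M\<^esub> b \<odot>\<^bsub>M\<^esub> x"
    and "\<And>a x y. a \<in> carrier R \<Longrightarrow> x \<in> carrier M \<Longrightarrow> y \<in> carrier M \<Longrightarrow>
      a \<odot>\<^bsub>M\<^esub> (x \<oplus>\<^bsub>M\<^esub> y) = a \<odot>\<^bsub>M\<^esub> x \<oplus>\<^bsub>M\<^esub> a \<odot>\<^bsub>M\<^esub> y"
    and "\<And>a b x. a \<in> carrier R \<Longrightarrow> b \<in> carrier R \<Longrightarrow> x \<in> carrier M \<Longrightarrow>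
      (a \<otimes> b) \<odot>\<^bsub>M\<^esub> x = a \<odot>\<^bsub>M\<^esub> (b \<odot>\<^bsub>M\<^esub> x)"
    and "\<And>x. x \<in> carrier M \<Longrightarrow> \<one> \<odot>\<^bsub>M\<^esub> x = x"
  shows "left_module R M"
proof -
  have "abelian_group M"
    by (rule abelian_groupI) (use assms in auto)
  then show ?thesis
    using assms ring_axioms by (auto simp: left_module_def left_module_axioms_def)
qed

lemma left_module_smult:
  assumes "left_module R M"
  shows "a \<in> carrier R \<Longrightarrow> b \<in> carrier R \<Longrightarrow> x \<in> carrier M \<Longrightarrow>
      (a \<oplus> b) \<odot>\<^bsub>M\<^esub> x = a \<odot>\<^bsub>M\<^esub> x \<oplus>\<^bsub>M\<^esub> b \<odot>\<^bsub>M\<^esub> x"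
    and "a \<in> carrier R \<Longrightarrow> b \<in> carrier R \<Longrightarrow> x \<in> carrier M \<Longrightarrow>
      (a \<otimes> b) \<odot>\<^bsub>M\<^esub> x = a \<odot>\<^bsub>M\<^esub> (b \<odot>\<^bsub>M\<^esub> x)"
    and "x \<in> carrier M \<Longrightarrow> \<one> \<odot>\<^bsub>M\<^esub> x = x"
    and "x \<in> carrier M \<Longrightarrow> \<zero> \<odot>\<^bsub>M\<^esub> x = \<zero>\<^bsub>M\<^esub>"
    and "x \<in> carrier M \<Longrightarrow> (\<ominus> \<one>) \<odot>\<^bsub>M\<^esub> x = \<ominus>\<^bsub>M\<^esub> x"
proof -
  interpret M: left_module R M by fact
  have ag: "abelian_group M" by (rule M.M.abelian_group_axioms)
  note me = abelian_group.minus_equality[OF ag]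
  show *: "\<zero> \<odot>\<^bsub>M\<^esub> x = \<zero>\<^bsub>M\<^esub>" if "x \<in> carrier M" for x
  proof -
    have "\<zero> \<odot>\<^bsub>M\<^esub> x \<oplus>\<^bsub>M\<^esub> \<zero> \<odot>\<^bsub>M\<^esub> x = \<zero> \<odot>\<^bsub>M\<^esub> x"
      using that M.smult_l_distr[of "\<zero>" "\<zero>" x] by simp
    then show ?thesis using that by (simp add: M.smult_closed)
  qed
  show "(\<ominus> \<one>) \<odot>\<^bsub>M\<^esub> x = \<ominus>\<^bsub>M\<^esub> x" if "x \<in> carrier M"
  proof -
    have "(\<ominus> \<one>) \<odot>\<^bsub>M\<^esub> x \<oplus>\<^bsub>M\<^esub> x = \<zero>\<^bsub>M\<^esub>"
      using that M.smult_l_distr[of "\<ominus> \<one>" "\<one>" x] * by (simp add: l_neg M.smult_one)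
    then show ?thesis using that by (simp add: M.smult_closed me)
  qed
qed (use left_module.smult_l_distr[OF assms] left_module.smult_assoc[OF assms]
      left_module.smult_one[OF assms] in auto)

lemma left_module_minus_eq_zero:
  assumes "left_module R M" "x \<in> carrier M" "y \<in> carrier M"
  shows "x \<ominus>\<^bsub>M\<^esub> y = \<zero>\<^bsub>M\<^esub> \<longleftrightarrow> x = y"
proof
  assume "x \<ominus>\<^bsub>M\<^esub> y = \<zero>\<^bsub>M\<^esub>"
  then have "\<ominus>\<^bsub>M\<^esub> (\<ominus>\<^bsub>M\<^esub> y) = x"
    using assms left_module_abelian abelian_group.minus_equality[of M x "\<ominus>\<^bsub>M\<^esub> y"]
    by (auto simp: a_minus_def left_module_simps(3))
  then show "x = y" using assms left_module_simps(14) by metis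
qed (use assms in \<open>simp add: left_module_simps(10,16)\<close>)

lemma submod_simps:
  assumes "left_module R M" "submod R M S"
  shows "x \<in> S \<Longrightarrow> x \<in> carrier M"
    and "\<zero>\<^bsub>M\<^esub> \<in> S"
    and "x \<in> S \<Longrightarrow> y \<in> S \<Longrightarrow> x \<oplus>\<^bsub>M\<^esub> y \<in> S"
    and "x \<in> S \<Longrightarrow> \<ominus>\<^bsub>M\<^esub> x \<in> S"
    and "x \<in> S \<Longrightarrow> y \<in> S \<Longrightarrow> x \<ominus>\<^bsub>M\<^esub> y \<in> S"
    and "a \<in> carrier R \<Longrightarrow> x \<in> S \<Longrightarrow> a \<odot>\<^bsub>M\<^esub> x \<in> S"
proof -
  have *: "\<ominus>\<^bsub>M\<^esub> x \<in> S" if "x \<in> S" for x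
    using assms that left_module_smult(5)[OF assms(1), of x, symmetric]
    by (auto simp: submod_def)
  then show "x \<in> S \<Longrightarrow> \<ominus>\<^bsub>M\<^esub> x \<in> S" .
  show "x \<in> S \<Longrightarrow> y \<in> S \<Longrightarrow> x \<ominus>\<^bsub>M\<^esub> y \<in> S"
    using * assms(2) by (auto simp: submod_def a_minus_def)
qed (use assms(2) in \<open>auto simp: submod_def\<close>)

lemma submod_carrier: "left_module R M \<Longrightarrow> submod R M (carrier M)"
  by (auto simp: submod_def left_module_simps)

lemma lin_on_modules: "lin_on R M S N f \<Longrightarrow> left_module R M \<and> left_module R N \<and> submod R M S"
  by (auto simp: lin_on_def)

lemma lin_on_simps:
  assumes "lin_on R M S N f"
  shows "x \<in> S \<Longrightarrow> f x \<in> carrier N"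
    and "x \<in> S \<Longrightarrow> y \<in> S \<Longrightarrow> f (x \<oplus>\<^bsub>M\<^esub> y) = f x \<oplus>\<^bsub>N\<^esub> f y"
    and "x \<in> S \<Longrightarrow> a \<in> carrier R \<Longrightarrow> f (a \<odot>\<^bsub>M\<^esub> x) = a \<odot>\<^bsub>N\<^esub> f x"
    and "f \<zero>\<^bsub>M\<^esub> = \<zero>\<^bsub>N\<^esub>"
    and "x \<in> S \<Longrightarrow> f (\<ominus>\<^bsub>M\<^esub> x) = \<ominus>\<^bsub>N\<^esub> f x"
    and "x \<in> S \<Longrightarrow> y \<in> S \<Longrightarrow> f (x \<ominus>\<^bsub>M\<^esub> y) = f x \<ominus>\<^bsub>N\<^esub> f y"
proof -
  have M: "left_module R M" and N: "left_module R N" and S: "submod R M S"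
    using assms by (auto simp: lin_on_def)
  note s = submod_simps[OF M S]
  have neg: "f (\<ominus>\<^bsub>M\<^esub> x) = \<ominus>\<^bsub>N\<^esub> f x" if "x \<in> S" for x
  proof -
    have "f (\<ominus>\<^bsub>M\<^esub> x) = f ((\<ominus> \<one>) \<odot>\<^bsub>M\<^esub> x)"
      using left_module_smult[OF M] s that by auto
    also have "\<dots> = (\<ominus> \<one>) \<odot>\<^bsub>N\<^esub> f x"
      using assms that unfolding lin_on_def by blast
    also have "\<dots> = \<ominus>\<^bsub>N\<^esub> f x"
      using assms that left_module_smult(5)[OF N, of "f x"] by (auto simp: lin_on_def)
    finally show ?thesis .
  qed
  then show "x \<in> S \<Longrightarrow> f (\<ominus>\<^bsub>M\<^esub> x) = \<ominus>\<^bsub>N\<^esub> f x" .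
  show "f \<zero>\<^bsub>M\<^esub> = \<zero>\<^bsub>N\<^esub>"
  proof -
    have "f (\<zero> \<odot>\<^bsub>M\<^esub> \<zero>\<^bsub>M\<^esub>) = \<zero> \<odot>\<^bsub>N\<^esub> f \<zero>\<^bsub>M\<^esub>"
      using assms s(2) zero_closed unfolding lin_on_def by blast
    moreover have "f \<zero>\<^bsub>M\<^esub> \<in> carrier N" using assms s(2) by (auto simp: lin_on_def)
    ultimately show ?thesis
      using left_module_smult(4)[OF N] left_module_smult(4)[OF M] left_module_simps(2)[OF M] by simp
  qed
  show "x \<in> S \<Longrightarrow> y \<in> S \<Longrightarrow> f (x \<ominus>\<^bsub>M\<^esub> y) = f x \<ominus>\<^bsub>N\<^esub> f y"
    using neg s assms by (auto simp: lin_on_def a_minus_def)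
qed (use assms in \<open>auto simp: lin_on_def\<close>)

lemma lin_onI:
  assumes "left_module R M" "left_module R N" "submod R M S"
    and "\<And>x. x \<in> S \<Longrightarrow> f x \<in> carrier N"
    and "\<And>x y. x \<in> S \<Longrightarrow> y \<in> S \<Longrightarrow> f (x \<oplus>\<^bsub>M\<^esub> y) = f x \<oplus>\<^bsub>N\<^esub> f y"
    and "\<And>a x. x \<in> S \<Longrightarrow> a \<in> carrier R \<Longrightarrow> f (a \<odot>\<^bsub>M\<^esub> x) = a \<odot>\<^bsub>N\<^esub> f x"
  shows "lin_on R M S N f"
  using assms by (auto simp: lin_on_def)

lemma lin_on_subset: "lin_on R M S N f \<Longrightarrow> submod R M T \<Longrightarrow> T \<subseteq> S \<Longrightarrow> lin_on R M T N f"
  by (auto simp: lin_on_def subset_iff)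

lemma lin_on_comp:
  assumes "lin_on R M S N f" "lin_on R N T L g" "f ` S \<subseteq> T"
  shows "lin_on R M S L (\<lambda>x. g (f x))"
  using assms by (auto simp: lin_on_def image_subset_iff Pi_iff)

lemma lin_on_add:
  assumes "lin_on R M S N f" "lin_on R M S N g"
  shows "lin_on R M S N (\<lambda>x. f x \<oplus>\<^bsub>N\<^esub> g x)"
proof -
  note m = lin_on_modules[OF assms(1)]
  note f = lin_on_simps[OF assms(1)] and g = lin_on_simps[OF assms(2)]
  show ?thesis
    by (rule lin_onI) (simp_all add: m f g left_module_simps[of N])
qed

lemma lin_on_minus:
  assumes "lin_on R M S N f" "lin_on R M S N g"
  shows "lin_on R M S N (\<lambda>x. f x \<ominus>\<^bsub>N\<^esub> g x)"
proof -
  note m = lin_on_modules[OF assms(1)]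
  note f = lin_on_simps[OF assms(1)] and g = lin_on_simps[OF assms(2)]
  show ?thesis
    by (rule lin_onI) (simp_all add: m f g left_module_simps[of N])
qed

lemma lin_on_zero:
  assumes "left_module R M" "left_module R N" "submod R M S"
  shows "lin_on R M S N (\<lambda>x. \<zero>\<^bsub>N\<^esub>)"
  by (rule lin_onI) (use assms in \<open>auto simp: left_module_simps\<close>)

lemma lin_on_id:
  assumes "left_module R M" "submod R M S"
  shows "lin_on R M S M (\<lambda>x. x)"
  by (rule lin_onI) (use assms in \<open>auto simp: submod_simps\<close>)

lemma submod_vimage:
  assumes "lin_on R M S N f" "submod R N T"
  shows "submod R M {x \<in> S. f x \<in> T}"
  using assms by (auto simp: lin_on_def submod_def lin_on_simps(4)[OF assms(1)])

lemma submod_zero: "left_module R M \<Longrightarrow> submod R M {\<zero>\<^bsub>M\<^esub>}"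
  by (auto simp: submod_def left_module_simps)

lemma submod_kernel: "lin_on R M S N f \<Longrightarrow> submod R M {x \<in> S. f x = \<zero>\<^bsub>N\<^esub>}"
  using submod_vimage[of M S N f "{\<zero>\<^bsub>N\<^esub>}"] submod_zero lin_on_modules by fastforce

lemma submod_image:
  assumes "lin_on R M S N f" "submod R M T" "T \<subseteq> S"
  shows "submod R N (f ` T)"
proof -
  note f = lin_on_simps[OF assms(1)]
  have m: "left_module R M" using lin_on_modules[OF assms(1)] by blast
  have "\<zero>\<^bsub>N\<^esub> \<in> f ` T" using f(4) assms(2) by (metis imageI submod_def)
  moreover have "f x \<oplus>\<^bsub>N\<^esub> f y \<in> f ` T" if "x \<in> T" "y \<in> T" for x y
    using that f(2)[of x y] assms submod_simps[OF m assms(2)] by (metis imageI subsetD)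
  moreover have "a \<odot>\<^bsub>N\<^esub> f x \<in> f ` T" if "x \<in> T" "a \<in> carrier R" for x a
    using that f(3)[of x a] assms submod_simps[OF m assms(2)] by (metis imageI subsetD)
  ultimately show ?thesis using f(1) assms(3) by (auto simp: submod_def)
qed

lemma lin_on_inj:
  assumes f: "lin_on R M S N f" and ker: "\<And>x. x \<in> S \<Longrightarrow> f x = \<zero>\<^bsub>N\<^esub> \<Longrightarrow> x = \<zero>\<^bsub>M\<^esub>"
  shows "inj_on f S"
proof (rule inj_onI)
  fix x y assume xy: "x \<in> S" "y \<in> S" "f x = f y"
  have M: "left_module R M" and N: "left_module R N" and S: "submod R M S"
    using lin_on_modules[OF f] by auto
  have "f x \<ominus>\<^bsub>N\<^esub> f y = \<zero>\<^bsub>N\<^esub>"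
    by (rule left_module_minus_eq_zero[THEN iffD2, OF N]) (rule lin_on_simps(1)[OF f] xy)+
  then have "x \<ominus>\<^bsub>M\<^esub> y = \<zero>\<^bsub>M\<^esub>"
    by (intro ker submod_simps(5)[OF M S] xy) (simp only: lin_on_simps(6)[OF f] xy)
  then show "x = y"
    by (rule left_module_minus_eq_zero[THEN iffD1, OF M submod_simps(1)[OF M S xy(1)] submod_simps(1)[OF M S xy(2)]])
qed

section \<open>Submodules as modules, and maps out of an image\<close>

lemma left_module_submod:
  assumes "left_module R M" "submod R M S"
  shows "left_module R (M\<lparr>carrier := S\<rparr>)"
proof -
  note s = submod_simps[OF assms] and m = left_module_simps[OF assms(1)]
  show ?thesis
  proof (rule left_moduleI)
    show "\<exists>y \<in> carrier (M\<lparr>carrier := S\<rparr>). y \<oplus>\<^bsub>M\<lparr>carrier := S\<rparr>\<^esub> x = \<zero>\<^bsub>M\<lparr>carrier := S\<rparr>\<^esub>"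
      if "x \<in> carrier (M\<lparr>carrier := S\<rparr>)" for x
      using that by (intro bexI[of _ "\<ominus>\<^bsub>M\<^esub> x"]) (simp_all add: s m(9))
  qed (simp_all add: s m(6-8,17,20,21) left_module_smult(1-3)[OF assms(1)])
qed

lemma lin_on_submod_source:
  assumes "left_module R M" "submod R M S"
  shows "lin_on R (M\<lparr>carrier := S\<rparr>) T N f \<longleftrightarrow> T \<subseteq> S \<and> lin_on R M T N f"
  using assms left_module_submod[OF assms] by (auto simp: lin_on_def submod_def)

lemma lin_on_submod_target:
  assumes "left_module R N" "submod R N S"
  shows "lin_on R M T (N\<lparr>carrier := S\<rparr>) f \<longleftrightarrow> f ` T \<subseteq> S \<and> lin_on R M T N f"
  using assms left_module_submod[OF assms] by (auto simp: lin_on_def submod_def)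

text \<open>Homomorphism theorem for a map \<open>g\<close> that need not be onto: \<open>k\<close>
  is linear on the image of \<open>g\<close>, and the three element types are independent. It serves
  for every construction of a map below: maps induced on quotients, inverses of bijections (with
  \<open>h\<close> the identity), and gluing of two maps along a sum of submodules.\<close>

lemma lin_on_factor:
  assumes g: "lin_on R X S Q g" and h: "lin_on R X S F h"
    and ker: "\<And>x. x \<in> S \<Longrightarrow> g x = \<zero>\<^bsub>Q\<^esub> \<Longrightarrow> h x = \<zero>\<^bsub>F\<^esub>"
  shows "\<exists>k. lin_on R Q (g ` S) F k \<and> (\<forall>x \<in> S. k (g x) = h x)"
proof -
  note mg = lin_on_modules[OF g] and mh = lin_on_modules[OF h]
  note gs = lin_on_simps[OF g] and hs = lin_on_simps[OF h]
  note s = submod_simps[of X S]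
  have eq: "h x = h y" if "x \<in> S" "y \<in> S" "g x = g y" for x y
  proof -
    have "g (x \<ominus>\<^bsub>X\<^esub> y) = \<zero>\<^bsub>Q\<^esub>"
      using that mg gs(1) gs(6)[of x y] by (simp add: left_module_minus_eq_zero)
    then have "h x \<ominus>\<^bsub>F\<^esub> h y = \<zero>\<^bsub>F\<^esub>"
      using ker[of "x \<ominus>\<^bsub>X\<^esub> y"] that s(5) mg hs(6) by simp
    then show ?thesis using that mh hs(1) by (simp add: left_module_minus_eq_zero)
  qed
  define k where "k z = h (SOME x. x \<in> S \<and> g x = z)" for z
  have k: "k (g x) = h x" if "x \<in> S" for x
  proof -
    have "(SOME y. y \<in> S \<and> g y = g x) \<in> S \<and> g (SOME y. y \<in> S \<and> g y = g x) = g x"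
      by (rule someI[of "\<lambda>y. y \<in> S \<and> g y = g x"]) (use that in auto)
    then show ?thesis unfolding k_def using eq that by blast
  qed
  have "lin_on R Q (g ` S) F k"
  proof (rule lin_onI)
    show "submod R Q (g ` S)" using submod_image[OF g] mg by blast
    show "k (x \<oplus>\<^bsub>Q\<^esub> y) = k x \<oplus>\<^bsub>F\<^esub> k y" if h: "x \<in> g ` S" "y \<in> g ` S" for x y
    proof -
      obtain u v where uv: "u \<in> S" "v \<in> S" "x = g u" "y = g v" using h by blast
      then have "k (g (u \<oplus>\<^bsub>X\<^esub> v)) = h u \<oplus>\<^bsub>F\<^esub> h v" using k s mg hs by simp
      with uv show ?thesis using gs k by simp
    qed
    show "k (a \<odot>\<^bsub>Q\<^esub> x) = a \<odot>\<^bsub>F\<^esub> k x" if h: "x \<in> g ` S" "a \<in> carrier R" for a x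
    proof -
      obtain u where u: "u \<in> S" "x = g u" using h by blast
      then have "k (g (a \<odot>\<^bsub>X\<^esub> u)) = a \<odot>\<^bsub>F\<^esub> h u" using k s mg hs h by simp
      with u h show ?thesis using gs k by simp
    qed
  qed (use mg mh in blast, use mg mh in blast, use k hs in force)
  then show ?thesis using k by blast
qed

end

section \<open>Small sets, products and quotients\<close>

text \<open>The predicate \<open>small\<close> only applies to subsets of \<open>'m\<close>.
  Auxiliary modules consist of pairs, functions or lists, and the type argument names the universe
  with which their size is compared.\<close>

definition fits :: "'m itself \<Rightarrow> 'a set \<Rightarrow> bool" where
  "fits _ A \<longleftrightarrow> |A| <o |UNIV :: 'm set|"

locale ring_universe = ring R for R :: "('r, 'x) ring_scheme" (structure) +
  fixes U :: "'m itself"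
  assumes universe: "universe_for U R"
begin

lemma fits_small: "fits U (A :: 'm set) \<longleftrightarrow> small A"
  by (simp add: fits_def small_def)

lemma fits_inj_on:
  assumes "fits U B" "inj_on f A" "f ` A \<subseteq> B"
  shows "fits U A"
proof -
  have "|A| \<le>o |B|" using assms(2,3) card_of_ordLeq[of A B] by blast
  then show ?thesis using assms(1) ordLeq_ordLess_trans unfolding fits_def by blast
qed

lemma fits_subset: "fits U B \<Longrightarrow> A \<subseteq> B \<Longrightarrow> fits U A"
  by (rule fits_inj_on[of B id]) auto

lemma fits_image: "fits U A \<Longrightarrow> fits U (f ` A)"
  unfolding fits_def using card_of_image ordLeq_ordLess_trans by blast

lemma fits_nat: "fits U (UNIV :: nat set)"
  using universe card_of_nat ordIso_ordLess_trans unfolding universe_for_def fits_def by blast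

lemma fits_countable: "countable A \<Longrightarrow> fits U A"
  using fits_inj_on[OF fits_nat] unfolding countable_def by blast

text \<open>Regularity in the form that controls disjoint unions: a family of fewer than
  \<open>|UNIV :: 'm set|\<close> sets, each smaller than \<open>'m\<close>, has a disjoint union
  smaller than \<open>'m\<close>.\<close>

lemma stable_universe: "stable |UNIV :: 'm set|"
proof (rule regularCard_stable)
  have "\<not> finite (UNIV :: 'm set)"
    using fits_nat card_of_ordLeq_finite[of "UNIV :: nat set" "UNIV :: 'm set"] ordLess_imp_ordLeq
    unfolding fits_def by blast
  then show "\<not> finite (Field |UNIV :: 'm set| )" unfolding Field_card_of .
qed (use universe card_of_Card_order in \<open>auto simp: universe_for_def\<close>)

lemma fits_UN: "fits U I \<Longrightarrow> (\<And>i. i \<in> I \<Longrightarrow> fits U (A i)) \<Longrightarrow> fits U (\<Union>i\<in>I. A i)"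
  unfolding fits_def using card_of_UNION_ordLess_infinite[OF stable_universe] by blast

lemma fits_Times: "fits U A \<Longrightarrow> fits U B \<Longrightarrow> fits U (A \<times> B)"
  unfolding fits_def using stable_elim[OF stable_universe, of A "\<lambda>_. B"] by simp

lemma fits_Un:
  assumes "fits U A" "fits U B"
  shows "fits U (A \<union> B)"
  using fits_UN[OF fits_countable[OF countable_finite[OF finite]], of "UNIV :: bool set" "\<lambda>b. if b then A else B"] assms
  by (auto simp: UNIV_bool Un_commute)

lemma fits_carrier: "fits U (carrier R)"
  using universe by (simp add: universe_for_def fits_def)

text \<open>The lists are the union of their pieces of fixed length, each bounded by a product. The
  union is countable, and its index set fits because the universe is uncountable.\<close>

lemma fits_lists:
  assumes "fits U A"
  shows "fits U (lists A)"
proof -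
  have "fits U {l \<in> lists A. length l = n}" for n
  proof (induction n)
    case 0
    have "{l \<in> lists A. length l = 0} = {[]}" by auto
    then show ?case using fits_countable[OF countable_finite, of "{[]}"] by simp
  next
    case (Suc n)
    have "{l \<in> lists A. length l = Suc n} \<subseteq> (\<lambda>(x, l). x # l) ` (A \<times> {l \<in> lists A. length l = n})"
      by (auto simp: length_Suc_conv image_iff)
    then show ?case by (rule fits_subset[OF fits_image[OF fits_Times[OF assms Suc]]])
  qed
  then have "fits U (\<Union>n. {l \<in> lists A. length l = n})" by (intro fits_UN fits_nat)
  moreover have "(\<Union>n. {l \<in> lists A. length l = n}) = lists A" by auto
  ultimately show ?thesis by simp
qed

lemma ObjD:
  assumes "(M :: ('r, 'm) module) \<in> Obj (R_Mod R)"
  shows "left_module R M" "fits U (carrier M)"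
  using assms by (auto simp: R_Mod_def fits_small)

lemma ObjI: "left_module R (M :: ('r, 'm) module) \<Longrightarrow> fits U (carrier M) \<Longrightarrow> M \<in> Obj (R_Mod R)"
  by (auto simp: R_Mod_def fits_small)

text \<open>Cosets are sets of elements and would leave the type \<open>'m\<close>; each coset is
  coded instead by the image in \<open>'m\<close> of one representative. With \<open>N\<close> zero
  this is transport of structure from any element type into the universe; with \<open>N\<close> a
  kernel or an image it provides the usual quotients.\<close>

lemma ex_quotient:
  assumes M: "left_module R M" and "fits U (carrier M)" and N: "submod R M N"
  shows "\<exists>(Q :: ('r, 'm) module) q. Q \<in> Obj (R_Mod R) \<and> lin R M Q q \<and> q ` carrier M = carrier Q \<and>
    (\<forall>x \<in> carrier M. q x = \<zero>\<^bsub>Q\<^esub> \<longleftrightarrow> x \<in> N)"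
proof -
  note n = submod_simps[OF M N] and m = left_module_simps[OF M]
  have "|carrier M| \<le>o |UNIV :: 'm set|"
    using assms(2) ordLess_imp_ordLeq unfolding fits_def by blast
  then obtain \<iota> :: "_ \<Rightarrow> 'm" where \<iota>: "inj_on \<iota> (carrier M)"
    using card_of_ordLeq[of "carrier M" "UNIV :: 'm set"] by auto
  have refl: "x \<ominus>\<^bsub>M\<^esub> x \<in> N" if "x \<in> carrier M" for x
    using that n(2) left_module_minus_eq_zero[OF M that that] by simp
  have symN: "y \<ominus>\<^bsub>M\<^esub> x \<in> N" if "x \<in> carrier M" "y \<in> carrier M" "x \<ominus>\<^bsub>M\<^esub> y \<in> N" for x y
  proof -
    have "y \<ominus>\<^bsub>M\<^esub> x = \<ominus>\<^bsub>M\<^esub> (x \<ominus>\<^bsub>M\<^esub> y)" using that M by algebra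
    then show ?thesis using n(4)[OF that(3)] by simp
  qed
  have transN: "x \<ominus>\<^bsub>M\<^esub> z \<in> N"
    if "x \<in> carrier M" "y \<in> carrier M" "z \<in> carrier M" "x \<ominus>\<^bsub>M\<^esub> y \<in> N" "y \<ominus>\<^bsub>M\<^esub> z \<in> N" for x y z
  proof -
    have "x \<ominus>\<^bsub>M\<^esub> z = (x \<ominus>\<^bsub>M\<^esub> y) \<oplus>\<^bsub>M\<^esub> (y \<ominus>\<^bsub>M\<^esub> z)" using that(1-3) M by algebra
    then show ?thesis using n(3)[OF that(4,5)] by simp
  qed
  define rep where "rep x = (SOME y. y \<in> carrier M \<and> x \<ominus>\<^bsub>M\<^esub> y \<in> N)" for x
  have rep: "rep x \<in> carrier M" "x \<ominus>\<^bsub>M\<^esub> rep x \<in> N" if "x \<in> carrier M" for x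
    using someI[of "\<lambda>y. y \<in> carrier M \<and> x \<ominus>\<^bsub>M\<^esub> y \<in> N" x] that refl unfolding rep_def by auto
  define q where "q x = \<iota> (rep x)" for x
  have q_eq: "q x = q y \<longleftrightarrow> x \<ominus>\<^bsub>M\<^esub> y \<in> N" if xy: "x \<in> carrier M" "y \<in> carrier M" for x y
  proof
    assume "q x = q y"
    then have "rep x = rep y" using \<iota> rep(1) xy by (auto simp: q_def inj_on_def)
    then show "x \<ominus>\<^bsub>M\<^esub> y \<in> N" using transN symN rep xy by metis
  next
    assume *: "x \<ominus>\<^bsub>M\<^esub> y \<in> N"
    \<comment> \<open>Congruent elements satisfy the same defining predicate, so \<open>SOME\<close>
      picks the same representative for both.\<close>
    have "x \<ominus>\<^bsub>M\<^esub> z \<in> N \<longleftrightarrow> y \<ominus>\<^bsub>M\<^esub> z \<in> N" if "z \<in> carrier M" for z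
      using * transN symN xy that by metis
    then have "rep x = rep y" unfolding rep_def by (metis (no_types, lifting))
    then show "q x = q y" by (simp add: q_def)
  qed
  \<comment> \<open>\<open>p\<close> returns some member of a coset. The operations of
    \<open>Q\<close> are computed through it; they do not depend on the member, because
    \<open>p (q x)\<close> and \<open>x\<close> differ by an element of \<open>N\<close>.\<close>
  define p where "p z = (SOME x. x \<in> carrier M \<and> q x = z)" for z
  have p: "p (q x) \<in> carrier M" "p (q x) \<ominus>\<^bsub>M\<^esub> x \<in> N" if "x \<in> carrier M" for x
  proof -
    have "p (q x) \<in> carrier M \<and> q (p (q x)) = q x"
      unfolding p_def by (rule someI[of "\<lambda>y. y \<in> carrier M \<and> q y = q x"]) (use that in auto)
    then show "p (q x) \<in> carrier M" "p (q x) \<ominus>\<^bsub>M\<^esub> x \<in> N" using q_eq that by auto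
  qed
  define Q :: "('r, 'm) module" where "Q = \<lparr>carrier = q ` carrier M, monoid.mult = undefined, one = undefined,
    zero = q \<zero>\<^bsub>M\<^esub>, add = (\<lambda>a b. q (p a \<oplus>\<^bsub>M\<^esub> p b)), smult = (\<lambda>r a. q (r \<odot>\<^bsub>M\<^esub> p a))\<rparr>"
  have c: "carrier Q = q ` carrier M" and z: "\<zero>\<^bsub>Q\<^esub> = q \<zero>\<^bsub>M\<^esub>" by (simp_all add: Q_def)
  have add: "q x \<oplus>\<^bsub>Q\<^esub> q y = q (x \<oplus>\<^bsub>M\<^esub> y)" if "x \<in> carrier M" "y \<in> carrier M" for x y
  proof -
    have "(p (q x) \<oplus>\<^bsub>M\<^esub> p (q y)) \<ominus>\<^bsub>M\<^esub> (x \<oplus>\<^bsub>M\<^esub> y) = (p (q x) \<ominus>\<^bsub>M\<^esub> x) \<oplus>\<^bsub>M\<^esub> (p (q y) \<ominus>\<^bsub>M\<^esub> y)"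
      using that p(1)[OF that(1)] p(1)[OF that(2)] M by algebra
    then have "(p (q x) \<oplus>\<^bsub>M\<^esub> p (q y)) \<ominus>\<^bsub>M\<^esub> (x \<oplus>\<^bsub>M\<^esub> y) \<in> N" using p(2) that n(3) by simp
    then show ?thesis using q_eq p(1) that m(1) by (simp add: Q_def)
  qed
  have smult: "r \<odot>\<^bsub>Q\<^esub> q x = q (r \<odot>\<^bsub>M\<^esub> x)" if "x \<in> carrier M" "r \<in> carrier R" for x r
  proof -
    have "r \<odot>\<^bsub>M\<^esub> p (q x) \<ominus>\<^bsub>M\<^esub> r \<odot>\<^bsub>M\<^esub> x = r \<odot>\<^bsub>M\<^esub> (p (q x) \<ominus>\<^bsub>M\<^esub> x)"
      using that p(1)[OF that(1)] M by algebra
    then have "r \<odot>\<^bsub>M\<^esub> p (q x) \<ominus>\<^bsub>M\<^esub> r \<odot>\<^bsub>M\<^esub> x \<in> N" using p(2) that n(6) by simp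
    then show ?thesis using q_eq p(1) that m(5) by (simp add: Q_def)
  qed
  have Q: "left_module R Q"
  proof (rule left_moduleI)
    fix x assume "x \<in> carrier Q"
    then obtain u where u: "u \<in> carrier M" "x = q u" by (auto simp: c)
    then have "q (\<ominus>\<^bsub>M\<^esub> u) \<oplus>\<^bsub>Q\<^esub> x = \<zero>\<^bsub>Q\<^esub>" using add m(3,9) z by simp
    then show "\<exists>y \<in> carrier Q. y \<oplus>\<^bsub>Q\<^esub> x = \<zero>\<^bsub>Q\<^esub>" using c m(3) u by auto
    show "\<zero>\<^bsub>Q\<^esub> \<oplus>\<^bsub>Q\<^esub> x = x" using u add z m(2,7) by simp
  next
    fix x y assume "x \<in> carrier Q" "y \<in> carrier Q"
    then show "x \<oplus>\<^bsub>Q\<^esub> y = y \<oplus>\<^bsub>Q\<^esub> x" using add m(20) c by auto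
  next
    fix x y v assume "x \<in> carrier Q" "y \<in> carrier Q" "v \<in> carrier Q"
    then show "x \<oplus>\<^bsub>Q\<^esub> y \<oplus>\<^bsub>Q\<^esub> v = x \<oplus>\<^bsub>Q\<^esub> (y \<oplus>\<^bsub>Q\<^esub> v)" using add m(6) m(1) c by auto
  next
    fix a b x assume ab: "a \<in> carrier R" "b \<in> carrier R" and "x \<in> carrier Q"
    then obtain u where u: "u \<in> carrier M" "x = q u" by (auto simp: c)
    show "(a \<oplus> b) \<odot>\<^bsub>Q\<^esub> x = a \<odot>\<^bsub>Q\<^esub> x \<oplus>\<^bsub>Q\<^esub> b \<odot>\<^bsub>Q\<^esub> x"
      "a \<otimes> b \<odot>\<^bsub>Q\<^esub> x = a \<odot>\<^bsub>Q\<^esub> (b \<odot>\<^bsub>Q\<^esub> x)"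
      using u ab add smult left_module_smult[OF M] m(1,5) by simp_all
  next
    fix x assume "x \<in> carrier Q"
    then show "\<one> \<odot>\<^bsub>Q\<^esub> x = x" using smult left_module_smult[OF M] c by auto
  next
    fix a x y assume a: "a \<in> carrier R" and "x \<in> carrier Q" "y \<in> carrier Q"
    then obtain u v where uv: "u \<in> carrier M" "x = q u" "v \<in> carrier M" "y = q v" by (auto simp: c)
    show "a \<odot>\<^bsub>Q\<^esub> (x \<oplus>\<^bsub>Q\<^esub> y) = a \<odot>\<^bsub>Q\<^esub> x \<oplus>\<^bsub>Q\<^esub> a \<odot>\<^bsub>Q\<^esub> y"
      using uv a add smult m(1,5,17) by simp
  qed (use c z add smult m(1,2,5) in auto)
  have lin: "lin R M Q q"
    by (rule lin_onI) (use M Q c add smult submod_carrier in auto)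
  moreover have "Q \<in> Obj (R_Mod R)"
    by (rule ObjI[OF Q]) (simp add: c fits_image assms(2))
  moreover have "q x = \<zero>\<^bsub>Q\<^esub> \<longleftrightarrow> x \<in> N" if x: "x \<in> carrier M" for x
  proof -
    have "x \<ominus>\<^bsub>M\<^esub> \<zero>\<^bsub>M\<^esub> = x" using x m(2,8,15,16) by simp
    then show ?thesis using q_eq[OF x m(2)] z by simp
  qed
  ultimately show ?thesis using c by (intro exI[of _ Q] exI[of _ q]) simp
qed

end

definition pmod :: "('r, 'a) module \<Rightarrow> ('r, 'b) module \<Rightarrow> ('r, 'a \<times> 'b) module" where
  "pmod M N = \<lparr>carrier = carrier M \<times> carrier N, monoid.mult = undefined, one = undefined,
     zero = (\<zero>\<^bsub>M\<^esub>, \<zero>\<^bsub>N\<^esub>), add = (\<lambda>(a, b) (c, d). (a \<oplus>\<^bsub>M\<^esub> c, b \<oplus>\<^bsub>N\<^esub> d)),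
     smult = (\<lambda>r (a, b). (r \<odot>\<^bsub>M\<^esub> a, r \<odot>\<^bsub>N\<^esub> b))\<rparr>"

lemma pmod_simps [simp]:
  "carrier (pmod M N) = carrier M \<times> carrier N"
  "\<zero>\<^bsub>pmod M N\<^esub> = (\<zero>\<^bsub>M\<^esub>, \<zero>\<^bsub>N\<^esub>)"
  "(a, b) \<oplus>\<^bsub>pmod M N\<^esub> (c, d) = (a \<oplus>\<^bsub>M\<^esub> c, b \<oplus>\<^bsub>N\<^esub> d)"
  "r \<odot>\<^bsub>pmod M N\<^esub> (a, b) = (r \<odot>\<^bsub>M\<^esub> a, r \<odot>\<^bsub>N\<^esub> b)"
  by (simp_all add: pmod_def)

context ring begin

lemma left_module_pmod:
  assumes M: "left_module R M" and N: "left_module R N"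
  shows "left_module R (pmod M N)"
proof (rule left_moduleI)
  fix x assume "x \<in> carrier (pmod M N)"
  then show "\<exists>y \<in> carrier (pmod M N). y \<oplus>\<^bsub>pmod M N\<^esub> x = \<zero>\<^bsub>pmod M N\<^esub>"
    by (intro bexI[of _ "(\<ominus>\<^bsub>M\<^esub> fst x, \<ominus>\<^bsub>N\<^esub> snd x)"])
      (auto simp: left_module_simps(3,9)[OF M] left_module_simps(3,9)[OF N])
qed (auto simp: left_module_simps(1,2,5,6,7,17)[OF M] left_module_simps(1,2,5,6,7,17)[OF N]
    left_module_smult(1-3)[OF M] left_module_smult(1-3)[OF N]
    intro: left_module_simps(20)[OF M] left_module_simps(20)[OF N])

lemma submod_pmod: "submod R M S \<Longrightarrow> submod R N T \<Longrightarrow> submod R (pmod M N) (S \<times> T)"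
  by (auto simp: submod_def)

lemma lin_on_fst:
  assumes "left_module R M" "left_module R N" "submod R (pmod M N) S"
  shows "lin_on R (pmod M N) S M fst"
  by (rule lin_onI) (use assms left_module_pmod in \<open>auto simp: submod_def\<close>)

lemma lin_on_snd:
  assumes "left_module R M" "left_module R N" "submod R (pmod M N) S"
  shows "lin_on R (pmod M N) S N snd"
  by (rule lin_onI) (use assms left_module_pmod in \<open>auto simp: submod_def\<close>)

lemma lin_on_Pair:
  assumes f: "lin_on R M S N f" and g: "lin_on R M S L g"
  shows "lin_on R M S (pmod N L) (\<lambda>x. (f x, g x))"
  by (rule lin_onI)
    (use lin_on_modules[OF f] lin_on_modules[OF g] left_module_pmod in
      \<open>auto simp: lin_on_simps[OF f] lin_on_simps[OF g]\<close>)

end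

section \<open>Extension of linear maps\<close>

text \<open>Vanishing of \<open>Ext\<^sup>1(A, L)\<close> without resolutions: for every epimorphism \<open>M \<rightarrow> A\<close> with kernel \<open>K\<close>,
  every map \<open>K \<rightarrow> L\<close> extends to \<open>M\<close>.\<close>

definition extends :: "('r, 'x) ring_scheme \<Rightarrow> ('r, 'm) module \<Rightarrow> ('r, 'm) module \<Rightarrow> bool" where
  "extends R A L \<longleftrightarrow> (\<forall>M \<in> Obj (R_Mod R) :: ('r, 'm) module set. \<forall>p f. lin R M A p \<and> p ` carrier M = carrier A \<and>
     lin_on R M {x \<in> carrier M. p x = \<zero>\<^bsub>A\<^esub>} L f \<longrightarrow>
     (\<exists>F. lin R M L F \<and> (\<forall>x \<in> carrier M. p x = \<zero>\<^bsub>A\<^esub> \<longrightarrow> F x = f x)))"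

context ring_universe begin

text \<open>The definition of \<open>extends\<close> can only quantify over modules on
  \<open>'m\<close>. A module \<open>M\<close> on another type, such as a pullback inside a product,
  is replaced by its quotient by zero, an isomorphic copy on \<open>'m\<close> to which both
  \<open>p\<close> and \<open>f\<close> descend.\<close>

lemma extendsD:
  fixes A L :: "('r, 'm) module" and M :: "('r, 'a) module"
  assumes ext: "extends R A L" and M: "left_module R M" and fits: "fits U (carrier M)"
    and p: "lin R M A p" "p ` carrier M = carrier A"
    and f: "lin_on R M {x \<in> carrier M. p x = \<zero>\<^bsub>A\<^esub>} L f"
  shows "\<exists>F. lin R M L F \<and> (\<forall>x \<in> carrier M. p x = \<zero>\<^bsub>A\<^esub> \<longrightarrow> F x = f x)"
proof -
  let ?K = "{x \<in> carrier M. p x = \<zero>\<^bsub>A\<^esub>}"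
  obtain M' :: "('r, 'm) module" and q where M': "M' \<in> Obj (R_Mod R)" and q: "lin R M M' q"
    and surj: "q ` carrier M = carrier M'" and "\<forall>x \<in> carrier M. q x = \<zero>\<^bsub>M'\<^esub> \<longleftrightarrow> x \<in> {\<zero>\<^bsub>M\<^esub>}"
    using ex_quotient[OF M fits submod_zero[OF M]] by (elim exE conjE)
  then have q0: "x = \<zero>\<^bsub>M\<^esub>" if "x \<in> carrier M" "q x = \<zero>\<^bsub>M'\<^esub>" for x using that by blast
  have ker: "p x = \<zero>\<^bsub>A\<^esub>" if "x \<in> carrier M" "q x = \<zero>\<^bsub>M'\<^esub>" for x
    unfolding q0[OF that] by (rule lin_on_simps(4)[OF p(1)])
  obtain p' where p': "lin_on R M' (q ` carrier M) A p'" "\<And>x. x \<in> carrier M \<Longrightarrow> p' (q x) = p x"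
    using lin_on_factor[OF q p(1) ker] by blast
  have K: "submod R M ?K" by (rule submod_kernel[OF p(1)])
  have qK: "lin_on R M ?K M' q" by (rule lin_on_subset[OF q K]) auto
  have kerf: "f x = \<zero>\<^bsub>L\<^esub>" if "x \<in> ?K" "q x = \<zero>\<^bsub>M'\<^esub>" for x
    using q0 that lin_on_simps(4)[OF f] by blast
  obtain f' where f': "lin_on R M' (q ` ?K) L f'" "\<And>x. x \<in> ?K \<Longrightarrow> f' (q x) = f x"
    using lin_on_factor[OF qK f kerf] by blast
  have eq: "q ` ?K = {x \<in> carrier M'. p' x = \<zero>\<^bsub>A\<^esub>}" unfolding surj[symmetric] using p'(2) by auto
  have "p' ` carrier M' = carrier A" unfolding surj[symmetric] p(2)[symmetric] image_image using p'(2) by auto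
  then obtain F where F: "lin R M' L F" "\<forall>x \<in> carrier M'. p' x = \<zero>\<^bsub>A\<^esub> \<longrightarrow> F x = f' x"
    using ext M' p'(1) f'(1) unfolding extends_def surj eq by blast
  show ?thesis
  proof (intro exI[of _ "\<lambda>x. F (q x)"] conjI ballI impI)
    show "lin R M L (\<lambda>x. F (q x))" by (rule lin_on_comp[OF q F(1)]) (simp add: surj)
    show "F (q x) = f x" if "x \<in> carrier M" "p x = \<zero>\<^bsub>A\<^esub>" for x
    proof -
      have "q x \<in> carrier M'" "p' (q x) = \<zero>\<^bsub>A\<^esub>" using surj p'(2) that by auto
      then show ?thesis using F(2) f'(2) that by simp
    qed
  qed
qed

text \<open>Relative lifting: the pullback of \<open>\<psi>\<close> and \<open>d\<close> is an extension of \<open>T\<close> by the kernel of \<open>d\<close>, and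
  \<open>\<phi>\<close> splits it over the kernel of \<open>p\<close>.\<close>

lemma extends_lift:
  fixes A B B' M :: "('r, 'm) module"
  assumes ext: "extends R A (B\<lparr>carrier := {b \<in> carrier B. d b = \<zero>\<^bsub>B'\<^esub>}\<rparr>)"
    and M: "M \<in> Obj (R_Mod R)" and B: "B \<in> Obj (R_Mod R)"
    and p: "lin_on R M T A p" "p ` T = carrier A"
    and d: "lin R B B' d"
    and \<psi>: "lin_on R M T B' \<psi>" "\<psi> ` T \<subseteq> d ` carrier B"
    and \<phi>: "lin_on R M {x \<in> T. p x = \<zero>\<^bsub>A\<^esub>} B \<phi>" "\<And>x. x \<in> T \<Longrightarrow> p x = \<zero>\<^bsub>A\<^esub> \<Longrightarrow> d (\<phi> x) = \<psi> x"
  shows "\<exists>F. lin_on R M T B F \<and> (\<forall>x \<in> T. p x = \<zero>\<^bsub>A\<^esub> \<longrightarrow> F x = \<phi> x) \<and> (\<forall>x \<in> T. d (F x) = \<psi> x)"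
proof -
  note lm = ObjD(1)[OF M] ObjD(1)[OF B]
  have T: "submod R M T" and A: "left_module R A" and B': "left_module R B'"
    using p(1) d by (auto simp: lin_on_def)
  note t = submod_simps[OF lm(1) T]
  let ?P = "pmod M B" and ?C = "T \<times> carrier B"
  let ?L = "B\<lparr>carrier := {b \<in> carrier B. d b = \<zero>\<^bsub>B'\<^esub>}\<rparr>"
  have P: "left_module R ?P" by (rule left_module_pmod[OF lm])
  have C: "submod R ?P ?C" by (rule submod_pmod[OF T submod_carrier[OF lm(2)]])
  note fst = lin_on_fst[OF lm] and snd = lin_on_snd[OF lm]
  \<comment> \<open>The pullback condition \<open>\<psi> m = d b\<close> in difference form: as the
    kernel of a linear map, \<open>D\<close> is a submodule at once.\<close>
  define D where "D = {x \<in> ?C. \<psi> (fst x) \<ominus>\<^bsub>B'\<^esub> d (snd x) = \<zero>\<^bsub>B'\<^esub>}"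
  have D: "submod R ?P D" unfolding D_def
    by (rule submod_kernel, rule lin_on_minus)
      (rule lin_on_comp[OF fst[OF C] \<psi>(1)] lin_on_comp[OF snd[OF C] d], force)+
  have D_iff: "(m, b) \<in> D \<longleftrightarrow> m \<in> T \<and> b \<in> carrier B \<and> \<psi> m = d b" for m b
    using left_module_minus_eq_zero[OF B'] lin_on_simps(1)[OF \<psi>(1)] lin_on_simps(1)[OF d]
    by (auto simp: D_def)
  define P' where "P' = ?P\<lparr>carrier := D\<rparr>"
  have P': "left_module R P'" unfolding P'_def by (rule left_module_submod[OF P D])
  have cP': "carrier P' = D" by (simp add: P'_def)
  have linP': "lin_on R P' S N g \<longleftrightarrow> S \<subseteq> D \<and> lin_on R ?P S N g" for S g and N :: "('r, 'm) module"
    unfolding P'_def by (rule lin_on_submod_source[OF P D])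
  have fitsP': "fits U (carrier P')"
    by (rule fits_subset[OF fits_Times[OF ObjD(2)[OF M] ObjD(2)[OF B]]]) (use t(1) in \<open>auto simp: cP' D_def\<close>)
  have fstD: "fst ` D = T"
  proof
    show "T \<subseteq> fst ` D"
    proof
      fix x assume x: "x \<in> T"
      then obtain b where "b \<in> carrier B" "\<psi> x = d b" using \<psi>(2) by blast
      then have "(x, b) \<in> D" using x D_iff by simp
      then show "x \<in> fst ` D" by force
    qed
  qed (auto simp: D_def)
  have pf: "lin R P' A (\<lambda>x. p (fst x))"
    unfolding linP' cP' using lin_on_comp[OF fst[OF D] p(1)] fstD by auto
  have pf_surj: "(\<lambda>x. p (fst x)) ` carrier P' = carrier A"
    using fstD p(2) by (simp add: cP' flip: image_image)
  let ?K = "{x \<in> carrier P'. p (fst x) = \<zero>\<^bsub>A\<^esub>}"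
  have K: "submod R ?P ?K"
    using submod_kernel[OF lin_on_comp[OF fst[OF D] p(1)]] fstD by (auto simp: cP')
  have Lsub: "submod R B {b \<in> carrier B. d b = \<zero>\<^bsub>B'\<^esub>}" by (rule submod_kernel[OF d])
  \<comment> \<open>Over the kernel of \<open>p\<close> the values \<open>b\<close> and
    \<open>\<phi> m\<close> have the same image under \<open>d\<close>, so their difference lies in
    the kernel of \<open>d\<close>. This is the map whose extension the hypothesis supplies.\<close>
  have r0: "lin_on R P' ?K ?L (\<lambda>x. snd x \<ominus>\<^bsub>B\<^esub> \<phi> (fst x))"
    unfolding linP' lin_on_submod_target[OF lm(2) Lsub]
  proof (intro conjI)
    show "lin_on R ?P ?K B (\<lambda>x. snd x \<ominus>\<^bsub>B\<^esub> \<phi> (fst x))"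
      by (rule lin_on_minus[OF snd[OF K]], rule lin_on_comp[OF fst[OF K] \<phi>(1)])
        (auto simp: cP' D_iff)
    show "(\<lambda>x. snd x \<ominus>\<^bsub>B\<^esub> \<phi> (fst x)) ` ?K \<subseteq> {b \<in> carrier B. d b = \<zero>\<^bsub>B'\<^esub>}"
    proof clarify
      fix m b assume "(m, b) \<in> carrier P'" "p (fst (m, b)) = \<zero>\<^bsub>A\<^esub>"
      then have mb: "m \<in> T" "b \<in> carrier B" "\<psi> m = d b" "p m = \<zero>\<^bsub>A\<^esub>" by (auto simp: cP' D_iff)
      then have b': "\<phi> m \<in> carrier B" using lin_on_simps(1)[OF \<phi>(1)] by auto
      have "d (b \<ominus>\<^bsub>B\<^esub> \<phi> m) = d b \<ominus>\<^bsub>B'\<^esub> d (\<phi> m)" using lin_on_simps(6)[OF d] mb b' by simp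
      also have "\<dots> = \<zero>\<^bsub>B'\<^esub>"
        using left_module_minus_eq_zero[OF B'] \<phi>(2) mb lin_on_simps(1)[OF d] by simp
      finally show "snd (m, b) \<ominus>\<^bsub>B\<^esub> \<phi> (fst (m, b)) \<in> carrier B \<and>
          d (snd (m, b) \<ominus>\<^bsub>B\<^esub> \<phi> (fst (m, b))) = \<zero>\<^bsub>B'\<^esub>"
        using left_module_simps(4)[OF lm(2)] mb b' by simp
    qed
  qed (auto simp: cP')
  obtain r where r: "lin R P' ?L r"
    and rK: "\<And>x. x \<in> carrier P' \<Longrightarrow> p (fst x) = \<zero>\<^bsub>A\<^esub> \<Longrightarrow> r x = snd x \<ominus>\<^bsub>B\<^esub> \<phi> (fst x)"
    using extendsD[OF ext P' fitsP' pf pf_surj r0] by blast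
  have r': "lin_on R ?P D B r" and rL: "r ` D \<subseteq> {b \<in> carrier B. d b = \<zero>\<^bsub>B'\<^esub>}"
    using r unfolding linP' cP' lin_on_submod_target[OF lm(2) Lsub] by auto
  \<comment> \<open>On pairs with first entry zero \<open>r\<close> returns the second entry, so
    \<open>snd x \<ominus> r x\<close> depends only on \<open>fst x\<close>. As \<open>r\<close>
    takes values in the kernel of \<open>d\<close>, the image of this difference under
    \<open>d\<close> is still \<open>\<psi> (fst x)\<close>.\<close>
  have h: "lin_on R ?P D B (\<lambda>x. snd x \<ominus>\<^bsub>B\<^esub> r x)" by (rule lin_on_minus[OF snd[OF D] r'])
  have zA: "p \<zero>\<^bsub>M\<^esub> = \<zero>\<^bsub>A\<^esub>" by (rule lin_on_simps(4)[OF p(1)])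
  have ker: "snd x \<ominus>\<^bsub>B\<^esub> r x = \<zero>\<^bsub>B\<^esub>" if x: "x \<in> D" "fst x = \<zero>\<^bsub>M\<^esub>" for x
  proof -
    have b: "snd x \<in> carrier B" using x(1) by (auto simp: D_def)
    have "r x = snd x \<ominus>\<^bsub>B\<^esub> \<zero>\<^bsub>B\<^esub>"
      using rK[of x] x zA lin_on_simps(4)[OF \<phi>(1)] by (simp add: cP')
    also have "\<dots> = snd x" using b left_module_simps(8,15,16)[OF lm(2)] by simp
    finally show ?thesis using b left_module_minus_eq_zero[OF lm(2)] by simp
  qed
  obtain F where F: "lin_on R M (fst ` D) B F" "\<And>x. x \<in> D \<Longrightarrow> F (fst x) = snd x \<ominus>\<^bsub>B\<^esub> r x"
    using lin_on_factor[OF fst[OF D] h ker] by blast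
  show ?thesis
  proof (intro exI[of _ F] conjI ballI impI)
    show "lin_on R M T B F" using F(1) fstD by simp
    show "d (F x) = \<psi> x" if x: "x \<in> T" for x
    proof -
      obtain b where b: "(x, b) \<in> D" using fstD x by auto
      then have c: "b \<in> carrier B" "r (x, b) \<in> carrier B" "d (r (x, b)) = \<zero>\<^bsub>B'\<^esub>" "d b = \<psi> x"
        using rL D_iff by auto
      have "F x = b \<ominus>\<^bsub>B\<^esub> r (x, b)" using F(2)[OF b] by simp
      then have "d (F x) = d b \<ominus>\<^bsub>B'\<^esub> \<zero>\<^bsub>B'\<^esub>" using c lin_on_simps(6)[OF d] by simp
      then show ?thesis
        using c lin_on_simps(1)[OF d c(1)] left_module_simps(8,15,16)[OF B'] by simp
    qed
  next
    fix x assume x: "x \<in> T" and px: "p x = \<zero>\<^bsub>A\<^esub>"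
    have "\<phi> x \<in> carrier B" using lin_on_simps(1)[OF \<phi>(1)] x px by simp
    then have xD: "(x, \<phi> x) \<in> D" using D_iff \<phi>(2) x px by simp
    have "F x = \<phi> x \<ominus>\<^bsub>B\<^esub> r (x, \<phi> x)" using F(2)[OF xD] by simp
    also have "r (x, \<phi> x) = \<zero>\<^bsub>B\<^esub>"
      using rK[of "(x, \<phi> x)"] xD px left_module_minus_eq_zero[OF lm(2)] \<open>\<phi> x \<in> carrier B\<close> by (simp add: cP')
    finally show "F x = \<phi> x" using \<open>\<phi> x \<in> carrier B\<close> left_module_simps(8,15,16)[OF lm(2)] by simp
  qed
qed

text \<open>Composition with the inverse of \<open>\<theta>\<close> turns an epimorphism onto
  \<open>A'\<close> into one onto \<open>A\<close> with the same kernel, so the extension problem is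
  literally the same.\<close>

lemma extends_iso:
  fixes A A' L :: "('r, 'm) module"
  assumes "extends R A L" "lin R A A' \<theta>" "bij_betw \<theta> (carrier A) (carrier A')"
  shows "extends R A' L"
proof -
  have A: "left_module R A" and A': "left_module R A'" using assms(2) by (auto simp: lin_on_def)
  have inj: "x = \<zero>\<^bsub>A\<^esub>" if "x \<in> carrier A" "\<theta> x = \<zero>\<^bsub>A'\<^esub>" for x
    using that assms(3) left_module_simps(2)[OF A] lin_on_simps(4)[OF assms(2)]
    by (metis bij_betw_inv_into_left)
  have im: "\<theta> ` carrier A = carrier A'" using assms(3) by (simp add: bij_betw_def)
  obtain k where k: "lin R A' A k" "\<And>x. x \<in> carrier A \<Longrightarrow> k (\<theta> x) = x"
    using lin_on_factor[OF assms(2) lin_on_id[OF A submod_carrier[OF A]] inj] im by auto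
  have k0: "k y = \<zero>\<^bsub>A\<^esub> \<longleftrightarrow> y = \<zero>\<^bsub>A'\<^esub>" if "y \<in> carrier A'" for y
  proof
    obtain x where x: "x \<in> carrier A" "y = \<theta> x" using \<open>y \<in> carrier A'\<close> im by blast
    assume "k y = \<zero>\<^bsub>A\<^esub>"
    then show "y = \<zero>\<^bsub>A'\<^esub>" using x k(2) lin_on_simps(4)[OF assms(2)] by simp
  qed (simp add: lin_on_simps(4)[OF k(1)])
  have kim: "k ` carrier A' = carrier A" using k(2) unfolding im[symmetric] image_image by simp
  show ?thesis unfolding extends_def
  proof (intro ballI allI impI, elim conjE)
    fix M :: "('r, 'm) module" and p f assume M: "M \<in> Obj (R_Mod R)" and p: "lin R M A' p" "p ` carrier M = carrier A'"
      and f: "lin_on R M {x \<in> carrier M. p x = \<zero>\<^bsub>A'\<^esub>} L f"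
    have kp: "lin R M A (\<lambda>x. k (p x))" by (rule lin_on_comp[OF p(1) k(1)]) (simp add: p(2))
    have "k (p x) = \<zero>\<^bsub>A\<^esub> \<longleftrightarrow> p x = \<zero>\<^bsub>A'\<^esub>" if "x \<in> carrier M" for x
      using k0 p(2) that by blast
    then have *: "{x \<in> carrier M. k (p x) = \<zero>\<^bsub>A\<^esub>} = {x \<in> carrier M. p x = \<zero>\<^bsub>A'\<^esub>}" by auto
    have "(\<lambda>x. k (p x)) ` carrier M = carrier A" using p(2) kim by (simp flip: image_image)
    then have "\<exists>F. lin R M L F \<and> (\<forall>x \<in> carrier M. k (p x) = \<zero>\<^bsub>A\<^esub> \<longrightarrow> F x = f x)"
      using assms(1)[unfolded extends_def, rule_format, OF M, of "\<lambda>x. k (p x)" f] kp f unfolding * by blast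
    then show "\<exists>F. lin R M L F \<and> (\<forall>x \<in> carrier M. p x = \<zero>\<^bsub>A'\<^esub> \<longrightarrow> F x = f x)"
      using * by blast
  qed
qed

end

section \<open>Projective resolutions and the first derived functor\<close>

text \<open>What modules and complexes share, and what is used to analyse \<open>Ext1\<close>.
  Additivity is stated on the side that makes precomposition with a differential a group
  homomorphism. The axiom on projectives delivers a kernel of the epimorphism as well, because a
  resolution arises by iterating the passage to this kernel.\<close>

locale preadditive_category =
  fixes K :: "('o, 'f) preadditive"
  assumes comp_closed: "\<lbrakk>A \<in> Obj K; B \<in> Obj K; C \<in> Obj K; f \<in> Hom K A B; g \<in> Hom K B C\<rbrakk> \<Longrightarrow>
      Comp K A g f \<in> Hom K A C"
    and comp_assoc: "\<lbrakk>A \<in> Obj K; B \<in> Obj K; C \<in> Obj K; D \<in> Obj K;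
      f \<in> Hom K A B; g \<in> Hom K B C; h \<in> Hom K C D\<rbrakk> \<Longrightarrow>
      Comp K A (Comp K B h g) f = Comp K A h (Comp K A g f)"
    and zero_closed: "\<lbrakk>A \<in> Obj K; B \<in> Obj K\<rbrakk> \<Longrightarrow> Zero K A B \<in> Hom K A B"
    and comp_zero_right: "\<lbrakk>A \<in> Obj K; B \<in> Obj K; C \<in> Obj K; g \<in> Hom K B C\<rbrakk> \<Longrightarrow>
      Comp K A g (Zero K A B) = Zero K A C"
    and comp_zero_left: "\<lbrakk>A \<in> Obj K; B \<in> Obj K; C \<in> Obj K; f \<in> Hom K A B\<rbrakk> \<Longrightarrow>
      Comp K A (Zero K B C) f = Zero K A C"
    and hom_comm_group: "\<lbrakk>A \<in> Obj K; B \<in> Obj K\<rbrakk> \<Longrightarrow> comm_group (hom_group K A B)"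
    and comp_add: "\<lbrakk>A \<in> Obj K; B \<in> Obj K; C \<in> Obj K; f \<in> Hom K A B; g \<in> Hom K B C; h \<in> Hom K B C\<rbrakk> \<Longrightarrow>
      Comp K A (Plus K B C g h) f = Plus K A C (Comp K A g f) (Comp K A h f)"
    and enough_projectives: "A \<in> Obj K \<Longrightarrow>
      \<exists>P e N k. projective_obj K P \<and> epic K P A e \<and> is_kernel K P A e N k"
begin

lemma exact_at_comp:
  assumes "exact_at K A f B g C" "A \<in> Obj K" "B \<in> Obj K" "C \<in> Obj K"
  shows "Comp K A g f = Zero K A C"
proof -
  obtain N k e where N: "is_kernel K B C g N k" "epic K A N e" "Comp K A k e = f" and g: "g \<in> Hom K B C"
    using assms(1) by (auto simp: exact_at_def)
  then have h: "N \<in> Obj K" "k \<in> Hom K N B" "e \<in> Hom K A N" "Comp K N g k = Zero K N C"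
    by (auto simp: is_kernel_def epic_def)
  have "Comp K A g f = Comp K A (Comp K N g k) e"
    using comp_assoc[of A N B C e k g] h assms N(3) g by simp
  then show ?thesis using h comp_zero_left assms by simp
qed

text \<open>Iterated syzygies: \<open>N i\<close> is covered by
  \<open>E i : P i \<rightarrow> N i\<close> with kernel
  \<open>\<kappa> i : N (i + 1) \<rightarrow> P i\<close>, and \<open>d i\<close> is
  \<open>E (i + 1)\<close> followed by \<open>\<kappa> i\<close>. Since \<open>\<kappa> i\<close>
  can be cancelled, a kernel of \<open>E (i + 1)\<close> is also a kernel of \<open>d i\<close>,
  which gives exactness.\<close>

lemma ex_projective_resolution:
  assumes A: "A \<in> Obj K"
  shows "\<exists>P d e. projective_resolution K A P d e"
proof -
  have "\<forall>A \<in> Obj K. \<exists>x. case x of (P, e, N, k) \<Rightarrow>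
      projective_obj K P \<and> epic K P A e \<and> is_kernel K P A e N k"
  proof
    fix A assume "A \<in> Obj K"
    then obtain P e N k where "projective_obj K P \<and> epic K P A e \<and> is_kernel K P A e N k"
      using enough_projectives by blast
    then show "\<exists>x. case x of (P, e, N, k) \<Rightarrow> projective_obj K P \<and> epic K P A e \<and> is_kernel K P A e N k"
      by (intro exI[of _ "(P, e, N, k)"]) simp
  qed
  from bchoice[OF this] obtain F where F: "\<forall>A \<in> Obj K. case F A of (P, e, N, k) \<Rightarrow>
      projective_obj K P \<and> epic K P A e \<and> is_kernel K P A e N k" ..
  define p where "p A = fst (F A)" for A
  define e where "e A = fst (snd (F A))" for A
  define n where "n A = fst (snd (snd (F A)))" for A
  define k where "k A = snd (snd (snd (F A)))" for A
  have F': "projective_obj K (p A) \<and> epic K (p A) A (e A) \<and> is_kernel K (p A) A (e A) (n A) (k A)"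
    if "A \<in> Obj K" for A
    using bspec[OF F that] by (cases "F A") (simp add: p_def e_def n_def k_def)
  define N where "N i = (n ^^ i) A" for i
  have N0: "N 0 = A" and NS: "N (Suc i) = n (N i)" for i by (simp_all add: N_def)
  have NO: "N i \<in> Obj K" for i
    by (induction i) (use A F' in \<open>auto simp: N0 NS is_kernel_def\<close>)
  define P where "P i = p (N i)" for i
  define E where "E i = e (N i)" for i
  define \<kappa> where "\<kappa> i = k (N i)" for i
  have proj: "projective_obj K (P i)" and epi: "epic K (P i) (N i) (E i)"
    and ker: "is_kernel K (P i) (N i) (E i) (N (Suc i)) (\<kappa> i)" for i
    using F'[OF NO[of i]] by (auto simp: P_def E_def \<kappa>_def NS)
  have PO: "P i \<in> Obj K" for i using proj by (simp add: projective_obj_def)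
  have EH: "E i \<in> Hom K (P i) (N i)" for i using epi by (simp add: epic_def)
  have \<kappa>H: "\<kappa> i \<in> Hom K (N (Suc i)) (P i)" for i using ker by (simp add: is_kernel_def)
  define d where "d i = Comp K (P (Suc i)) (\<kappa> i) (E (Suc i))" for i
  have dH: "d i \<in> Hom K (P (Suc i)) (P i)" for i
    unfolding d_def using comp_closed PO NO EH \<kappa>H by blast
  have ker': "is_kernel K (P (Suc i)) (P i) (d i) (N (Suc (Suc i))) (\<kappa> (Suc i))" for i
    unfolding is_kernel_def
  proof (intro conjI ballI impI)
    have "Comp K (N (Suc (Suc i))) (d i) (\<kappa> (Suc i)) =
        Comp K (N (Suc (Suc i))) (\<kappa> i) (Comp K (N (Suc (Suc i))) (E (Suc i)) (\<kappa> (Suc i)))"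
      unfolding d_def using comp_assoc PO NO EH \<kappa>H by blast
    also have "\<dots> = Zero K (N (Suc (Suc i))) (P i)"
      using ker[of "Suc i"] comp_zero_right NO PO \<kappa>H by (simp add: is_kernel_def)
    finally show "Comp K (N (Suc (Suc i))) (d i) (\<kappa> (Suc i)) = Zero K (N (Suc (Suc i))) (P i)" .
  next
    fix T u assume T: "T \<in> Obj K" and u: "u \<in> Hom K T (P (Suc i))"
      and z: "Comp K T (d i) u = Zero K T (P i)"
    have EuH: "Comp K T (E (Suc i)) u \<in> Hom K T (N (Suc i))"
      using comp_closed T u PO NO EH by blast
    have "Comp K T (\<kappa> i) (Comp K T (E (Suc i)) u) = Zero K T (P i)"
      using z comp_assoc[OF T PO NO PO u EH \<kappa>H] by (simp add: d_def)
    moreover have "Comp K T (\<kappa> i) (Zero K T (N (Suc i))) = Zero K T (P i)"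
      using comp_zero_right T NO PO \<kappa>H by blast
    \<comment> \<open>Cancellation of \<open>\<kappa> i\<close>: zero and the composite with
      \<open>E (i + 1)\<close> both factor the zero morphism through a kernel, and such a
      factorisation is unique.\<close>
    moreover have "\<exists>!w. w \<in> Hom K T (N (Suc i)) \<and> Comp K T (\<kappa> i) w = Zero K T (P i)"
    proof -
      have "Comp K T (E i) (Zero K T (P i)) = Zero K T (N i)"
        using comp_zero_right[OF T PO NO EH] .
      then show ?thesis using ker[of i] T zero_closed[OF T PO] unfolding is_kernel_def by blast
    qed
    ultimately have "Comp K T (E (Suc i)) u = Zero K T (N (Suc i))"
      using EuH zero_closed[OF T NO] by blast
    then show "\<exists>!w. w \<in> Hom K T (N (Suc (Suc i))) \<and> Comp K T (\<kappa> (Suc i)) w = u"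
      using ker[of "Suc i"] T u unfolding is_kernel_def by blast
  qed (use NO \<kappa>H in auto)
  have "projective_resolution K A P d (E 0)"
    unfolding projective_resolution_def
  proof (intro conjI allI)
    show "epic K (P 0) A (E 0)" using epi[of 0] by (simp add: N0)
    show "exact_at K (P 1) (d 0) (P 0) (E 0) A"
      unfolding exact_at_def using dH[of 0] EH[of 0] ker[of 0] epi[of 1]
      by (auto simp: N0 d_def)
    show "exact_at K (P (Suc (Suc i))) (d (Suc i)) (P (Suc i)) (d i) (P i)" for i
      unfolding exact_at_def using dH[of i] dH[of "Suc i"] ker'[of i] epi[of "Suc (Suc i)"] d_def[of "Suc i"]
      by metis
  qed (rule proj)
  then show ?thesis by blast
qed

text \<open>\<open>Ext1\<close> refers to one resolution picked by \<open>SOME\<close>. The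
  statement hands out just this resolution together with the criterion, so that different
  resolutions never have to be compared.\<close>

lemma Ext1_trivial_iff:
  assumes A: "A \<in> Obj K" and B: "B \<in> Obj K"
  shows "\<exists>P d e. projective_resolution K A P d e \<and>
    (trivial_group (Ext1 K A B) \<longleftrightarrow> hom_cocycles1 K P d B \<subseteq> hom_coboundaries1 K P d B)"
proof -
  define x where "x = (SOME (P, d, e). projective_resolution K A P d e)"
  obtain P d e where x: "x = (P, d, e)" by (cases x)
  have "case x of (P, d, e) \<Rightarrow> projective_resolution K A P d e"
    unfolding x_def by (rule someI_ex) (use ex_projective_resolution[OF A] in auto)
  then have res: "projective_resolution K A P d e" by (simp add: x)
  have Ext: "Ext1 K A B = hom_cohomology1 K P d B"
    unfolding Ext1_def using x by (simp add: x_def)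
  have PO: "P i \<in> Obj K" for i using res by (simp add: projective_resolution_def projective_obj_def)
  have ex: "exact_at K (P (Suc (Suc 0))) (d (Suc 0)) (P (Suc 0)) (d 0) (P 0)"
    using res by (simp add: projective_resolution_def)
  then have dH: "d (Suc 0) \<in> Hom K (P (Suc (Suc 0))) (P (Suc 0))" "d 0 \<in> Hom K (P (Suc 0)) (P 0)"
    by (auto simp: exact_at_def)
  let ?G = "hom_group K (P (Suc 0)) B" and ?H = "hom_group K (P 0) B"
  let ?Z = "hom_cocycles1 K P d B" and ?C = "hom_coboundaries1 K P d B"
  interpret G: comm_group ?G by (rule hom_comm_group[OF PO B])
  interpret H: comm_group ?H by (rule hom_comm_group[OF PO B])
  interpret h: group_hom ?H ?G "\<lambda>h. Comp K (P (Suc 0)) h (d 0)"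
    by unfold_locales
      (use comp_closed[OF PO PO B dH(2)] comp_add[OF PO PO B dH(2)] in \<open>auto simp: hom_def hom_group_def\<close>)
  have C_eq: "?C = (\<lambda>h. Comp K (P (Suc 0)) h (d 0)) ` carrier ?H"
    by (simp add: hom_coboundaries1_def hom_group_def)
  have C: "subgroup ?C ?G" unfolding C_eq by (rule h.img_is_subgroup)
  have "?C \<subseteq> ?Z"
  proof
    fix g assume "g \<in> ?C"
    then obtain h where h: "h \<in> Hom K (P 0) B" "g = Comp K (P (Suc 0)) h (d 0)"
      by (auto simp: hom_coboundaries1_def)
    have "Comp K (P (Suc (Suc 0))) g (d (Suc 0)) =
        Comp K (P (Suc (Suc 0))) h (Comp K (P (Suc (Suc 0))) (d 0) (d (Suc 0)))"
      unfolding h(2) by (rule comp_assoc[OF PO PO PO B dH h(1)])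
    also have "\<dots> = Zero K (P (Suc (Suc 0))) B"
      using exact_at_comp[OF ex PO PO PO] comp_zero_right[OF PO PO B h(1)] by simp
    finally show "g \<in> ?Z"
      using comp_closed[OF PO PO B dH(2) h(1)] h(2) by (simp add: hom_cocycles1_def numeral_2_eq_2)
  qed
  let ?GZ = "?G\<lparr>carrier := ?Z\<rparr>"
  have cohom: "hom_cohomology1 K P d B = ?GZ Mod ?C" by (simp add: hom_cohomology1_def)
  have "trivial_group (?GZ Mod ?C) \<longleftrightarrow> ?Z \<subseteq> ?C"
  proof
    assume "trivial_group (?GZ Mod ?C)"
    \<comment> \<open>The neutral element of the factor group is \<open>?C\<close> itself, so
      triviality says that every coset of \<open>?C\<close> equals \<open>?C\<close>.\<close>
    then have *: "rcosets\<^bsub>?GZ\<^esub> ?C = {?C}" by (simp add: trivial_group_def FactGroup_def)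
    show "?Z \<subseteq> ?C"
    proof
      fix z assume z: "z \<in> ?Z"
      then have "?C #>\<^bsub>?GZ\<^esub> z = ?C" using * by (auto simp: RCOSETS_def)
      moreover have "\<one>\<^bsub>?G\<^esub> \<otimes>\<^bsub>?G\<^esub> z \<in> ?C #>\<^bsub>?GZ\<^esub> z"
        using subgroup.one_closed[OF C] by (auto simp: r_coset_def)
      moreover have "z \<in> carrier ?G" using z by (simp add: hom_cocycles1_def hom_group_def)
      ultimately show "z \<in> ?C" by simp
    qed
  next
    assume "?Z \<subseteq> ?C"
    with \<open>?C \<subseteq> ?Z\<close> have ZC: "?Z = ?C" by blast
    interpret GZ: group ?GZ unfolding ZC by (rule subgroup.subgroup_is_group[OF C G.is_group])
    have cos: "?C #>\<^bsub>?GZ\<^esub> z = ?C" if "z \<in> ?Z" for z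
      using GZ.coset_join2[OF _ GZ.subgroup_self, of z] that by (simp add: ZC)
    have "?C \<lhd> ?GZ" using GZ.normal_self ZC by simp
    then have "group (?GZ Mod ?C)" by (rule normal.factorgroup_is_group)
    moreover have "rcosets\<^bsub>?GZ\<^esub> ?C = {?C}"
      using cos GZ.one_closed unfolding RCOSETS_def by (auto simp: ZC)
    ultimately show "trivial_group (?GZ Mod ?C)" by (simp add: trivial_group_def FactGroup_def)
  qed
  then show ?thesis using res Ext cohom by metis
qed

end

section \<open>Free modules\<close>

text \<open>Finitely supported functions on the whole type \<open>'g\<close> that vanish off
  \<open>S\<close>. Zero, sum and multiples do not mention \<open>S\<close>, so the same expression
  can be evaluated in \<open>free_mod R T\<close> for any other \<open>T\<close>.\<close>

definition free_mod :: "('r, 'x) ring_scheme \<Rightarrow> 'g set \<Rightarrow> ('r, 'g \<Rightarrow> 'r) module" where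
  "free_mod R S = \<lparr>carrier = {\<phi>. (\<forall>s. \<phi> s \<in> carrier R) \<and> (\<forall>s. s \<notin> S \<longrightarrow> \<phi> s = \<zero>\<^bsub>R\<^esub>) \<and> finite {s. \<phi> s \<noteq> \<zero>\<^bsub>R\<^esub>}},
     monoid.mult = undefined, one = undefined, zero = (\<lambda>_. \<zero>\<^bsub>R\<^esub>),
     add = (\<lambda>\<phi> \<psi> s. \<phi> s \<oplus>\<^bsub>R\<^esub> \<psi> s), smult = (\<lambda>r \<phi> s. r \<otimes>\<^bsub>R\<^esub> \<phi> s)\<rparr>"

definition free_gen :: "('r, 'x) ring_scheme \<Rightarrow> 'g \<Rightarrow> 'g \<Rightarrow> 'r" where
  "free_gen R g = (\<lambda>s. if s = g then \<one>\<^bsub>R\<^esub> else \<zero>\<^bsub>R\<^esub>)"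

text \<open>Linear combinations are given by lists rather than by finite sets of indices: a list can
  be stored inside a recursive datatype, and repeated entries or zero coefficients do no
  harm.\<close>

primrec lincomb :: "('r, 'b) module \<Rightarrow> ('r \<times> 'b) list \<Rightarrow> 'b" where
  "lincomb M [] = \<zero>\<^bsub>M\<^esub>"
| "lincomb M (p # l) = (fst p \<odot>\<^bsub>M\<^esub> snd p) \<oplus>\<^bsub>M\<^esub> lincomb M l"

lemma free_mod_simps [simp]:
  "\<zero>\<^bsub>free_mod R S\<^esub> = (\<lambda>_. \<zero>\<^bsub>R\<^esub>)"
  "\<phi> \<oplus>\<^bsub>free_mod R S\<^esub> \<psi> = (\<lambda>s. \<phi> s \<oplus>\<^bsub>R\<^esub> \<psi> s)"
  "r \<odot>\<^bsub>free_mod R S\<^esub> \<phi> = (\<lambda>s. r \<otimes>\<^bsub>R\<^esub> \<phi> s)"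
  by (simp_all add: free_mod_def)

lemma free_mod_carrier:
  "\<phi> \<in> carrier (free_mod R S) \<longleftrightarrow>
    (\<forall>s. \<phi> s \<in> carrier R) \<and> (\<forall>s. s \<notin> S \<longrightarrow> \<phi> s = \<zero>\<^bsub>R\<^esub>) \<and> finite {s. \<phi> s \<noteq> \<zero>\<^bsub>R\<^esub>}"
  by (simp add: free_mod_def)

context ring begin

lemma left_module_free: "left_module R (free_mod R S)"
proof (rule left_moduleI)
  fix \<phi> \<psi> assume *: "\<phi> \<in> carrier (free_mod R S)" "\<psi> \<in> carrier (free_mod R S)"
  have "finite {s. \<phi> s \<oplus> \<psi> s \<noteq> \<zero>}"
    by (rule finite_subset[of _ "{s. \<phi> s \<noteq> \<zero>} \<union> {s. \<psi> s \<noteq> \<zero>}"]) (use * in \<open>auto simp: free_mod_carrier\<close>)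
  then show "\<phi> \<oplus>\<^bsub>free_mod R S\<^esub> \<psi> \<in> carrier (free_mod R S)" using * by (auto simp: free_mod_carrier)
next
  fix \<phi> assume *: "\<phi> \<in> carrier (free_mod R S)"
  then have "(\<lambda>s. \<ominus> \<phi> s) \<in> carrier (free_mod R S)"
    by (auto simp: free_mod_carrier elim: rev_finite_subset)
  then show "\<exists>y \<in> carrier (free_mod R S). y \<oplus>\<^bsub>free_mod R S\<^esub> \<phi> = \<zero>\<^bsub>free_mod R S\<^esub>"
    by (rule bexI[rotated]) (use * in \<open>auto simp: free_mod_carrier l_neg\<close>)
next
  fix a \<phi> assume *: "a \<in> carrier R" "\<phi> \<in> carrier (free_mod R S)"
  then show "a \<odot>\<^bsub>free_mod R S\<^esub> \<phi> \<in> carrier (free_mod R S)"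
    by (auto simp: free_mod_carrier elim: rev_finite_subset)
qed (auto simp: free_mod_carrier a_ac l_distr r_distr m_assoc intro!: ext)

lemma free_gen_closed: "s \<in> S \<Longrightarrow> free_gen R s \<in> carrier (free_mod R S)"
  by (auto simp: free_mod_carrier free_gen_def)

lemma lincomb_closed:
  assumes "left_module R M"
  shows "submod R M S \<Longrightarrow> set l \<subseteq> carrier R \<times> S \<Longrightarrow> lincomb M l \<in> S"
  by (induction l) (auto simp: submod_def)

lemma lincomb_lin_on:
  assumes f: "lin_on R M S N f"
  shows "set l \<subseteq> carrier R \<times> S \<Longrightarrow> f (lincomb M l) = lincomb N (map (map_prod id f) l)"
proof (induction l)
  case Nil
  then show ?case using lin_on_simps(4)[OF f] by simp
next
  case (Cons p l)
  obtain r x where p: "p = (r, x)" by (cases p)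
  note m = lin_on_modules[OF f]
  have "lincomb M l \<in> S" using lincomb_closed[of M S l] m Cons.prems by simp
  moreover have "r \<odot>\<^bsub>M\<^esub> x \<in> S" using submod_simps(6)[of M S r x] m Cons.prems p by simp
  ultimately show ?case using Cons lin_on_simps(2,3)[OF f] p by simp
qed

lemma finsum_smult:
  assumes N: "left_module R N" and a: "a \<in> carrier R" and "finite A"
  shows "f \<in> A \<rightarrow> carrier N \<Longrightarrow> a \<odot>\<^bsub>N\<^esub> finsum N f A = finsum N (\<lambda>s. a \<odot>\<^bsub>N\<^esub> f s) A"
  using \<open>finite A\<close>
proof (induction A)
  case empty
  interpret N: abelian_group N by (rule left_module_abelian[OF N])
  show ?case using left_module_simps(18)[OF N a] by simp
next
  case (insert s A)
  interpret N: abelian_group N by (rule left_module_abelian[OF N])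
  have f: "f \<in> A \<rightarrow> carrier N" "f s \<in> carrier N" "(\<lambda>s. a \<odot>\<^bsub>N\<^esub> f s) \<in> A \<rightarrow> carrier N" "a \<odot>\<^bsub>N\<^esub> f s \<in> carrier N"
    using insert.prems left_module_simps(5)[OF N a] by auto
  show ?case
    using insert.IH[OF f(1)] f insert.hyps left_module_simps(17)[OF N a f(2) N.finsum_closed[OF f(1)]] by simp
qed

text \<open>Sums and multiples of functions may have smaller supports than expected. Summation over
  any finite set that contains the support makes the sums for different functions
  comparable.\<close>

lemma free_mod_finite_sum:
  assumes N: "left_module R N" and u: "u \<in> S \<rightarrow> carrier N" and \<phi>: "\<phi> \<in> carrier (free_mod R S)"
    and A: "finite A" "{s. \<phi> s \<noteq> \<zero>} \<subseteq> A" "A \<subseteq> S"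
  shows "finsum N (\<lambda>s. \<phi> s \<odot>\<^bsub>N\<^esub> u s) {s. \<phi> s \<noteq> \<zero>} = finsum N (\<lambda>s. \<phi> s \<odot>\<^bsub>N\<^esub> u s) A"
proof -
  interpret N: abelian_group N by (rule left_module_abelian[OF N])
  have c: "\<phi> s \<odot>\<^bsub>N\<^esub> u s \<in> carrier N" if "s \<in> S" for s
    using left_module_simps(5)[OF N] u \<phi> that by (auto simp: free_mod_carrier)
  show ?thesis
  proof (rule N.add.finprod_mono_neutral_cong_left[OF A(1,2)])
    show "\<phi> i \<odot>\<^bsub>N\<^esub> u i = \<zero>\<^bsub>N\<^esub>" if "i \<in> A - {s. \<phi> s \<noteq> \<zero>}" for i
      using that A(3) u left_module_smult(4)[OF N] by auto
  qed (use c A in auto)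
qed

lemma free_mod_lift:
  assumes N: "left_module R N" and u: "u \<in> S \<rightarrow> carrier N"
  shows "\<exists>h. lin R (free_mod R S) N h \<and> (\<forall>s \<in> S. h (free_gen R s) = u s)"
proof -
  interpret N: abelian_group N by (rule left_module_abelian[OF N])
  let ?F = "free_mod R S"
  define h where "h \<phi> = finsum N (\<lambda>s. \<phi> s \<odot>\<^bsub>N\<^esub> u s) {s. \<phi> s \<noteq> \<zero>}" for \<phi>
  have c: "\<phi> s \<odot>\<^bsub>N\<^esub> u s \<in> carrier N" if "s \<in> S" "\<phi> \<in> carrier ?F" for s \<phi>
    using left_module_simps(5)[OF N] u that by (auto simp: free_mod_carrier)
  have h: "h \<phi> = finsum N (\<lambda>s. \<phi> s \<odot>\<^bsub>N\<^esub> u s) A"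
    if "\<phi> \<in> carrier ?F" "finite A" "{s. \<phi> s \<noteq> \<zero>} \<subseteq> A" "A \<subseteq> S" for \<phi> A
    unfolding h_def by (rule free_mod_finite_sum[OF N u that])
  have F: "left_module R ?F" by (rule left_module_free)
  have supp: "finite {s. \<phi> s \<noteq> \<zero>}" "{s. \<phi> s \<noteq> \<zero>} \<subseteq> S" if "\<phi> \<in> carrier ?F" for \<phi>
    using that by (auto simp: free_mod_carrier)
  have "lin R ?F N h"
  proof (rule lin_onI[OF F N submod_carrier[OF F]])
    fix \<phi> assume \<phi>: "\<phi> \<in> carrier ?F"
    show "h \<phi> \<in> carrier N" unfolding h_def by (rule N.finsum_closed) (use c supp(2)[OF \<phi>] \<phi> in auto)
    fix \<psi> assume \<psi>: "\<psi> \<in> carrier ?F"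
    let ?A = "{s. \<phi> s \<noteq> \<zero>} \<union> {s. \<psi> s \<noteq> \<zero>}"
    have A: "finite ?A" "?A \<subseteq> S" using supp \<phi> \<psi> by auto
    have sum: "\<phi> \<oplus>\<^bsub>?F\<^esub> \<psi> \<in> carrier ?F" using left_module_simps(1)[OF F \<phi> \<psi>] .
    have "h (\<phi> \<oplus>\<^bsub>?F\<^esub> \<psi>) = finsum N (\<lambda>s. (\<phi> s \<oplus> \<psi> s) \<odot>\<^bsub>N\<^esub> u s) ?A"
    proof -
      have "{s. (\<phi> \<oplus>\<^bsub>?F\<^esub> \<psi>) s \<noteq> \<zero>} \<subseteq> ?A" by auto
      from h[OF sum A(1) this A(2)] show ?thesis by simp
    qed
    also have "\<dots> = finsum N (\<lambda>s. \<phi> s \<odot>\<^bsub>N\<^esub> u s \<oplus>\<^bsub>N\<^esub> \<psi> s \<odot>\<^bsub>N\<^esub> u s) ?A"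
    proof (rule N.finsum_cong')
      show "(\<phi> s \<oplus> \<psi> s) \<odot>\<^bsub>N\<^esub> u s = \<phi> s \<odot>\<^bsub>N\<^esub> u s \<oplus>\<^bsub>N\<^esub> \<psi> s \<odot>\<^bsub>N\<^esub> u s" if "s \<in> ?A" for s
      proof -
        have "u s \<in> carrier N" using A(2) u that by blast
        then show ?thesis using left_module_smult(1)[OF N] \<phi> \<psi> by (simp add: free_mod_carrier)
      qed
    qed (use c[OF _ \<phi>] c[OF _ \<psi>] A in auto)
    also have "\<dots> = h \<phi> \<oplus>\<^bsub>N\<^esub> h \<psi>"
    proof -
      have "h \<phi> = finsum N (\<lambda>s. \<phi> s \<odot>\<^bsub>N\<^esub> u s) ?A" "h \<psi> = finsum N (\<lambda>s. \<psi> s \<odot>\<^bsub>N\<^esub> u s) ?A"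
        by (rule h[OF \<phi> A(1) _ A(2)], simp, rule h[OF \<psi> A(1) _ A(2)], simp)
      moreover have "(\<lambda>s. \<phi> s \<odot>\<^bsub>N\<^esub> u s) \<in> ?A \<rightarrow> carrier N" "(\<lambda>s. \<psi> s \<odot>\<^bsub>N\<^esub> u s) \<in> ?A \<rightarrow> carrier N"
        using c[OF _ \<phi>] c[OF _ \<psi>] A(2) by blast+
      ultimately show ?thesis by (simp add: N.finsum_addf)
    qed
    finally show "h (\<phi> \<oplus>\<^bsub>?F\<^esub> \<psi>) = h \<phi> \<oplus>\<^bsub>N\<^esub> h \<psi>" .
  next
    fix a \<phi> assume \<phi>: "\<phi> \<in> carrier ?F" and a: "a \<in> carrier R"
    let ?A = "{s. \<phi> s \<noteq> \<zero>}"
    have s: "a \<odot>\<^bsub>?F\<^esub> \<phi> \<in> carrier ?F" using left_module_simps(5)[OF F a \<phi>] .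
    have "h (a \<odot>\<^bsub>?F\<^esub> \<phi>) = finsum N (\<lambda>s. (a \<otimes> \<phi> s) \<odot>\<^bsub>N\<^esub> u s) ?A"
    proof -
      have "{s. (a \<odot>\<^bsub>?F\<^esub> \<phi>) s \<noteq> \<zero>} \<subseteq> ?A" using a by auto
      from h[OF s supp(1)[OF \<phi>] this supp(2)[OF \<phi>]] show ?thesis by simp
    qed
    also have "\<dots> = finsum N (\<lambda>s. a \<odot>\<^bsub>N\<^esub> (\<phi> s \<odot>\<^bsub>N\<^esub> u s)) ?A"
    proof (rule N.finsum_cong')
      show "(a \<otimes> \<phi> s) \<odot>\<^bsub>N\<^esub> u s = a \<odot>\<^bsub>N\<^esub> (\<phi> s \<odot>\<^bsub>N\<^esub> u s)" if "s \<in> ?A" for s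
      proof -
        have "u s \<in> carrier N" using supp(2)[OF \<phi>] u that by blast
        then show ?thesis using left_module_smult(2)[OF N a] \<phi> by (simp add: free_mod_carrier)
      qed
    qed (use c[OF _ \<phi>] supp(2)[OF \<phi>] left_module_simps(5)[OF N a] in auto)
    also have "\<dots> = a \<odot>\<^bsub>N\<^esub> finsum N (\<lambda>s. \<phi> s \<odot>\<^bsub>N\<^esub> u s) ?A"
      by (rule finsum_smult[OF N a supp(1)[OF \<phi>], symmetric]) (use c[OF _ \<phi>] supp(2)[OF \<phi>] in auto)
    finally show "h (a \<odot>\<^bsub>?F\<^esub> \<phi>) = a \<odot>\<^bsub>N\<^esub> h \<phi>" by (simp add: h_def)
  qed
  moreover have "h (free_gen R s) = u s" if s: "s \<in> S" for s
  proof -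
    have "h (free_gen R s) = finsum N (\<lambda>t. free_gen R s t \<odot>\<^bsub>N\<^esub> u t) {s}"
      by (rule h[OF free_gen_closed[OF s]]) (use s in \<open>auto simp: free_gen_def\<close>)
    also have "\<dots> = \<one> \<odot>\<^bsub>N\<^esub> u s"
      using left_module_simps(5)[OF N, of "\<one>" "u s"] u s by (auto simp: free_gen_def Pi_iff)
    finally show ?thesis using left_module_smult(3)[OF N, of "u s"] u s by (simp add: Pi_iff)
  qed
  ultimately show ?thesis by blast
qed

text \<open>The presentation by a list is what a cell stores as its boundary, and it also bounds the
  size of the free module. It is obtained by splitting off one coordinate at a time from a finite
  set that contains the support.\<close>

lemma free_mod_lincomb:
  assumes "\<phi> \<in> carrier (free_mod R S)"
  shows "\<exists>l. set l \<subseteq> carrier R \<times> S \<and> \<phi> = lincomb (free_mod R S) (map (map_prod id (free_gen R)) l)"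
proof -
  have "\<forall>\<phi> \<in> carrier (free_mod R S). {s. \<phi> s \<noteq> \<zero>} \<subseteq> A \<longrightarrow>
      (\<exists>l. set l \<subseteq> carrier R \<times> S \<and> \<phi> = lincomb (free_mod R S) (map (map_prod id (free_gen R)) l))"
    if "finite A" for A
    using that
  proof (induction A)
    case empty
    show ?case by (auto intro!: exI[of _ "[]"])
  next
    case (insert t A)
    show ?case
    proof (intro ballI impI)
      fix \<phi> assume \<phi>: "\<phi> \<in> carrier (free_mod R S)" and sub: "{s. \<phi> s \<noteq> \<zero>} \<subseteq> insert t A"
      define \<psi> where "\<psi> = \<phi>(t := \<zero>)"
      have \<psi>: "\<psi> \<in> carrier (free_mod R S)"
        using \<phi> by (auto simp: free_mod_carrier \<psi>_def elim: rev_finite_subset)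
      have sub\<psi>: "{s. \<psi> s \<noteq> \<zero>} \<subseteq> A" using sub by (auto simp: \<psi>_def)
      then obtain l where l: "set l \<subseteq> carrier R \<times> S"
        "\<psi> = lincomb (free_mod R S) (map (map_prod id (free_gen R)) l)"
        using insert.IH \<psi> by blast
      show "\<exists>l. set l \<subseteq> carrier R \<times> S \<and> \<phi> = lincomb (free_mod R S) (map (map_prod id (free_gen R)) l)"
      proof (cases "t \<in> S")
        case True
        have "\<phi> = (\<lambda>s. \<phi> t \<otimes> free_gen R t s \<oplus> \<psi> s)"
          using \<phi> by (auto simp: \<psi>_def free_gen_def free_mod_carrier)
        then have "\<phi> = lincomb (free_mod R S) (map (map_prod id (free_gen R)) ((\<phi> t, t) # l))"
          using l(2) by simp
        moreover have "set ((\<phi> t, t) # l) \<subseteq> carrier R \<times> S" using l(1) True \<phi> by (auto simp: free_mod_carrier)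
        ultimately show ?thesis by blast
      next
        case False
        then have "\<psi> = \<phi>" using \<phi> by (auto simp: \<psi>_def free_mod_carrier)
        then show ?thesis using l by blast
      qed
    qed
  qed
  then show ?thesis using assms by (auto simp: free_mod_carrier)
qed

lemma free_mod_ext:
  assumes f: "lin R (free_mod R S) N f" and g: "lin R (free_mod R S) N g"
    and eq: "\<And>s. s \<in> S \<Longrightarrow> f (free_gen R s) = g (free_gen R s)" and \<phi>: "\<phi> \<in> carrier (free_mod R S)"
  shows "f \<phi> = g \<phi>"
proof -
  obtain l where l: "set l \<subseteq> carrier R \<times> S" "\<phi> = lincomb (free_mod R S) (map (map_prod id (free_gen R)) l)"
    using free_mod_lincomb[OF \<phi>] by (elim exE conjE)
  have s: "set (map (map_prod id (free_gen R)) l) \<subseteq> carrier R \<times> carrier (free_mod R S)"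
  proof (clarsimp, intro conjI)
    fix r g assume "(r, g) \<in> set l"
    then have "(r, g) \<in> carrier R \<times> S" using l(1) by (rule rev_subsetD)
    then show "r \<in> carrier R" "free_gen R g \<in> carrier (free_mod R S)" by (simp_all add: free_gen_closed)
  qed
  have "map (map_prod id f) (map (map_prod id (free_gen R)) l) = map (map_prod id g) (map (map_prod id (free_gen R)) l)"
    using l(1) by (auto simp: eq subset_iff)
  then show ?thesis by (simp only: l(2) lincomb_lin_on[OF f s] lincomb_lin_on[OF g s])
qed

end

context ring_universe begin

text \<open>The elements are counted through lists of coefficients and generators instead of
  functions, so that smallness of the ring and of \<open>S\<close> suffices.\<close>

lemma fits_free_mod:
  assumes "fits U S"
  shows "fits U (carrier (free_mod R S))"
proof (rule fits_subset[OF fits_image[OF fits_lists[OF fits_Times[OF fits_carrier assms]]]])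
  show "carrier (free_mod R S) \<subseteq>
      (\<lambda>l. lincomb (free_mod R S) (map (map_prod id (free_gen R)) l)) ` lists (carrier R \<times> S)"
  proof
    fix \<phi> assume "\<phi> \<in> carrier (free_mod R S)"
    from free_mod_lincomb[OF this] show "\<phi> \<in> (\<lambda>l. lincomb (free_mod R S) (map (map_prod id (free_gen R)) l)) ` lists (carrier R \<times> S)"
      by (elim exE conjE) (rule image_eqI, assumption, simp add: lists_eq_set)
  qed
qed

end

section \<open>The category of modules\<close>

lemma R_Mod_simps [simp]:
  "Hom (R_Mod R) = mod_hom R"
  "preadditive.Id (R_Mod R) M = (\<lambda>x\<in>carrier M. x)"
  "Comp (R_Mod R) M g f = (\<lambda>x\<in>carrier M. g (f x))"
  "Plus (R_Mod R) M N f g = (\<lambda>x\<in>carrier M. f x \<oplus>\<^bsub>N\<^esub> g x)"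
  "Zero (R_Mod R) M N = (\<lambda>x\<in>carrier M. \<zero>\<^bsub>N\<^esub>)"
  by (simp_all add: R_Mod_def)

text \<open>Freeness by its universal property, existence and uniqueness of linear extensions to
  modules on \<open>'m\<close>. The copy of \<open>free_mod R S\<close> inside the universe no
  longer consists of functions, so its generators are recorded by \<open>\<eta>\<close>.\<close>

definition free_on :: "('r, 'x) ring_scheme \<Rightarrow> 'g set \<Rightarrow> ('r, 'm) module \<Rightarrow> ('g \<Rightarrow> 'm) \<Rightarrow> bool" where
  "free_on R S P \<eta> \<longleftrightarrow> P \<in> Obj (R_Mod R) \<and> \<eta> \<in> S \<rightarrow> carrier P \<and>
    (\<forall>(N :: ('r, 'm) module) u. left_module R N \<and> u \<in> S \<rightarrow> carrier N \<longrightarrow>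
       (\<exists>h. lin R P N h \<and> (\<forall>s \<in> S. h (\<eta> s) = u s))) \<and>
    (\<forall>(N :: ('r, 'm) module) f g. lin R P N f \<and> lin R P N g \<and> (\<forall>s \<in> S. f (\<eta> s) = g (\<eta> s)) \<longrightarrow>
       (\<forall>x \<in> carrier P. f x = g x))"

section \<open>Categorical notions for modules in terms of elements\<close>

context ring_universe begin

lemma mod_hom_lin:
  fixes M N :: "('r, 'm) module"
  assumes "f \<in> mod_hom R M N" "M \<in> Obj (R_Mod R)" "N \<in> Obj (R_Mod R)"
  shows "lin R M N f" "f \<in> extensional (carrier M)"
  using assms submod_carrier ObjD(1) by (auto simp: mod_hom_def lin_on_def PiE_iff)

lemma lin_mod_hom: "lin R M N f \<Longrightarrow> restrict f (carrier M) \<in> mod_hom R M N"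
  by (auto simp: mod_hom_def lin_on_def submod_def)

lemma mod_hom_closed: "f \<in> mod_hom R M N \<Longrightarrow> x \<in> carrier M \<Longrightarrow> f x \<in> carrier N"
  by (auto simp: mod_hom_def)

lemma mod_hom_eqI:
  assumes "f \<in> mod_hom R M N" "g \<in> mod_hom R M L" "\<And>x. x \<in> carrier M \<Longrightarrow> f x = g x"
  shows "f = g"
proof (rule extensionalityI)
  show "f \<in> extensional (carrier M)" "g \<in> extensional (carrier M)"
    using assms(1,2) by (simp_all add: mod_hom_def PiE_def)
qed (rule assms(3))

lemma Obj_submod: "(M :: ('r, 'm) module) \<in> Obj (R_Mod R) \<Longrightarrow> submod R M S \<Longrightarrow> M\<lparr>carrier := S\<rparr> \<in> Obj (R_Mod R)"
  by (rule ObjI) (auto intro: left_module_submod ObjD fits_subset simp: submod_def)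

text \<open>The projection of \<open>B\<close> onto its quotient by the image of \<open>f\<close>
  and the zero map agree after composition with \<open>f\<close>. For an epimorphism they are
  therefore equal, and the quotient is zero.\<close>

lemma R_Mod_epic_surj:
  fixes A B :: "('r, 'm) module"
  assumes A: "A \<in> Obj (R_Mod R)" and B: "B \<in> Obj (R_Mod R)" and e: "epic (R_Mod R) A B f"
  shows "f ` carrier A = carrier B"
proof -
  have f: "lin R A B f" using e A B mod_hom_lin by (simp add: epic_def)
  have im: "submod R B (f ` carrier A)" by (rule submod_image[OF f submod_carrier[OF ObjD(1)[OF A]]]) simp
  obtain Q :: "('r, 'm) module" and q where Q: "Q \<in> Obj (R_Mod R)" and q: "lin R B Q q"
    and ker: "\<forall>x \<in> carrier B. q x = \<zero>\<^bsub>Q\<^esub> \<longleftrightarrow> x \<in> f ` carrier A"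
    using ex_quotient[OF ObjD[OF B] im] by (elim exE conjE)
  have fc: "f x \<in> carrier B" if "x \<in> carrier A" for x using lin_on_simps(1)[OF f that] .
  have "restrict q (carrier B) = (\<lambda>x\<in>carrier B. \<zero>\<^bsub>Q\<^esub>)"
  proof (rule e[unfolded epic_def, THEN conjunct2, rule_format, OF Q])
    show "restrict q (carrier B) \<in> Hom (R_Mod R) B Q" using lin_mod_hom[OF q] by simp
    show "(\<lambda>x\<in>carrier B. \<zero>\<^bsub>Q\<^esub>) \<in> Hom (R_Mod R) B Q"
      using lin_mod_hom[OF lin_on_zero[OF ObjD(1)[OF B] ObjD(1)[OF Q] submod_carrier[OF ObjD(1)[OF B]]]] by simp
    show "Comp (R_Mod R) A (restrict q (carrier B)) f = Comp (R_Mod R) A (\<lambda>x\<in>carrier B. \<zero>\<^bsub>Q\<^esub>) f"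
      using ker fc by (auto intro!: restrict_ext)
  qed
  then have "q x = \<zero>\<^bsub>Q\<^esub>" if "x \<in> carrier B" for x using that by (metis restrict_apply')
  then show ?thesis using ker fc by auto
qed

lemma R_Mod_surj_epic:
  assumes "f \<in> mod_hom R A B" "f ` carrier A = carrier B"
  shows "epic (R_Mod R) A B f"
  unfolding epic_def
proof (intro conjI ballI impI)
  fix T u v assume u: "u \<in> Hom (R_Mod R) B T" and v: "v \<in> Hom (R_Mod R) B T"
    and eq: "Comp (R_Mod R) A u f = Comp (R_Mod R) A v f"
  have "u y = v y" if "y \<in> carrier B" for y
  proof -
    have "y \<in> f ` carrier A" using that assms(2) by simp
    then obtain x where "x \<in> carrier A" "y = f x" by blast
    then show ?thesis using fun_cong[OF eq, of x] by simp
  qed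
  then show "u = v" using u v by (intro mod_hom_eqI) simp_all
qed (use assms in auto)

lemma R_Mod_inj_monic:
  assumes "f \<in> mod_hom R A B" "inj_on f (carrier A)"
  shows "monic (R_Mod R) A B f"
  unfolding monic_def
proof (intro conjI ballI impI)
  fix T u v assume u: "u \<in> Hom (R_Mod R) T A" and v: "v \<in> Hom (R_Mod R) T A"
    and eq: "Comp (R_Mod R) T f u = Comp (R_Mod R) T f v"
  have "u y = v y" if "y \<in> carrier T" for y
  proof (rule inj_onD[OF assms(2)])
    show "f (u y) = f (v y)" using fun_cong[OF eq, of y] that by simp
  qed (use mod_hom_closed u v that in auto)
  then show "u = v" using u v by (intro mod_hom_eqI) simp_all
qed (use assms in auto)

text \<open>The inclusion of the kernel and the zero map agree after composition with
  \<open>f\<close>, so for a monomorphism the kernel is zero.\<close>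

lemma R_Mod_monic_inj:
  fixes A B :: "('r, 'm) module"
  assumes A: "A \<in> Obj (R_Mod R)" and B: "B \<in> Obj (R_Mod R)" and m: "monic (R_Mod R) A B f"
  shows "inj_on f (carrier A)"
proof (rule lin_on_inj)
  show f: "lin R A B f" using m A B mod_hom_lin by (simp add: monic_def)
  fix x assume x: "x \<in> carrier A" "f x = \<zero>\<^bsub>B\<^esub>"
  let ?K = "{x \<in> carrier A. f x = \<zero>\<^bsub>B\<^esub>}"
  have K: "submod R A ?K" by (rule submod_kernel[OF f])
  note lmA = ObjD(1)[OF A]
  have "(\<lambda>x\<in>?K. x) = (\<lambda>x\<in>?K. \<zero>\<^bsub>A\<^esub>)"
  proof (rule m[unfolded monic_def, THEN conjunct2, rule_format, OF Obj_submod[OF A K]])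
    show "(\<lambda>x\<in>?K. x) \<in> Hom (R_Mod R) (A\<lparr>carrier := ?K\<rparr>) A"
      using lin_mod_hom[of "A\<lparr>carrier := ?K\<rparr>" A "\<lambda>x. x"] lin_on_id[OF lmA K]
      by (simp add: lin_on_submod_source[OF lmA K])
    show "(\<lambda>x\<in>?K. \<zero>\<^bsub>A\<^esub>) \<in> Hom (R_Mod R) (A\<lparr>carrier := ?K\<rparr>) A"
      using lin_mod_hom[of "A\<lparr>carrier := ?K\<rparr>" A "\<lambda>x. \<zero>\<^bsub>A\<^esub>"] lin_on_zero[OF lmA lmA K]
      by (simp add: lin_on_submod_source[OF lmA K])
    show "Comp (R_Mod R) (A\<lparr>carrier := ?K\<rparr>) f (\<lambda>x\<in>?K. x) =
        Comp (R_Mod R) (A\<lparr>carrier := ?K\<rparr>) f (\<lambda>x\<in>?K. \<zero>\<^bsub>A\<^esub>)"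
      by (auto simp: lin_on_simps(4)[OF f] intro!: restrict_ext)
  qed
  from fun_cong[OF this, of x] show "x = \<zero>\<^bsub>A\<^esub>" using x by simp
qed

lemma R_Mod_is_kernel:
  fixes A B :: "('r, 'm) module"
  assumes A: "A \<in> Obj (R_Mod R)" and B: "B \<in> Obj (R_Mod R)" and f: "f \<in> mod_hom R A B"
  shows "is_kernel (R_Mod R) A B f (A\<lparr>carrier := {x \<in> carrier A. f x = \<zero>\<^bsub>B\<^esub>}\<rparr>) (\<lambda>x\<in>{x \<in> carrier A. f x = \<zero>\<^bsub>B\<^esub>}. x)"
    (is "is_kernel _ _ _ _ ?N ?k")
proof -
  let ?K = "{x \<in> carrier A. f x = \<zero>\<^bsub>B\<^esub>}"
  have lf: "lin R A B f" by (rule mod_hom_lin(1)[OF f A B])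
  have K: "submod R A ?K" by (rule submod_kernel[OF lf])
  note lmA = ObjD(1)[OF A]
  show ?thesis unfolding is_kernel_def
  proof (intro conjI ballI impI)
    show "?N \<in> Obj (R_Mod R)" by (rule Obj_submod[OF A K])
    show "?k \<in> Hom (R_Mod R) ?N A"
      using lin_mod_hom[of ?N A "\<lambda>x. x"] lin_on_id[OF lmA K]
      by (simp add: lin_on_submod_source[OF lmA K])
    show "Comp (R_Mod R) ?N f ?k = Zero (R_Mod R) ?N B" by (auto intro!: restrict_ext)
    fix T u assume u: "u \<in> Hom (R_Mod R) T A" and z: "Comp (R_Mod R) T f u = Zero (R_Mod R) T B"
    have uK: "u x \<in> ?K" if "x \<in> carrier T" for x
      using fun_cong[OF z, of x] mod_hom_closed[of u T A x] u that by simp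
    show "\<exists>!w. w \<in> Hom (R_Mod R) T ?N \<and> Comp (R_Mod R) T ?k w = u"
    proof (rule ex1I[of _ u])
      have "Comp (R_Mod R) T ?k u = restrict u (carrier T)"
        using uK by (auto intro!: restrict_ext)
      moreover have "restrict u (carrier T) = u"
        using u by (simp add: mod_hom_def PiE_def extensional_restrict)
      ultimately show "u \<in> Hom (R_Mod R) T ?N \<and> Comp (R_Mod R) T ?k u = u"
        using u uK by (auto simp: mod_hom_def)
      fix w assume w: "w \<in> Hom (R_Mod R) T ?N \<and> Comp (R_Mod R) T ?k w = u"
      show "w = u"
      proof (rule mod_hom_eqI)
        fix x assume x: "x \<in> carrier T"
        have "w x \<in> carrier ?N" using mod_hom_closed[of w T ?N x] w x by simp
        moreover have "Comp (R_Mod R) T ?k w x = u x" using w by simp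
        ultimately show "w x = u x" using x by simp
      qed (use u w in auto)
    qed
  qed
qed

text \<open>The inclusion of the concrete kernel factors through the abstract one, so every element
  killed by \<open>f\<close> is a value of \<open>k\<close>.\<close>

lemma R_Mod_kernel_image:
  fixes A B N :: "('r, 'm) module"
  assumes A: "A \<in> Obj (R_Mod R)" and B: "B \<in> Obj (R_Mod R)" and f: "f \<in> mod_hom R A B"
    and k: "is_kernel (R_Mod R) A B f N k"
  shows "k ` carrier N = {x \<in> carrier A. f x = \<zero>\<^bsub>B\<^esub>}" (is "_ = ?K")
proof
  have kH: "k \<in> mod_hom R N A" and z: "Comp (R_Mod R) N f k = Zero (R_Mod R) N B"
    using k by (auto simp: is_kernel_def)
  show "k ` carrier N \<subseteq> ?K"
  proof clarify
    fix x assume "x \<in> carrier N"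
    then show "k x \<in> carrier A \<and> f (k x) = \<zero>\<^bsub>B\<^esub>"
      using fun_cong[OF z, of x] mod_hom_closed[OF kH, of x] by simp
  qed
  let ?N = "A\<lparr>carrier := ?K\<rparr>" and ?k = "\<lambda>x\<in>?K. x"
  have "?N \<in> Obj (R_Mod R)" "?k \<in> Hom (R_Mod R) ?N A" "Comp (R_Mod R) ?N f ?k = Zero (R_Mod R) ?N B"
    using R_Mod_is_kernel[OF A B f] unfolding is_kernel_def by blast+
  then obtain w where w: "w \<in> Hom (R_Mod R) ?N N" "Comp (R_Mod R) ?N k w = ?k"
    using k unfolding is_kernel_def by blast
  show "?K \<subseteq> k ` carrier N"
  proof
    fix x assume x: "x \<in> ?K"
    then have "k (w x) = x" using fun_cong[OF w(2), of x] by simp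
    moreover have "w x \<in> carrier N" using mod_hom_closed[of w ?N N x] w(1) x by simp
    ultimately show "x \<in> k ` carrier N" using image_eqI[of x k "w x"] by simp
  qed
qed

lemma R_Mod_exact:
  fixes A B C :: "('r, 'm) module"
  assumes A: "A \<in> Obj (R_Mod R)" and B: "B \<in> Obj (R_Mod R)" and C: "C \<in> Obj (R_Mod R)"
    and ex: "exact_at (R_Mod R) A f B g C"
  shows "f ` carrier A = {x \<in> carrier B. g x = \<zero>\<^bsub>C\<^esub>}"
proof -
  obtain N k e where N: "is_kernel (R_Mod R) B C g N k" "epic (R_Mod R) A N e" "Comp (R_Mod R) A k e = f"
    and g: "g \<in> mod_hom R B C" using ex by (auto simp: exact_at_def)
  have "e ` carrier A = carrier N" using R_Mod_epic_surj[OF A _ N(2)] N(1) by (simp add: is_kernel_def)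
  moreover have "f ` carrier A = k ` e ` carrier A" using N(3) by (force simp: image_image)
  ultimately show ?thesis using R_Mod_kernel_image[OF B C g N(1)] by simp
qed

text \<open>An abstract cokernel is epic by the uniqueness half of its universal property, hence
  onto. Its kernel is no larger than the image of \<open>f\<close>, because the projection onto the
  concrete quotient by this image factors through it.\<close>

lemma R_Mod_cokernel:
  fixes A B Q :: "('r, 'm) module"
  assumes A: "A \<in> Obj (R_Mod R)" and B: "B \<in> Obj (R_Mod R)" and f: "f \<in> mod_hom R A B"
    and q: "is_cokernel (R_Mod R) A B f Q q"
  shows "Q \<in> Obj (R_Mod R)" "lin R B Q q" "q ` carrier B = carrier Q"
    "\<And>x. x \<in> carrier B \<Longrightarrow> q x = \<zero>\<^bsub>Q\<^esub> \<longleftrightarrow> x \<in> f ` carrier A"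
proof -
  show Q: "Q \<in> Obj (R_Mod R)" using q by (simp add: is_cokernel_def)
  have qH: "q \<in> mod_hom R B Q" and z: "Comp (R_Mod R) A q f = Zero (R_Mod R) A Q"
    using q by (auto simp: is_cokernel_def)
  show lq: "lin R B Q q" by (rule mod_hom_lin(1)[OF qH B Q])
  have lf: "lin R A B f" by (rule mod_hom_lin(1)[OF f A B])
  have fc: "f x \<in> carrier B" if "x \<in> carrier A" for x using lin_on_simps(1)[OF lf that] .
  have "epic (R_Mod R) B Q q"
    unfolding epic_def
  proof (intro conjI ballI impI)
    fix T u v assume T: "T \<in> Obj (R_Mod R)" and u: "u \<in> Hom (R_Mod R) Q T" and v: "v \<in> Hom (R_Mod R) Q T"
      and eq: "Comp (R_Mod R) B u q = Comp (R_Mod R) B v q"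
    have lu: "lin R Q T u" using u mod_hom_lin(1)[OF _ Q T] by simp
    have uq: "lin R B T (\<lambda>x. u (q x))"
      by (rule lin_on_comp[OF lq lu]) (use lin_on_simps(1)[OF lq] in auto)
    have "Comp (R_Mod R) B u q \<in> Hom (R_Mod R) B T"
      using lin_mod_hom[OF uq] by simp
    moreover have "Comp (R_Mod R) A (Comp (R_Mod R) B u q) f = Zero (R_Mod R) A T"
    proof (simp, rule restrict_ext)
      fix x assume "x \<in> carrier A"
      then show "(if f x \<in> carrier B then u (q (f x)) else undefined) = \<zero>\<^bsub>T\<^esub>"
        using fun_cong[OF z, of x] fc lin_on_simps(4)[OF lu] by simp
    qed
    ultimately show "u = v" using q T u v eq unfolding is_cokernel_def by metis
  qed (use qH in simp)
  then show "q ` carrier B = carrier Q" by (rule R_Mod_epic_surj[OF B Q])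
  have im: "submod R B (f ` carrier A)" by (rule submod_image[OF lf submod_carrier[OF ObjD(1)[OF A]]]) simp
  obtain Q' :: "('r, 'm) module" and q' where Q': "Q' \<in> Obj (R_Mod R)" and q': "lin R B Q' q'"
    and ker: "\<forall>x \<in> carrier B. q' x = \<zero>\<^bsub>Q'\<^esub> \<longleftrightarrow> x \<in> f ` carrier A"
    using ex_quotient[OF ObjD[OF B] im] by (elim exE conjE)
  have "restrict q' (carrier B) \<in> Hom (R_Mod R) B Q'" using lin_mod_hom[OF q'] by simp
  moreover have "Comp (R_Mod R) A (restrict q' (carrier B)) f = Zero (R_Mod R) A Q'"
    using ker fc by (auto intro!: restrict_ext)
  ultimately obtain w where w: "w \<in> Hom (R_Mod R) Q Q'" "Comp (R_Mod R) B w q = restrict q' (carrier B)"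
    using q Q' unfolding is_cokernel_def by blast
  have lw: "lin R Q Q' w" using w(1) mod_hom_lin(1)[OF _ Q Q'] by simp
  show "q x = \<zero>\<^bsub>Q\<^esub> \<longleftrightarrow> x \<in> f ` carrier A" if x: "x \<in> carrier B" for x
  proof
    assume "q x = \<zero>\<^bsub>Q\<^esub>"
    then have "q' x = \<zero>\<^bsub>Q'\<^esub>" using fun_cong[OF w(2), of x] x lin_on_simps(4)[OF lw] by simp
    then show "x \<in> f ` carrier A" using ker x by blast
  next
    assume "x \<in> f ` carrier A"
    then obtain y where "y \<in> carrier A" "x = f y" by blast
    then show "q x = \<zero>\<^bsub>Q\<^esub>" using fun_cong[OF z, of y] by simp
  qed
qed

lemma R_Mod_is_cokernel:
  fixes A B Q :: "('r, 'm) module"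
  assumes A: "A \<in> Obj (R_Mod R)" and B: "B \<in> Obj (R_Mod R)" and Q: "Q \<in> Obj (R_Mod R)"
    and f: "f \<in> mod_hom R A B" and q: "q \<in> mod_hom R B Q" "q ` carrier B = carrier Q"
    and ker: "\<And>x. x \<in> carrier B \<Longrightarrow> q x = \<zero>\<^bsub>Q\<^esub> \<longleftrightarrow> x \<in> f ` carrier A"
  shows "is_cokernel (R_Mod R) A B f Q q"
  unfolding is_cokernel_def
proof (intro conjI ballI impI)
  have fc: "f x \<in> carrier B" if "x \<in> carrier A" for x using mod_hom_closed[OF f that] .
  show "Comp (R_Mod R) A q f = Zero (R_Mod R) A Q" using ker fc by (auto intro!: restrict_ext)
  fix T u assume T: "T \<in> Obj (R_Mod R)" and u: "u \<in> Hom (R_Mod R) B T"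
    and z: "Comp (R_Mod R) A u f = Zero (R_Mod R) A T"
  have lq: "lin R B Q q" and lu: "lin R B T u" using mod_hom_lin(1) q(1) u B Q T by auto
  have "u x = \<zero>\<^bsub>T\<^esub>" if "x \<in> carrier B" "q x = \<zero>\<^bsub>Q\<^esub>" for x
  proof -
    have "x \<in> f ` carrier A" using ker that by simp
    then obtain y where "y \<in> carrier A" "x = f y" by blast
    then show ?thesis using fun_cong[OF z, of y] by simp
  qed
  then obtain w where w: "lin R Q T w" "\<forall>x \<in> carrier B. w (q x) = u x"
    using lin_on_factor[OF lq lu] q(2) by auto
  show "\<exists>!w. w \<in> Hom (R_Mod R) Q T \<and> Comp (R_Mod R) B w q = u"
  proof (rule ex1I[of _ "restrict w (carrier Q)"])
    have "Comp (R_Mod R) B (restrict w (carrier Q)) q = u"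
    proof -
      have "Comp (R_Mod R) B (restrict w (carrier Q)) q = restrict u (carrier B)"
        using w(2) lin_on_simps(1)[OF lq] by (auto intro!: restrict_ext)
      then show ?thesis using u by (simp add: mod_hom_def PiE_def extensional_restrict)
    qed
    then show *: "restrict w (carrier Q) \<in> Hom (R_Mod R) Q T \<and> Comp (R_Mod R) B (restrict w (carrier Q)) q = u"
      using lin_mod_hom[OF w(1)] by simp
    show "w' = restrict w (carrier Q)" if "w' \<in> Hom (R_Mod R) Q T \<and> Comp (R_Mod R) B w' q = u" for w'
      using R_Mod_surj_epic[OF q, unfolded epic_def, THEN conjunct2, rule_format, OF T] * that by simp
  qed
qed (use Q q in auto)

section \<open>Free covers and the meaning of \<open>Ext1\<close> for modules\<close>

lemma ex_free_module:
  assumes "fits U S"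
  shows "\<exists>(P :: ('r, 'm) module) \<eta>. free_on R S P \<eta>"
proof -
  let ?F = "free_mod R S"
  have F: "left_module R ?F" by (rule left_module_free)
  obtain P :: "('r, 'm) module" and q where P: "P \<in> Obj (R_Mod R)" and q: "lin R ?F P q"
    and surj: "q ` carrier ?F = carrier P" and "\<forall>x \<in> carrier ?F. q x = \<zero>\<^bsub>P\<^esub> \<longleftrightarrow> x \<in> {\<zero>\<^bsub>?F\<^esub>}"
    using ex_quotient[OF F fits_free_mod[OF assms] submod_zero[OF F]] by (elim exE conjE)
  then have q0: "x = \<zero>\<^bsub>?F\<^esub>" if "x \<in> carrier ?F" "q x = \<zero>\<^bsub>P\<^esub>" for x using that by blast
  show ?thesis
    unfolding free_on_def
  proof (rule exI[of _ P], rule exI[of _ "\<lambda>s. q (free_gen R s)"], intro conjI allI impI)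
    show "P \<in> Obj (R_Mod R)" by fact
    show "(\<lambda>s. q (free_gen R s)) \<in> S \<rightarrow> carrier P"
      using lin_on_simps(1)[OF q free_gen_closed] by blast
  next
    fix N :: "('r, 'm) module" and u assume "left_module R N \<and> u \<in> S \<rightarrow> carrier N"
    then have N: "left_module R N" "u \<in> S \<rightarrow> carrier N" by auto
    obtain h where h: "lin R ?F N h" "\<forall>s \<in> S. h (free_gen R s) = u s" using free_mod_lift[OF N] by blast
    have ker: "h x = \<zero>\<^bsub>N\<^esub>" if "x \<in> carrier ?F" "q x = \<zero>\<^bsub>P\<^esub>" for x
      unfolding q0[OF that] by (rule lin_on_simps(4)[OF h(1)])
    obtain k where k: "lin R P N k" "\<forall>x \<in> carrier ?F. k (q x) = h x"
      using lin_on_factor[OF q h(1) ker] surj by auto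
    then show "\<exists>h. lin R P N h \<and> (\<forall>s \<in> S. h (q (free_gen R s)) = u s)"
      using h(2) by (intro exI[of _ k]) (auto simp: free_gen_closed)
  next
    fix N :: "('r, 'm) module" and f g
    assume "lin R P N f \<and> lin R P N g \<and> (\<forall>s \<in> S. f (q (free_gen R s)) = g (q (free_gen R s)))"
    then have f: "lin R P N f" and g: "lin R P N g"
      and eq: "\<forall>s \<in> S. f (q (free_gen R s)) = g (q (free_gen R s))" by auto
    have "f (q y) = g (q y)" if "y \<in> carrier ?F" for y
    proof (rule free_mod_ext[OF _ _ _ that])
      show "lin R ?F N (\<lambda>x. f (q x))" "lin R ?F N (\<lambda>x. g (q x))"
        using lin_on_comp[OF q f] lin_on_comp[OF q g] surj by auto
    qed (use eq in blast)
    then show "\<forall>x \<in> carrier P. f x = g x" unfolding surj[symmetric] by blast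
  qed
qed


lemma free_onD:
  fixes P N :: "('r, 'm) module"
  assumes "free_on R S P \<eta>"
  shows "P \<in> Obj (R_Mod R)" "s \<in> S \<Longrightarrow> \<eta> s \<in> carrier P"
    "left_module R N \<Longrightarrow> (\<And>s. s \<in> S \<Longrightarrow> u s \<in> carrier N) \<Longrightarrow> \<exists>h. lin R P N h \<and> (\<forall>s \<in> S. h (\<eta> s) = u s)"
    "lin R P N f \<Longrightarrow> lin R P N g \<Longrightarrow> (\<And>s. s \<in> S \<Longrightarrow> f (\<eta> s) = g (\<eta> s)) \<Longrightarrow> x \<in> carrier P \<Longrightarrow> f x = g x"
  using assms unfolding free_on_def by blast+

text \<open>The free module on the underlying set of \<open>A\<close> covers \<open>A\<close> by
  sending each generator to the element that names it.\<close>

lemma R_Mod_enough_projectives: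
  fixes A :: "('r, 'm) module"
  assumes A: "A \<in> Obj (R_Mod R)"
  shows "\<exists>P e N k. projective_obj (R_Mod R) P \<and> epic (R_Mod R) P A e \<and> is_kernel (R_Mod R) P A e N k"
proof -
  obtain P :: "('r, 'm) module" and \<eta> where free: "free_on R (carrier A) P \<eta>"
    using ex_free_module[OF ObjD(2)[OF A]] by (elim exE)
  note P = free_onD(1)[OF free] and \<eta> = free_onD(2)[OF free] and lift = free_onD(3)[OF free]
    and uniq = free_onD(4)[OF free]
  have "projective_obj (R_Mod R) P"
    unfolding projective_obj_def
  proof (intro conjI ballI allI impI)
    fix B C e f assume B: "B \<in> Obj (R_Mod R)" and C: "C \<in> Obj (R_Mod R)"
      and ef: "epic (R_Mod R) B C e \<and> f \<in> Hom (R_Mod R) P C"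
    then have e: "lin R B C e" and f: "lin R P C f"
      using mod_hom_lin(1)[OF _ B C] mod_hom_lin(1)[OF _ P C] by (auto simp: epic_def)
    have surj: "e ` carrier B = carrier C" using R_Mod_epic_surj[OF B C] ef by blast
    define u where "u s = (SOME b. b \<in> carrier B \<and> e b = f (\<eta> s))" for s
    have u: "u s \<in> carrier B \<and> e (u s) = f (\<eta> s)" if "s \<in> carrier A" for s
    proof -
      have "f (\<eta> s) \<in> e ` carrier B" unfolding surj using lin_on_simps(1)[OF f \<eta>[OF that]] .
      then have "\<exists>b. b \<in> carrier B \<and> e b = f (\<eta> s)" by auto
      then show ?thesis unfolding u_def by (rule someI_ex)
    qed
    from lift[OF ObjD(1)[OF B], of u] u obtain h where h: "lin R P B h" "\<forall>s \<in> carrier A. h (\<eta> s) = u s" by blast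
    have hc: "h ` carrier P \<subseteq> carrier B" using lin_on_simps(1)[OF h(1)] by blast
    have "lin R P C (\<lambda>x. e (h x))" by (rule lin_on_comp[OF h(1) e hc])
    then have eq: "e (h x) = f x" if "x \<in> carrier P" for x
      by (rule uniq[OF _ f _ that]) (use h(2) u in simp)
    have fE: "restrict f (carrier P) = f"
      using ef by (simp add: mod_hom_def PiE_def extensional_restrict)
    show "\<exists>g \<in> Hom (R_Mod R) P B. Comp (R_Mod R) P e g = f"
    proof (rule bexI)
      have "Comp (R_Mod R) P e (restrict h (carrier P)) = restrict f (carrier P)"
        using eq by (auto intro!: restrict_ext)
      then show "Comp (R_Mod R) P e (restrict h (carrier P)) = f" using fE by simp
      show "restrict h (carrier P) \<in> Hom (R_Mod R) P B" using lin_mod_hom[OF h(1)] by simp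
    qed
  qed (rule P)
  moreover from lift[OF ObjD(1)[OF A], of "\<lambda>x. x"] obtain h where h: "lin R P A h" "\<forall>s \<in> carrier A. h (\<eta> s) = s" by blast
  have eH: "restrict h (carrier P) \<in> mod_hom R P A" by (rule lin_mod_hom[OF h(1)])
  moreover have "restrict h (carrier P) ` carrier P = carrier A"
  proof
    show "carrier A \<subseteq> restrict h (carrier P) ` carrier P"
    proof
      fix a assume a: "a \<in> carrier A"
      then have "\<eta> a \<in> carrier P" by (rule \<eta>)
      then show "a \<in> restrict h (carrier P) ` carrier P" using h(2) a by (intro image_eqI[of _ _ "\<eta> a"]) auto
    qed
  qed (use lin_on_simps(1)[OF h(1)] in auto)
  ultimately show ?thesis using R_Mod_surj_epic[OF eH] R_Mod_is_kernel[OF P A eH] by blast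
qed

lemma R_Mod_preadditive: "preadditive_category (R_Mod R :: (('r, 'm) module, 'm \<Rightarrow> 'm) preadditive)"
proof (rule preadditive_category.intro; (rule R_Mod_enough_projectives; assumption)?)
  fix A B C D :: "('r, 'm) module" and f g h
  assume A: "A \<in> Obj (R_Mod R)" and B: "B \<in> Obj (R_Mod R)"
  note lm = ObjD(1)[OF A] ObjD(1)[OF B]
  have lz: "lin R A B (\<lambda>x. \<zero>\<^bsub>B\<^esub>)" by (rule lin_on_zero[OF lm submod_carrier[OF lm(1)]])
  then show "Zero (R_Mod R) A B \<in> Hom (R_Mod R) A B" using lin_mod_hom by simp
  show "comm_group (hom_group (R_Mod R) A B)"
  proof (rule comm_groupI)
    fix x y assume x: "x \<in> carrier (hom_group (R_Mod R) A B)" and y: "y \<in> carrier (hom_group (R_Mod R) A B)"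
    then have l: "lin R A B x" "lin R A B y" using mod_hom_lin(1)[OF _ A B] by (auto simp: hom_group_def)
    show "x \<otimes>\<^bsub>hom_group (R_Mod R) A B\<^esub> y \<in> carrier (hom_group (R_Mod R) A B)"
      using lin_mod_hom[OF lin_on_add[OF l]] by (simp add: hom_group_def)
    show "x \<otimes>\<^bsub>hom_group (R_Mod R) A B\<^esub> y = y \<otimes>\<^bsub>hom_group (R_Mod R) A B\<^esub> x"
      using lin_on_simps(1)[OF l(1)] lin_on_simps(1)[OF l(2)] left_module_simps(20)[OF lm(2)]
      by (auto simp: hom_group_def intro!: restrict_ext)
    fix z assume "z \<in> carrier (hom_group (R_Mod R) A B)"
    then have lz: "lin R A B z" using mod_hom_lin(1)[OF _ A B] by (auto simp: hom_group_def)
    show "x \<otimes>\<^bsub>hom_group (R_Mod R) A B\<^esub> y \<otimes>\<^bsub>hom_group (R_Mod R) A B\<^esub> z =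
        x \<otimes>\<^bsub>hom_group (R_Mod R) A B\<^esub> (y \<otimes>\<^bsub>hom_group (R_Mod R) A B\<^esub> z)"
      using lin_on_simps(1)[OF l(1)] lin_on_simps(1)[OF l(2)] lin_on_simps(1)[OF lz] left_module_simps(6)[OF lm(2)]
      by (auto simp: hom_group_def intro!: restrict_ext)
  next
    show "\<one>\<^bsub>hom_group (R_Mod R) A B\<^esub> \<in> carrier (hom_group (R_Mod R) A B)"
      using lin_mod_hom[OF lz] by (simp add: hom_group_def)
    fix x assume x: "x \<in> carrier (hom_group (R_Mod R) A B)"
    then have l: "lin R A B x" using mod_hom_lin(1)[OF _ A B] by (auto simp: hom_group_def)
    have xE: "restrict x (carrier A) = x" using x by (simp add: hom_group_def mod_hom_def PiE_def extensional_restrict)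
    have "\<one>\<^bsub>hom_group (R_Mod R) A B\<^esub> \<otimes>\<^bsub>hom_group (R_Mod R) A B\<^esub> x = restrict x (carrier A)"
      using lin_on_simps(1)[OF l] left_module_simps(7)[OF lm(2)]
      by (auto simp: hom_group_def intro!: restrict_ext)
    then show "\<one>\<^bsub>hom_group (R_Mod R) A B\<^esub> \<otimes>\<^bsub>hom_group (R_Mod R) A B\<^esub> x = x" using xE by simp
    let ?y = "\<lambda>a\<in>carrier A. \<zero>\<^bsub>B\<^esub> \<ominus>\<^bsub>B\<^esub> x a"
    have "?y \<in> carrier (hom_group (R_Mod R) A B)"
      using lin_mod_hom[OF lin_on_minus[OF lz l]] by (simp add: hom_group_def)
    moreover have "?y \<otimes>\<^bsub>hom_group (R_Mod R) A B\<^esub> x = \<one>\<^bsub>hom_group (R_Mod R) A B\<^esub>"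
      using lin_on_simps(1)[OF l] left_module_simps(2,3,7,9,16)[OF lm(2)]
      by (auto simp: hom_group_def intro!: restrict_ext)
    ultimately show "\<exists>y \<in> carrier (hom_group (R_Mod R) A B).
        y \<otimes>\<^bsub>hom_group (R_Mod R) A B\<^esub> x = \<one>\<^bsub>hom_group (R_Mod R) A B\<^esub>" by blast
  qed
  assume C: "C \<in> Obj (R_Mod R)"
  show "Comp (R_Mod R) A g (Zero (R_Mod R) A B) = Zero (R_Mod R) A C" if "g \<in> Hom (R_Mod R) B C"
    using lin_on_simps(4)[OF mod_hom_lin(1)[OF _ B C], of g] that by (auto intro!: restrict_ext)
  assume f: "f \<in> Hom (R_Mod R) A B"
  then have lf: "lin R A B f" using mod_hom_lin(1)[OF _ A B] by simp
  note fc = lin_on_simps(1)[OF lf]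
  show "Comp (R_Mod R) A (Zero (R_Mod R) B C) f = Zero (R_Mod R) A C"
    using fc by (auto intro!: restrict_ext)
  assume g: "g \<in> Hom (R_Mod R) B C"
  then have lg: "lin R B C g" using mod_hom_lin(1)[OF _ B C] by simp
  have "lin R A C (\<lambda>x. g (f x))" by (rule lin_on_comp[OF lf lg]) (use fc in auto)
  then show "Comp (R_Mod R) A g f \<in> Hom (R_Mod R) A C" using lin_mod_hom by simp
  show "Comp (R_Mod R) A (Plus (R_Mod R) B C g h) f = Plus (R_Mod R) A C (Comp (R_Mod R) A g f) (Comp (R_Mod R) A h f)"
    using fc by (auto intro!: restrict_ext)
  show "Comp (R_Mod R) A (Comp (R_Mod R) B h g) f = Comp (R_Mod R) A h (Comp (R_Mod R) A g f)"
    using fc by (auto intro!: restrict_ext)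
qed

text \<open>Projectivity lifts the augmentation \<open>e\<close> to
  \<open>\<phi> : P 0 \<rightarrow> M\<close>, and \<open>\<phi>\<close> carries the kernel of
  \<open>e\<close> into the kernel \<open>?K\<close> of \<open>p\<close>. The composite of
  \<open>d 0\<close>, \<open>\<phi>\<close> and \<open>f\<close> is a cocycle, hence comes from some
  \<open>h\<close> on \<open>P 0\<close>. Then \<open>h\<close> and \<open>f \<circ> \<phi>\<close>
  agree on the kernel of \<open>e\<close>, and \<open>f\<close> on \<open>?K\<close> and
  \<open>h\<close> on \<open>P 0\<close> glue to a map on \<open>M\<close>.\<close>

lemma extends_of_Ext1:
  fixes A L :: "('r, 'm) module"
  assumes A: "A \<in> Obj (R_Mod R)" and L: "L \<in> Obj (R_Mod R)" and triv: "trivial_group (Ext1 (R_Mod R) A L)"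
  shows "extends R A L"
  unfolding extends_def
proof (intro ballI allI impI, elim conjE)
  fix M :: "('r, 'm) module" and p f
  let ?K = "{x \<in> carrier M. p x = \<zero>\<^bsub>A\<^esub>}"
  assume M: "M \<in> Obj (R_Mod R)" and p: "lin R M A p" "p ` carrier M = carrier A" and f: "lin_on R M ?K L f"
  interpret preadditive_category "R_Mod R :: (('r, 'm) module, 'm \<Rightarrow> 'm) preadditive"
    by (rule R_Mod_preadditive)
  obtain P d e where res: "projective_resolution (R_Mod R) A P d e"
    and sub: "hom_cocycles1 (R_Mod R) P d L \<subseteq> hom_coboundaries1 (R_Mod R) P d L"
    using Ext1_trivial_iff[OF A L] triv by blast
  have proj: "projective_obj (R_Mod R) (P i)" for i using res by (simp add: projective_resolution_def)
  then have PO: "P i \<in> Obj (R_Mod R)" for i by (simp add: projective_obj_def)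
  have epi: "epic (R_Mod R) (P 0) A e" and ex0: "exact_at (R_Mod R) (P (Suc 0)) (d 0) (P 0) e A"
    and ex1: "exact_at (R_Mod R) (P (Suc (Suc 0))) (d (Suc 0)) (P (Suc 0)) (d 0) (P 0)"
    using res by (auto simp: projective_resolution_def)
  have eH: "e \<in> mod_hom R (P 0) A" and d0: "d 0 \<in> mod_hom R (P (Suc 0)) (P 0)"
    and d1: "d (Suc 0) \<in> mod_hom R (P (Suc (Suc 0))) (P (Suc 0))"
    using ex0 ex1 by (auto simp: exact_at_def)
  have le: "lin R (P 0) A e" and ld: "lin R (P (Suc 0)) (P 0) (d 0)"
    using mod_hom_lin(1) eH d0 PO A by auto
  have im: "d 0 ` carrier (P (Suc 0)) = {x \<in> carrier (P 0). e x = \<zero>\<^bsub>A\<^esub>}"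
    by (rule R_Mod_exact[OF PO PO A ex0])
  have pH: "restrict p (carrier M) \<in> mod_hom R M A" by (rule lin_mod_hom[OF p(1)])
  have "epic (R_Mod R) M A (restrict p (carrier M))"
    by (rule R_Mod_surj_epic[OF pH]) (use p(2) in auto)
  then obtain \<phi> where \<phi>: "\<phi> \<in> Hom (R_Mod R) (P 0) M" "Comp (R_Mod R) (P 0) (restrict p (carrier M)) \<phi> = e"
    using proj[of 0] M A eH unfolding projective_obj_def by (metis R_Mod_simps(1))
  have l\<phi>: "lin R (P 0) M \<phi>" using \<phi>(1) mod_hom_lin(1)[OF _ PO M] by simp
  note \<phi>c = lin_on_simps(1)[OF l\<phi>]
  have p\<phi>: "p (\<phi> x) = e x" if "x \<in> carrier (P 0)" for x
    using fun_cong[OF \<phi>(2), of x] that \<phi>c by simp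
  have K: "submod R M ?K" by (rule submod_kernel[OF p(1)])
  have lg: "lin R (P (Suc 0)) L (\<lambda>x. f (\<phi> (d 0 x)))"
  proof (rule lin_on_comp[OF ld])
    have K0: "submod R (P 0) {x \<in> carrier (P 0). e x = \<zero>\<^bsub>A\<^esub>}" by (rule submod_kernel[OF le])
    show "lin_on R (P 0) {x \<in> carrier (P 0). e x = \<zero>\<^bsub>A\<^esub>} L (\<lambda>x. f (\<phi> x))"
      by (rule lin_on_comp[OF lin_on_subset[OF l\<phi> K0] f]) (use \<phi>c p\<phi> in auto)
  qed (use im in auto)
  let ?g = "\<lambda>x\<in>carrier (P (Suc 0)). f (\<phi> (d 0 x))"
  have "?g \<in> hom_cocycles1 (R_Mod R) P d L"
    unfolding hom_cocycles1_def
  proof (simp add: numeral_2_eq_2 lin_mod_hom[OF lg], rule restrict_ext)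
    fix x assume x: "x \<in> carrier (P (Suc (Suc 0)))"
    have c: "d (Suc 0) x \<in> carrier (P (Suc 0))" by (rule mod_hom_closed[OF d1 x])
    have "d 0 (d (Suc 0) x) = \<zero>\<^bsub>P 0\<^esub>"
      using R_Mod_exact[OF PO PO PO ex1] x by blast
    then show "(if d (Suc 0) x \<in> carrier (P (Suc 0)) then f (\<phi> (d 0 (d (Suc 0) x))) else undefined) = \<zero>\<^bsub>L\<^esub>"
      using c lin_on_simps(4)[OF l\<phi>] lin_on_simps(4)[OF f] by simp
  qed
  then obtain h where h: "h \<in> mod_hom R (P 0) L" "Comp (R_Mod R) (P (Suc 0)) h (d 0) = ?g"
    using sub unfolding hom_coboundaries1_def by auto
  have lh: "lin R (P 0) L h" by (rule mod_hom_lin(1)[OF h(1) PO L])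
  have hd: "h x = f (\<phi> x)" if "x \<in> carrier (P 0)" "e x = \<zero>\<^bsub>A\<^esub>" for x
  proof -
    have "x \<in> d 0 ` carrier (P (Suc 0))" using im that by simp
    then obtain y where "y \<in> carrier (P (Suc 0))" "x = d 0 y" by blast
    then show ?thesis using fun_cong[OF h(2), of y] by simp
  qed
  \<comment> \<open>\<open>M\<close> is the image of \<open>?K \<times> P 0\<close> under
    \<open>(k, x) \<mapsto> k + \<phi> x\<close>. The extension is the map that
    \<open>(k, x) \<mapsto> f k + h x\<close> induces on this image.\<close>
  let ?S = "?K \<times> carrier (P 0)"
  note lmM = ObjD(1)[OF M] and lmP = ObjD(1)[OF PO[of 0]] and lmL = ObjD(1)[OF L]
  have S: "submod R (pmod M (P 0)) ?S" by (rule submod_pmod[OF K submod_carrier[OF lmP]])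
  note fs = lin_on_fst[OF lmM lmP S] and sn = lin_on_snd[OF lmM lmP S]
  have g1: "lin_on R (pmod M (P 0)) ?S M (\<lambda>z. fst z \<oplus>\<^bsub>M\<^esub> \<phi> (snd z))"
    by (rule lin_on_add[OF fs lin_on_comp[OF sn l\<phi>]]) auto
  have h1: "lin_on R (pmod M (P 0)) ?S L (\<lambda>z. f (fst z) \<oplus>\<^bsub>L\<^esub> h (snd z))"
    by (rule lin_on_add[OF lin_on_comp[OF fs f] lin_on_comp[OF sn lh]]) auto
  \<comment> \<open>If \<open>k + \<phi> x = 0\<close>, then applying \<open>p\<close> gives
    \<open>e x = 0\<close>. So \<open>h x = f (\<phi> x)\<close>, and \<open>f k + h x\<close> is
    the value of \<open>f\<close> at zero.\<close>
  have ker: "f (fst z) \<oplus>\<^bsub>L\<^esub> h (snd z) = \<zero>\<^bsub>L\<^esub>"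
    if z: "z \<in> ?S" "fst z \<oplus>\<^bsub>M\<^esub> \<phi> (snd z) = \<zero>\<^bsub>M\<^esub>" for z
  proof -
    obtain k x where zz: "z = (k, x)" "k \<in> carrier M" "p k = \<zero>\<^bsub>A\<^esub>" "x \<in> carrier (P 0)" using z(1) by auto
    have "p (k \<oplus>\<^bsub>M\<^esub> \<phi> x) = \<zero>\<^bsub>A\<^esub>" using z(2) zz(1) lin_on_simps(4)[OF p(1)] by simp
    then have "\<zero>\<^bsub>A\<^esub> \<oplus>\<^bsub>A\<^esub> e x = \<zero>\<^bsub>A\<^esub>"
      using lin_on_simps(2)[OF p(1) zz(2) \<phi>c[OF zz(4)]] zz(3) p\<phi>[OF zz(4)] by simp
    then have ex: "e x = \<zero>\<^bsub>A\<^esub>" using left_module_simps(7)[OF ObjD(1)[OF A]] lin_on_simps(1)[OF le zz(4)] by simp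
    have "\<phi> x \<in> ?K" using \<phi>c[OF zz(4)] p\<phi>[OF zz(4)] ex by simp
    then have "f k \<oplus>\<^bsub>L\<^esub> h x = f (k \<oplus>\<^bsub>M\<^esub> \<phi> x)"
      using lin_on_simps(2)[OF f, of k "\<phi> x"] zz hd[OF zz(4) ex] by simp
    then show ?thesis using z(2) zz(1) lin_on_simps(4)[OF f] by simp
  qed
  obtain F where F: "lin_on R M ((\<lambda>z. fst z \<oplus>\<^bsub>M\<^esub> \<phi> (snd z)) ` ?S) L F"
    "\<forall>z \<in> ?S. F (fst z \<oplus>\<^bsub>M\<^esub> \<phi> (snd z)) = f (fst z) \<oplus>\<^bsub>L\<^esub> h (snd z)"
    using lin_on_factor[OF g1 h1 ker] by blast
  have "(\<lambda>z. fst z \<oplus>\<^bsub>M\<^esub> \<phi> (snd z)) ` ?S = carrier M"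
  proof
    show "carrier M \<subseteq> (\<lambda>z. fst z \<oplus>\<^bsub>M\<^esub> \<phi> (snd z)) ` ?S"
    proof
      fix m assume m: "m \<in> carrier M"
      have "p m \<in> e ` carrier (P 0)"
        using R_Mod_epic_surj[OF PO A epi] lin_on_simps(1)[OF p(1) m] by simp
      then obtain x where x: "x \<in> carrier (P 0)" "p m = e x" by blast
      have c: "\<phi> x \<in> carrier M" "e x \<in> carrier A" using \<phi>c[OF x(1)] lin_on_simps(1)[OF le x(1)] by auto
      have "p (m \<ominus>\<^bsub>M\<^esub> \<phi> x) = \<zero>\<^bsub>A\<^esub>"
        using lin_on_simps(6)[OF p(1) m c(1)] p\<phi>[OF x(1)] x(2) c(2) left_module_minus_eq_zero[OF ObjD(1)[OF A]] by simp
      moreover have "m \<ominus>\<^bsub>M\<^esub> \<phi> x \<in> carrier M" using left_module_simps(4)[OF lmM m c(1)] .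
      moreover have "m = (m \<ominus>\<^bsub>M\<^esub> \<phi> x) \<oplus>\<^bsub>M\<^esub> \<phi> x" using m c(1) lmM by algebra
      ultimately show "m \<in> (\<lambda>z. fst z \<oplus>\<^bsub>M\<^esub> \<phi> (snd z)) ` ?S"
        using x(1) by (intro image_eqI[of _ _ "(m \<ominus>\<^bsub>M\<^esub> \<phi> x, x)"]) simp_all
    qed
  qed (use lin_on_simps(1)[OF g1] in blast)
  then have "lin R M L F" using F(1) by simp
  moreover have "F x = f x" if "x \<in> carrier M" "p x = \<zero>\<^bsub>A\<^esub>" for x
  proof -
    have "(x, \<zero>\<^bsub>P 0\<^esub>) \<in> ?S" using that left_module_simps(2)[OF lmP] by simp
    then have "F (x \<oplus>\<^bsub>M\<^esub> \<phi> \<zero>\<^bsub>P 0\<^esub>) = f x \<oplus>\<^bsub>L\<^esub> h \<zero>\<^bsub>P 0\<^esub>" using F(2) by force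
    then show ?thesis
      using that lin_on_simps(1)[OF f, of x] left_module_simps(8)[OF lmM] left_module_simps(8)[OF lmL]
      by (simp add: lin_on_simps(4)[OF l\<phi>] lin_on_simps(4)[OF lh])
  qed
  ultimately show "\<exists>F. lin R M L F \<and> (\<forall>x \<in> carrier M. p x = \<zero>\<^bsub>A\<^esub> \<longrightarrow> F x = f x)" by blast
qed

end

section \<open>The category of complexes\<close>

text \<open>Relates to \<open>chain_map\<close> as \<open>lin\<close> does to
  \<open>mod_hom\<close>: element types may differ and values outside the carriers are free.
  Restriction to the carriers gives a morphism.\<close>

definition chain_lin ::
    "('r, 'x) ring_scheme \<Rightarrow> ('r, 'a) mod_complex \<Rightarrow> ('r, 'b) mod_complex \<Rightarrow> (int \<Rightarrow> 'a \<Rightarrow> 'b) \<Rightarrow> bool" where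
  "chain_lin R C D f \<longleftrightarrow> (\<forall>n. lin R (cmod C n) (cmod D n) (f n)) \<and>
     (\<forall>n. \<forall>x \<in> carrier (cmod C n). cdiff D n (f n x) = f (n - 1) (cdiff C n x))"

definition subcomplex ::
    "('r, 'x) ring_scheme \<Rightarrow> ('r, 'a) mod_complex \<Rightarrow> (int \<Rightarrow> 'a set) \<Rightarrow> bool" where
  "subcomplex R C S \<longleftrightarrow> (\<forall>n. submod R (cmod C n) (S n)) \<and> (\<forall>n. \<forall>x \<in> S n. cdiff C n x \<in> S (n - 1))"

definition restrict_complex :: "('r, 'a) mod_complex \<Rightarrow> (int \<Rightarrow> 'a set) \<Rightarrow> ('r, 'a) mod_complex" where
  "restrict_complex C S =
     \<lparr>cmod = (\<lambda>n. (cmod C n)\<lparr>carrier := S n\<rparr>), cdiff = (\<lambda>n. restrict (cdiff C n) (S n))\<rparr>"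

lemma restrict_complex_simps [simp]:
  "cmod (restrict_complex C S) n = (cmod C n)\<lparr>carrier := S n\<rparr>"
  "cdiff (restrict_complex C S) n = restrict (cdiff C n) (S n)"
  by (simp_all add: restrict_complex_def)

lemma Complexes_simps [simp]:
  "Obj (Complexes R) = {C. is_complex R C}"
  "Hom (Complexes R) = chain_map R"
  "preadditive.Id (Complexes R) C = (\<lambda>n. preadditive.Id (R_Mod R) (cmod C n))"
  "Comp (Complexes R) C g f = (\<lambda>n. Comp (R_Mod R) (cmod C n) (g n) (f n))"
  "Plus (Complexes R) C D f g = (\<lambda>n. Plus (R_Mod R) (cmod C n) (cmod D n) (f n) (g n))"
  "Zero (Complexes R) C D = (\<lambda>n. Zero (R_Mod R) (cmod C n) (cmod D n))"
  by (simp_all add: Complexes_def)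

context ring_universe begin

lemma is_complexD:
  fixes C :: "('r, 'm) mod_complex"
  assumes "is_complex R C"
  shows "cmod C n \<in> Obj (R_Mod R)" "lin R (cmod C n) (cmod C (n - 1)) (cdiff C n)"
    "x \<in> carrier (cmod C n) \<Longrightarrow> cdiff C (n - 1) (cdiff C n x) = \<zero>\<^bsub>cmod C (n - 2)\<^esub>"
proof -
  show O: "cmod C n \<in> Obj (R_Mod R)" for n using assms by (simp add: is_complex_def)
  show "lin R (cmod C n) (cmod C (n - 1)) (cdiff C n)"
    using assms by (intro mod_hom_lin(1) O) (simp add: is_complex_def)
  show "x \<in> carrier (cmod C n) \<Longrightarrow> cdiff C (n - 1) (cdiff C n x) = \<zero>\<^bsub>cmod C (n - 2)\<^esub>"
    using assms by (simp add: is_complex_def)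
qed

text \<open>Differentials that are built from choices take arbitrary values outside the carrier; the
  restriction makes them extensional, as membership in \<open>mod_hom\<close> demands.\<close>

lemma is_complexI:
  fixes M :: "int \<Rightarrow> ('r, 'm) module"
  assumes M: "\<And>n. M n \<in> Obj (R_Mod R)" and d: "\<And>n. lin R (M n) (M (n - 1)) (d n)"
    and dd: "\<And>n x. x \<in> carrier (M n) \<Longrightarrow> d (n - 1) (d n x) = \<zero>\<^bsub>M (n - 2)\<^esub>"
  shows "is_complex R \<lparr>cmod = M, cdiff = \<lambda>n. restrict (d n) (carrier (M n))\<rparr>"
  unfolding is_complex_def
  using M lin_mod_hom[OF d] lin_on_simps(1)[OF d] dd by simp

lemma chain_linD:
  assumes "chain_lin R C D f"
  shows "lin R (cmod C n) (cmod D n) (f n)"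
    "x \<in> carrier (cmod C n) \<Longrightarrow> cdiff D n (f n x) = f (n - 1) (cdiff C n x)"
  using assms by (auto simp: chain_lin_def)

lemma chain_map_lin:
  fixes C D :: "('r, 'm) mod_complex"
  assumes "f \<in> chain_map R C D" "is_complex R C" "is_complex R D"
  shows "chain_lin R C D f"
  using assms mod_hom_lin(1)[OF _ is_complexD(1)[OF assms(2)] is_complexD(1)[OF assms(3)]]
  by (simp add: chain_map_def chain_lin_def)

lemma chain_map_mod_hom: "f \<in> chain_map R C D \<Longrightarrow> f n \<in> mod_hom R (cmod C n) (cmod D n)"
  by (simp add: chain_map_def)

lemma chain_map_comm: "f \<in> chain_map R C D \<Longrightarrow> x \<in> carrier (cmod C n) \<Longrightarrow>
    cdiff D n (f n x) = f (n - 1) (cdiff C n x)"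
  by (simp add: chain_map_def)

lemma chain_lin_map:
  fixes C D :: "('r, 'm) mod_complex"
  assumes "chain_lin R C D f" "is_complex R C"
  shows "(\<lambda>n. restrict (f n) (carrier (cmod C n))) \<in> chain_map R C D"
  unfolding chain_map_def
  using lin_mod_hom[OF chain_linD(1)[OF assms(1)]] chain_linD(2)[OF assms(1)]
    lin_on_simps(1)[OF is_complexD(2)[OF assms(2)]]
  by simp

lemma chain_map_restrict: "f \<in> chain_map R C D \<Longrightarrow> (\<lambda>n. restrict (f n) (carrier (cmod C n))) = f"
  by (rule ext) (simp add: chain_map_def mod_hom_def PiE_def extensional_restrict)

lemma chain_lin_comp:
  assumes f: "chain_lin R C D f" and g: "chain_lin R D E g"
  shows "chain_lin R C E (\<lambda>n x. g n (f n x))"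
  unfolding chain_lin_def
proof (intro conjI allI ballI)
  fix n
  show "lin R (cmod C n) (cmod E n) (\<lambda>x. g n (f n x))"
    by (rule lin_on_comp[OF chain_linD(1)[OF f] chain_linD(1)[OF g]])
      (use lin_on_simps(1)[OF chain_linD(1)[OF f]] in auto)
  fix x assume x: "x \<in> carrier (cmod C n)"
  then show "cdiff E n (g n (f n x)) = g (n - 1) (f (n - 1) (cdiff C n x))"
    using chain_linD(2)[OF f x] chain_linD(2)[OF g] lin_on_simps(1)[OF chain_linD(1)[OF f] x] by simp
qed

lemma subcomplex_kernel:
  assumes C: "is_complex R (C :: ('r, 'm) mod_complex)" and f: "chain_lin R C D f"
    and z: "\<And>n. cdiff D n \<zero>\<^bsub>cmod D n\<^esub> = \<zero>\<^bsub>cmod D (n - 1)\<^esub>"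
  shows "subcomplex R C (\<lambda>n. {x \<in> carrier (cmod C n). f n x = \<zero>\<^bsub>cmod D n\<^esub>})"
  unfolding subcomplex_def
  using submod_kernel[OF chain_linD(1)[OF f]] lin_on_simps(1)[OF is_complexD(2)[OF C]]
    chain_linD(2)[OF f, symmetric] z by simp

lemma restrict_complex:
  fixes C :: "('r, 'm) mod_complex"
  assumes C: "is_complex R C" and S: "subcomplex R C S"
  shows "is_complex R (restrict_complex C S)"
proof -
  have s: "submod R (cmod C n) (S n)" "x \<in> S n \<Longrightarrow> cdiff C n x \<in> S (n - 1)" for n x
    using S by (auto simp: subcomplex_def)
  have c: "x \<in> S n \<Longrightarrow> x \<in> carrier (cmod C n)" for n x using s(1)[of n] by (auto simp: submod_def)
  have "is_complex R \<lparr>cmod = (\<lambda>n. (cmod C n)\<lparr>carrier := S n\<rparr>),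
      cdiff = (\<lambda>n. restrict (cdiff C n) (carrier ((cmod C n)\<lparr>carrier := S n\<rparr>)))\<rparr>"
  proof (rule is_complexI)
    fix n
    show "(cmod C n)\<lparr>carrier := S n\<rparr> \<in> Obj (R_Mod R)" by (rule Obj_submod[OF is_complexD(1)[OF C] s(1)])
    have "lin_on R (cmod C n) (S n) (cmod C (n - 1)) (cdiff C n)"
      by (rule lin_on_subset[OF is_complexD(2)[OF C] s(1)]) (use c in auto)
    then show "lin R ((cmod C n)\<lparr>carrier := S n\<rparr>) ((cmod C (n - 1))\<lparr>carrier := S (n - 1)\<rparr>) (cdiff C n)"
      using ObjD(1)[OF is_complexD(1)[OF C]] s
      by (auto simp: lin_on_submod_source lin_on_submod_target)
  qed (use is_complexD(3)[OF C] c in simp)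
  then show ?thesis by (simp add: restrict_complex_def)
qed

text \<open>The predicate \<open>is_complex\<close> is tied to \<open>'m\<close>, so for another
  element type its clauses appear as separate hypotheses. With \<open>S\<close> zero the lemma
  copies a complex into the universe, which is needed for complexes assembled from cells.\<close>

lemma ex_quotient_complex:
  fixes C :: "('r, 'a) mod_complex"
  assumes d: "\<And>n. lin R (cmod C n) (cmod C (n - 1)) (cdiff C n)" and fits: "\<And>n. fits U (carrier (cmod C n))"
    and dd: "\<And>n x. x \<in> carrier (cmod C n) \<Longrightarrow> cdiff C (n - 1) (cdiff C n x) = \<zero>\<^bsub>cmod C (n - 2)\<^esub>"
    and S: "subcomplex R C S"
  shows "\<exists>(Q :: ('r, 'm) mod_complex) q. is_complex R Q \<and> chain_lin R C Q q \<and>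
    (\<forall>n. q n ` carrier (cmod C n) = carrier (cmod Q n)) \<and>
    (\<forall>n. \<forall>x \<in> carrier (cmod C n). q n x = \<zero>\<^bsub>cmod Q n\<^esub> \<longleftrightarrow> x \<in> S n)"
proof -
  have lmC: "left_module R (cmod C n)" for n using lin_on_modules[OF d] by blast
  have s: "submod R (cmod C n) (S n)" "x \<in> S n \<Longrightarrow> cdiff C n x \<in> S (n - 1)" for n x
    using S by (auto simp: subcomplex_def)
  have "\<forall>n. \<exists>(Q :: ('r, 'm) module) q. Q \<in> Obj (R_Mod R) \<and> lin R (cmod C n) Q q \<and>
      q ` carrier (cmod C n) = carrier Q \<and> (\<forall>x \<in> carrier (cmod C n). q x = \<zero>\<^bsub>Q\<^esub> \<longleftrightarrow> x \<in> S n)"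
    by (rule allI) (rule ex_quotient[OF lmC fits s(1)])
  from choice[OF this] obtain Q :: "int \<Rightarrow> ('r, 'm) module" where
    "\<forall>n. \<exists>q. Q n \<in> Obj (R_Mod R) \<and> lin R (cmod C n) (Q n) q \<and>
      q ` carrier (cmod C n) = carrier (Q n) \<and> (\<forall>x \<in> carrier (cmod C n). q x = \<zero>\<^bsub>Q n\<^esub> \<longleftrightarrow> x \<in> S n)" ..
  from choice[OF this] obtain q where
    Qq: "\<forall>n. Q n \<in> Obj (R_Mod R) \<and> lin R (cmod C n) (Q n) (q n) \<and>
      q n ` carrier (cmod C n) = carrier (Q n) \<and>
      (\<forall>x \<in> carrier (cmod C n). q n x = \<zero>\<^bsub>Q n\<^esub> \<longleftrightarrow> x \<in> S n)" ..
  then have Q: "Q n \<in> Obj (R_Mod R)" and q: "lin R (cmod C n) (Q n) (q n)"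
    and surj: "q n ` carrier (cmod C n) = carrier (Q n)"
    and ker: "\<forall>x \<in> carrier (cmod C n). q n x = \<zero>\<^bsub>Q n\<^esub> \<longleftrightarrow> x \<in> S n" for n by blast+
  have dc: "cdiff C n x \<in> carrier (cmod C (n - 1))" if "x \<in> carrier (cmod C n)" for n x
    using lin_on_simps(1)[OF d that] .
  have "\<forall>n. \<exists>k. lin R (Q n) (Q (n - 1)) k \<and> (\<forall>x \<in> carrier (cmod C n). k (q n x) = q (n - 1) (cdiff C n x))"
  proof
    fix n
    have h: "lin R (cmod C n) (Q (n - 1)) (\<lambda>x. q (n - 1) (cdiff C n x))"
      by (rule lin_on_comp[OF d q]) (use dc in auto)
    have "q (n - 1) (cdiff C n x) = \<zero>\<^bsub>Q (n - 1)\<^esub>" if "x \<in> carrier (cmod C n)" "q n x = \<zero>\<^bsub>Q n\<^esub>" for x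
      using ker s(2) that dc by blast
    from lin_on_factor[OF q h this] surj
    show "\<exists>k. lin R (Q n) (Q (n - 1)) k \<and> (\<forall>x \<in> carrier (cmod C n). k (q n x) = q (n - 1) (cdiff C n x))"
      by simp
  qed
  from choice[OF this] obtain \<delta> where
    \<delta>: "\<forall>n. lin R (Q n) (Q (n - 1)) (\<delta> n) \<and> (\<forall>x \<in> carrier (cmod C n). \<delta> n (q n x) = q (n - 1) (cdiff C n x))" ..
  let ?Q = "\<lparr>cmod = Q, cdiff = \<lambda>n. restrict (\<delta> n) (carrier (Q n))\<rparr>"
  have "is_complex R ?Q"
  proof (rule is_complexI)
    fix n x assume "x \<in> carrier (Q n)"
    then have "x \<in> q n ` carrier (cmod C n)" using surj by simp
    then obtain y where y: "y \<in> carrier (cmod C n)" "x = q n y" by blast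
    have "\<delta> (n - 1) (\<delta> n x) = q (n - 1 - 1) (cdiff C (n - 1) (cdiff C n y))"
      using \<delta> y dc by simp
    also have "\<dots> = q (n - 2) \<zero>\<^bsub>cmod C (n - 2)\<^esub>" using dd[OF y(1)] by simp
    also have "\<dots> = \<zero>\<^bsub>Q (n - 2)\<^esub>" by (rule lin_on_simps(4)[OF q])
    finally show "\<delta> (n - 1) (\<delta> n x) = \<zero>\<^bsub>Q (n - 2)\<^esub>" .
  qed (use Q \<delta> in blast)+
  moreover have "chain_lin R C ?Q q"
    unfolding chain_lin_def using q \<delta> lin_on_simps(1)[OF q] by simp
  ultimately show ?thesis using surj ker by (intro exI[of _ ?Q] exI[of _ q]) simp
qed

lemma ex_quotient_is_complex:
  fixes C :: "('r, 'm) mod_complex"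
  assumes C: "is_complex R C" and S: "subcomplex R C S"
  shows "\<exists>(Q :: ('r, 'm) mod_complex) q. is_complex R Q \<and> chain_lin R C Q q \<and>
    (\<forall>n. q n ` carrier (cmod C n) = carrier (cmod Q n)) \<and>
    (\<forall>n. \<forall>x \<in> carrier (cmod C n). q n x = \<zero>\<^bsub>cmod Q n\<^esub> \<longleftrightarrow> x \<in> S n)"
  by (rule ex_quotient_complex[OF is_complexD(2)[OF C] ObjD(2)[OF is_complexD(1)[OF C]] _ S])
    (rule is_complexD(3)[OF C])

section \<open>Epimorphisms, monomorphisms, kernels and cokernels of complexes\<close>

lemma Complexes_surj_epic:
  fixes A B :: "('r, 'm) mod_complex"
  assumes f: "f \<in> chain_map R A B" and surj: "\<And>n. f n ` carrier (cmod A n) = carrier (cmod B n)"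
  shows "epic (Complexes R) A B f"
  unfolding epic_def
proof (intro conjI ballI impI)
  fix T u v assume T: "T \<in> Obj (Complexes R)" and u: "u \<in> Hom (Complexes R) B T" and v: "v \<in> Hom (Complexes R) B T"
    and eq: "Comp (Complexes R) A u f = Comp (Complexes R) A v f"
  show "u = v"
  proof
    fix n
    show "u n = v n"
    proof (rule R_Mod_surj_epic[OF chain_map_mod_hom[OF f] surj, unfolded epic_def, THEN conjunct2, rule_format])
      show "cmod T n \<in> Obj (R_Mod R)" using T is_complexD(1) by simp
      show "Comp (R_Mod R) (cmod A n) (u n) (f n) = Comp (R_Mod R) (cmod A n) (v n) (f n)"
        using fun_cong[OF eq, of n] by simp
    qed (use u v chain_map_mod_hom in auto)
  qed
qed (use f in simp)

lemma Complexes_inj_monic: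
  fixes A B :: "('r, 'm) mod_complex"
  assumes f: "f \<in> chain_map R A B" and inj: "\<And>n. inj_on (f n) (carrier (cmod A n))"
  shows "monic (Complexes R) A B f"
  unfolding monic_def
proof (intro conjI ballI impI)
  fix T u v assume T: "T \<in> Obj (Complexes R)" and u: "u \<in> Hom (Complexes R) T A" and v: "v \<in> Hom (Complexes R) T A"
    and eq: "Comp (Complexes R) T f u = Comp (Complexes R) T f v"
  show "u = v"
  proof
    fix n
    show "u n = v n"
    proof (rule R_Mod_inj_monic[OF chain_map_mod_hom[OF f] inj, unfolded monic_def, THEN conjunct2, rule_format])
      show "cmod T n \<in> Obj (R_Mod R)" using T is_complexD(1) by simp
      show "Comp (R_Mod R) (cmod T n) (f n) (u n) = Comp (R_Mod R) (cmod T n) (f n) (v n)"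
        using fun_cong[OF eq, of n] by simp
    qed (use u v chain_map_mod_hom in auto)
  qed
qed (use f in simp)

lemma complex_zero:
  assumes "is_complex R (C :: ('r, 'm) mod_complex)"
  shows "cdiff C n \<zero>\<^bsub>cmod C n\<^esub> = \<zero>\<^bsub>cmod C (n - 1)\<^esub>"
  by (rule lin_on_simps(4)[OF is_complexD(2)[OF assms]])

lemma chain_lin_zero:
  assumes A: "is_complex R (A :: ('r, 'm) mod_complex)" and B: "is_complex R (B :: ('r, 'm) mod_complex)"
  shows "chain_lin R A B (\<lambda>n x. \<zero>\<^bsub>cmod B n\<^esub>)"
  unfolding chain_lin_def
  using lin_on_zero[OF ObjD(1)[OF is_complexD(1)[OF A]] ObjD(1)[OF is_complexD(1)[OF B]]
      submod_carrier[OF ObjD(1)[OF is_complexD(1)[OF A]]]] complex_zero[OF B] by simp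

lemma subcomplex_image:
  assumes A: "is_complex R (A :: ('r, 'm) mod_complex)" and B: "is_complex R (B :: ('r, 'm) mod_complex)"
    and f: "chain_lin R A B f"
  shows "subcomplex R B (\<lambda>n. f n ` carrier (cmod A n))"
  unfolding subcomplex_def
proof (intro conjI allI ballI)
  fix n
  show "submod R (cmod B n) (f n ` carrier (cmod A n))"
    by (rule submod_image[OF chain_linD(1)[OF f] submod_carrier[OF ObjD(1)[OF is_complexD(1)[OF A]]]]) simp
  fix x assume "x \<in> f n ` carrier (cmod A n)"
  then obtain y where y: "y \<in> carrier (cmod A n)" "x = f n y" by blast
  have "cdiff B n x = f (n - 1) (cdiff A n y)" using chain_linD(2)[OF f y(1)] y(2) by simp
  then show "cdiff B n x \<in> f (n - 1) ` carrier (cmod A (n - 1))"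
    using lin_on_simps(1)[OF is_complexD(2)[OF A] y(1)] by simp
qed

text \<open>The test map has to be a chain map, so the argument for modules cannot be applied in one
  degree alone; the test object is the quotient complex by the image.\<close>

lemma Complexes_epic_surj:
  fixes A B :: "('r, 'm) mod_complex"
  assumes A: "is_complex R A" and B: "is_complex R B" and e: "epic (Complexes R) A B f"
  shows "f n ` carrier (cmod A n) = carrier (cmod B n)"
proof -
  have f: "chain_lin R A B f" using e chain_map_lin[OF _ A B] by (simp add: epic_def)
  note fc = lin_on_simps(1)[OF chain_linD(1)[OF f]]
  obtain Q :: "('r, 'm) mod_complex" and q where Q: "is_complex R Q" and q: "chain_lin R B Q q"
    and surj: "\<forall>n. q n ` carrier (cmod B n) = carrier (cmod Q n)"
    and ker: "\<forall>n. \<forall>x \<in> carrier (cmod B n). q n x = \<zero>\<^bsub>cmod Q n\<^esub> \<longleftrightarrow> x \<in> f n ` carrier (cmod A n)"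
    using ex_quotient_is_complex[OF B subcomplex_image[OF A B f]] by (elim exE conjE)
  have "(\<lambda>n. restrict (q n) (carrier (cmod B n))) = (\<lambda>n. \<lambda>x\<in>carrier (cmod B n). \<zero>\<^bsub>cmod Q n\<^esub>)"
  proof (rule e[unfolded epic_def, THEN conjunct2, rule_format])
    show "Q \<in> Obj (Complexes R)" using Q by simp
    show "(\<lambda>n. restrict (q n) (carrier (cmod B n))) \<in> Hom (Complexes R) B Q"
      using chain_lin_map[OF q B] by simp
    show "(\<lambda>n. \<lambda>x\<in>carrier (cmod B n). \<zero>\<^bsub>cmod Q n\<^esub>) \<in> Hom (Complexes R) B Q"
      using chain_lin_map[OF chain_lin_zero[OF B Q] B] by simp
    show "Comp (Complexes R) A (\<lambda>n. restrict (q n) (carrier (cmod B n))) f =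
        Comp (Complexes R) A (\<lambda>n. \<lambda>x\<in>carrier (cmod B n). \<zero>\<^bsub>cmod Q n\<^esub>) f"
      using ker fc by (auto intro!: ext restrict_ext)
  qed
  from fun_cong[OF fun_cong[OF this, of n]]
  have "q n x = \<zero>\<^bsub>cmod Q n\<^esub>" if "x \<in> carrier (cmod B n)" for x
    using that restrict_apply' by metis
  then show ?thesis using ker fc by auto
qed

lemma Complexes_is_kernel:
  fixes A B :: "('r, 'm) mod_complex"
  assumes A: "is_complex R A" and B: "is_complex R B" and f: "f \<in> chain_map R A B"
    and K: "\<And>n. K n = {x \<in> carrier (cmod A n). f n x = \<zero>\<^bsub>cmod B n\<^esub>}"
  shows "is_kernel (Complexes R) A B f (restrict_complex A K) (\<lambda>n. \<lambda>x\<in>K n. x)"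
    (is "is_kernel _ _ _ _ ?N ?k")
proof -
  have lf: "chain_lin R A B f" by (rule chain_map_lin[OF f A B])
  have KK: "K = (\<lambda>n. {x \<in> carrier (cmod A n). f n x = \<zero>\<^bsub>cmod B n\<^esub>})" using K by auto
  have S: "subcomplex R A K" unfolding KK by (rule subcomplex_kernel[OF A lf complex_zero[OF B]])
  have N: "is_complex R ?N" by (rule restrict_complex[OF A S])
  have kn: "is_kernel (R_Mod R) (cmod A n) (cmod B n) (f n) (cmod ?N n) (?k n)" for n
    unfolding K restrict_complex_simps
    by (rule R_Mod_is_kernel[OF is_complexD(1)[OF A] is_complexD(1)[OF B] chain_map_mod_hom[OF f]])
  have dK: "cdiff A n x \<in> K (n - 1)" if "x \<in> K n" for n x using S that by (simp add: subcomplex_def)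
  show ?thesis unfolding is_kernel_def
  proof (intro conjI ballI impI)
    show "?N \<in> Obj (Complexes R)" using N by simp
    show "?k \<in> Hom (Complexes R) ?N A"
      using kn dK by (simp add: chain_map_def is_kernel_def)
    show "Comp (Complexes R) ?N f ?k = Zero (Complexes R) ?N B"
      using kn by (simp add: is_kernel_def)
    fix T u assume T: "T \<in> Obj (Complexes R)" and u: "u \<in> Hom (Complexes R) T A"
      and z: "Comp (Complexes R) T f u = Zero (Complexes R) T B"
    have uH: "u n \<in> mod_hom R (cmod T n) (cmod A n)" for n using u chain_map_mod_hom by simp
    have uK: "u n x \<in> K n" if "x \<in> carrier (cmod T n)" for n x
      using fun_cong[OF fun_cong[OF z, of n], of x] mod_hom_closed[OF uH that] that by (simp add: K)
    show "\<exists>!w. w \<in> Hom (Complexes R) T ?N \<and> Comp (Complexes R) T ?k w = u"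
    proof (rule ex1I[of _ u])
      have "Comp (Complexes R) T ?k u = (\<lambda>n. restrict (u n) (carrier (cmod T n)))"
        using uK by (auto intro!: ext restrict_ext)
      moreover have "(\<lambda>n. restrict (u n) (carrier (cmod T n))) = u"
        using chain_map_restrict u by simp
      moreover have "u \<in> chain_map R T ?N"
        using u uK by (auto simp: chain_map_def mod_hom_def)
      ultimately show "u \<in> Hom (Complexes R) T ?N \<and> Comp (Complexes R) T ?k u = u" by simp
      fix w assume w: "w \<in> Hom (Complexes R) T ?N \<and> Comp (Complexes R) T ?k w = u"
      then have wH: "w n \<in> mod_hom R (cmod T n) (cmod ?N n)" for n
        using chain_map_mod_hom[of w T ?N n] by simp
      show "w = u"
      proof
        fix n show "w n = u n"
        proof (rule mod_hom_eqI[OF wH uH])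
          fix x assume x: "x \<in> carrier (cmod T n)"
          have "w n x \<in> K n" using mod_hom_closed[OF wH x] by simp
          moreover have "Comp (Complexes R) T ?k w n x = u n x" using w by simp
          ultimately show "w n x = u n x" using x by simp
        qed
      qed
    qed
  qed
qed

lemma Complexes_kernel_image:
  fixes A B N :: "('r, 'm) mod_complex"
  assumes A: "is_complex R A" and B: "is_complex R B" and f: "f \<in> chain_map R A B"
    and k: "is_kernel (Complexes R) A B f N k"
  shows "k n ` carrier (cmod N n) = {x \<in> carrier (cmod A n). f n x = \<zero>\<^bsub>cmod B n\<^esub>}"
proof
  let ?K = "\<lambda>n. {x \<in> carrier (cmod A n). f n x = \<zero>\<^bsub>cmod B n\<^esub>}"
  have kH: "k \<in> chain_map R N A" and z: "Comp (Complexes R) N f k = Zero (Complexes R) N B"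
    using k by (auto simp: is_kernel_def)
  show "k n ` carrier (cmod N n) \<subseteq> ?K n"
  proof clarify
    fix x assume "x \<in> carrier (cmod N n)"
    then show "k n x \<in> carrier (cmod A n) \<and> f n (k n x) = \<zero>\<^bsub>cmod B n\<^esub>"
      using fun_cong[OF fun_cong[OF z, of n], of x] mod_hom_closed[OF chain_map_mod_hom[OF kH], of x] by simp
  qed
  let ?N = "restrict_complex A ?K" and ?k = "\<lambda>n. \<lambda>x\<in>?K n. x"
  have "?N \<in> Obj (Complexes R)" "?k \<in> Hom (Complexes R) ?N A" "Comp (Complexes R) ?N f ?k = Zero (Complexes R) ?N B"
    using Complexes_is_kernel[OF A B f refl] unfolding is_kernel_def by blast+
  then obtain w where w: "w \<in> Hom (Complexes R) ?N N" "Comp (Complexes R) ?N k w = ?k"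
    using k unfolding is_kernel_def by blast
  show "?K n \<subseteq> k n ` carrier (cmod N n)"
  proof
    fix x assume x: "x \<in> ?K n"
    then have "k n (w n x) = x" using fun_cong[OF fun_cong[OF w(2), of n], of x] by simp
    moreover have "w n x \<in> carrier (cmod N n)"
      using mod_hom_closed[OF chain_map_mod_hom, of w ?N N x n] w(1) x by simp
    ultimately show "x \<in> k n ` carrier (cmod N n)" using image_eqI[of x "k n" "w n x"] by simp
  qed
qed

lemma Complexes_exact:
  fixes A B C :: "('r, 'm) mod_complex"
  assumes A: "is_complex R A" and B: "is_complex R B" and C: "is_complex R C"
    and ex: "exact_at (Complexes R) A f B g C"
  shows "f n ` carrier (cmod A n) = {x \<in> carrier (cmod B n). g n x = \<zero>\<^bsub>cmod C n\<^esub>}"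
proof -
  obtain N k e where N: "is_kernel (Complexes R) B C g N k" "epic (Complexes R) A N e" "Comp (Complexes R) A k e = f"
    and g: "g \<in> chain_map R B C" using ex by (auto simp: exact_at_def)
  have "is_complex R N" using N(1) by (simp add: is_kernel_def)
  then have "e n ` carrier (cmod A n) = carrier (cmod N n)" by (rule Complexes_epic_surj[OF A _ N(2)])
  moreover have "f n ` carrier (cmod A n) = k n ` e n ` carrier (cmod A n)"
    unfolding N(3)[symmetric] by (simp add: image_image)
  ultimately show ?thesis using Complexes_kernel_image[OF B C g N(1)] by simp
qed

text \<open>The factorisations are chosen in each degree separately. They commute with the
  differentials because every element of \<open>Q\<close> is the image of an element of
  \<open>B\<close>, where the commutation is known.\<close>

lemma Complexes_is_cokernel:
  fixes A B Q :: "('r, 'm) mod_complex"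
  assumes A: "is_complex R A" and B: "is_complex R B" and Q: "is_complex R Q"
    and f: "f \<in> chain_map R A B" and q: "q \<in> chain_map R B Q" "\<And>n. q n ` carrier (cmod B n) = carrier (cmod Q n)"
    and ker: "\<And>n x. x \<in> carrier (cmod B n) \<Longrightarrow> q n x = \<zero>\<^bsub>cmod Q n\<^esub> \<longleftrightarrow> x \<in> f n ` carrier (cmod A n)"
  shows "is_cokernel (Complexes R) A B f Q q"
proof -
  have cn: "is_cokernel (R_Mod R) (cmod A n) (cmod B n) (f n) (cmod Q n) (q n)" for n
    by (rule R_Mod_is_cokernel) (use is_complexD(1) A B Q f q ker chain_map_mod_hom in auto)
  show ?thesis unfolding is_cokernel_def
  proof (intro conjI ballI impI)
    show "Comp (Complexes R) A q f = Zero (Complexes R) A Q" using cn by (simp add: is_cokernel_def)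
    fix T u assume T: "T \<in> Obj (Complexes R)" and u: "u \<in> Hom (Complexes R) B T"
      and z: "Comp (Complexes R) A u f = Zero (Complexes R) A T"
    have uH: "u n \<in> Hom (R_Mod R) (cmod B n) (cmod T n)" for n using u chain_map_mod_hom by simp
    have "\<forall>n. \<exists>w. w \<in> Hom (R_Mod R) (cmod Q n) (cmod T n) \<and> Comp (R_Mod R) (cmod B n) w (q n) = u n"
    proof
      fix n
      have "cmod T n \<in> Obj (R_Mod R)" using T is_complexD(1) by simp
      moreover have "Comp (R_Mod R) (cmod A n) (u n) (f n) = Zero (R_Mod R) (cmod A n) (cmod T n)"
        using fun_cong[OF z, of n] by simp
      ultimately show "\<exists>w. w \<in> Hom (R_Mod R) (cmod Q n) (cmod T n) \<and> Comp (R_Mod R) (cmod B n) w (q n) = u n"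
        using cn[of n] uH[of n] unfolding is_cokernel_def by blast
    qed
    from choice[OF this] obtain w where w: "\<forall>n. w n \<in> Hom (R_Mod R) (cmod Q n) (cmod T n) \<and>
        Comp (R_Mod R) (cmod B n) (w n) (q n) = u n" ..
    have wq: "w n (q n x) = u n x" if "x \<in> carrier (cmod B n)" for n x
    proof -
      have "Comp (R_Mod R) (cmod B n) (w n) (q n) x = u n x" using w by simp
      then show ?thesis using that by simp
    qed
    have wH: "w \<in> chain_map R Q T"
      unfolding chain_map_def
    proof (clarsimp, intro conjI allI ballI)
      show "w n \<in> mod_hom R (cmod Q n) (cmod T n)" for n using w by simp
      fix n x assume "x \<in> carrier (cmod Q n)"
      then have "x \<in> q n ` carrier (cmod B n)" using q(2) by simp
      then obtain y where y: "y \<in> carrier (cmod B n)" "x = q n y" by blast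
      have dy: "cdiff B n y \<in> carrier (cmod B (n - 1))" by (rule lin_on_simps(1)[OF is_complexD(2)[OF B] y(1)])
      have "cdiff T n (w n x) = u (n - 1) (cdiff B n y)"
        using wq[OF y(1)] y chain_map_comm[of u B T y n] u by simp
      also have "\<dots> = w (n - 1) (cdiff Q n x)"
        using wq[OF dy] chain_map_comm[OF q(1) y(1)] y(2) by simp
      finally show "cdiff T n (w n x) = w (n - 1) (cdiff Q n x)" .
    qed
    show "\<exists>!w. w \<in> Hom (Complexes R) Q T \<and> Comp (Complexes R) B w q = u"
    proof (rule ex1I[of _ w])
      have "Comp (Complexes R) B w q = u" using w by (auto simp del: R_Mod_simps)
      then show *: "w \<in> Hom (Complexes R) Q T \<and> Comp (Complexes R) B w q = u" using wH by simp
      show "w' = w" if "w' \<in> Hom (Complexes R) Q T \<and> Comp (Complexes R) B w' q = u" for w'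
        using Complexes_surj_epic[OF q, unfolded epic_def, THEN conjunct2, rule_format, OF T] * that by simp
    qed
  qed (use Q q in auto)
qed

end

section \<open>Extension of chain maps, and \<open>Ext1\<close> for complexes\<close>

definition chain_on ::
    "('r, 'x) ring_scheme \<Rightarrow> ('r, 'a) mod_complex \<Rightarrow> (int \<Rightarrow> 'a set) \<Rightarrow> ('r, 'b) mod_complex \<Rightarrow>
      (int \<Rightarrow> 'a \<Rightarrow> 'b) \<Rightarrow> bool" where
  "chain_on R C S D f \<longleftrightarrow> (\<forall>n. lin_on R (cmod C n) (S n) (cmod D n) (f n)) \<and>
     (\<forall>n. \<forall>x \<in> S n. cdiff D n (f n x) = f (n - 1) (cdiff C n x))"

text \<open>The analogue of \<open>extends\<close> for complexes. The element type of
  \<open>Q\<close> is left free, so that the semifree complex of cells can be used as it stands,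
  without a copy in the universe.\<close>

definition complex_extends ::
    "('r, 'x) ring_scheme \<Rightarrow> ('r, 'b) mod_complex \<Rightarrow> ('r, 'm) mod_complex \<Rightarrow> bool" where
  "complex_extends R Q B \<longleftrightarrow> (\<forall>M :: ('r, 'm) mod_complex. \<forall>p f. is_complex R M \<and> chain_lin R M Q p \<and>
     (\<forall>n. p n ` carrier (cmod M n) = carrier (cmod Q n)) \<and>
     chain_on R M (\<lambda>n. {x \<in> carrier (cmod M n). p n x = \<zero>\<^bsub>cmod Q n\<^esub>}) B f \<longrightarrow>
     (\<exists>F. chain_lin R M B F \<and>
       (\<forall>n. \<forall>x \<in> carrier (cmod M n). p n x = \<zero>\<^bsub>cmod Q n\<^esub> \<longrightarrow> F n x = f n x)))"

context ring_universe begin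

lemma chain_onD:
  assumes "chain_on R C S D f"
  shows "lin_on R (cmod C n) (S n) (cmod D n) (f n)"
    "x \<in> S n \<Longrightarrow> cdiff D n (f n x) = f (n - 1) (cdiff C n x)"
  using assms by (auto simp: chain_on_def)

text \<open>A sum of disks: each \<open>a\<close> in degree \<open>n\<close> of \<open>Q\<close>
  contributes a generator \<open>Inl a\<close> in degree \<open>n\<close> and its boundary
  \<open>Inr a\<close> in degree \<open>n - 1\<close>. So the generators in degree \<open>n\<close>
  come from degrees \<open>n\<close> and \<open>n + 1\<close> of \<open>Q\<close>. A chain map out
  of this complex may be prescribed freely on the generators \<open>Inl a\<close>, and hence can be
  lifted along epimorphisms.\<close>

lemma Complexes_enough_projectives:
  fixes Q :: "('r, 'm) mod_complex"
  assumes Q: "is_complex R Q"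
  shows "\<exists>P e N k. projective_obj (Complexes R) P \<and> epic (Complexes R) P Q e \<and> is_kernel (Complexes R) P Q e N k"
proof -
  note QO = is_complexD(1)[OF Q]
  let ?S = "\<lambda>n. carrier (cmod Q n) <+> carrier (cmod Q (n + 1))"
  have "fits U (?S n)" for n
    unfolding Sum_Type.Plus_def by (intro fits_Un fits_image ObjD(2) QO)
  then have "\<forall>n. \<exists>(P :: ('r, 'm) module) \<eta>. free_on R (?S n) P \<eta>" using ex_free_module by blast
  from choice[OF this] obtain P :: "int \<Rightarrow> ('r, 'm) module" where "\<forall>n. \<exists>\<eta>. free_on R (?S n) (P n) \<eta>" ..
  from choice[OF this] obtain \<eta> where "\<forall>n. free_on R (?S n) (P n) (\<eta> n)" ..
  then have free: "free_on R (?S n) (P n) (\<eta> n)" for n by blast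
  note PO = free_onD(1)[OF free]
  have \<eta>: "a \<in> carrier (cmod Q n) \<Longrightarrow> \<eta> n (Inl a) \<in> carrier (P n)"
    "b \<in> carrier (cmod Q (n + 1)) \<Longrightarrow> \<eta> n (Inr b) \<in> carrier (P n)" for n a b
    using free_onD(2)[OF free] by auto
  have lift: "\<exists>h. lin R (P n) N h \<and> (\<forall>a \<in> carrier (cmod Q n). h (\<eta> n (Inl a)) = u a) \<and>
      (\<forall>b \<in> carrier (cmod Q (n + 1)). h (\<eta> n (Inr b)) = v b)"
    if N: "N \<in> Obj (R_Mod R)" and u: "\<And>a. a \<in> carrier (cmod Q n) \<Longrightarrow> u a \<in> carrier N"
      and v: "\<And>b. b \<in> carrier (cmod Q (n + 1)) \<Longrightarrow> v b \<in> carrier N" for n u v and N :: "('r, 'm) module"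
  proof -
    have "case_sum u v s \<in> carrier N" if "s \<in> ?S n" for s using that u v by auto
    from free_onD(3)[OF free ObjD(1)[OF N], of n "case_sum u v", OF this]
    obtain h where h: "lin R (P n) N h" "\<forall>s \<in> ?S n. h (\<eta> n s) = case_sum u v s" by blast
    have "h (\<eta> n (Inl a)) = u a" if "a \<in> carrier (cmod Q n)" for a
      using bspec[OF h(2) InlI[OF that]] by simp
    moreover have "h (\<eta> n (Inr b)) = v b" if "b \<in> carrier (cmod Q (n + 1))" for b
      using bspec[OF h(2) InrI[OF that]] by simp
    ultimately show ?thesis using h(1) by blast
  qed
  have uniq: "f x = g x"
    if "lin R (P n) N f" "lin R (P n) N g" "\<And>a. a \<in> carrier (cmod Q n) \<Longrightarrow> f (\<eta> n (Inl a)) = g (\<eta> n (Inl a))"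
      "\<And>b. b \<in> carrier (cmod Q (n + 1)) \<Longrightarrow> f (\<eta> n (Inr b)) = g (\<eta> n (Inr b))" "x \<in> carrier (P n)"
    for n f g x and N :: "('r, 'm) module"
    by (rule free_onD(4)[OF free that(1,2) _ that(5)]) (use that(3,4) in auto)
  have "\<forall>n. \<exists>d. lin R (P n) (P (n - 1)) d \<and> (\<forall>a \<in> carrier (cmod Q n). d (\<eta> n (Inl a)) = \<eta> (n - 1) (Inr a)) \<and>
      (\<forall>b \<in> carrier (cmod Q (n + 1)). d (\<eta> n (Inr b)) = \<zero>\<^bsub>P (n - 1)\<^esub>)"
    by (rule allI, rule lift[OF PO]) (use \<eta>(2)[of _ "_ - 1"] left_module_simps(2)[OF ObjD(1)[OF PO]] in auto)
  from choice[OF this] obtain d where "\<forall>n. lin R (P n) (P (n - 1)) (d n) \<and>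
      (\<forall>a \<in> carrier (cmod Q n). d n (\<eta> n (Inl a)) = \<eta> (n - 1) (Inr a)) \<and>
      (\<forall>b \<in> carrier (cmod Q (n + 1)). d n (\<eta> n (Inr b)) = \<zero>\<^bsub>P (n - 1)\<^esub>)" ..
  then have d: "lin R (P n) (P (n - 1)) (d n)"
    and dl: "a \<in> carrier (cmod Q n) \<Longrightarrow> d n (\<eta> n (Inl a)) = \<eta> (n - 1) (Inr a)"
    and dr: "b \<in> carrier (cmod Q (n + 1)) \<Longrightarrow> d n (\<eta> n (Inr b)) = \<zero>\<^bsub>P (n - 1)\<^esub>" for n a b by blast+
  note dc = lin_on_simps(1)[OF d]
  let ?P = "\<lparr>cmod = P, cdiff = \<lambda>n. restrict (d n) (carrier (P n))\<rparr>"
  have P: "is_complex R ?P"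
  proof (rule is_complexI)
    show "P n \<in> Obj (R_Mod R)" "lin R (P n) (P (n - 1)) (d n)" for n by (rule PO, rule d)
    fix n x assume x: "x \<in> carrier (P n)"
    have "lin R (P n) (P (n - 1 - 1)) (\<lambda>x. d (n - 1) (d n x))" by (rule lin_on_comp[OF d d]) (use dc in auto)
    then have dd: "lin R (P n) (P (n - 2)) (\<lambda>x. d (n - 1) (d n x))" by simp
    show "d (n - 1) (d n x) = \<zero>\<^bsub>P (n - 2)\<^esub>"
    proof (rule uniq[OF dd lin_on_zero[OF ObjD(1)[OF PO] ObjD(1)[OF PO] submod_carrier[OF ObjD(1)[OF PO]]] _ _ x])
      show "d (n - 1) (d n (\<eta> n (Inl a))) = \<zero>\<^bsub>P (n - 2)\<^esub>" if "a \<in> carrier (cmod Q n)" for a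
        using dl[OF that] dr[of a "n - 1"] that by simp
      show "d (n - 1) (d n (\<eta> n (Inr b))) = \<zero>\<^bsub>P (n - 2)\<^esub>" if "b \<in> carrier (cmod Q (n + 1))" for b
        using dr[OF that] lin_on_simps(4)[OF d[of "n - 1"]] by simp
    qed
  qed
  \<comment> \<open>Commutation is asked only at the generators \<open>Inl a\<close>. At
    \<open>Inr b\<close> it is automatic, since \<open>Inr b\<close> in degree \<open>n\<close> is
    the boundary of \<open>Inl b\<close> in degree \<open>n + 1\<close> and the square of the
    differential of \<open>B\<close> is zero.\<close>
  have chainI: "chain_lin R ?P B h"
    if B: "is_complex R B" and h: "\<And>n. lin R (P n) (cmod B n) (h n)"
      and hd: "\<And>n a. a \<in> carrier (cmod Q n) \<Longrightarrow> h (n - 1) (\<eta> (n - 1) (Inr a)) = cdiff B n (h n (\<eta> n (Inl a)))"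
    for B :: "('r, 'm) mod_complex" and h
    unfolding chain_lin_def
  proof (intro conjI allI ballI)
    fix n
    show "lin R (cmod ?P n) (cmod B n) (h n)" using h by simp
    note hc = lin_on_simps(1)[OF h]
    have 1: "lin R (P n) (cmod B (n - 1)) (\<lambda>x. cdiff B n (h n x))"
      by (rule lin_on_comp[OF h is_complexD(2)[OF B]]) (use hc in auto)
    have 2: "lin R (P n) (cmod B (n - 1)) (\<lambda>x. h (n - 1) (d n x))"
      by (rule lin_on_comp[OF d h]) (use dc in auto)
    fix x assume "x \<in> carrier (cmod ?P n)"
    then have x: "x \<in> carrier (P n)" by simp
    have "cdiff B n (h n x) = h (n - 1) (d n x)"
    proof (rule uniq[OF 1 2 _ _ x])
      show "cdiff B n (h n (\<eta> n (Inl a))) = h (n - 1) (d n (\<eta> n (Inl a)))" if "a \<in> carrier (cmod Q n)" for a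
        using hd[OF that] dl[OF that] by simp
      fix b assume b: "b \<in> carrier (cmod Q (n + 1))"
      have "h n (\<eta> n (Inr b)) = cdiff B (n + 1) (h (n + 1) (\<eta> (n + 1) (Inl b)))"
        using hd[OF b] by simp
      then have "cdiff B n (h n (\<eta> n (Inr b))) = \<zero>\<^bsub>cmod B (n - 1)\<^esub>"
        using is_complexD(3)[OF B, of _ "n + 1"] hc[OF \<eta>(1)[OF b]] by simp
      then show "cdiff B n (h n (\<eta> n (Inr b))) = h (n - 1) (d n (\<eta> n (Inr b)))"
        using dr[OF b] lin_on_simps(4)[OF h] by simp
    qed
    then show "cdiff B n (h n x) = h (n - 1) (cdiff ?P n x)" using x by simp
  qed
  \<comment> \<open>The values on \<open>Inr b\<close> are forced: the differential of the value
    prescribed at \<open>Inl b\<close> one degree higher.\<close>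
  have extend: "\<exists>h. chain_lin R ?P B h \<and> (\<forall>n. \<forall>a \<in> carrier (cmod Q n). h n (\<eta> n (Inl a)) = u n a)"
    if B: "is_complex R B" and u: "\<And>n a. a \<in> carrier (cmod Q n) \<Longrightarrow> u n a \<in> carrier (cmod B n)"
    for B :: "('r, 'm) mod_complex" and u
  proof -
    note dB = lin_on_simps(1)[OF is_complexD(2)[OF B]]
    have "\<forall>n. \<exists>h. lin R (P n) (cmod B n) h \<and> (\<forall>a \<in> carrier (cmod Q n). h (\<eta> n (Inl a)) = u n a) \<and>
      (\<forall>b \<in> carrier (cmod Q (n + 1)). h (\<eta> n (Inr b)) = cdiff B (n + 1) (u (n + 1) b))"
      by (rule allI, rule lift[OF is_complexD(1)[OF B]]) (use u dB[of _ "_ + 1"] in auto)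
    from choice[OF this] obtain h where h: "\<forall>n. lin R (P n) (cmod B n) (h n) \<and>
      (\<forall>a \<in> carrier (cmod Q n). h n (\<eta> n (Inl a)) = u n a) \<and>
      (\<forall>b \<in> carrier (cmod Q (n + 1)). h n (\<eta> n (Inr b)) = cdiff B (n + 1) (u (n + 1) b))" ..
    have "chain_lin R ?P B h"
    proof (rule chainI[OF B])
      show "h (n - 1) (\<eta> (n - 1) (Inr a)) = cdiff B n (h n (\<eta> n (Inl a)))" if "a \<in> carrier (cmod Q n)" for n a
        using h[rule_format, of n] h[rule_format, of "n - 1"] that by simp
    qed (use h in blast)
    then show ?thesis using h by blast
  qed
  have "projective_obj (Complexes R) ?P"
    unfolding projective_obj_def
  proof (intro conjI ballI allI impI)
    show "?P \<in> Obj (Complexes R)" using P by simp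
    fix B C e f assume "B \<in> Obj (Complexes R)" "C \<in> Obj (Complexes R)"
      and ef: "epic (Complexes R) B C e \<and> f \<in> Hom (Complexes R) ?P C"
    then have B: "is_complex R B" and C: "is_complex R C" by auto
    have e: "chain_lin R B C e" and f: "chain_lin R ?P C f"
      using ef chain_map_lin[OF _ B C] chain_map_lin[OF _ P C] by (auto simp: epic_def)
    have surj: "e n ` carrier (cmod B n) = carrier (cmod C n)" for n
      using Complexes_epic_surj[OF B C] ef by blast
    have fl: "lin R (P n) (cmod C n) (f n)" for n using chain_linD(1)[OF f, of n] by simp
    define u where "u n a = (SOME b. b \<in> carrier (cmod B n) \<and> e n b = f n (\<eta> n (Inl a)))" for n a
    have u: "u n a \<in> carrier (cmod B n) \<and> e n (u n a) = f n (\<eta> n (Inl a))" if "a \<in> carrier (cmod Q n)" for n a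
    proof -
      have "f n (\<eta> n (Inl a)) \<in> e n ` carrier (cmod B n)"
        unfolding surj using lin_on_simps(1)[OF fl \<eta>(1)[OF that]] .
      then have "\<exists>b. b \<in> carrier (cmod B n) \<and> e n b = f n (\<eta> n (Inl a))" by auto
      then show ?thesis unfolding u_def by (rule someI_ex)
    qed
    from extend[OF B, of u] u obtain h where h: "chain_lin R ?P B h"
      "\<forall>n. \<forall>a \<in> carrier (cmod Q n). h n (\<eta> n (Inl a)) = u n a" by blast
    have eh: "chain_lin R ?P C (\<lambda>n x. e n (h n x))" by (rule chain_lin_comp[OF h(1) e])
    have eq: "e n (h n x) = f n x" if x: "x \<in> carrier (P n)" for n x
    proof (rule uniq[OF _ fl _ _ x])
      show "lin R (P n) (cmod C n) (\<lambda>x. e n (h n x))" using chain_linD(1)[OF eh, of n] by simp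
      show inl: "e n (h n (\<eta> n (Inl a))) = f n (\<eta> n (Inl a))" if "a \<in> carrier (cmod Q n)" for n a
        using h(2) u that by simp
      show "e n (h n (\<eta> n (Inr b))) = f n (\<eta> n (Inr b))" if b: "b \<in> carrier (cmod Q (n + 1))" for b
      proof -
        have "\<eta> n (Inr b) = cdiff ?P (n + 1) (\<eta> (n + 1) (Inl b))" using dl[OF b] \<eta>(1)[OF b] by simp
        then show ?thesis
          using chain_linD(2)[OF eh, of "\<eta> (n + 1) (Inl b)" "n + 1"] chain_linD(2)[OF f, of "\<eta> (n + 1) (Inl b)" "n + 1"]
            inl[OF b] \<eta>(1)[OF b] by simp
      qed
    qed
    show "\<exists>g \<in> Hom (Complexes R) ?P B. Comp (Complexes R) ?P e g = f"
    proof (rule bexI)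
      have "Comp (Complexes R) ?P e (\<lambda>n. restrict (h n) (carrier (cmod ?P n))) = (\<lambda>n. restrict (f n) (carrier (cmod ?P n)))"
        using eq by (auto intro!: ext restrict_ext)
      then show "Comp (Complexes R) ?P e (\<lambda>n. restrict (h n) (carrier (cmod ?P n))) = f"
        using chain_map_restrict[of f ?P C] ef by simp
      show "(\<lambda>n. restrict (h n) (carrier (cmod ?P n))) \<in> Hom (Complexes R) ?P B"
        using chain_lin_map[OF h(1) P] by simp
    qed
  qed
  moreover from extend[OF Q, of "\<lambda>n a. a"] obtain e where e: "chain_lin R ?P Q e"
    "\<forall>n. \<forall>a \<in> carrier (cmod Q n). e n (\<eta> n (Inl a)) = a" by auto
  have eH: "(\<lambda>n. restrict (e n) (carrier (cmod ?P n))) \<in> chain_map R ?P Q" by (rule chain_lin_map[OF e(1) P])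
  moreover have "restrict (e n) (carrier (cmod ?P n)) ` carrier (cmod ?P n) = carrier (cmod Q n)" for n
  proof
    show "carrier (cmod Q n) \<subseteq> restrict (e n) (carrier (cmod ?P n)) ` carrier (cmod ?P n)"
    proof
      fix a assume a: "a \<in> carrier (cmod Q n)"
      then show "a \<in> restrict (e n) (carrier (cmod ?P n)) ` carrier (cmod ?P n)"
        using e(2) \<eta>(1)[OF a] by (intro image_eqI[of _ _ "\<eta> n (Inl a)"]) auto
    qed
  qed (use lin_on_simps(1)[OF chain_linD(1)[OF e(1)]] in auto)
  ultimately show ?thesis
    using Complexes_surj_epic[OF eH] Complexes_is_kernel[OF P Q eH refl] by blast
qed

text \<open>The equations among morphisms are inherited from \<open>R_Mod R\<close> in each degree;
  the differentials matter where sums, negatives and composites have to be chain maps again.\<close>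

lemma Complexes_preadditive:
  "preadditive_category (Complexes R :: (('r, 'm) mod_complex, int \<Rightarrow> 'm \<Rightarrow> 'm) preadditive)"
proof (rule preadditive_category.intro)
  interpret R: preadditive_category "R_Mod R :: (('r, 'm) module, 'm \<Rightarrow> 'm) preadditive"
    by (rule R_Mod_preadditive)
  have ob: "cmod A n \<in> Obj (R_Mod R)" if "A \<in> Obj (Complexes R)" for A :: "('r, 'm) mod_complex" and n
    using that is_complexD(1) by simp
  have hm: "f n \<in> Hom (R_Mod R) (cmod A n) (cmod B n)" if "f \<in> Hom (Complexes R) A B"
    for A B :: "('r, 'm) mod_complex" and f n
    using that chain_map_mod_hom by simp
  fix A B C D :: "('r, 'm) mod_complex" and f g h
  assume A: "A \<in> Obj (Complexes R)"
  show "\<exists>P e N k. projective_obj (Complexes R) P \<and> epic (Complexes R) P A e \<and> is_kernel (Complexes R) P A e N k"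
    by (rule Complexes_enough_projectives) (use A in simp)
  assume B: "B \<in> Obj (Complexes R)"
  have cA: "is_complex R A" and cB: "is_complex R B" using A B by auto
  note lin = chain_map_lin[OF _ cA cB]
  note lmB = ObjD(1)[OF is_complexD(1)[OF cB]] and dB = is_complexD(2)[OF cB]
  have zero: "Zero (Complexes R) A B \<in> Hom (Complexes R) A B"
    using chain_lin_map[OF chain_lin_zero[OF cA cB] cA] by simp
  show "Zero (Complexes R) A B \<in> Hom (Complexes R) A B" by (rule zero)
  let ?G = "hom_group (Complexes R) A B" and ?Gn = "\<lambda>n. hom_group (R_Mod R) (cmod A n) (cmod B n)"
  have Gn: "comm_group (?Gn n)" for n by (rule R.hom_comm_group[OF ob[OF A] ob[OF B]])
  have mult: "(x \<otimes>\<^bsub>?G\<^esub> y) n = x n \<otimes>\<^bsub>?Gn n\<^esub> y n" and one: "\<one>\<^bsub>?G\<^esub> n = \<one>\<^bsub>?Gn n\<^esub>" for x y n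
    by (simp_all add: hom_group_def)
  have car: "x n \<in> carrier (?Gn n)" if "x \<in> carrier ?G" for x n
    using that chain_map_mod_hom by (simp add: hom_group_def)
  show "comm_group (hom_group (Complexes R) A B)"
  proof (rule comm_groupI)
    fix x y assume x: "x \<in> carrier ?G" and y: "y \<in> carrier ?G"
    have lx: "chain_lin R A B x" and ly: "chain_lin R A B y" using x y lin by (auto simp: hom_group_def)
    note xc = lin_on_simps(1)[OF chain_linD(1)[OF lx]] and yc = lin_on_simps(1)[OF chain_linD(1)[OF ly]]
    have "chain_lin R A B (\<lambda>n a. x n a \<oplus>\<^bsub>cmod B n\<^esub> y n a)"
      unfolding chain_lin_def
      using lin_on_add[OF chain_linD(1)[OF lx] chain_linD(1)[OF ly]] lin_on_simps(2)[OF dB] xc yc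
        chain_linD(2)[OF lx] chain_linD(2)[OF ly] by simp
    then show "x \<otimes>\<^bsub>?G\<^esub> y \<in> carrier ?G" using chain_lin_map[OF _ cA] by (simp add: hom_group_def)
    show "x \<otimes>\<^bsub>?G\<^esub> y = y \<otimes>\<^bsub>?G\<^esub> x"
      by (rule ext) (simp only: mult comm_monoid.m_comm[OF comm_group.axioms(1)[OF Gn] car[OF x] car[OF y]])
    fix z assume z: "z \<in> carrier ?G"
    show "x \<otimes>\<^bsub>?G\<^esub> y \<otimes>\<^bsub>?G\<^esub> z = x \<otimes>\<^bsub>?G\<^esub> (y \<otimes>\<^bsub>?G\<^esub> z)"
      by (rule ext) (simp only: mult monoid.m_assoc[OF comm_monoid.axioms(1)[OF comm_group.axioms(1)[OF Gn]]
          car[OF x] car[OF y] car[OF z]])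
  next
    show "\<one>\<^bsub>?G\<^esub> \<in> carrier ?G" using zero by (simp add: hom_group_def)
    fix x assume x: "x \<in> carrier ?G"
    show "\<one>\<^bsub>?G\<^esub> \<otimes>\<^bsub>?G\<^esub> x = x"
      by (rule ext) (simp only: mult one monoid.l_one[OF comm_monoid.axioms(1)[OF comm_group.axioms(1)[OF Gn]] car[OF x]])
    have lx: "chain_lin R A B x" using x lin by (auto simp: hom_group_def)
    note xc = lin_on_simps(1)[OF chain_linD(1)[OF lx]]
    let ?y = "\<lambda>n a. \<ominus>\<^bsub>cmod B n\<^esub> x n a"
    have "chain_lin R A B (\<lambda>n a. \<zero>\<^bsub>cmod B n\<^esub> \<ominus>\<^bsub>cmod B n\<^esub> x n a)"
      unfolding chain_lin_def
      using lin_on_minus[OF chain_linD(1)[OF chain_lin_zero[OF cA cB]] chain_linD(1)[OF lx]]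
        lin_on_simps(6)[OF dB left_module_simps(2)[OF lmB]] xc complex_zero[OF cB]
        chain_linD(2)[OF lx] by simp
    then have "(\<lambda>n. \<lambda>a\<in>carrier (cmod A n). \<zero>\<^bsub>cmod B n\<^esub> \<ominus>\<^bsub>cmod B n\<^esub> x n a) \<in> carrier ?G" (is "?y \<in> _")
      using chain_lin_map[OF _ cA] by (simp add: hom_group_def)
    moreover have "?y \<otimes>\<^bsub>?G\<^esub> x = \<one>\<^bsub>?G\<^esub>"
    proof -
      have "(\<zero>\<^bsub>cmod B n\<^esub> \<ominus>\<^bsub>cmod B n\<^esub> x n a) \<oplus>\<^bsub>cmod B n\<^esub> x n a = \<zero>\<^bsub>cmod B n\<^esub>"
        if "a \<in> carrier (cmod A n)" for n a
        using xc[OF that] left_module_simps(2,3,7,9,16)[OF lmB] by simp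
      then show ?thesis by (auto simp: hom_group_def intro!: ext restrict_ext)
    qed
    ultimately show "\<exists>y \<in> carrier ?G. y \<otimes>\<^bsub>?G\<^esub> x = \<one>\<^bsub>?G\<^esub>" by blast
  qed
  assume C: "C \<in> Obj (Complexes R)"
  have cC: "is_complex R C" using C by simp
  show "Comp (Complexes R) A g (Zero (Complexes R) A B) = Zero (Complexes R) A C" if "g \<in> Hom (Complexes R) B C"
    unfolding Complexes_simps by (rule ext) (rule R.comp_zero_right[OF ob[OF A] ob[OF B] ob[OF C] hm[OF that]])
  assume f: "f \<in> Hom (Complexes R) A B"
  show "Comp (Complexes R) A (Zero (Complexes R) B C) f = Zero (Complexes R) A C"
    unfolding Complexes_simps by (rule ext) (rule R.comp_zero_left[OF ob[OF A] ob[OF B] ob[OF C] hm[OF f]])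
  assume g: "g \<in> Hom (Complexes R) B C"
  have "chain_lin R A C (\<lambda>n x. g n (f n x))"
    by (rule chain_lin_comp[OF lin chain_map_lin[OF _ cB cC]]) (use f g in auto)
  then show "Comp (Complexes R) A g f \<in> Hom (Complexes R) A C" using chain_lin_map[OF _ cA] by simp
  show "Comp (Complexes R) A (Plus (Complexes R) B C g h) f =
      Plus (Complexes R) A C (Comp (Complexes R) A g f) (Comp (Complexes R) A h f)"
    if "h \<in> Hom (Complexes R) B C"
    unfolding Complexes_simps
    by (rule ext) (rule R.comp_add[OF ob[OF A] ob[OF B] ob[OF C] hm[OF f] hm[OF g] hm[OF that]])
  assume D: "D \<in> Obj (Complexes R)" and h: "h \<in> Hom (Complexes R) C D"
  show "Comp (Complexes R) A (Comp (Complexes R) B h g) f = Comp (Complexes R) A h (Comp (Complexes R) A g f)"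
    unfolding Complexes_simps
    by (rule ext) (rule R.comp_assoc[OF ob[OF A] ob[OF B] ob[OF C] ob[OF D] hm[OF f] hm[OF g] hm[OF h]])
qed

text \<open>A cocycle on \<open>P 1\<close> vanishes on the kernel of \<open>d 0\<close> and so
  descends to the image of \<open>d 0\<close>, which is the kernel of the augmentation
  \<open>P 0 \<rightarrow> Q\<close>. An extension of the descended map to \<open>P 0\<close>
  exhibits the cocycle as a coboundary.\<close>

lemma Ext1_of_complex_extends:
  fixes Q B :: "('r, 'm) mod_complex"
  assumes Q: "is_complex R Q" and B: "is_complex R B" and ext: "complex_extends R Q B"
  shows "trivial_group (Ext1 (Complexes R) Q B)"
proof -
  interpret preadditive_category "Complexes R :: (('r, 'm) mod_complex, int \<Rightarrow> 'm \<Rightarrow> 'm) preadditive"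
    by (rule Complexes_preadditive)
  have QO: "Q \<in> Obj (Complexes R)" and BO: "B \<in> Obj (Complexes R)" using Q B by auto
  obtain P d e where res: "projective_resolution (Complexes R) Q P d e"
    and iff: "trivial_group (Ext1 (Complexes R) Q B) \<longleftrightarrow>
      hom_cocycles1 (Complexes R) P d B \<subseteq> hom_coboundaries1 (Complexes R) P d B"
    using Ext1_trivial_iff[OF QO BO] by (elim exE conjE)
  have P: "is_complex R (P i)" for i
    using res by (simp add: projective_resolution_def projective_obj_def)
  have epi: "epic (Complexes R) (P 0) Q e" and ex0: "exact_at (Complexes R) (P (Suc 0)) (d 0) (P 0) e Q"
    and ex1: "exact_at (Complexes R) (P (Suc (Suc 0))) (d (Suc 0)) (P (Suc 0)) (d 0) (P 0)"
    using res by (auto simp: projective_resolution_def)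
  have e: "chain_lin R (P 0) Q e" and d0: "chain_lin R (P (Suc 0)) (P 0) (d 0)"
    using ex0 chain_map_lin[OF _ P Q] chain_map_lin[OF _ P P] by (auto simp: exact_at_def)
  have im: "d 0 n ` carrier (cmod (P (Suc 0)) n) = {x \<in> carrier (cmod (P 0) n). e n x = \<zero>\<^bsub>cmod Q n\<^esub>}" for n
    by (rule Complexes_exact[OF P P Q ex0])
  have im1: "d (Suc 0) n ` carrier (cmod (P (Suc (Suc 0))) n) =
      {x \<in> carrier (cmod (P (Suc 0)) n). d 0 n x = \<zero>\<^bsub>cmod (P 0) n\<^esub>}" for n
    by (rule Complexes_exact[OF P P P ex1])
  have "hom_cocycles1 (Complexes R) P d B \<subseteq> hom_coboundaries1 (Complexes R) P d B"
  proof
    fix g assume "g \<in> hom_cocycles1 (Complexes R) P d B"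
    then have gH: "g \<in> chain_map R (P (Suc 0)) B"
      and z: "Comp (Complexes R) (P (Suc (Suc 0))) g (d (Suc 0)) = Zero (Complexes R) (P (Suc (Suc 0))) B"
      by (auto simp: hom_cocycles1_def numeral_2_eq_2)
    have g: "chain_lin R (P (Suc 0)) B g" by (rule chain_map_lin[OF gH P B])
    have g0: "g n x = \<zero>\<^bsub>cmod B n\<^esub>" if "x \<in> carrier (cmod (P (Suc 0)) n)" "d 0 n x = \<zero>\<^bsub>cmod (P 0) n\<^esub>" for n x
    proof -
      have "x \<in> d (Suc 0) n ` carrier (cmod (P (Suc (Suc 0))) n)" using im1 that by simp
      then obtain y where y: "y \<in> carrier (cmod (P (Suc (Suc 0))) n)" "x = d (Suc 0) n y" by blast
      then show ?thesis using fun_cong[OF fun_cong[OF z, of n], of y] by simp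
    qed
    have "\<forall>n. \<exists>k. lin_on R (cmod (P 0) n) (d 0 n ` carrier (cmod (P (Suc 0)) n)) (cmod B n) k \<and>
        (\<forall>x \<in> carrier (cmod (P (Suc 0)) n). k (d 0 n x) = g n x)"
      by (rule allI, rule lin_on_factor[OF chain_linD(1)[OF d0] chain_linD(1)[OF g] g0])
    from choice[OF this] obtain f where
      f: "\<forall>n. lin_on R (cmod (P 0) n) (d 0 n ` carrier (cmod (P (Suc 0)) n)) (cmod B n) (f n) \<and>
        (\<forall>x \<in> carrier (cmod (P (Suc 0)) n). f n (d 0 n x) = g n x)" ..
    have chain: "chain_on R (P 0) (\<lambda>n. {x \<in> carrier (cmod (P 0) n). e n x = \<zero>\<^bsub>cmod Q n\<^esub>}) B f"
      unfolding im[symmetric] chain_on_def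
    proof (intro conjI allI ballI)
      fix n x assume "x \<in> d 0 n ` carrier (cmod (P (Suc 0)) n)"
      then obtain y where y: "y \<in> carrier (cmod (P (Suc 0)) n)" "x = d 0 n y" by blast
      have "cdiff (P (Suc 0)) n y \<in> carrier (cmod (P (Suc 0)) (n - 1))"
        by (rule lin_on_simps(1)[OF is_complexD(2)[OF P] y(1)])
      then show "cdiff B n (f n x) = f (n - 1) (cdiff (P 0) n x)"
        using f y chain_linD(2)[OF g y(1)] chain_linD(2)[OF d0 y(1)] by simp
    qed (use f in blast)
    have surj: "\<forall>n. e n ` carrier (cmod (P 0) n) = carrier (cmod Q n)"
      by (rule allI) (rule Complexes_epic_surj[OF P Q epi])
    from ext[unfolded complex_extends_def, THEN spec, THEN spec, THEN spec, THEN mp,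
        OF conjI[OF P conjI[OF e conjI[OF surj chain]]]]
    obtain F where F: "chain_lin R (P 0) B F"
      "\<forall>n. \<forall>x \<in> carrier (cmod (P 0) n). e n x = \<zero>\<^bsub>cmod Q n\<^esub> \<longrightarrow> F n x = f n x"
      by (elim exE conjE)
    let ?F = "\<lambda>n. restrict (F n) (carrier (cmod (P 0) n))"
    have "Comp (Complexes R) (P (Suc 0)) ?F (d 0) = (\<lambda>n. restrict (g n) (carrier (cmod (P (Suc 0)) n)))"
    proof
      fix n
      have "F n (d 0 n x) = g n x" "d 0 n x \<in> carrier (cmod (P 0) n)"
        if x: "x \<in> carrier (cmod (P (Suc 0)) n)" for x
      proof -
        have "d 0 n x \<in> {x \<in> carrier (cmod (P 0) n). e n x = \<zero>\<^bsub>cmod Q n\<^esub>}" using im x by blast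
        then show "F n (d 0 n x) = g n x" "d 0 n x \<in> carrier (cmod (P 0) n)" using F(2) f x by simp_all
      qed
      then show "Comp (Complexes R) (P (Suc 0)) ?F (d 0) n = restrict (g n) (carrier (cmod (P (Suc 0)) n))"
        by (auto intro!: restrict_ext)
    qed
    then have "g = Comp (Complexes R) (P 1) ?F (d 0)"
      using chain_map_restrict[OF gH] by simp
    moreover have "?F \<in> Hom (Complexes R) (P 0) B" using chain_lin_map[OF F(1) P] by simp
    ultimately show "g \<in> hom_coboundaries1 (Complexes R) P d B"
      unfolding hom_coboundaries1_def by blast
  qed
  then show ?thesis using iff by blast
qed

end

section \<open>Exact complexes\<close>

context ring_universe begin

text \<open>Let \<open>W\<close> be the preimage of the cycles of \<open>A\<close> in \<open>M\<close>. Lift \<open>f\<close> first to \<open>\<phi>\<close> on \<open>W\<close> with \<open>d \<phi> = f d\<close>, then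
  \<open>\<phi>\<close> to \<open>F\<close> on \<open>M\<close> with \<open>d F = \<phi> d\<close>. Since \<open>d\<close> maps \<open>M\<close> into \<open>W\<close>, the degrees can be treated independently.\<close>

lemma complex_extends_exact:
  fixes A B :: "('r, 'm) mod_complex"
  assumes A: "is_complex R A" "exact_complex A" and B: "is_complex R B" "exact_complex B"
    and ext: "\<And>n k. extends R (cycles A n) (cycles B k)"
  shows "complex_extends R A B"
  unfolding complex_extends_def
proof (intro allI impI, elim conjE)
  fix M :: "('r, 'm) mod_complex" and p f
  let ?K = "\<lambda>n. {x \<in> carrier (cmod M n). p n x = \<zero>\<^bsub>cmod A n\<^esub>}"
  assume M: "is_complex R M" and p: "chain_lin R M A p"
    and surj: "\<forall>n. p n ` carrier (cmod M n) = carrier (cmod A n)" and f: "chain_on R M ?K B f"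
  note pl = chain_linD(1)[OF p] and pd = chain_linD(2)[OF p]
  note fl = chain_onD(1)[OF f] and fd = chain_onD(2)[OF f]
  note dM = is_complexD(2)[OF M] and dB = is_complexD(2)[OF B(1)] and dA = is_complexD(2)[OF A(1)]
  note dMc = lin_on_simps(1)[OF dM] and pc = lin_on_simps(1)[OF pl]
  define W where "W n = {x \<in> carrier (cmod M n). p n x \<in> carrier (cycles A n)}" for n
  have cyc: "carrier (cycles C n) = {x \<in> carrier (cmod C n). cdiff C n x = \<zero>\<^bsub>cmod C (n - 1)\<^esub>}"
    for C :: "('r, 'm) mod_complex" and n by (simp add: cycles_def)
  have cycA: "submod R (cmod A n) (carrier (cycles A n))" for n
    unfolding cyc by (rule submod_kernel[OF dA])
  have W: "submod R (cmod M n) (W n)" for n unfolding W_def by (rule submod_vimage[OF pl cycA])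
  have WM: "W n \<subseteq> carrier (cmod M n)" for n by (auto simp: W_def)
  have exB: "b \<in> cdiff B n ` carrier (cmod B n)"
    if "b \<in> carrier (cmod B (n - 1))" "cdiff B (n - 1) b = \<zero>\<^bsub>cmod B (n - 2)\<^esub>" for b n
    using B(2)[unfolded exact_complex_def, rule_format, of "n - 1"] that by (auto simp: cyc)
  have dW: "cdiff M n x \<in> ?K (n - 1)" if "x \<in> W n" for n x
    using that pd[of x n] dMc[of x n] by (simp add: W_def cyc)
  have dWM: "cdiff M n x \<in> W (n - 1)" if x: "x \<in> carrier (cmod M n)" for n x
    using pd[OF x, symmetric] dMc[OF x] pc[OF x] lin_on_simps(1)[OF dA] is_complexD(3)[OF A(1)]
    by (simp add: W_def cyc)
  have "\<forall>n. \<exists>\<phi>. lin_on R (cmod M n) (W n) (cmod B n) \<phi> \<and>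
      (\<forall>x \<in> W n. p n x = \<zero>\<^bsub>cycles A n\<^esub> \<longrightarrow> \<phi> x = f n x) \<and>
      (\<forall>x \<in> W n. cdiff B n (\<phi> x) = f (n - 1) (cdiff M n x))"
  proof (rule allI, rule extends_lift[OF _ is_complexD(1)[OF M] is_complexD(1)[OF B(1)] _ _ dB])
    fix n
    show "extends R (cycles A n) ((cmod B n)\<lparr>carrier := {b \<in> carrier (cmod B n). cdiff B n b = \<zero>\<^bsub>cmod B (n - 1)\<^esub>}\<rparr>)"
      using ext[of n n] by (simp add: cycles_def)
    have pW: "lin_on R (cmod M n) (W n) (cmod A n) (p n)" by (rule lin_on_subset[OF pl W WM])
    have "p n ` W n = carrier (cycles A n)"
    proof
      show "carrier (cycles A n) \<subseteq> p n ` W n"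
      proof
        fix a assume a: "a \<in> carrier (cycles A n)"
        then have "a \<in> p n ` carrier (cmod M n)" using surj by (simp add: cyc)
        then show "a \<in> p n ` W n" using a by (auto simp: W_def)
      qed
    qed (auto simp: W_def)
    then show "lin_on R (cmod M n) (W n) (cycles A n) (p n)" and "p n ` W n = carrier (cycles A n)"
      using pW lin_on_submod_target[OF ObjD(1)[OF is_complexD(1)[OF A(1)]] cycA, of "cmod M n" "W n" n "p n"]
      by (simp_all add: cycles_def)
    have dMW: "lin_on R (cmod M n) (W n) (cmod M (n - 1)) (cdiff M n)" by (rule lin_on_subset[OF dM W WM])
    show "lin_on R (cmod M n) (W n) (cmod B (n - 1)) (\<lambda>x. f (n - 1) (cdiff M n x))"
      by (rule lin_on_comp[OF dMW fl]) (use dW in blast)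
    \<comment> \<open>The value is a cycle because the square of the differential of
      \<open>M\<close> is zero; exactness of \<open>B\<close> makes it a boundary, so that a lift
      exists elementwise.\<close>
    show "(\<lambda>x. f (n - 1) (cdiff M n x)) ` W n \<subseteq> cdiff B n ` carrier (cmod B n)"
    proof clarify
      fix x assume x: "x \<in> W n"
      have "cdiff B (n - 1) (f (n - 1) (cdiff M n x)) = f (n - 1 - 1) (cdiff M (n - 1) (cdiff M n x))"
        using fd[OF dW[OF x]] .
      also have "\<dots> = \<zero>\<^bsub>cmod B (n - 2)\<^esub>"
        using is_complexD(3)[OF M subsetD[OF WM x]] lin_on_simps(4)[OF fl, of "n - 2"] by simp
      finally show "f (n - 1) (cdiff M n x) \<in> cdiff B n ` carrier (cmod B n)"
        by (intro exB lin_on_simps(1)[OF fl dW[OF x]])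
    qed
    \<comment> \<open>Zero is a cycle, so \<open>W n\<close> contains the whole kernel of
      \<open>p n\<close>.\<close>
    have KW: "{x \<in> W n. p n x = \<zero>\<^bsub>cycles A n\<^esub>} = ?K n"
      using left_module_simps(2)[OF ObjD(1)[OF is_complexD(1)[OF A(1)]]] complex_zero[OF A(1)]
      by (auto simp: W_def cyc) (auto simp: cycles_def)
    show "lin_on R (cmod M n) {x \<in> W n. p n x = \<zero>\<^bsub>cycles A n\<^esub>} (cmod B n) (f n)"
      unfolding KW by (rule fl)
    show "cdiff B n (f n x) = f (n - 1) (cdiff M n x)" if "x \<in> W n" "p n x = \<zero>\<^bsub>cycles A n\<^esub>" for x
      by (rule fd) (use that KW in blast)
  qed
  from choice[OF this] obtain \<phi> where \<phi>: "\<forall>n. lin_on R (cmod M n) (W n) (cmod B n) (\<phi> n) \<and>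
      (\<forall>x \<in> W n. p n x = \<zero>\<^bsub>cycles A n\<^esub> \<longrightarrow> \<phi> n x = f n x) \<and>
      (\<forall>x \<in> W n. cdiff B n (\<phi> n x) = f (n - 1) (cdiff M n x))" ..
  then have \<phi>l: "lin_on R (cmod M n) (W n) (cmod B n) (\<phi> n)" for n by blast
  have KW: "x \<in> W n" if "x \<in> ?K n" for n x
    using that left_module_simps(2)[OF ObjD(1)[OF is_complexD(1)[OF A(1)]]] complex_zero[OF A(1)]
    by (simp add: W_def cyc)
  have \<phi>f: "\<phi> n x = f n x" if "x \<in> ?K n" for n x
    using \<phi> KW[OF that] that by (auto simp: cycles_def)
  have \<phi>d: "cdiff B n (\<phi> n x) = f (n - 1) (cdiff M n x)" if "x \<in> W n" for n x
    using \<phi> that by blast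
  have ker: "{x \<in> carrier (cmod M n). cdiff A n (p n x) = \<zero>\<^bsub>cycles A (n - 1)\<^esub>} = W n" for n
    using pc by (auto simp: W_def cyc) (auto simp: cycles_def)
  \<comment> \<open>The second lift is taken relative to \<open>M \<rightarrow> A\<close>, followed
    by the differential of \<open>A\<close>. By exactness of \<open>A\<close> this is onto the
    cycles of degree \<open>n - 1\<close>, and its kernel is \<open>W n\<close>, where
    \<open>\<phi> n\<close> prescribes the lift.\<close>
  have "\<forall>n. \<exists>F. lin R (cmod M n) (cmod B n) F \<and>
      (\<forall>x \<in> carrier (cmod M n). cdiff A n (p n x) = \<zero>\<^bsub>cycles A (n - 1)\<^esub> \<longrightarrow> F x = \<phi> n x) \<and>
      (\<forall>x \<in> carrier (cmod M n). cdiff B n (F x) = \<phi> (n - 1) (cdiff M n x))"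
  proof (rule allI, rule extends_lift[OF _ is_complexD(1)[OF M] is_complexD(1)[OF B(1)] _ _ dB])
    fix n
    show "extends R (cycles A (n - 1)) ((cmod B n)\<lparr>carrier := {b \<in> carrier (cmod B n). cdiff B n b = \<zero>\<^bsub>cmod B (n - 1)\<^esub>}\<rparr>)"
      using ext[of "n - 1" n] by (simp add: cycles_def)
    have "(\<lambda>x. cdiff A n (p n x)) ` carrier (cmod M n) = cdiff A n ` carrier (cmod A n)"
      unfolding surj[rule_format, symmetric] by (simp add: image_image)
    also have "\<dots> = carrier (cycles A (n - 1))"
      using A(2)[unfolded exact_complex_def, rule_format, of "n - 1"] by simp
    finally show *: "(\<lambda>x. cdiff A n (p n x)) ` carrier (cmod M n) = carrier (cycles A (n - 1))" .
    have "lin R (cmod M n) (cmod A (n - 1)) (\<lambda>x. cdiff A n (p n x))"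
      by (rule lin_on_comp[OF pl dA]) (use pc in blast)
    then show "lin R (cmod M n) (cycles A (n - 1)) (\<lambda>x. cdiff A n (p n x))"
      using * lin_on_submod_target[OF ObjD(1)[OF is_complexD(1)[OF A(1)]] cycA, of "cmod M n" "carrier (cmod M n)" "n - 1"]
      by (simp add: cycles_def)
    show "lin R (cmod M n) (cmod B (n - 1)) (\<lambda>x. \<phi> (n - 1) (cdiff M n x))"
      by (rule lin_on_comp[OF dM \<phi>l]) (use dWM in blast)
    show "(\<lambda>x. \<phi> (n - 1) (cdiff M n x)) ` carrier (cmod M n) \<subseteq> cdiff B n ` carrier (cmod B n)"
    proof clarify
      fix x assume x: "x \<in> carrier (cmod M n)"
      have "cdiff B (n - 1) (\<phi> (n - 1) (cdiff M n x)) = f (n - 1 - 1) (cdiff M (n - 1) (cdiff M n x))"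
        using \<phi>d[OF dWM[OF x]] .
      also have "\<dots> = \<zero>\<^bsub>cmod B (n - 2)\<^esub>"
        using is_complexD(3)[OF M x] lin_on_simps(4)[OF fl, of "n - 2"] by simp
      finally show "\<phi> (n - 1) (cdiff M n x) \<in> cdiff B n ` carrier (cmod B n)"
        by (intro exB lin_on_simps(1)[OF \<phi>l dWM[OF x]])
    qed
    show "lin_on R (cmod M n) {x \<in> carrier (cmod M n). cdiff A n (p n x) = \<zero>\<^bsub>cycles A (n - 1)\<^esub>} (cmod B n) (\<phi> n)"
      unfolding ker by (rule \<phi>l)
    fix x assume "x \<in> carrier (cmod M n)" "cdiff A n (p n x) = \<zero>\<^bsub>cycles A (n - 1)\<^esub>"
    then have x: "x \<in> W n" using ker by blast
    \<comment> \<open>The two prescriptions are compatible: on \<open>W n\<close> the differential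
      of \<open>M\<close> lands in the kernel of \<open>p\<close>, and there
      \<open>\<phi> (n - 1)\<close> is \<open>f (n - 1)\<close>.\<close>
    show "cdiff B n (\<phi> n x) = \<phi> (n - 1) (cdiff M n x)" using \<phi>d[OF x] \<phi>f[OF dW[OF x]] by simp
  qed
  from choice[OF this] obtain F where F: "\<forall>n. lin R (cmod M n) (cmod B n) (F n) \<and>
      (\<forall>x \<in> carrier (cmod M n). cdiff A n (p n x) = \<zero>\<^bsub>cycles A (n - 1)\<^esub> \<longrightarrow> F n x = \<phi> n x) \<and>
      (\<forall>x \<in> carrier (cmod M n). cdiff B n (F n x) = \<phi> (n - 1) (cdiff M n x))" ..
  have FW: "F n x = \<phi> n x" if "x \<in> W n" for n x
    using F that ker[of n] by blast
  have "chain_lin R M B F"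
    unfolding chain_lin_def
  proof (intro conjI allI ballI)
    fix n x assume x: "x \<in> carrier (cmod M n)"
    show "cdiff B n (F n x) = F (n - 1) (cdiff M n x)" using F x FW[OF dWM[OF x]] by simp
  qed (use F in blast)
  moreover have "F n x = f n x" if "x \<in> carrier (cmod M n)" "p n x = \<zero>\<^bsub>cmod A n\<^esub>" for n x
    using FW KW \<phi>f that by simp
  ultimately show "\<exists>F. chain_lin R M B F \<and> (\<forall>n. \<forall>x \<in> carrier (cmod M n). p n x = \<zero>\<^bsub>cmod A n\<^esub> \<longrightarrow> F n x = f n x)"
    by blast
qed

text \<open>The extension \<open>0 \<rightarrow> L \<rightarrow> Y \<rightarrow> L' \<rightarrow> 0\<close> below extends \<open>0 \<rightarrow> Z \<rightarrow> E \<rightarrow> d E \<rightarrow> 0\<close> along \<open>i\<close> and \<open>i'\<close>. Instead of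
  using \<open>Ext\<^sup>2\<close>, embed the pushout of \<open>L\<close> and \<open>E\<close> into some \<open>L1\<close> in the class; then \<open>Y\<close> is the pullback of
  \<open>L1 \<rightarrow> L1 / L\<close> along a map \<open>L' \<rightarrow> L1 / L\<close>.\<close>

lemma ex_extension_along:
  fixes E E' L L' :: "('r, 'm) module"
  assumes E: "E \<in> Obj (R_Mod R)" and L: "L \<in> \<L>" and L': "L' \<in> Obj (R_Mod R)" and \<L>: "\<L> \<subseteq> Obj (R_Mod R)"
    and emb: "\<And>M :: ('r, 'm) module. M \<in> Obj (R_Mod R) \<Longrightarrow> \<exists>L \<in> \<L>. \<exists>j. lin R M L j \<and> inj_on j (carrier M)"
    and coker: "\<And>A B v C c. A \<in> \<L> \<Longrightarrow> B \<in> \<L> \<Longrightarrow> lin R A B v \<Longrightarrow> inj_on v (carrier A) \<Longrightarrow>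
      C \<in> Obj (R_Mod R) \<Longrightarrow> lin R B C c \<Longrightarrow> c ` carrier B = carrier C \<Longrightarrow>
      (\<forall>x \<in> carrier B. c x = \<zero>\<^bsub>C\<^esub> \<longleftrightarrow> x \<in> v ` carrier A) \<Longrightarrow> C \<in> \<L>"
    and d: "lin R E E' d"
    and i: "lin_on R E {x \<in> carrier E. d x = \<zero>\<^bsub>E'\<^esub>} L i" "inj_on i {x \<in> carrier E. d x = \<zero>\<^bsub>E'\<^esub>}"
    and i': "lin_on R E' (d ` carrier E) L' i'"
    and ext: "\<And>G g. G \<in> \<L> \<Longrightarrow> lin_on R E' (d ` carrier E) G g \<Longrightarrow>
      \<exists>\<gamma>. lin R L' G \<gamma> \<and> (\<forall>z \<in> d ` carrier E. \<gamma> (i' z) = g z)"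
  shows "\<exists>(Y :: ('r, 'm) module) l \<pi> j. Y \<in> Obj (R_Mod R) \<and> lin R L Y l \<and> inj_on l (carrier L) \<and>
    lin R Y L' \<pi> \<and> \<pi> ` carrier Y = carrier L' \<and>
    (\<forall>y \<in> carrier Y. \<pi> y = \<zero>\<^bsub>L'\<^esub> \<longleftrightarrow> y \<in> l ` carrier L) \<and> lin R E Y j \<and> inj_on j (carrier E) \<and>
    (\<forall>x \<in> carrier E. d x = \<zero>\<^bsub>E'\<^esub> \<longrightarrow> l (i x) = j x) \<and> (\<forall>x \<in> carrier E. \<pi> (j x) = i' (d x))"
proof -
  let ?Z = "{x \<in> carrier E. d x = \<zero>\<^bsub>E'\<^esub>}"
  have LO: "L \<in> Obj (R_Mod R)" using L \<L> by blast
  note lmE = ObjD(1)[OF E] and lmL = ObjD(1)[OF LO] and lmL' = ObjD(1)[OF L']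
  note sE = left_module_simps[OF lmE] and sL = left_module_simps[OF lmL]
  have Z: "submod R E ?Z" by (rule submod_kernel[OF d])
  have LE: "left_module R (pmod L E)" by (rule left_module_pmod[OF lmL lmE])
  \<comment> \<open>The quotient of \<open>pmod L E\<close> by all pairs \<open>(i z, - z)\<close>
    is the pushout of \<open>L\<close> and \<open>E\<close> over the kernel of \<open>d\<close>.
    Injectivity of \<open>i\<close> keeps \<open>E\<close> embedded in it.\<close>
  define \<tau> where "\<tau> z = (i z, \<zero>\<^bsub>E\<^esub> \<ominus>\<^bsub>E\<^esub> z)" for z
  have \<tau>: "lin_on R E ?Z (pmod L E) \<tau>"
    unfolding \<tau>_def by (intro lin_on_Pair i lin_on_minus lin_on_zero lin_on_id lmE Z)
  have \<tau>S: "submod R (pmod L E) (\<tau> ` ?Z)" by (rule submod_image[OF \<tau> Z]) simp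
  have "fits U (carrier (pmod L E))" using fits_Times[OF ObjD(2)[OF LO] ObjD(2)[OF E]] by simp
  from ex_quotient[OF LE this \<tau>S] obtain P :: "('r, 'm) module" and q where P: "P \<in> Obj (R_Mod R)"
    and q: "lin R (pmod L E) P q"
    and qk: "\<forall>x \<in> carrier (pmod L E). q x = \<zero>\<^bsub>P\<^esub> \<longleftrightarrow> x \<in> \<tau> ` ?Z" by (elim exE conjE)
  obtain L1 j1 where L1: "L1 \<in> \<L>" and j1: "lin R P L1 j1" "inj_on j1 (carrier P)" using emb[OF P] by blast
  have L1O: "L1 \<in> Obj (R_Mod R)" using L1 \<L> by blast
  have j1q: "lin R (pmod L E) L1 (\<lambda>x. j1 (q x))"
    by (rule lin_on_comp[OF q j1(1)]) (use lin_on_simps(1)[OF q] in auto)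
  have j1q0: "x \<in> \<tau> ` ?Z" if "x \<in> carrier (pmod L E)" "j1 (q x) = \<zero>\<^bsub>L1\<^esub>" for x
  proof -
    have "q x = \<zero>\<^bsub>P\<^esub>"
      using that lin_on_simps(1)[OF q that(1)] lin_on_simps(4)[OF j1(1)] left_module_simps(2)[OF ObjD(1)[OF P]]
        inj_onD[OF j1(2)] by metis
    then show ?thesis using qk that(1) by blast
  qed
  define v where "v l = j1 (q (l, \<zero>\<^bsub>E\<^esub>))" for l
  define j' where "j' x = j1 (q (\<zero>\<^bsub>L\<^esub>, x))" for x
  have v: "lin R L L1 v"
    unfolding v_def
    by (rule lin_on_comp[OF lin_on_Pair[OF lin_on_id lin_on_zero] j1q]) (use lmL lmE submod_carrier sE(2) in auto)
  have j': "lin R E L1 j'"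
    unfolding j'_def
    by (rule lin_on_comp[OF lin_on_Pair[OF lin_on_zero lin_on_id] j1q]) (use lmL lmE submod_carrier sL(2) in auto)
  have i0: "z = \<zero>\<^bsub>E\<^esub>" if "z \<in> ?Z" "i z = \<zero>\<^bsub>L\<^esub>" for z
    using inj_onD[OF i(2), of z "\<zero>\<^bsub>E\<^esub>"] that lin_on_simps(4)[OF i(1)] submod_simps(2)[OF lmE Z] by simp
  have vi: "v (i z) = j' z" if z: "z \<in> ?Z" for z
  proof -
    have c: "i z \<in> carrier L" "z \<in> carrier E" using lin_on_simps(1)[OF i(1) z] z by auto
    have m: "(i z, \<zero>\<^bsub>E\<^esub> \<ominus>\<^bsub>E\<^esub> z) \<in> carrier (pmod L E)" "(\<zero>\<^bsub>L\<^esub>, z) \<in> carrier (pmod L E)"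
      using c sE(2,4) sL(2) by auto
    have "q (i z, \<zero>\<^bsub>E\<^esub> \<ominus>\<^bsub>E\<^esub> z) = \<zero>\<^bsub>P\<^esub>" using qk m(1) z by (auto simp: \<tau>_def)
    moreover have "(i z, \<zero>\<^bsub>E\<^esub> \<ominus>\<^bsub>E\<^esub> z) \<oplus>\<^bsub>pmod L E\<^esub> (\<zero>\<^bsub>L\<^esub>, z) = (i z, \<zero>\<^bsub>E\<^esub>)"
      using c sE(2,3,7,9,16) sL(8) by simp
    ultimately have "q (i z, \<zero>\<^bsub>E\<^esub>) = \<zero>\<^bsub>P\<^esub> \<oplus>\<^bsub>P\<^esub> q (\<zero>\<^bsub>L\<^esub>, z)"
      using lin_on_simps(2)[OF q m] by simp
    then have "q (i z, \<zero>\<^bsub>E\<^esub>) = q (\<zero>\<^bsub>L\<^esub>, z)"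
      using left_module_simps(7)[OF ObjD(1)[OF P]] lin_on_simps(1)[OF q m(2)] by simp
    then show ?thesis by (simp add: v_def j'_def)
  qed
  have vinj: "inj_on v (carrier L)"
  proof (rule lin_on_inj[OF v])
    fix l assume l: "l \<in> carrier L" "v l = \<zero>\<^bsub>L1\<^esub>"
    then have "(l, \<zero>\<^bsub>E\<^esub>) \<in> \<tau> ` ?Z" using j1q0[of "(l, \<zero>\<^bsub>E\<^esub>)"] sE(2) by (simp add: v_def)
    then obtain z where z: "z \<in> ?Z" "l = i z" "\<zero>\<^bsub>E\<^esub> = \<zero>\<^bsub>E\<^esub> \<ominus>\<^bsub>E\<^esub> z" by (auto simp: \<tau>_def)
    have "\<zero>\<^bsub>E\<^esub> = z" using left_module_minus_eq_zero[OF lmE sE(2), of z] z(1,3) by simp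
    then show "l = \<zero>\<^bsub>L\<^esub>" using z(2) lin_on_simps(4)[OF i(1)] by simp
  qed
  have j'inj: "inj_on j' (carrier E)"
  proof (rule lin_on_inj[OF j'])
    fix x assume x: "x \<in> carrier E" "j' x = \<zero>\<^bsub>L1\<^esub>"
    then have "(\<zero>\<^bsub>L\<^esub>, x) \<in> \<tau> ` ?Z" using j1q0[of "(\<zero>\<^bsub>L\<^esub>, x)"] sL(2) by (simp add: j'_def)
    then obtain z where z: "z \<in> ?Z" "i z = \<zero>\<^bsub>L\<^esub>" "x = \<zero>\<^bsub>E\<^esub> \<ominus>\<^bsub>E\<^esub> z" by (auto simp: \<tau>_def)
    show "x = \<zero>\<^bsub>E\<^esub>"
      unfolding z(3) i0[OF z(1,2)] by (simp add: left_module_minus_eq_zero[OF lmE sE(2) sE(2)])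
  qed
  have vS: "submod R L1 (v ` carrier L)" by (rule submod_image[OF v submod_carrier[OF lmL]]) simp
  from ex_quotient[OF ObjD[OF L1O] vS] obtain G :: "('r, 'm) module" and c where G: "G \<in> Obj (R_Mod R)"
    and c: "lin R L1 G c" "c ` carrier L1 = carrier G"
    and ck: "\<forall>x \<in> carrier L1. c x = \<zero>\<^bsub>G\<^esub> \<longleftrightarrow> x \<in> v ` carrier L" by (elim exE conjE)
  \<comment> \<open>\<open>G\<close> is \<open>L1 / L\<close>. Its membership in the class is what
    permits a map from the boundaries \<open>d E\<close> to \<open>G\<close> to be extended to
    \<open>L'\<close> along \<open>i'\<close>.\<close>
  have G\<L>: "G \<in> \<L>" by (rule coker[OF L L1 v vinj G c ck])
  have cj: "lin R E G (\<lambda>x. c (j' x))"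
    by (rule lin_on_comp[OF j' c(1)]) (use lin_on_simps(1)[OF j'] in auto)
  \<comment> \<open>On the kernel of \<open>d\<close> the map \<open>j'\<close> is
    \<open>v \<circ> i\<close>, so its values lie in the copy of \<open>L\<close> that
    \<open>c\<close> kills. Hence \<open>c \<circ> j'\<close> descends to the boundaries.\<close>
  have "c (j' x) = \<zero>\<^bsub>G\<^esub>" if "x \<in> carrier E" "d x = \<zero>\<^bsub>E'\<^esub>" for x
  proof -
    have "j' x \<in> v ` carrier L" using vi[of x, symmetric] that lin_on_simps(1)[OF i(1), of x] by simp
    then show ?thesis using ck lin_on_simps(1)[OF j' that(1)] by blast
  qed
  from lin_on_factor[OF d cj this] obtain g where g: "lin_on R E' (d ` carrier E) G g"
    "\<forall>x \<in> carrier E. g (d x) = c (j' x)" by blast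
  from ext[OF G\<L> g(1)] obtain \<gamma> where \<gamma>: "lin R L' G \<gamma>" "\<forall>z \<in> d ` carrier E. \<gamma> (i' z) = g z" by blast
  have lmL1: "left_module R L1" by (rule ObjD(1)[OF L1O])
  have L1L': "left_module R (pmod L1 L')" by (rule left_module_pmod[OF lmL1 lmL'])
  note C = submod_carrier[OF L1L']
  \<comment> \<open>The pullback of \<open>c\<close> and \<open>\<gamma>\<close>. Over zero in
    \<open>L'\<close> it is the kernel of \<open>c\<close>, the copy of \<open>L\<close> in
    \<open>L1\<close>; and \<open>\<gamma> (i' (d x)) = c (j' x)\<close> places
    \<open>(j' x, i' (d x))\<close> in it, which embeds \<open>E\<close> because \<open>j'\<close>
    is injective.\<close>
  define D where "D = {x \<in> carrier (pmod L1 L'). c (fst x) \<ominus>\<^bsub>G\<^esub> \<gamma> (snd x) = \<zero>\<^bsub>G\<^esub>}"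
  have D: "submod R (pmod L1 L') D"
    unfolding D_def
    by (rule submod_kernel, rule lin_on_minus)
      (rule lin_on_comp[OF lin_on_fst[OF lmL1 lmL' C] c(1)] lin_on_comp[OF lin_on_snd[OF lmL1 lmL' C] \<gamma>(1)], force)+
  have D_iff: "(x, l) \<in> D \<longleftrightarrow> x \<in> carrier L1 \<and> l \<in> carrier L' \<and> c x = \<gamma> l" for x l
    using left_module_minus_eq_zero[OF ObjD(1)[OF G]] lin_on_simps(1)[OF c(1)] lin_on_simps(1)[OF \<gamma>(1)]
    by (auto simp: D_def)
  let ?D = "(pmod L1 L')\<lparr>carrier := D\<rparr>"
  have lmD: "left_module R ?D" by (rule left_module_submod[OF L1L' D])
  have "fits U (carrier ?D)"
    by (rule fits_subset[OF fits_Times[OF ObjD(2)[OF L1O] ObjD(2)[OF L']]]) (auto simp: D_def)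
  \<comment> \<open>The elements of \<open>D\<close> are pairs; \<open>Y\<close> is its copy on
    \<open>'m\<close>.\<close>
  from ex_quotient[OF lmD this submod_zero[OF lmD]] obtain Y :: "('r, 'm) module" and \<theta> where
    Y: "Y \<in> Obj (R_Mod R)" and \<theta>: "lin R ?D Y \<theta>" "\<theta> ` carrier ?D = carrier Y"
    and "\<forall>x \<in> carrier ?D. \<theta> x = \<zero>\<^bsub>Y\<^esub> \<longleftrightarrow> x \<in> {\<zero>\<^bsub>?D\<^esub>}" by (elim exE conjE)
  then have \<theta>0: "x = \<zero>\<^bsub>?D\<^esub>" if "x \<in> carrier ?D" "\<theta> x = \<zero>\<^bsub>Y\<^esub>" for x using that by blast
  have \<theta>inj: "inj_on \<theta> D" using lin_on_inj[OF \<theta>(1)] \<theta>0 by simp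
  have \<theta>': "lin_on R (pmod L1 L') D Y \<theta>" using \<theta>(1) by (simp add: lin_on_submod_source[OF L1L' D])
  have sndD: "lin R ?D L' snd"
    using lin_on_snd[OF lmL1 lmL' D] by (simp add: lin_on_submod_source[OF L1L' D])
  have "snd x = \<zero>\<^bsub>L'\<^esub>" if "x \<in> carrier ?D" "\<theta> x = \<zero>\<^bsub>Y\<^esub>" for x
    unfolding \<theta>0[OF that] by simp
  from lin_on_factor[OF \<theta>(1) sndD this] \<theta>(2) obtain \<pi> where \<pi>: "lin R Y L' \<pi>" "\<forall>x \<in> D. \<pi> (\<theta> x) = snd x"
    by auto
  define l where "l x = \<theta> (v x, \<zero>\<^bsub>L'\<^esub>)" for x
  define j where "j x = \<theta> (j' x, i' (d x))" for x
  have vD: "(v x, \<zero>\<^bsub>L'\<^esub>) \<in> D" if "x \<in> carrier L" for x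
  proof -
    have "v x \<in> carrier L1" by (rule lin_on_simps(1)[OF v that])
    moreover have "c (v x) = \<zero>\<^bsub>G\<^esub>" using ck calculation that by blast
    ultimately show ?thesis using D_iff left_module_simps(2)[OF lmL'] lin_on_simps(4)[OF \<gamma>(1)] by simp
  qed
  have jD: "(j' x, i' (d x)) \<in> D" if "x \<in> carrier E" for x
    using D_iff lin_on_simps(1)[OF j' that] lin_on_simps(1)[OF i', of "d x"] \<gamma>(2) g(2) that by simp
  have l: "lin R L Y l"
    unfolding l_def
    by (rule lin_on_comp[OF lin_on_Pair[OF v lin_on_zero[OF lmL lmL' submod_carrier[OF lmL]]] \<theta>']) (use vD in auto)
  have i'd: "lin R E L' (\<lambda>x. i' (d x))" by (rule lin_on_comp[OF d i']) simp
  have j: "lin R E Y j"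
    unfolding j_def by (rule lin_on_comp[OF lin_on_Pair[OF j' i'd] \<theta>']) (use jD in auto)
  have linj: "inj_on l (carrier L)"
  proof (rule inj_onI)
    fix x y assume xy: "x \<in> carrier L" "y \<in> carrier L" "l x = l y"
    then have "(v x, \<zero>\<^bsub>L'\<^esub>) = (v y, \<zero>\<^bsub>L'\<^esub>)" using inj_onD[OF \<theta>inj _ vD vD] by (simp add: l_def)
    then show "x = y" using inj_onD[OF vinj] xy by simp
  qed
  have jinj: "inj_on j (carrier E)"
  proof (rule inj_onI)
    fix x y assume xy: "x \<in> carrier E" "y \<in> carrier E" "j x = j y"
    then have "(j' x, i' (d x)) = (j' y, i' (d y))" using inj_onD[OF \<theta>inj _ jD jD] by (simp add: j_def)
    then show "x = y" using inj_onD[OF j'inj] xy by simp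
  qed
  have YD: "\<exists>x \<in> D. y = \<theta> x" if "y \<in> carrier Y" for y using that \<theta>(2) by auto
  have surj: "\<pi> ` carrier Y = carrier L'"
  proof
    show "carrier L' \<subseteq> \<pi> ` carrier Y"
    proof
      fix b assume b: "b \<in> carrier L'"
      have "\<gamma> b \<in> c ` carrier L1" unfolding c(2) by (rule lin_on_simps(1)[OF \<gamma>(1) b])
      then obtain a where "a \<in> carrier L1" "c a = \<gamma> b" by auto
      then have ab: "(a, b) \<in> D" using D_iff b by simp
      then have "\<pi> (\<theta> (a, b)) = b" "\<theta> (a, b) \<in> carrier Y" using \<pi>(2) lin_on_simps(1)[OF \<theta>'] by auto
      then show "b \<in> \<pi> ` carrier Y" by (intro image_eqI[of _ _ "\<theta> (a, b)"]) simp_all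
    qed
  qed (use lin_on_simps(1)[OF \<pi>(1)] in blast)
  have kerY: "\<pi> y = \<zero>\<^bsub>L'\<^esub> \<longleftrightarrow> y \<in> l ` carrier L" if y: "y \<in> carrier Y" for y
  proof
    obtain a b where ab: "(a, b) \<in> D" "y = \<theta> (a, b)" using YD[OF y] by auto
    assume "\<pi> y = \<zero>\<^bsub>L'\<^esub>"
    then have "b = \<zero>\<^bsub>L'\<^esub>" using \<pi>(2) ab by auto
    then have "a \<in> carrier L1" "c a = \<zero>\<^bsub>G\<^esub>" using ab(1) D_iff lin_on_simps(4)[OF \<gamma>(1)] by auto
    then have "a \<in> v ` carrier L" using ck by blast
    then show "y \<in> l ` carrier L" using ab(2) \<open>b = \<zero>\<^bsub>L'\<^esub>\<close> by (auto simp: l_def)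
  next
    assume "y \<in> l ` carrier L"
    then obtain x where "x \<in> carrier L" "y = \<theta> (v x, \<zero>\<^bsub>L'\<^esub>)" by (auto simp: l_def)
    then show "\<pi> y = \<zero>\<^bsub>L'\<^esub>" using \<pi>(2) vD by simp
  qed
  have li: "l (i x) = j x" if "x \<in> carrier E" "d x = \<zero>\<^bsub>E'\<^esub>" for x
    using vi[of x] that lin_on_simps(4)[OF i'] by (simp add: l_def j_def)
  have \<pi>j: "\<pi> (j x) = i' (d x)" if "x \<in> carrier E" for x using \<pi>(2) jD[OF that] by (simp add: j_def)
  show ?thesis
    by (rule exI[of _ Y], rule exI[of _ l], rule exI[of _ \<pi>], rule exI[of _ j])
      (use Y l linj \<pi>(1) surj kerY j jinj li \<pi>j in blast)
qed

end

section \<open>Semifree complexes\<close>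

text \<open>Killing the homology of a complex \<open>C\<close>: a cell of degree \<open>n\<close> has as boundary a cycle \<open>c + \<Sum> r\<^sub>i g\<^sub>i\<close>,
  with \<open>c \<in> C\<^sub>n\<^sub>-\<^sub>1\<close> and earlier cells \<open>g\<^sub>i\<close> of degree \<open>n - 1\<close>. Different cells may have the same boundary.\<close>

datatype ('r, 'm) cell = Cell (base: 'm) (bound: "('r \<times> ('r, 'm) cell) list")

text \<open>The part of the boundary that lies on cells, as a vector. It is formed in
  \<open>free_mod R UNIV\<close> because the definition of the cells of a given degree already
  refers to it.\<close>

definition bound_val :: "('r, 'x) ring_scheme \<Rightarrow> ('r, 'm) cell \<Rightarrow> ('r, 'm) cell \<Rightarrow> 'r" where
  "bound_val R g = lincomb (free_mod R UNIV) (map (map_prod id (free_gen R)) (bound g))"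

text \<open>The last two premises say that the boundary
  \<open>c + \<Sum> r\<^sub>i g\<^sub>i\<close> is a cycle, one premise for each component of its
  differential: \<open>g\<^sub>i\<close> contributes \<open>base g\<^sub>i\<close> in
  \<open>C\<close> and \<open>bound_val R g\<^sub>i\<close> on cells. The boundary has degree
  \<open>n - 1\<close>, so these equations live in degree \<open>n - 2\<close>.\<close>

inductive cell_at :: "('r, 'x) ring_scheme \<Rightarrow> ('r, 'm) mod_complex \<Rightarrow> int \<Rightarrow> ('r, 'm) cell \<Rightarrow> bool"
  for R C where
  cell_atI: "c \<in> carrier (cmod C (n - 1)) \<Longrightarrow> \<forall>p \<in> set l. fst p \<in> carrier R \<and> cell_at R C (n - 1) (snd p) \<Longrightarrow>
    cdiff C (n - 1) c \<oplus>\<^bsub>cmod C (n - 2)\<^esub> lincomb (cmod C (n - 2)) (map (map_prod id base) l) = \<zero>\<^bsub>cmod C (n - 2)\<^esub> \<Longrightarrow>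
    lincomb (free_mod R UNIV) (map (map_prod id (bound_val R)) l) = (\<lambda>_. \<zero>\<^bsub>R\<^esub>) \<Longrightarrow>
    cell_at R C n (Cell c l)"

definition cells :: "('r, 'x) ring_scheme \<Rightarrow> ('r, 'm) mod_complex \<Rightarrow> int \<Rightarrow> ('r, 'm) cell set" where
  "cells R C n = {g. cell_at R C n g}"

text \<open>Degrees are unbounded below and give no induction; recursion rests on the cell being a
  finite tree. The function \<open>H\<close> also receives the cell itself, since the equation to be
  solved depends on it and not only on the values at the cells in its list.\<close>

primrec cell_fold :: "(('r, 'm) cell \<Rightarrow> ('r \<times> 'z) list \<Rightarrow> 'z) \<Rightarrow> ('r, 'm) cell \<Rightarrow> 'z" where
  "cell_fold H (Cell c l) = H (Cell c l) (map (map_prod id (cell_fold H)) l)"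

lemma lincomb_free_mod: "lincomb (free_mod R S) l = lincomb (free_mod R T) l"
  by (induction l) simp_all

context ring_universe begin

lemma cells_cases:
  assumes "g \<in> cells R C n"
  shows "base g \<in> carrier (cmod C (n - 1))" "set (bound g) \<subseteq> carrier R \<times> cells R C (n - 1)"
    "cdiff C (n - 1) (base g) \<oplus>\<^bsub>cmod C (n - 2)\<^esub> lincomb (cmod C (n - 2)) (map (map_prod id base) (bound g)) = \<zero>\<^bsub>cmod C (n - 2)\<^esub>"
    "lincomb (free_mod R S) (map (map_prod id (bound_val R)) (bound g)) = (\<lambda>_. \<zero>)"
proof -
  have "cell_at R C n g" using assms by (simp add: cells_def)
  then show "base g \<in> carrier (cmod C (n - 1))" "set (bound g) \<subseteq> carrier R \<times> cells R C (n - 1)"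
    "cdiff C (n - 1) (base g) \<oplus>\<^bsub>cmod C (n - 2)\<^esub> lincomb (cmod C (n - 2)) (map (map_prod id base) (bound g)) = \<zero>\<^bsub>cmod C (n - 2)\<^esub>"
    "lincomb (free_mod R S) (map (map_prod id (bound_val R)) (bound g)) = (\<lambda>_. \<zero>)"
    unfolding lincomb_free_mod[of R S _ UNIV]
    by (cases rule: cell_at.cases; simp add: subset_eq mem_Times_iff cells_def)+
qed

lemma set_map_map_prod:
  assumes "set l \<subseteq> A \<times> B" "\<And>b. b \<in> B \<Longrightarrow> f b \<in> D"
  shows "set (map (map_prod id f) l) \<subseteq> A \<times> D"
  using assms by fastforce

lemma bound_val_eq: "bound_val R g = lincomb (free_mod R S) (map (map_prod id (free_gen R)) (bound g))"
  by (simp add: bound_val_def lincomb_free_mod[of R UNIV _ S])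

lemma bound_val_closed:
  assumes "g \<in> cells R C n"
  shows "bound_val R g \<in> carrier (free_mod R (cells R C (n - 1)))"
  unfolding bound_val_eq[of _ "cells R C (n - 1)"]
  by (rule lincomb_closed[OF left_module_free submod_carrier[OF left_module_free]])
    (rule set_map_map_prod[OF cells_cases(2)[OF assms] free_gen_closed])

text \<open>\<open>T k\<close> collects the trees of height at most \<open>k\<close> with bases from
  any degree and coefficients in the ring. Each \<open>T k\<close> fits, as lists over a set that
  fits do; and every cell, being a finite tree, occurs in some \<open>T k\<close>.\<close>

lemma fits_cells:
  fixes C :: "('r, 'm) mod_complex"
  assumes C: "is_complex R C"
  shows "fits U (cells R C n)"
proof -
  define A where "A = (\<Union>n. carrier (cmod C n))"
  define T :: "nat \<Rightarrow> ('r, 'm) cell set" where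
    "T k = ((\<lambda>S. (\<lambda>(c, l). Cell c l) ` (A \<times> lists (carrier R \<times> S))) ^^ k) {}" for k
  have T0: "T 0 = {}" and TS: "T (Suc k) = (\<lambda>(c, l). Cell c l) ` (A \<times> lists (carrier R \<times> T k))" for k
    by (simp_all add: T_def)
  have "countable (UNIV :: int set)" by simp
  then have A: "fits U A"
    unfolding A_def by (intro fits_UN fits_countable ObjD(2) is_complexD(1)[OF C])
  have "fits U (T k)" for k
  proof (induction k)
    case 0
    then show ?case using fits_countable[OF countable_empty] by (simp add: T0)
  next
    case (Suc k)
    then show ?case unfolding TS by (intro fits_image fits_Times fits_lists A fits_carrier)
  qed
  then have fT: "fits U (\<Union>k. T k)" by (intro fits_UN fits_nat)
  \<comment> \<open>Membership in all late \<open>T k\<close>, rather than in one, lets the bounds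
    for the finitely many cells of a list be combined by their maximum.\<close>
  have "\<exists>K. \<forall>k\<ge>K. g \<in> T k" if "cell_at R C n g" for n g
    using that
  proof induction
    case (cell_atI c n l)
    have "\<exists>K. \<forall>k\<ge>K. set l' \<subseteq> carrier R \<times> T k" if "set l' \<subseteq> set l" for l'
      using that
    proof (induction l')
      case (Cons p l')
      then obtain K where K: "\<forall>k\<ge>K. set l' \<subseteq> carrier R \<times> T k" by auto
      obtain K' where K': "\<forall>k\<ge>K'. snd p \<in> T k" "fst p \<in> carrier R" using cell_atI Cons.prems by auto
      have "\<forall>k \<ge> max K K'. set (p # l') \<subseteq> carrier R \<times> T k"
        using K K' by (auto simp: mem_Times_iff)
      then show ?case by blast
    qed auto
    then obtain K where K: "\<forall>k\<ge>K. set l \<subseteq> carrier R \<times> T k" by blast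
    have "c \<in> A" using cell_atI(1) by (auto simp: A_def)
    have "Cell c l \<in> T k" if k: "k \<ge> Suc K" for k
    proof -
      obtain k' where k': "k = Suc k'" "k' \<ge> K" using k by (cases k) auto
      have "(c, l) \<in> A \<times> lists (carrier R \<times> T k')" using K k'(2) \<open>c \<in> A\<close> by (auto simp: lists_eq_set)
      then show ?thesis unfolding k'(1) TS by (rule rev_image_eqI) simp
    qed
    then show ?case by blast
  qed
  then have "cells R C n \<subseteq> (\<Union>k. T k)" unfolding cells_def by blast
  with fT show ?thesis by (rule fits_subset)
qed

end

text \<open>The quotient of the exact extension of \<open>C\<close> by \<open>C\<close> itself: the
  free graded module on the cells, with the base of each boundary discarded.\<close>

definition semifree ::
    "('r, 'x) ring_scheme \<Rightarrow> ('r, 'm) mod_complex \<Rightarrow> ('r, ('r, 'm) cell \<Rightarrow> 'r) mod_complex" where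
  "semifree R C = \<lparr>cmod = (\<lambda>n. free_mod R (cells R C n)),
     cdiff = (\<lambda>n. SOME h. lin R (free_mod R (cells R C n)) (free_mod R (cells R C (n - 1))) h \<and>
       (\<forall>g \<in> cells R C n. h (free_gen R g) = bound_val R g))\<rparr>"

lemma cmod_semifree [simp]: "cmod (semifree R C) n = free_mod R (cells R C n)"
  by (simp add: semifree_def)

context ring_universe begin

lemma cdiff_semifree:
  "lin R (free_mod R (cells R C n)) (free_mod R (cells R C (n - 1))) (cdiff (semifree R C) n)"
  "g \<in> cells R C n \<Longrightarrow> cdiff (semifree R C) n (free_gen R g) = bound_val R g"
proof -
  have "\<exists>h. lin R (free_mod R (cells R C n)) (free_mod R (cells R C (n - 1))) h \<and>
       (\<forall>g \<in> cells R C n. h (free_gen R g) = bound_val R g)"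
    by (rule free_mod_lift[OF left_module_free]) (use bound_val_closed in blast)
  from someI_ex[OF this]
  show "lin R (free_mod R (cells R C n)) (free_mod R (cells R C (n - 1))) (cdiff (semifree R C) n)"
    "g \<in> cells R C n \<Longrightarrow> cdiff (semifree R C) n (free_gen R g) = bound_val R g"
    by (simp_all add: semifree_def)
qed

text \<open>Reduces the value of a linear map at a boundary to the list stored in the cell, which is
  the form in which an induction over cells delivers its hypotheses.\<close>

lemma lincomb_bound:
  assumes g: "g \<in> cells R C n" and h: "lin R (free_mod R (cells R C (n - 1))) N h"
  shows "h (bound_val R g) = lincomb N (map (map_prod id (\<lambda>k. h (free_gen R k))) (bound g))"
proof -
  have s: "set (map (map_prod id (free_gen R)) (bound g)) \<subseteq> carrier R \<times> carrier (free_mod R (cells R C (n - 1)))"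
    by (rule set_map_map_prod[OF cells_cases(2)[OF g] free_gen_closed])
  have "map (map_prod id h) (map (map_prod id (free_gen R)) (bound g)) = map (map_prod id (\<lambda>k. h (free_gen R k))) (bound g)"
    by auto
  then show ?thesis by (simp only: bound_val_eq[of g "cells R C (n - 1)"] lincomb_lin_on[OF h s])
qed

lemma lincomb_map_cong:
  assumes "set l \<subseteq> A \<times> B" "\<And>b. b \<in> B \<Longrightarrow> f b = h b"
  shows "map (map_prod id f) l = map (map_prod id h) l"
  using assms by fastforce

text \<open>By linearity this is the last premise in the definition of a cell.\<close>

lemma cdiff_semifree_bound:
  assumes g: "g \<in> cells R C n"
  shows "cdiff (semifree R C) (n - 1) (bound_val R g) = \<zero>\<^bsub>free_mod R (cells R C (n - 2))\<^esub>"
proof -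
  have l: "lin R (free_mod R (cells R C (n - 1))) (free_mod R (cells R C (n - 2))) (cdiff (semifree R C) (n - 1))"
    using cdiff_semifree(1)[of C "n - 1"] by simp
  have eq: "map (map_prod id (\<lambda>k. cdiff (semifree R C) (n - 1) (free_gen R k))) (bound g) =
      map (map_prod id (bound_val R)) (bound g)"
    by (rule lincomb_map_cong[OF cells_cases(2)[OF g]]) (rule cdiff_semifree(2))
  show ?thesis unfolding lincomb_bound[OF g l] eq cells_cases(4)[OF g] by simp
qed

lemma cdiff_semifree_square:
  assumes "\<phi> \<in> carrier (free_mod R (cells R C n))"
  shows "cdiff (semifree R C) (n - 1) (cdiff (semifree R C) n \<phi>) = \<zero>\<^bsub>free_mod R (cells R C (n - 2))\<^esub>"
proof (rule free_mod_ext[OF _ _ _ assms])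
  have l: "lin R (free_mod R (cells R C (n - 1))) (free_mod R (cells R C (n - 2))) (cdiff (semifree R C) (n - 1))"
    using cdiff_semifree(1)[of C "n - 1"] by simp
  show "lin R (free_mod R (cells R C n)) (free_mod R (cells R C (n - 2)))
      (\<lambda>\<phi>. cdiff (semifree R C) (n - 1) (cdiff (semifree R C) n \<phi>))"
    by (rule lin_on_comp[OF cdiff_semifree(1) l]) (use lin_on_simps(1)[OF cdiff_semifree(1)] in blast)
  show "lin R (free_mod R (cells R C n)) (free_mod R (cells R C (n - 2))) (\<lambda>\<phi>. \<zero>\<^bsub>free_mod R (cells R C (n - 2))\<^esub>)"
    by (rule lin_on_zero[OF left_module_free left_module_free submod_carrier[OF left_module_free]])
  show "cdiff (semifree R C) (n - 1) (cdiff (semifree R C) n (free_gen R g)) = \<zero>\<^bsub>free_mod R (cells R C (n - 2))\<^esub>"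
    if "g \<in> cells R C n" for g
    unfolding cdiff_semifree(2)[OF that] by (rule cdiff_semifree_bound[OF that])
qed

text \<open>As a graded module, \<open>M\<close> is the sum of the kernel of \<open>p\<close> and the image of a section \<open>\<sigma>\<close> of \<open>p\<close>. The values
  of the extension on the cells are chosen by recursion: the boundary that is prescribed for the
  value at a cell is a cycle of \<open>B\<close>, hence a boundary.\<close>

lemma complex_extends_semifree:
  fixes B C :: "('r, 'm) mod_complex"
  assumes B: "is_complex R B" "exact_complex B"
  shows "complex_extends R (semifree R C) B"
  unfolding complex_extends_def cmod_semifree
proof (intro allI impI, elim conjE)
  fix M :: "('r, 'm) mod_complex" and p f
  let ?F = "\<lambda>n. free_mod R (cells R C n)" and ?\<delta> = "cdiff (semifree R C)"
  let ?K = "\<lambda>n. {x \<in> carrier (cmod M n). p n x = \<zero>\<^bsub>?F n\<^esub>}"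
  assume M: "is_complex R M" and p: "chain_lin R M (semifree R C) p"
    and surj: "\<forall>n. p n ` carrier (cmod M n) = carrier (?F n)" and f: "chain_on R M ?K B f"
  have pl: "lin R (cmod M n) (?F n) (p n)" for n using chain_linD(1)[OF p, of n] by simp
  have pd: "?\<delta> n (p n x) = p (n - 1) (cdiff M n x)" if "x \<in> carrier (cmod M n)" for n x
    by (rule chain_linD(2)[OF p that])
  have lmF: "left_module R (?F n)" for n by (rule left_module_free)
  have lmM: "left_module R (cmod M n)" and lmB: "left_module R (cmod B n)" for n
    using ObjD(1) is_complexD(1) M B(1) by blast+
  have \<delta>: "lin R (?F n) (?F (n - 1)) (?\<delta> n)" for n by (rule cdiff_semifree(1))
  have fl: "lin_on R (cmod M n) (?K n) (cmod B n) (f n)" for n by (rule chain_onD(1)[OF f])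
  have fd: "cdiff B n (f n x) = f (n - 1) (cdiff M n x)" if "x \<in> ?K n" for n x by (rule chain_onD(2)[OF f that])
  note dM = is_complexD(2)[OF M] and dB = is_complexD(2)[OF B(1)]
  note dMc = lin_on_simps(1)[OF dM] and pc = lin_on_simps(1)[OF pl]
    and \<delta>c = lin_on_simps(1)[OF \<delta>]
  have K: "submod R (cmod M n) (?K n)" for n by (rule submod_kernel[OF pl])
  define \<mu> where "\<mu> n g = (SOME m. m \<in> carrier (cmod M n) \<and> p n m = free_gen R g)" for n g
  have \<mu>: "\<mu> n g \<in> carrier (cmod M n) \<and> p n (\<mu> n g) = free_gen R g" if "g \<in> cells R C n" for n g
  proof -
    have "free_gen R g \<in> p n ` carrier (cmod M n)" using surj free_gen_closed[OF that] by simp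
    then have "\<exists>m. m \<in> carrier (cmod M n) \<and> p n m = free_gen R g" by force
    then show ?thesis unfolding \<mu>_def by (rule someI_ex)
  qed
  \<comment> \<open>A section of \<open>p\<close> exists in each degree since the target is free; it
    need not commute with the differentials.\<close>
  have "\<forall>n. \<exists>h. lin R (?F n) (cmod M n) h \<and> (\<forall>g \<in> cells R C n. h (free_gen R g) = \<mu> n g)"
    by (rule allI, rule free_mod_lift[OF lmM]) (use \<mu> in blast)
  from choice[OF this] obtain \<sigma> where
    \<sigma>': "\<forall>n. lin R (?F n) (cmod M n) (\<sigma> n) \<and> (\<forall>g \<in> cells R C n. \<sigma> n (free_gen R g) = \<mu> n g)" ..
  then have \<sigma>: "lin R (?F n) (cmod M n) (\<sigma> n)" and \<sigma>g: "g \<in> cells R C n \<Longrightarrow> \<sigma> n (free_gen R g) = \<mu> n g" for n g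
    by blast+
  note \<sigma>c = lin_on_simps(1)[OF \<sigma>]
  have p\<sigma>: "p n (\<sigma> n \<phi>) = \<phi>" if "\<phi> \<in> carrier (?F n)" for n \<phi>
  proof (rule free_mod_ext[OF _ lin_on_id[OF lmF submod_carrier[OF lmF]] _ that])
    show "lin R (?F n) (?F n) (\<lambda>\<phi>. p n (\<sigma> n \<phi>))"
      by (rule lin_on_comp[OF \<sigma> pl]) (use \<sigma>c in blast)
  qed (use \<sigma>g \<mu> in simp)
  have \<kappa>K: "cdiff M n (\<sigma> n \<phi>) \<ominus>\<^bsub>cmod M (n - 1)\<^esub> \<sigma> (n - 1) (?\<delta> n \<phi>) \<in> ?K (n - 1)"
    if \<phi>: "\<phi> \<in> carrier (?F n)" for n \<phi>
  proof -
    have c: "cdiff M n (\<sigma> n \<phi>) \<in> carrier (cmod M (n - 1))" "\<sigma> (n - 1) (?\<delta> n \<phi>) \<in> carrier (cmod M (n - 1))"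
      using dMc[OF \<sigma>c[OF \<phi>]] \<sigma>c[OF \<delta>c[OF \<phi>]] .
    have "p (n - 1) (cdiff M n (\<sigma> n \<phi>)) = ?\<delta> n \<phi>" using pd[OF \<sigma>c[OF \<phi>]] p\<sigma>[OF \<phi>] by simp
    then have "p (n - 1) (cdiff M n (\<sigma> n \<phi>) \<ominus>\<^bsub>cmod M (n - 1)\<^esub> \<sigma> (n - 1) (?\<delta> n \<phi>)) =
        ?\<delta> n \<phi> \<ominus>\<^bsub>?F (n - 1)\<^esub> ?\<delta> n \<phi>"
      using lin_on_simps(6)[OF pl c] p\<sigma>[OF \<delta>c[OF \<phi>]] by simp
    then show ?thesis
      using left_module_minus_eq_zero[OF lmF \<delta>c[OF \<phi>] \<delta>c[OF \<phi>]] left_module_simps(4)[OF lmM c] by simp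
  qed
  \<comment> \<open>The image under \<open>f\<close> of the defect of \<open>\<sigma>\<close> from
    being a chain map. With the ansatz \<open>F m = f (m - \<sigma> (p m)) + \<beta> (p m)\<close>
    the chain condition for \<open>F\<close> becomes
    \<open>d \<beta> = \<zeta> + \<beta> \<delta>\<close>, an equation for \<open>\<beta>\<close> on
    the cells.\<close>
  define \<zeta> where "\<zeta> n \<phi> = f (n - 1) (cdiff M n (\<sigma> n \<phi>) \<ominus>\<^bsub>cmod M (n - 1)\<^esub> \<sigma> (n - 1) (?\<delta> n \<phi>))" for n \<phi>
  have \<zeta>: "lin R (?F n) (cmod B (n - 1)) (\<zeta> n)" for n
    unfolding \<zeta>_def
  proof (rule lin_on_comp[OF lin_on_minus fl])
    show "lin R (?F n) (cmod M (n - 1)) (\<lambda>\<phi>. cdiff M n (\<sigma> n \<phi>))"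
      by (rule lin_on_comp[OF \<sigma> dM]) (use \<sigma>c in blast)
    show "lin R (?F n) (cmod M (n - 1)) (\<lambda>\<phi>. \<sigma> (n - 1) (?\<delta> n \<phi>))"
      by (rule lin_on_comp[OF \<delta> \<sigma>]) (use \<delta>c in blast)
  qed (use \<kappa>K in blast)
  \<comment> \<open>\<open>y\<close> solves this equation at the cell \<open>g\<close> in degree
    \<open>n\<close>. A cell does not record its degree and may belong to several, so the values
    already found at the cells of the list are functions of the degree.\<close>
  define S where "S g l n y \<longleftrightarrow> y \<in> carrier (cmod B n) \<and> cdiff B n y = \<zeta> n (free_gen R g) \<oplus>\<^bsub>cmod B (n - 1)\<^esub>
      lincomb (cmod B (n - 1)) (map (map_prod id (\<lambda>y. y (n - 1))) l)"
    for g and l :: "('r \<times> (int \<Rightarrow> 'm)) list" and n y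
  \<comment> \<open>The default zero makes the recursion total with values in the carriers, so that
    \<open>\<beta>\<close> can be defined before solvability is known. The induction in
    \<open>key\<close> shows that a solution exists for every cell in
    \<open>cells R C n\<close>.\<close>
  define H where "H g l n = (if \<exists>y. S g l n y then SOME y. S g l n y else \<zero>\<^bsub>cmod B n\<^esub>)" for g l n
  have HS: "S g l n (H g l n)" if "\<exists>y. S g l n y" for g l n
    unfolding H_def if_P[OF that] by (rule someI_ex[OF that])
  have HB: "H g l n \<in> carrier (cmod B n)" for g l n
  proof (cases "\<exists>y. S g l n y")
    case True
    then show ?thesis using HS by (simp add: S_def)
  next
    case False
    then show ?thesis unfolding H_def if_not_P[OF False] using left_module_simps(2)[OF lmB] by simp
  qed
  define b where "b = cell_fold H"
  have bH: "b g n = H g (map (map_prod id b) (bound g)) n" for g n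
    by (cases g) (simp add: b_def)
  have bB: "b g n \<in> carrier (cmod B n)" for g n by (subst bH) (rule HB)
  have "\<forall>n. \<exists>h. lin R (?F n) (cmod B n) h \<and> (\<forall>g \<in> cells R C n. h (free_gen R g) = b g n)"
    by (rule allI, rule free_mod_lift[OF lmB]) (use bB in blast)
  from choice[OF this] obtain \<beta> where
    \<beta>': "\<forall>n. lin R (?F n) (cmod B n) (\<beta> n) \<and> (\<forall>g \<in> cells R C n. \<beta> n (free_gen R g) = b g n)" ..
  then have \<beta>: "lin R (?F n) (cmod B n) (\<beta> n)" and \<beta>g: "g \<in> cells R C n \<Longrightarrow> \<beta> n (free_gen R g) = b g n" for n g
    by blast+
  note \<beta>c = lin_on_simps(1)[OF \<beta>] and \<zeta>c = lin_on_simps(1)[OF \<zeta>]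
  have d\<beta>: "lin R (?F n) (cmod B (n - 1)) (\<lambda>\<phi>. cdiff B n (\<beta> n \<phi>))" for n
    by (rule lin_on_comp[OF \<beta> dB]) (use \<beta>c in blast)
  have \<beta>\<delta>: "lin R (?F n) (cmod B (n - 1)) (\<lambda>\<phi>. \<beta> (n - 1) (?\<delta> n \<phi>))" for n
    by (rule lin_on_comp[OF \<delta> \<beta>]) (use \<delta>c in blast)
  note rhs = lin_on_add[OF \<zeta> \<beta>\<delta>]
  have key: "cdiff B n (\<beta> n (free_gen R g)) =
      \<zeta> n (free_gen R g) \<oplus>\<^bsub>cmod B (n - 1)\<^esub> \<beta> (n - 1) (?\<delta> n (free_gen R g))"
    if "g \<in> cells R C n" for g n
    using that
  proof (induction g arbitrary: n)
    case (Cell c l)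
    let ?g = "Cell c l"
    note g = Cell.prems
    have e: "free_gen R ?g \<in> carrier (?F n)" by (rule free_gen_closed[OF g])
    have \<delta>e: "?\<delta> n (free_gen R ?g) = bound_val R ?g" by (rule cdiff_semifree(2)[OF g])
    have bv: "bound_val R ?g \<in> carrier (?F (n - 1))" by (rule bound_val_closed[OF g])
    have l: "set l \<subseteq> carrier R \<times> cells R C (n - 1)" using cells_cases(2)[OF g] by simp
    \<comment> \<open>The equation holds at the cells of the list by induction, hence at the
      boundary of \<open>?g\<close> by linearity. There its last term vanishes, because the boundary
      is a cycle of the semifree complex.\<close>
    have "cdiff B (n - 1) (\<beta> (n - 1) (bound_val R ?g)) =
        \<zeta> (n - 1) (bound_val R ?g) \<oplus>\<^bsub>cmod B (n - 1 - 1)\<^esub> \<beta> (n - 1 - 1) (?\<delta> (n - 1) (bound_val R ?g))"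
    proof -
      have "map (map_prod id (\<lambda>k. cdiff B (n - 1) (\<beta> (n - 1) (free_gen R k)))) (bound ?g) =
        map (map_prod id (\<lambda>k. \<zeta> (n - 1) (free_gen R k) \<oplus>\<^bsub>cmod B (n - 1 - 1)\<^esub>
          \<beta> (n - 1 - 1) (?\<delta> (n - 1) (free_gen R k)))) (bound ?g)"
      proof (rule map_cong[OF refl])
        fix q assume q: "q \<in> set (bound ?g)"
        then have "snd q \<in> cells R C (n - 1)" using l by auto
        moreover have "q \<in> set l" "snd q \<in> Basic_BNFs.snds q" using q by (auto simp: snds.simps)
        ultimately have "cdiff B (n - 1) (\<beta> (n - 1) (free_gen R (snd q))) = \<zeta> (n - 1) (free_gen R (snd q))
          \<oplus>\<^bsub>cmod B (n - 1 - 1)\<^esub> \<beta> (n - 1 - 1) (?\<delta> (n - 1) (free_gen R (snd q)))"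
          using Cell.IH by blast
        then show "map_prod id (\<lambda>k. cdiff B (n - 1) (\<beta> (n - 1) (free_gen R k))) q =
          map_prod id (\<lambda>k. \<zeta> (n - 1) (free_gen R k) \<oplus>\<^bsub>cmod B (n - 1 - 1)\<^esub>
          \<beta> (n - 1 - 1) (?\<delta> (n - 1) (free_gen R k))) q" by (cases q) simp
      qed
      then show ?thesis
        unfolding lincomb_bound[OF g d\<beta>] lincomb_bound[OF g rhs] by (rule arg_cong)
    qed
    also have "?\<delta> (n - 1) (bound_val R ?g) = \<zero>\<^bsub>?F (n - 2)\<^esub>" by (rule cdiff_semifree_bound[OF g])
    finally have IH: "cdiff B (n - 1) (\<beta> (n - 1) (bound_val R ?g)) = \<zeta> (n - 1) (bound_val R ?g)"
      using left_module_simps(8)[OF lmB \<zeta>c[OF bv]] lin_on_simps(4)[OF \<beta>, of "n - 2"] by simp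
    let ?w = "cdiff M (n - 1) (\<sigma> (n - 1) (bound_val R ?g))"
    have \<sigma>b: "\<sigma> (n - 1) (bound_val R ?g) \<in> carrier (cmod M (n - 1))" by (rule \<sigma>c[OF bv])
    have w: "?w \<in> carrier (cmod M (n - 2))" using dMc[OF \<sigma>b] by simp
    have "\<zeta> (n - 1) (bound_val R ?g) = f (n - 2) (?w \<ominus>\<^bsub>cmod M (n - 2)\<^esub> \<zero>\<^bsub>cmod M (n - 2)\<^esub>)"
      using cdiff_semifree_bound[OF g] lin_on_simps(4)[OF \<sigma>, of "n - 2"] by (simp add: \<zeta>_def)
    then have \<zeta>w: "\<zeta> (n - 1) (bound_val R ?g) = f (n - 2) ?w"
      using w left_module_simps(8,15,16)[OF lmM] by simp
    have wK: "?w \<in> ?K (n - 2)"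
      using pd[OF \<sigma>b] p\<sigma>[OF bv] cdiff_semifree_bound[OF g] w by simp
    have \<mu>M: "\<sigma> n (free_gen R ?g) \<in> carrier (cmod M n)" by (rule \<sigma>c[OF e])
    have "cdiff B (n - 1) (\<zeta> n (free_gen R ?g)) =
        f (n - 2) (cdiff M (n - 1) (cdiff M n (\<sigma> n (free_gen R ?g)) \<ominus>\<^bsub>cmod M (n - 1)\<^esub> \<sigma> (n - 1) (bound_val R ?g)))"
      using fd[OF \<kappa>K[OF e]] \<delta>e by (simp add: \<zeta>_def)
    also have "cdiff M (n - 1) (cdiff M n (\<sigma> n (free_gen R ?g)) \<ominus>\<^bsub>cmod M (n - 1)\<^esub> \<sigma> (n - 1) (bound_val R ?g)) =
        \<zero>\<^bsub>cmod M (n - 2)\<^esub> \<ominus>\<^bsub>cmod M (n - 2)\<^esub> ?w"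
      using lin_on_simps(6)[OF dM[of "n - 1"] dMc[OF \<mu>M] \<sigma>b] is_complexD(3)[OF M \<mu>M] by simp
    also have "\<dots> = \<ominus>\<^bsub>cmod M (n - 2)\<^esub> ?w"
      using w left_module_simps(3,7,16)[OF lmM] by simp
    also have "f (n - 2) (\<ominus>\<^bsub>cmod M (n - 2)\<^esub> ?w) = \<ominus>\<^bsub>cmod B (n - 2)\<^esub> f (n - 2) ?w"
      by (rule lin_on_simps(5)[OF fl wK])
    finally have dz: "cdiff B (n - 1) (\<zeta> n (free_gen R ?g)) = \<ominus>\<^bsub>cmod B (n - 2)\<^esub> f (n - 2) ?w" .
    let ?z = "\<zeta> n (free_gen R ?g) \<oplus>\<^bsub>cmod B (n - 1)\<^esub> \<beta> (n - 1) (bound_val R ?g)"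
    have zc: "?z \<in> carrier (cmod B (n - 1))" using left_module_simps(1)[OF lmB] \<zeta>c[OF e] \<beta>c[OF bv] by blast
    have fw: "f (n - 2) ?w \<in> carrier (cmod B (n - 2))" by (rule lin_on_simps(1)[OF fl wK])
    have lb: "lincomb (cmod B (n - 1)) (map (map_prod id (\<lambda>y. y (n - 1))) (map (map_prod id b) (bound ?g))) =
        \<beta> (n - 1) (bound_val R ?g)"
    proof -
      have "map (map_prod id (\<lambda>y. y (n - 1))) (map (map_prod id b) (bound ?g)) =
          map (map_prod id (\<lambda>k. b k (n - 1))) (bound ?g)" by auto
      also have "\<dots> = map (map_prod id (\<lambda>k. \<beta> (n - 1) (free_gen R k))) (bound ?g)"
        by (rule lincomb_map_cong[OF cells_cases(2)[OF g]]) (rule \<beta>g[symmetric])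
      finally show ?thesis unfolding lincomb_bound[OF g \<beta>] by (rule arg_cong)
    qed
    \<comment> \<open>The summands of \<open>?z\<close> have differentials \<open>- f ?w\<close> and
      \<open>f ?w\<close>, which cancel. So the boundary prescribed for the value at
      \<open>?g\<close> is a cycle, and exactness of \<open>B\<close> yields a solution.\<close>
    have "cdiff B (n - 1) ?z = \<zero>\<^bsub>cmod B (n - 2)\<^esub>"
      using lin_on_simps(2)[OF dB[of "n - 1"] \<zeta>c[OF e] \<beta>c[OF bv]] dz IH \<zeta>w left_module_simps(9)[OF lmB fw] by simp
    then have "?z \<in> carrier (cycles B (n - 1))" using zc by (simp add: cycles_def)
    then have "?z \<in> cdiff B n ` carrier (cmod B n)"
      using B(2)[unfolded exact_complex_def, rule_format, of "n - 1"] by simp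
    then have "\<exists>y. S ?g (map (map_prod id b) (bound ?g)) n y"
      unfolding S_def lb by auto
    from HS[OF this] have "S ?g (map (map_prod id b) (bound ?g)) n (b ?g n)" by (subst bH)
    then have "cdiff B n (b ?g n) = ?z" unfolding S_def lb by blast
    then show ?case using \<beta>g[OF g] \<delta>e by simp
  qed
  have key': "cdiff B n (\<beta> n \<phi>) = \<zeta> n \<phi> \<oplus>\<^bsub>cmod B (n - 1)\<^esub> \<beta> (n - 1) (?\<delta> n \<phi>)"
    if "\<phi> \<in> carrier (?F n)" for n \<phi>
    by (rule free_mod_ext[OF d\<beta> rhs key that])
  define F where "F n m = f n (m \<ominus>\<^bsub>cmod M n\<^esub> \<sigma> n (p n m)) \<oplus>\<^bsub>cmod B n\<^esub> \<beta> n (p n m)" for n m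
  have rK: "m \<ominus>\<^bsub>cmod M n\<^esub> \<sigma> n (p n m) \<in> ?K n" if m: "m \<in> carrier (cmod M n)" for m n
  proof -
    have c: "\<sigma> n (p n m) \<in> carrier (cmod M n)" by (rule \<sigma>c[OF pc[OF m]])
    show ?thesis
      using lin_on_simps(6)[OF pl m c] p\<sigma>[OF pc[OF m]] left_module_simps(4)[OF lmM m c]
        left_module_minus_eq_zero[OF lmF pc[OF m] pc[OF m]] by simp
  qed
  have \<sigma>p: "lin R (cmod M n) (cmod M n) (\<lambda>m. \<sigma> n (p n m))" for n
    by (rule lin_on_comp[OF pl \<sigma>]) (use pc in blast)
  have "lin R (cmod M n) (cmod B n) (F n)" for n
    unfolding F_def
  proof (rule lin_on_add)
    show "lin R (cmod M n) (cmod B n) (\<lambda>m. f n (m \<ominus>\<^bsub>cmod M n\<^esub> \<sigma> n (p n m)))"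
      by (rule lin_on_comp[OF lin_on_minus[OF lin_on_id[OF lmM submod_carrier[OF lmM]] \<sigma>p] fl]) (use rK in blast)
    show "lin R (cmod M n) (cmod B n) (\<lambda>m. \<beta> n (p n m))"
      by (rule lin_on_comp[OF pl \<beta>]) (use pc in blast)
  qed
  moreover have "cdiff B n (F n m) = F (n - 1) (cdiff M n m)" if m: "m \<in> carrier (cmod M n)" for n m
  proof -
    let ?\<phi> = "p n m" and ?B = "cmod B (n - 1)" and ?M = "cmod M (n - 1)"
    have \<phi>: "?\<phi> \<in> carrier (?F n)" by (rule pc[OF m])
    have \<sigma>\<phi>: "\<sigma> n ?\<phi> \<in> carrier (cmod M n)" by (rule \<sigma>c[OF \<phi>])
    have c: "cdiff M n m \<in> carrier ?M" "cdiff M n (\<sigma> n ?\<phi>) \<in> carrier ?M" "\<sigma> (n - 1) (?\<delta> n ?\<phi>) \<in> carrier ?M"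
      using dMc[OF m] dMc[OF \<sigma>\<phi>] \<sigma>c[OF \<delta>c[OF \<phi>]] .
    have a: "cdiff M n (m \<ominus>\<^bsub>cmod M n\<^esub> \<sigma> n ?\<phi>) = cdiff M n m \<ominus>\<^bsub>?M\<^esub> cdiff M n (\<sigma> n ?\<phi>)"
      by (rule lin_on_simps(6)[OF dM m \<sigma>\<phi>])
    have aK: "cdiff M n m \<ominus>\<^bsub>?M\<^esub> cdiff M n (\<sigma> n ?\<phi>) \<in> ?K (n - 1)"
    proof -
      have "p (n - 1) (cdiff M n m \<ominus>\<^bsub>?M\<^esub> cdiff M n (\<sigma> n ?\<phi>)) = ?\<delta> n ?\<phi> \<ominus>\<^bsub>?F (n - 1)\<^esub> ?\<delta> n ?\<phi>"
        using lin_on_simps(6)[OF pl c(1,2)] pd[OF m] pd[OF \<sigma>\<phi>] p\<sigma>[OF \<phi>] by simp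
      then show ?thesis
        using left_module_minus_eq_zero[OF lmF \<delta>c[OF \<phi>] \<delta>c[OF \<phi>]] left_module_simps(4)[OF lmM c(1,2)] by simp
    qed
    have "cdiff B n (F n m) = cdiff B n (f n (m \<ominus>\<^bsub>cmod M n\<^esub> \<sigma> n ?\<phi>)) \<oplus>\<^bsub>?B\<^esub> cdiff B n (\<beta> n ?\<phi>)"
      unfolding F_def by (rule lin_on_simps(2)[OF dB lin_on_simps(1)[OF fl rK[OF m]] \<beta>c[OF \<phi>]])
    also have "\<dots> = f (n - 1) (cdiff M n m \<ominus>\<^bsub>?M\<^esub> cdiff M n (\<sigma> n ?\<phi>)) \<oplus>\<^bsub>?B\<^esub>
        (f (n - 1) (cdiff M n (\<sigma> n ?\<phi>) \<ominus>\<^bsub>?M\<^esub> \<sigma> (n - 1) (?\<delta> n ?\<phi>)) \<oplus>\<^bsub>?B\<^esub> \<beta> (n - 1) (?\<delta> n ?\<phi>))"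
      using fd[OF rK[OF m]] a key'[OF \<phi>] by (simp add: \<zeta>_def)
    also have "\<dots> = (f (n - 1) (cdiff M n m \<ominus>\<^bsub>?M\<^esub> cdiff M n (\<sigma> n ?\<phi>)) \<oplus>\<^bsub>?B\<^esub>
        f (n - 1) (cdiff M n (\<sigma> n ?\<phi>) \<ominus>\<^bsub>?M\<^esub> \<sigma> (n - 1) (?\<delta> n ?\<phi>))) \<oplus>\<^bsub>?B\<^esub> \<beta> (n - 1) (?\<delta> n ?\<phi>)"
      using left_module_simps(6)[OF lmB lin_on_simps(1)[OF fl aK] lin_on_simps(1)[OF fl \<kappa>K[OF \<phi>]] \<beta>c[OF \<delta>c[OF \<phi>]]] by simp
    also have "f (n - 1) (cdiff M n m \<ominus>\<^bsub>?M\<^esub> cdiff M n (\<sigma> n ?\<phi>)) \<oplus>\<^bsub>?B\<^esub>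
        f (n - 1) (cdiff M n (\<sigma> n ?\<phi>) \<ominus>\<^bsub>?M\<^esub> \<sigma> (n - 1) (?\<delta> n ?\<phi>)) =
      f (n - 1) ((cdiff M n m \<ominus>\<^bsub>?M\<^esub> cdiff M n (\<sigma> n ?\<phi>)) \<oplus>\<^bsub>?M\<^esub> (cdiff M n (\<sigma> n ?\<phi>) \<ominus>\<^bsub>?M\<^esub> \<sigma> (n - 1) (?\<delta> n ?\<phi>)))"
      by (rule lin_on_simps(2)[OF fl aK \<kappa>K[OF \<phi>], symmetric])
    also have "(cdiff M n m \<ominus>\<^bsub>?M\<^esub> cdiff M n (\<sigma> n ?\<phi>)) \<oplus>\<^bsub>?M\<^esub> (cdiff M n (\<sigma> n ?\<phi>) \<ominus>\<^bsub>?M\<^esub> \<sigma> (n - 1) (?\<delta> n ?\<phi>)) =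
        cdiff M n m \<ominus>\<^bsub>?M\<^esub> \<sigma> (n - 1) (?\<delta> n ?\<phi>)"
      using c lmM[of "n - 1"] by algebra
    also have "?\<delta> n ?\<phi> = p (n - 1) (cdiff M n m)" by (rule pd[OF m])
    finally show ?thesis by (simp add: F_def)
  qed
  ultimately have "chain_lin R M B F" by (simp add: chain_lin_def)
  moreover have "F n m = f n m" if m: "m \<in> carrier (cmod M n)" "p n m = \<zero>\<^bsub>?F n\<^esub>" for n m
  proof -
    have "f n m \<in> carrier (cmod B n)" using lin_on_simps(1)[OF fl, of m n] m by blast
    moreover have "m \<ominus>\<^bsub>cmod M n\<^esub> \<zero>\<^bsub>cmod M n\<^esub> = m" using left_module_simps(8,15,16)[OF lmM] m(1) by simp
    ultimately show ?thesis
      unfolding F_def m(2) lin_on_simps(4)[OF \<sigma>] lin_on_simps(4)[OF \<beta>] using left_module_simps(8)[OF lmB] by simp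
  qed
  ultimately show "\<exists>F. chain_lin R M B F \<and>
      (\<forall>n. \<forall>x \<in> carrier (cmod M n). p n x = \<zero>\<^bsub>?F n\<^esub> \<longrightarrow> F n x = f n x)" by blast
qed

end

section \<open>Special preenvelopes of complexes\<close>

context ring_universe begin

lemma exact_complexI:
  fixes C :: "('r, 'm) mod_complex"
  assumes C: "is_complex R C"
    and ex: "\<And>n x. x \<in> carrier (cmod C n) \<Longrightarrow> cdiff C n x = \<zero>\<^bsub>cmod C (n - 1)\<^esub> \<Longrightarrow>
      \<exists>y \<in> carrier (cmod C (n + 1)). x = cdiff C (n + 1) y"
  shows "exact_complex C"
  unfolding exact_complex_def
proof
  fix n
  show "carrier (cycles C n) = cdiff C (n + 1) ` carrier (cmod C (n + 1))"
  proof
    show "carrier (cycles C n) \<subseteq> cdiff C (n + 1) ` carrier (cmod C (n + 1))"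
      using ex by (auto simp: cycles_def)
    show "cdiff C (n + 1) ` carrier (cmod C (n + 1)) \<subseteq> carrier (cycles C n)"
      using lin_on_simps(1)[OF is_complexD(2)[OF C], of _ "n + 1"] is_complexD(3)[OF C, of _ "n + 1"]
      by (auto simp: cycles_def)
  qed
qed

text \<open>All stages of attaching cells are carried out at once. A cycle
  \<open>(c, \<phi>)\<close> involves only finitely many cells, so it is itself the boundary of a
  cell, with base \<open>c\<close> and a list that presents \<open>\<phi>\<close>; this is
  exactness.\<close>

lemma ex_exact_extension:
  fixes C :: "('r, 'm) mod_complex"
  assumes C: "is_complex R C"
  shows "\<exists>(E :: ('r, 'm) mod_complex) \<iota> \<kappa>. is_complex R E \<and> exact_complex E \<and> chain_lin R C E \<iota> \<and>
    (\<forall>n. inj_on (\<iota> n) (carrier (cmod C n))) \<and> chain_lin R E (semifree R C) \<kappa> \<and>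
    (\<forall>n. \<kappa> n ` carrier (cmod E n) = carrier (cmod (semifree R C) n)) \<and>
    (\<forall>n. \<forall>x \<in> carrier (cmod E n). \<kappa> n x = \<zero>\<^bsub>cmod (semifree R C) n\<^esub> \<longleftrightarrow> x \<in> \<iota> n ` carrier (cmod C n))"
proof -
  let ?F = "\<lambda>n. free_mod R (cells R C n)" and ?\<delta> = "cdiff (semifree R C)"
  note dC = is_complexD(2)[OF C] and \<delta> = cdiff_semifree(1)[of C]
  note dCc = lin_on_simps(1)[OF dC] and \<delta>c = lin_on_simps(1)[OF \<delta>]
  have lmC: "left_module R (cmod C n)" for n by (rule ObjD(1)[OF is_complexD(1)[OF C]])
  have lmF: "left_module R (?F n)" for n by (rule left_module_free)
  have "\<forall>n. \<exists>h. lin R (?F n) (cmod C (n - 1)) h \<and> (\<forall>g \<in> cells R C n. h (free_gen R g) = base g)"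
    by (rule allI, rule free_mod_lift[OF lmC]) (use cells_cases(1) in blast)
  from choice[OF this] obtain \<gamma> where
    "\<forall>n. lin R (?F n) (cmod C (n - 1)) (\<gamma> n) \<and> (\<forall>g \<in> cells R C n. \<gamma> n (free_gen R g) = base g)" ..
  then have \<gamma>: "lin R (?F n) (cmod C (n - 1)) (\<gamma> n)" and \<gamma>g: "g \<in> cells R C n \<Longrightarrow> \<gamma> n (free_gen R g) = base g" for n g
    by blast+
  note \<gamma>c = lin_on_simps(1)[OF \<gamma>]
  have \<gamma>': "lin R (?F (n - 1)) (cmod C (n - 2)) (\<gamma> (n - 1))" and dC': "lin R (cmod C (n - 1)) (cmod C (n - 2)) (cdiff C (n - 1))" for n
    using \<gamma>[of "n - 1"] dC[of "n - 1"] by simp_all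
  have \<gamma>b: "\<gamma> (n - 1) (lincomb (?F (n - 1)) (map (map_prod id (free_gen R)) l)) = lincomb (cmod C (n - 2)) (map (map_prod id base) l)"
    if l: "set l \<subseteq> carrier R \<times> cells R C (n - 1)" for n l
  proof -
    have s: "set (map (map_prod id (free_gen R)) l) \<subseteq> carrier R \<times> carrier (?F (n - 1))"
      by (rule set_map_map_prod[OF l free_gen_closed])
    have "map (map_prod id (\<gamma> (n - 1))) (map (map_prod id (free_gen R)) l) = map (map_prod id (\<lambda>k. \<gamma> (n - 1) (free_gen R k))) l"
      by auto
    also have "\<dots> = map (map_prod id base) l" by (rule lincomb_map_cong[OF l \<gamma>g])
    finally show ?thesis by (simp only: lincomb_lin_on[OF \<gamma>' s])
  qed
  \<comment> \<open>The component from cells to \<open>C\<close> of the square of the differential.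
    On a generator it is the third premise in the definition of a cell.\<close>
  have \<gamma>\<delta>: "cdiff C (n - 1) (\<gamma> n \<phi>) \<oplus>\<^bsub>cmod C (n - 2)\<^esub> \<gamma> (n - 1) (?\<delta> n \<phi>) = \<zero>\<^bsub>cmod C (n - 2)\<^esub>"
    if \<phi>: "\<phi> \<in> carrier (?F n)" for n \<phi>
  proof (rule free_mod_ext[OF lin_on_add lin_on_zero[OF lmF lmC submod_carrier[OF lmF]] _ \<phi>])
    show "lin R (?F n) (cmod C (n - 2)) (\<lambda>\<phi>. cdiff C (n - 1) (\<gamma> n \<phi>))"
      by (rule lin_on_comp[OF \<gamma> dC']) (use \<gamma>c in blast)
    show "lin R (?F n) (cmod C (n - 2)) (\<lambda>\<phi>. \<gamma> (n - 1) (?\<delta> n \<phi>))"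
      by (rule lin_on_comp[OF \<delta> \<gamma>']) (use \<delta>c in blast)
    show "cdiff C (n - 1) (\<gamma> n (free_gen R g)) \<oplus>\<^bsub>cmod C (n - 2)\<^esub> \<gamma> (n - 1) (?\<delta> n (free_gen R g)) = \<zero>\<^bsub>cmod C (n - 2)\<^esub>"
      if g: "g \<in> cells R C n" for g
      using cells_cases(3)[OF g]
      unfolding cdiff_semifree(2)[OF g] \<gamma>g[OF g] bound_val_eq[of g "cells R C (n - 1)"] \<gamma>b[OF cells_cases(2)[OF g]] .
  qed
  \<comment> \<open>A twisted sum: a cell contributes its base through \<open>\<gamma>\<close> and
    its boundary on cells through \<open>?\<delta>\<close>. So \<open>C\<close> is a subcomplex, and
    the quotient is the semifree complex.\<close>
  let ?D = "\<lambda>n x. (cdiff C n (fst x) \<oplus>\<^bsub>cmod C (n - 1)\<^esub> \<gamma> n (snd x), ?\<delta> n (snd x))"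
  let ?E = "\<lparr>cmod = \<lambda>n. pmod (cmod C n) (?F n), cdiff = ?D\<rparr>"
  have lmE: "left_module R (pmod (cmod C n) (?F n))" for n by (rule left_module_pmod[OF lmC lmF])
  note fstE = lin_on_fst[OF lmC lmF submod_carrier[OF lmE]] and sndE = lin_on_snd[OF lmC lmF submod_carrier[OF lmE]]
  have D: "lin R (pmod (cmod C n) (?F n)) (pmod (cmod C (n - 1)) (?F (n - 1))) (?D n)" for n
    by (rule lin_on_Pair[OF lin_on_add]; rule lin_on_comp[OF fstE dC] lin_on_comp[OF sndE \<gamma>] lin_on_comp[OF sndE \<delta>]; force)
  have DD: "?D (n - 1) (?D n x) = \<zero>\<^bsub>pmod (cmod C (n - 2)) (?F (n - 2))\<^esub>" if x: "x \<in> carrier (pmod (cmod C n) (?F n))" for n x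
  proof -
    obtain c \<phi> where x': "x = (c, \<phi>)" "c \<in> carrier (cmod C n)" "\<phi> \<in> carrier (?F n)" using x by auto
    have m: "cdiff C (n - 1) (\<gamma> n \<phi>) \<in> carrier (cmod C (n - 2))"
      using lin_on_simps(1)[OF dC' \<gamma>c[OF x'(3)]] .
    have "cdiff C (n - 1) (cdiff C n c \<oplus>\<^bsub>cmod C (n - 1)\<^esub> \<gamma> n \<phi>) = \<zero>\<^bsub>cmod C (n - 2)\<^esub> \<oplus>\<^bsub>cmod C (n - 2)\<^esub> cdiff C (n - 1) (\<gamma> n \<phi>)"
      using lin_on_simps(2)[OF dC' dCc[OF x'(2)] \<gamma>c[OF x'(3)]] is_complexD(3)[OF C x'(2)] by simp
    also have "\<dots> = cdiff C (n - 1) (\<gamma> n \<phi>)" by (rule left_module_simps(7)[OF lmC m])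
    finally show ?thesis
      using \<gamma>\<delta>[OF x'(3)] cdiff_semifree_square[OF x'(3)] x'(1) by simp
  qed
  have E0ex: "\<exists>y \<in> carrier (pmod (cmod C (n + 1)) (?F (n + 1))). x = ?D (n + 1) y"
    if x: "x \<in> carrier (pmod (cmod C n) (?F n))" "?D n x = \<zero>\<^bsub>pmod (cmod C (n - 1)) (?F (n - 1))\<^esub>" for n x
  proof -
    obtain c \<phi> where x': "x = (c, \<phi>)" "c \<in> carrier (cmod C n)" "\<phi> \<in> carrier (?F n)" using x(1) by auto
    obtain l where l: "set l \<subseteq> carrier R \<times> cells R C n" "\<phi> = lincomb (?F n) (map (map_prod id (free_gen R)) l)"
      using free_mod_lincomb[OF x'(3)] by (elim exE conjE)
    \<comment> \<open>The cell whose boundary is the given cycle \<open>x\<close>; it has degree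
      \<open>n + 1\<close>. The two components of \<open>?D n x = 0\<close> are the two conditions
      that a cell must satisfy.\<close>
    let ?g = "Cell c l"
    have "cell_at R C (n + 1) ?g"
    proof (rule cell_atI)
      show "c \<in> carrier (cmod C (n + 1 - 1))" using x'(2) by simp
      show "\<forall>p \<in> set l. fst p \<in> carrier R \<and> cell_at R C (n + 1 - 1) (snd p)"
        using l(1) by (simp add: cells_def subset_eq mem_Times_iff)
      have 1: "\<gamma> n \<phi> = lincomb (cmod C (n - 1)) (map (map_prod id base) l)"
        using \<gamma>b[of l "n + 1"] l by (simp add: algebra_simps)
      have "cdiff C n c \<oplus>\<^bsub>cmod C (n - 1)\<^esub> \<gamma> n \<phi> = \<zero>\<^bsub>cmod C (n - 1)\<^esub>" using x(2) x'(1) by simp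
      then show "cdiff C (n + 1 - 1) c \<oplus>\<^bsub>cmod C (n + 1 - 2)\<^esub> lincomb (cmod C (n + 1 - 2)) (map (map_prod id base) l) =
          \<zero>\<^bsub>cmod C (n + 1 - 2)\<^esub>"
        unfolding 1 by (simp add: algebra_simps)
      have s: "set (map (map_prod id (free_gen R)) l) \<subseteq> carrier R \<times> carrier (?F n)"
        by (rule set_map_map_prod[OF l(1) free_gen_closed])
      have "map (map_prod id (?\<delta> n)) (map (map_prod id (free_gen R)) l) = map (map_prod id (\<lambda>k. ?\<delta> n (free_gen R k))) l"
        by auto
      also have "\<dots> = map (map_prod id (bound_val R)) l" by (rule lincomb_map_cong[OF l(1) cdiff_semifree(2)])
      finally have "?\<delta> n \<phi> = lincomb (?F (n - 1)) (map (map_prod id (bound_val R)) l)"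
        by (simp only: l(2) lincomb_lin_on[OF \<delta> s])
      then show "lincomb (free_mod R UNIV) (map (map_prod id (bound_val R)) l) = (\<lambda>_. \<zero>)"
        using x(2) x'(1) by (simp add: lincomb_free_mod[of R UNIV _ "cells R C (n - 1)"])
    qed
    then have g: "?g \<in> cells R C (n + 1)" by (simp add: cells_def)
    have "\<gamma> (n + 1) (free_gen R ?g) = c" using \<gamma>g[OF g] by simp
    moreover have "?\<delta> (n + 1) (free_gen R ?g) = \<phi>"
      using cdiff_semifree(2)[OF g] l(2) by (simp add: bound_val_eq[of _ "cells R C n"])
    moreover have "cdiff C (n + 1) \<zero>\<^bsub>cmod C (n + 1)\<^esub> = \<zero>\<^bsub>cmod C n\<^esub>" using complex_zero[OF C, of "n + 1"] by simp
    ultimately have "x = ?D (n + 1) (\<zero>\<^bsub>cmod C (n + 1)\<^esub>, free_gen R ?g)"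
      using x' left_module_simps(7)[OF lmC x'(2)] by simp
    then show ?thesis
      using free_gen_closed[OF g] left_module_simps(2)[OF lmC, of "n + 1"]
      by (intro bexI[of _ "(\<zero>\<^bsub>cmod C (n + 1)\<^esub>, free_gen R ?g)"]) simp_all
  qed
  \<comment> \<open>The copy of \<open>?E\<close> on the type \<open>'m\<close>, as its quotient by
    zero; the smallness of the set of cells is used here.\<close>
  have "\<exists>(Q :: ('r, 'm) mod_complex) q. is_complex R Q \<and> chain_lin R ?E Q q \<and>
    (\<forall>n. q n ` carrier (cmod ?E n) = carrier (cmod Q n)) \<and>
    (\<forall>n. \<forall>x \<in> carrier (cmod ?E n). q n x = \<zero>\<^bsub>cmod Q n\<^esub> \<longleftrightarrow> x \<in> {\<zero>\<^bsub>cmod ?E n\<^esub>})"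
  proof (rule ex_quotient_complex)
    show "lin R (cmod ?E n) (cmod ?E (n - 1)) (cdiff ?E n)" for n using D by simp
    show "fits U (carrier (cmod ?E n))" for n
      using fits_Times[OF ObjD(2)[OF is_complexD(1)[OF C]] fits_free_mod[OF fits_cells[OF C]]] by simp
    show "cdiff ?E (n - 1) (cdiff ?E n x) = \<zero>\<^bsub>cmod ?E (n - 2)\<^esub>" if "x \<in> carrier (cmod ?E n)" for n x
      using DD[of x n] that by simp
    show "subcomplex R ?E (\<lambda>n. {\<zero>\<^bsub>cmod ?E n\<^esub>})"
      unfolding subcomplex_def using submod_zero[OF lmE] lin_on_simps(4)[OF D] by simp
  qed
  then obtain E :: "('r, 'm) mod_complex" and \<theta> where E: "is_complex R E" and \<theta>: "chain_lin R ?E E \<theta>"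
    and surj: "\<forall>n. \<theta> n ` carrier (cmod ?E n) = carrier (cmod E n)"
    and \<theta>0: "\<forall>n. \<forall>x \<in> carrier (cmod ?E n). \<theta> n x = \<zero>\<^bsub>cmod E n\<^esub> \<longleftrightarrow> x \<in> {\<zero>\<^bsub>cmod ?E n\<^esub>}"
    by (elim exE conjE)
  have \<theta>l: "lin R (pmod (cmod C n) (?F n)) (cmod E n) (\<theta> n)" for n using chain_linD(1)[OF \<theta>, of n] by simp
  have \<theta>d: "cdiff E n (\<theta> n x) = \<theta> (n - 1) (?D n x)" if "x \<in> carrier (pmod (cmod C n) (?F n))" for n x
    using chain_linD(2)[OF \<theta>, of x n] that by simp
  have \<theta>z: "x = \<zero>\<^bsub>pmod (cmod C n) (?F n)\<^esub>" if "x \<in> carrier (pmod (cmod C n) (?F n))" "\<theta> n x = \<zero>\<^bsub>cmod E n\<^esub>" for n x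
    using \<theta>0[THEN spec, of n] that by auto
  have E\<theta>: "\<exists>x \<in> carrier (pmod (cmod C n) (?F n)). y = \<theta> n x" if "y \<in> carrier (cmod E n)" for n y
  proof -
    have "y \<in> \<theta> n ` carrier (cmod ?E n)" using surj that by simp
    then show ?thesis by auto
  qed
  have ex: "exact_complex E"
  proof (rule exact_complexI[OF E])
    fix n y assume y: "y \<in> carrier (cmod E n)" "cdiff E n y = \<zero>\<^bsub>cmod E (n - 1)\<^esub>"
    obtain x where x: "x \<in> carrier (pmod (cmod C n) (?F n))" "y = \<theta> n x" using E\<theta>[OF y(1)] by blast
    have "?D n x = \<zero>\<^bsub>pmod (cmod C (n - 1)) (?F (n - 1))\<^esub>"
      by (rule \<theta>z[OF lin_on_simps(1)[OF D x(1)]]) (use \<theta>d[OF x(1)] y(2) x(2) in simp)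
    from E0ex[OF x(1) this] obtain x' where x': "x' \<in> carrier (pmod (cmod C (n + 1)) (?F (n + 1)))"
      "x = ?D (n + 1) x'" by (elim bexE)
    have "\<theta> (n + 1 - 1) (?D (n + 1) x') = y" unfolding x'(2)[symmetric] using x(2) by simp
    then have "y = cdiff E (n + 1) (\<theta> (n + 1) x')" using \<theta>d[OF x'(1)] by simp
    then show "\<exists>z \<in> carrier (cmod E (n + 1)). y = cdiff E (n + 1) z"
      using lin_on_simps(1)[OF \<theta>l x'(1)] by blast
  qed
  have "\<forall>n. \<exists>k. lin R (cmod E n) (?F n) k \<and> (\<forall>x \<in> carrier (pmod (cmod C n) (?F n)). k (\<theta> n x) = snd x)"
  proof
    fix n
    have "snd x = \<zero>\<^bsub>?F n\<^esub>" if "x \<in> carrier (pmod (cmod C n) (?F n))" "\<theta> n x = \<zero>\<^bsub>cmod E n\<^esub>" for x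
      unfolding \<theta>z[OF that] by simp
    from lin_on_factor[OF \<theta>l sndE this] show "\<exists>k. lin R (cmod E n) (?F n) k \<and> (\<forall>x \<in> carrier (pmod (cmod C n) (?F n)). k (\<theta> n x) = snd x)"
      using surj by simp
  qed
  from choice[OF this] obtain \<kappa> where "\<forall>n. lin R (cmod E n) (?F n) (\<kappa> n) \<and>
    (\<forall>x \<in> carrier (pmod (cmod C n) (?F n)). \<kappa> n (\<theta> n x) = snd x)" ..
  then have \<kappa>: "lin R (cmod E n) (?F n) (\<kappa> n)"
    and \<kappa>\<theta>: "x \<in> carrier (pmod (cmod C n) (?F n)) \<Longrightarrow> \<kappa> n (\<theta> n x) = snd x" for n x by blast+
  define \<iota> where "\<iota> n c = \<theta> n (c, \<zero>\<^bsub>?F n\<^esub>)" for n c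
  have \<iota>m: "(c, \<zero>\<^bsub>?F n\<^esub>) \<in> carrier (pmod (cmod C n) (?F n))" if "c \<in> carrier (cmod C n)" for n c
    using that left_module_simps(2)[OF lmF, of n] by simp
  have "chain_lin R C E \<iota>"
    unfolding chain_lin_def
  proof (intro conjI allI ballI)
    show "lin R (cmod C n) (cmod E n) (\<iota> n)" for n
      unfolding \<iota>_def
      by (rule lin_on_comp[OF lin_on_Pair[OF lin_on_id[OF lmC submod_carrier[OF lmC]]
          lin_on_zero[OF lmC lmF submod_carrier[OF lmC]]] \<theta>l]) (use \<iota>m in auto)
    fix n c assume c: "c \<in> carrier (cmod C n)"
    have "?D n (c, \<zero>\<^bsub>?F n\<^esub>) = (cdiff C n c, \<zero>\<^bsub>?F (n - 1)\<^esub>)"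
      using lin_on_simps(4)[OF \<gamma>, of n] lin_on_simps(4)[OF \<delta>, of n] left_module_simps(8)[OF lmC dCc[OF c]] by simp
    then show "cdiff E n (\<iota> n c) = \<iota> (n - 1) (cdiff C n c)"
      using \<theta>d[OF \<iota>m[OF c]] unfolding \<iota>_def by metis
  qed
  moreover have "inj_on (\<iota> n) (carrier (cmod C n))" for n
  proof (rule inj_onI)
    fix x y assume xy: "x \<in> carrier (cmod C n)" "y \<in> carrier (cmod C n)" "\<iota> n x = \<iota> n y"
    have "inj_on (\<theta> n) (carrier (pmod (cmod C n) (?F n)))" by (rule lin_on_inj[OF \<theta>l \<theta>z])
    from inj_onD[OF this _ \<iota>m[OF xy(1)] \<iota>m[OF xy(2)]] xy(3) show "x = y" by (simp add: \<iota>_def)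
  qed
  moreover have "chain_lin R E (semifree R C) \<kappa>"
    unfolding chain_lin_def
  proof (intro conjI allI ballI)
    show "lin R (cmod E n) (cmod (semifree R C) n) (\<kappa> n)" for n using \<kappa> by simp
    fix n y assume "y \<in> carrier (cmod E n)"
    then obtain x where x: "x \<in> carrier (pmod (cmod C n) (?F n))" "y = \<theta> n x" using E\<theta> by blast
    have "\<kappa> (n - 1) (cdiff E n y) = snd (?D n x)"
      unfolding x(2) \<theta>d[OF x(1)] by (rule \<kappa>\<theta>[OF lin_on_simps(1)[OF D x(1)]])
    then show "?\<delta> n (\<kappa> n y) = \<kappa> (n - 1) (cdiff E n y)" using x \<kappa>\<theta> by simp
  qed
  moreover have "\<kappa> n ` carrier (cmod E n) = carrier (?F n)" for n
  proof
    show "carrier (?F n) \<subseteq> \<kappa> n ` carrier (cmod E n)"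
    proof
      fix \<phi> assume "\<phi> \<in> carrier (?F n)"
      then have x: "(\<zero>\<^bsub>cmod C n\<^esub>, \<phi>) \<in> carrier (pmod (cmod C n) (?F n))" using left_module_simps(2)[OF lmC] by simp
      show "\<phi> \<in> \<kappa> n ` carrier (cmod E n)"
        by (rule image_eqI[OF _ lin_on_simps(1)[OF \<theta>l x]]) (use \<kappa>\<theta>[OF x] in simp)
    qed
  qed (use lin_on_simps(1)[OF \<kappa>] in blast)
  moreover have "\<kappa> n y = \<zero>\<^bsub>?F n\<^esub> \<longleftrightarrow> y \<in> \<iota> n ` carrier (cmod C n)" if y: "y \<in> carrier (cmod E n)" for n y
  proof
    obtain c \<phi> where x: "(c, \<phi>) \<in> carrier (pmod (cmod C n) (?F n))" "y = \<theta> n (c, \<phi>)" using E\<theta>[OF y] by auto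
    assume "\<kappa> n y = \<zero>\<^bsub>?F n\<^esub>"
    then have "\<phi> = \<zero>\<^bsub>?F n\<^esub>" using \<kappa>\<theta>[OF x(1)] x(2) by simp
    then show "y \<in> \<iota> n ` carrier (cmod C n)" using x by (auto simp: \<iota>_def)
  next
    assume "y \<in> \<iota> n ` carrier (cmod C n)"
    then obtain c where "c \<in> carrier (cmod C n)" "y = \<theta> n (c, \<zero>\<^bsub>?F n\<^esub>)" by (auto simp: \<iota>_def)
    then show "\<kappa> n y = \<zero>\<^bsub>?F n\<^esub>" using \<kappa>\<theta>[OF \<iota>m] by simp
  qed
  ultimately show ?thesis
    using E ex by (intro exI[of _ E] exI[of _ \<iota>] exI[of _ \<kappa>]) simp
qed

text \<open>A map on the kernel of \<open>M \<rightarrow> Q\<close> is extended to the preimage of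
  \<open>Q1\<close> by \<open>ext1\<close>, and from there to \<open>M\<close> by
  \<open>ext2\<close>. The exact sequence of \<open>Q1\<close>, \<open>Q\<close>, \<open>Q2\<close>
  is encoded in \<open>aj\<close>, \<open>bj\<close>, \<open>ab\<close> through maps out of
  \<open>E\<close> and \<open>Y\<close>, the form in which the quotients \<open>E / C\<close>,
  \<open>Y / C\<close>, \<open>Y / E\<close> present themselves. The element type of
  \<open>Q1\<close> is free, for the semifree complex.\<close>

lemma complex_extends_comp:
  fixes E Y Q Q2 B :: "('r, 'm) mod_complex" and Q1 :: "('r, 'b) mod_complex"
  assumes E: "is_complex R E" and Y: "is_complex R Y" and Q: "is_complex R Q" and Q2: "is_complex R Q2"
    and j: "chain_lin R E Y j" and \<kappa>: "chain_lin R E Q1 \<kappa>" "\<And>n. \<kappa> n ` carrier (cmod E n) = carrier (cmod Q1 n)"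
    and a: "chain_lin R Y Q a" "\<And>n. a n ` carrier (cmod Y n) = carrier (cmod Q n)"
    and b: "chain_lin R Y Q2 b" "\<And>n. b n ` carrier (cmod Y n) = carrier (cmod Q2 n)"
    and aj: "\<And>n x. x \<in> carrier (cmod E n) \<Longrightarrow> a n (j n x) = \<zero>\<^bsub>cmod Q n\<^esub> \<longleftrightarrow> \<kappa> n x = \<zero>\<^bsub>cmod Q1 n\<^esub>"
    and bj: "\<And>n y. y \<in> carrier (cmod Y n) \<Longrightarrow> b n y = \<zero>\<^bsub>cmod Q2 n\<^esub> \<longleftrightarrow> y \<in> j n ` carrier (cmod E n)"
    and ab: "\<And>n y. y \<in> carrier (cmod Y n) \<Longrightarrow> a n y = \<zero>\<^bsub>cmod Q n\<^esub> \<Longrightarrow> b n y = \<zero>\<^bsub>cmod Q2 n\<^esub>"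
    and ext1: "complex_extends R Q1 B" and ext2: "complex_extends R Q2 B"
  shows "complex_extends R Q B"
  unfolding complex_extends_def
proof (intro allI impI, elim conjE)
  fix M :: "('r, 'm) mod_complex" and p f
  let ?K = "\<lambda>n. {x \<in> carrier (cmod M n). p n x = \<zero>\<^bsub>cmod Q n\<^esub>}"
  assume M: "is_complex R M" and p: "chain_lin R M Q p"
    and surj: "\<forall>n. p n ` carrier (cmod M n) = carrier (cmod Q n)" and f: "chain_on R M ?K B f"
  note al = chain_linD(1)[OF a(1)] and bl = chain_linD(1)[OF b(1)] and jl = chain_linD(1)[OF j]
    and \<kappa>l = chain_linD(1)[OF \<kappa>(1)] and pl = chain_linD(1)[OF p]
  note ac = lin_on_simps(1)[OF al] and jc = lin_on_simps(1)[OF jl] and pc = lin_on_simps(1)[OF pl]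
  \<comment> \<open>The projection of \<open>Q\<close> onto \<open>Q2\<close>, induced by
    \<open>b\<close> because the kernel of \<open>a\<close> is contained in that of
    \<open>b\<close>.\<close>
  have "\<forall>n. \<exists>t. lin R (cmod Q n) (cmod Q2 n) t \<and> (\<forall>y \<in> carrier (cmod Y n). t (a n y) = b n y)"
    using lin_on_factor[OF al bl ab] a(2) by simp
  from choice[OF this] obtain t where
    "\<forall>n. lin R (cmod Q n) (cmod Q2 n) (t n) \<and> (\<forall>y \<in> carrier (cmod Y n). t n (a n y) = b n y)" ..
  then have t: "lin R (cmod Q n) (cmod Q2 n) (t n)" and ta: "y \<in> carrier (cmod Y n) \<Longrightarrow> t n (a n y) = b n y" for n y
    by blast+
  have aY: "\<exists>y \<in> carrier (cmod Y n). z = a n y" if "z \<in> carrier (cmod Q n)" for n z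
    using that a(2)[of n] by blast
  have tch: "chain_lin R Q Q2 t"
    unfolding chain_lin_def
  proof (intro conjI allI ballI)
    fix n z assume "z \<in> carrier (cmod Q n)"
    then obtain y where y: "y \<in> carrier (cmod Y n)" "z = a n y" using aY by blast
    have dy: "cdiff Y n y \<in> carrier (cmod Y (n - 1))" by (rule lin_on_simps(1)[OF is_complexD(2)[OF Y] y(1)])
    show "cdiff Q2 n (t n z) = t (n - 1) (cdiff Q n z)"
      using ta[OF y(1)] ta[OF dy] chain_linD(2)[OF a(1) y(1)] chain_linD(2)[OF b(1) y(1)] y(2) by simp
  qed (rule t)
  have p2: "chain_lin R M Q2 (\<lambda>n x. t n (p n x))" by (rule chain_lin_comp[OF p tch])
  have surj2: "\<forall>n. (\<lambda>x. t n (p n x)) ` carrier (cmod M n) = carrier (cmod Q2 n)"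
  proof
    fix n
    have "(\<lambda>x. t n (p n x)) ` carrier (cmod M n) = t n ` a n ` carrier (cmod Y n)"
      using surj a(2) by (simp flip: image_image)
    also have "\<dots> = b n ` carrier (cmod Y n)" using ta by (simp add: image_image)
    finally show "(\<lambda>x. t n (p n x)) ` carrier (cmod M n) = carrier (cmod Q2 n)" using b(2) by simp
  qed
  let ?N = "\<lambda>n. {x \<in> carrier (cmod M n). t n (p n x) = \<zero>\<^bsub>cmod Q2 n\<^esub>}"
  have NS: "subcomplex R M ?N" by (rule subcomplex_kernel[OF M p2 complex_zero[OF Q2]])
  let ?MN = "restrict_complex M ?N"
  have MN: "is_complex R ?MN" by (rule restrict_complex[OF M NS])
  have NSm: "submod R (cmod M n) (?N n)" for n using NS by (simp add: subcomplex_def)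
  have lmM: "left_module R (cmod M n)" for n by (rule ObjD(1)[OF is_complexD(1)[OF M]])
  have ajl: "lin R (cmod E n) (cmod Q n) (\<lambda>x. a n (j n x))" for n
    by (rule lin_on_comp[OF jl al]) (use jc in blast)
  \<comment> \<open>The image of \<open>E\<close> in \<open>Q\<close> is the kernel of
    \<open>t\<close>. Since \<open>a \<circ> j\<close> and \<open>\<kappa>\<close> have the same
    kernel by \<open>aj\<close>, \<open>s\<close> identifies this image with
    \<open>Q1\<close>.\<close>
  have "\<forall>n. \<exists>s. lin_on R (cmod Q n) ((\<lambda>x. a n (j n x)) ` carrier (cmod E n)) (cmod Q1 n) s \<and>
      (\<forall>x \<in> carrier (cmod E n). s (a n (j n x)) = \<kappa> n x)"
    using lin_on_factor[OF ajl \<kappa>l] aj by simp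
  from choice[OF this] obtain s where
    "\<forall>n. lin_on R (cmod Q n) ((\<lambda>x. a n (j n x)) ` carrier (cmod E n)) (cmod Q1 n) (s n) \<and>
      (\<forall>x \<in> carrier (cmod E n). s n (a n (j n x)) = \<kappa> n x)" ..
  then have s: "lin_on R (cmod Q n) ((\<lambda>x. a n (j n x)) ` carrier (cmod E n)) (cmod Q1 n) (s n)"
    and saj: "x \<in> carrier (cmod E n) \<Longrightarrow> s n (a n (j n x)) = \<kappa> n x" for n x by blast+
  have NE: "\<exists>x \<in> carrier (cmod E n). p n m = a n (j n x)" if m: "m \<in> ?N n" for n m
  proof -
    obtain y where y: "y \<in> carrier (cmod Y n)" "p n m = a n y" using aY[OF pc, of m n] m by blast
    have "y \<in> j n ` carrier (cmod E n)" using bj[OF y(1)] ta[OF y(1)] y(2) m by simp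
    then show ?thesis using y(2) by blast
  qed
  let ?\<rho> = "\<lambda>n m. s n (p n m)"
  have \<rho>: "chain_lin R ?MN Q1 ?\<rho>"
    unfolding chain_lin_def
  proof (intro conjI allI ballI)
    fix n
    have "lin_on R (cmod M n) (?N n) (cmod Q1 n) (?\<rho> n)"
      by (rule lin_on_comp[OF lin_on_subset[OF pl NSm] s]) (use NE in auto)
    then show "lin R (cmod ?MN n) (cmod Q1 n) (?\<rho> n)" by (simp add: lin_on_submod_source[OF lmM NSm])
    fix m assume "m \<in> carrier (cmod ?MN n)"
    then have m: "m \<in> ?N n" by simp
    then obtain x where x: "x \<in> carrier (cmod E n)" "p n m = a n (j n x)" using NE by blast
    have dx: "cdiff E n x \<in> carrier (cmod E (n - 1))" by (rule lin_on_simps(1)[OF is_complexD(2)[OF E] x(1)])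
    have mM: "m \<in> carrier (cmod M n)" using m by simp
    have "p (n - 1) (cdiff M n m) = a (n - 1) (j (n - 1) (cdiff E n x))"
      using chain_linD(2)[OF p mM, symmetric] chain_linD(2)[OF a(1) jc[OF x(1)]] chain_linD(2)[OF j x(1)] x(2) by simp
    then have "?\<rho> (n - 1) (cdiff M n m) = \<kappa> (n - 1) (cdiff E n x)" using saj[OF dx] by simp
    then show "cdiff Q1 n (?\<rho> n m) = ?\<rho> (n - 1) (cdiff ?MN n m)"
      using saj[OF x(1)] x(2) chain_linD(2)[OF \<kappa>(1) x(1)] m by simp
  qed
  have \<rho>surj: "\<forall>n. ?\<rho> n ` carrier (cmod ?MN n) = carrier (cmod Q1 n)"
  proof
    fix n
    show "?\<rho> n ` carrier (cmod ?MN n) = carrier (cmod Q1 n)"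
    proof
      show "carrier (cmod Q1 n) \<subseteq> ?\<rho> n ` carrier (cmod ?MN n)"
      proof
        fix z assume "z \<in> carrier (cmod Q1 n)"
        then have "z \<in> \<kappa> n ` carrier (cmod E n)" using \<kappa>(2) by simp
        then obtain x where x: "x \<in> carrier (cmod E n)" "z = \<kappa> n x" by blast
        have "a n (j n x) \<in> p n ` carrier (cmod M n)" using surj ac[OF jc[OF x(1)]] by simp
        then obtain m where m: "m \<in> carrier (cmod M n)" "p n m = a n (j n x)" by force
        have "t n (p n m) = \<zero>\<^bsub>cmod Q2 n\<^esub>"
          using ta[OF jc[OF x(1)]] bj[OF jc[OF x(1)]] m(2) x(1) by simp
        then have "m \<in> carrier (cmod ?MN n)" using m(1) by simp
        moreover have "z = ?\<rho> n m" using saj[OF x(1)] m(2) x(2) by simp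
        ultimately show "z \<in> ?\<rho> n ` carrier (cmod ?MN n)" by blast
      qed
    qed (use lin_on_simps(1)[OF chain_linD(1)[OF \<rho>]] in blast)
  qed
  \<comment> \<open>On \<open>?N\<close> the kernel of \<open>?\<rho>\<close> is the whole kernel of
    \<open>p\<close>, so \<open>f\<close> poses the extension problem for \<open>Q1\<close> without
    change.\<close>
  have ker: "{m \<in> carrier (cmod ?MN n). ?\<rho> n m = \<zero>\<^bsub>cmod Q1 n\<^esub>} = ?K n" for n
  proof (intro equalityI subsetI)
    fix m assume "m \<in> {m \<in> carrier (cmod ?MN n). ?\<rho> n m = \<zero>\<^bsub>cmod Q1 n\<^esub>}"
    then have m: "m \<in> ?N n" "?\<rho> n m = \<zero>\<^bsub>cmod Q1 n\<^esub>" by auto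
    then obtain x where x: "x \<in> carrier (cmod E n)" "p n m = a n (j n x)" using NE by blast
    then show "m \<in> ?K n" using aj[OF x(1)] saj[OF x(1)] m by simp
  next
    fix m assume m: "m \<in> ?K n"
    then have mN: "m \<in> ?N n" using lin_on_simps(4)[OF t] by simp
    then obtain x where x: "x \<in> carrier (cmod E n)" "p n m = a n (j n x)" using NE by blast
    then show "m \<in> {m \<in> carrier (cmod ?MN n). ?\<rho> n m = \<zero>\<^bsub>cmod Q1 n\<^esub>}"
      using aj[OF x(1)] saj[OF x(1)] m mN by simp
  qed
  have KN: "?K n \<subseteq> ?N n" for n using lin_on_simps(4)[OF t] by auto
  have "chain_on R ?MN (\<lambda>n. {m \<in> carrier (cmod ?MN n). ?\<rho> n m = \<zero>\<^bsub>cmod Q1 n\<^esub>}) B f"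
    unfolding ker chain_on_def
  proof (intro conjI allI ballI)
    fix n
    show "lin_on R (cmod ?MN n) (?K n) (cmod B n) (f n)"
      using chain_onD(1)[OF f, of n] KN by (simp add: lin_on_submod_source[OF lmM NSm])
    fix x assume x: "x \<in> ?K n"
    then have "x \<in> ?N n" using KN by blast
    then show "cdiff B n (f n x) = f (n - 1) (cdiff ?MN n x)" using chain_onD(2)[OF f x] by simp
  qed
  from ext1[unfolded complex_extends_def, THEN spec, THEN spec, THEN spec, THEN mp,
      OF conjI[OF MN conjI[OF \<rho> conjI[OF \<rho>surj this]]]]
  obtain F1 where F1: "chain_lin R ?MN B F1"
    "\<forall>n. \<forall>x \<in> carrier (cmod ?MN n). ?\<rho> n x = \<zero>\<^bsub>cmod Q1 n\<^esub> \<longrightarrow> F1 n x = f n x" by (elim exE conjE)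
  have F1f: "F1 n x = f n x" if "x \<in> ?K n" for n x
    using F1(2) that ker[of n] by blast
  have "chain_on R M ?N B F1"
    unfolding chain_on_def
  proof (intro conjI allI ballI)
    fix n
    show "lin_on R (cmod M n) (?N n) (cmod B n) (F1 n)"
      using chain_linD(1)[OF F1(1), of n] by (simp add: lin_on_submod_source[OF lmM NSm])
    fix x assume x: "x \<in> ?N n"
    then show "cdiff B n (F1 n x) = F1 (n - 1) (cdiff M n x)" using chain_linD(2)[OF F1(1), of x n] by simp
  qed
  from ext2[unfolded complex_extends_def, THEN spec, THEN spec, THEN spec, THEN mp,
      OF conjI[OF M conjI[OF p2 conjI[OF surj2 this]]]]
  obtain F where F: "chain_lin R M B F"
    "\<forall>n. \<forall>x \<in> carrier (cmod M n). t n (p n x) = \<zero>\<^bsub>cmod Q2 n\<^esub> \<longrightarrow> F n x = F1 n x" by (elim exE conjE)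
  have "F n x = f n x" if "x \<in> carrier (cmod M n)" "p n x = \<zero>\<^bsub>cmod Q n\<^esub>" for n x
  proof -
    have x: "x \<in> ?K n" using that by simp
    then have "x \<in> ?N n" using KN by blast
    then have "F n x = F1 n x" using F(2) by simp
    then show ?thesis using F1f[OF x] by simp
  qed
  then show "\<exists>F. chain_lin R M B F \<and> (\<forall>n. \<forall>x \<in> carrier (cmod M n). p n x = \<zero>\<^bsub>cmod Q n\<^esub> \<longrightarrow> F n x = f n x)"
    using F(1) by blast
qed

end

text \<open>The hypotheses on the class in terms of linear maps and elements. The last one joins an
  embedding into the class with the extension property of its cokernel.\<close>

locale preenveloping_class = ring_universe R U
  for R :: "('r, 'x) ring_scheme" (structure) and U :: "'m itself" +
  fixes \<L> :: "('r, 'm) module set"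
  assumes class_Obj: "\<L> \<subseteq> Obj (R_Mod R)"
    and class_iso: "\<And>M N \<theta>. M \<in> \<L> \<Longrightarrow> N \<in> Obj (R_Mod R) \<Longrightarrow> lin R M N \<theta> \<Longrightarrow>
      bij_betw \<theta> (carrier M) (carrier N) \<Longrightarrow> N \<in> \<L>"
    and class_coker: "\<And>A B v C c. A \<in> \<L> \<Longrightarrow> B \<in> \<L> \<Longrightarrow> lin R A B v \<Longrightarrow> inj_on v (carrier A) \<Longrightarrow>
      C \<in> Obj (R_Mod R) \<Longrightarrow> lin R B C c \<Longrightarrow> c ` carrier B = carrier C \<Longrightarrow>
      (\<forall>x \<in> carrier B. c x = \<zero>\<^bsub>C\<^esub> \<longleftrightarrow> x \<in> v ` carrier A) \<Longrightarrow> C \<in> \<L>"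
    and class_preenvelope: "\<And>M :: ('r, 'm) module. M \<in> Obj (R_Mod R) \<Longrightarrow> \<exists>L i A a. L \<in> \<L> \<and> lin R M L i \<and> inj_on i (carrier M) \<and>
      A \<in> Obj (R_Mod R) \<and> lin R L A a \<and> a ` carrier L = carrier A \<and>
      (\<forall>x \<in> carrier L. a x = \<zero>\<^bsub>A\<^esub> \<longleftrightarrow> x \<in> i ` carrier M) \<and> (\<forall>L' \<in> \<L>. extends R A L')"
begin

text \<open>The last clause speaks of every cokernel \<open>b\<close> of \<open>j\<close> instead of
  one produced here, so that it applies to a quotient of \<open>Y\<close> formed later. It holds
  because the cycles of such a cokernel are isomorphic to the cokernels \<open>A n\<close> of the
  chosen preenvelopes.\<close>

lemma ex_exact_preenvelope:
  fixes E :: "('r, 'm) mod_complex"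
  assumes E: "is_complex R E" "exact_complex E"
  shows "\<exists>(Y :: ('r, 'm) mod_complex) j. is_complex R Y \<and> exact_complex Y \<and> (\<forall>n. cycles Y n \<in> \<L>) \<and> chain_lin R E Y j \<and>
    (\<forall>n. inj_on (j n) (carrier (cmod E n))) \<and>
    (\<forall>(A :: ('r, 'm) mod_complex) b (B :: ('r, 'm) mod_complex). is_complex R A \<and> chain_lin R Y A b \<and> (\<forall>n. b n ` carrier (cmod Y n) = carrier (cmod A n)) \<and>
       (\<forall>n. \<forall>y \<in> carrier (cmod Y n). b n y = \<zero>\<^bsub>cmod A n\<^esub> \<longleftrightarrow> y \<in> j n ` carrier (cmod E n)) \<and>
       is_complex R B \<and> exact_complex B \<and> (\<forall>n. cycles B n \<in> \<L>) \<longrightarrow> complex_extends R A B)"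
proof -
  note dE = is_complexD(2)[OF E(1)] and EO = is_complexD(1)[OF E(1)]
  let ?Z = "\<lambda>n. {x \<in> carrier (cmod E n). cdiff E n x = \<zero>\<^bsub>cmod E (n - 1)\<^esub>}"
  have Z: "submod R (cmod E n) (?Z n)" for n by (rule submod_kernel[OF dE])
  have lmE: "left_module R (cmod E n)" for n by (rule ObjD(1)[OF EO])
  have cyc: "cycles E n = (cmod E n)\<lparr>carrier := ?Z n\<rparr>" for n by (simp add: cycles_def)
  have im: "cdiff E n ` carrier (cmod E n) = ?Z (n - 1)" for n
    using E(2)[unfolded exact_complex_def, rule_format, of "n - 1"] by (simp add: cycles_def)
  \<comment> \<open>One predicate for four dependent witnesses, which can then be chosen one after
    another for all degrees; \<open>extn\<close> below has the same purpose.\<close>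
  define preenv where "preenv n L i A a \<longleftrightarrow> L \<in> \<L> \<and> lin R (cycles E n) L i \<and> inj_on i (?Z n) \<and>
      A \<in> Obj (R_Mod R) \<and> lin R L A a \<and> a ` carrier L = carrier A \<and>
      (\<forall>x \<in> carrier L. a x = \<zero>\<^bsub>A\<^esub> \<longleftrightarrow> x \<in> i ` ?Z n) \<and> (\<forall>L' \<in> \<L>. extends R A L')" for n L i A a
  have "\<forall>n. \<exists>L i A a. preenv n L i A a"
  proof
    fix n
    have O: "cycles E n \<in> Obj (R_Mod R)" unfolding cyc by (rule Obj_submod[OF EO Z])
    show "\<exists>L i A a. preenv n L i A a"
      using class_preenvelope[OF O] by (simp only: preenv_def) (simp add: cycles_def)
  qed
  from choice[OF this] obtain L where "\<forall>n. \<exists>i A a. preenv n (L n) i A a" ..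
  from choice[OF this] obtain i where "\<forall>n. \<exists>A a. preenv n (L n) (i n) A a" ..
  from choice[OF this] obtain A where "\<forall>n. \<exists>a. preenv n (L n) (i n) (A n) a" ..
  from choice[OF this] obtain a where "\<forall>n. preenv n (L n) (i n) (A n) (a n)" ..
  then have L: "L n \<in> \<L>" and i0: "lin R (cycles E n) (L n) (i n)" and iinj: "inj_on (i n) (?Z n)"
    and a: "lin R (L n) (A n) (a n)" and asurj: "a n ` carrier (L n) = carrier (A n)"
    and aker: "\<forall>x \<in> carrier (L n). a n x = \<zero>\<^bsub>A n\<^esub> \<longleftrightarrow> x \<in> i n ` ?Z n"
    and Aext: "\<forall>L' \<in> \<L>. extends R (A n) L'" for n unfolding preenv_def by blast+
  have LO: "L n \<in> Obj (R_Mod R)" for n using L class_Obj by blast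
  have i: "lin_on R (cmod E n) (?Z n) (L n) (i n)" for n
    using i0[of n] unfolding cyc by (simp add: lin_on_submod_source[OF lmE Z])
  note ic = lin_on_simps(1)[OF i]
  have emb: "\<exists>L \<in> \<L>. \<exists>j. lin R M L j \<and> inj_on j (carrier M)" if "M \<in> Obj (R_Mod R)" for M :: "('r, 'm) module"
    using class_preenvelope[OF that] by blast
  \<comment> \<open>Through the image of \<open>i n\<close>, which is the kernel of
    \<open>L n \<rightarrow> A n\<close>, a map on the cycles becomes an extension problem for
    \<open>A n\<close>. The special property of the preenvelope solves it for targets in the
    class.\<close>
  have ext: "\<exists>\<gamma>. lin R (L n) G \<gamma> \<and> (\<forall>z \<in> ?Z n. \<gamma> (i n z) = g z)"
    if G: "G \<in> \<L>" and g: "lin_on R (cmod E n) (?Z n) G g" for n G g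
  proof -
    have "g z = \<zero>\<^bsub>G\<^esub>" if z: "z \<in> ?Z n" "i n z = \<zero>\<^bsub>L n\<^esub>" for z
    proof -
      have "z = \<zero>\<^bsub>cmod E n\<^esub>"
        by (rule inj_onD[OF iinj _ z(1) submod_simps(2)[OF lmE Z]]) (simp only: z(2) lin_on_simps(4)[OF i])
      then show ?thesis using lin_on_simps(4)[OF g] by simp
    qed
    from lin_on_factor[OF i g this] obtain k where k: "lin_on R (L n) (i n ` ?Z n) G k" "\<forall>z \<in> ?Z n. k (i n z) = g z"
      by blast
    have "i n ` ?Z n = {x \<in> carrier (L n). a n x = \<zero>\<^bsub>A n\<^esub>}" using aker ic by blast
    with k(1) have k': "lin_on R (L n) {x \<in> carrier (L n). a n x = \<zero>\<^bsub>A n\<^esub>} G k" by simp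
    have "extends R (A n) G" using Aext G by blast
    from extendsD[OF this ObjD[OF LO] a asurj k'] obtain \<gamma> where \<gamma>: "lin R (L n) G \<gamma>"
      "\<forall>x \<in> carrier (L n). a n x = \<zero>\<^bsub>A n\<^esub> \<longrightarrow> \<gamma> x = k x" by blast
    have "\<gamma> (i n z) = g z" if z: "z \<in> ?Z n" for z
    proof -
      have "a n (i n z) = \<zero>\<^bsub>A n\<^esub>" using aker[of n] ic[OF z] z by blast
      then have "\<gamma> (i n z) = k (i n z)" using \<gamma>(2) ic[OF z] by blast
      then show ?thesis using k(2) z by simp
    qed
    then show ?thesis using \<gamma>(1) by blast
  qed
  define extn where "extn n Y l \<pi> j \<longleftrightarrow> (Y :: ('r, 'm) module) \<in> Obj (R_Mod R) \<and> lin R (L n) Y l \<and> inj_on l (carrier (L n)) \<and>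
    lin R Y (L (n - 1)) \<pi> \<and> \<pi> ` carrier Y = carrier (L (n - 1)) \<and>
    (\<forall>y \<in> carrier Y. \<pi> y = \<zero>\<^bsub>L (n - 1)\<^esub> \<longleftrightarrow> y \<in> l ` carrier (L n)) \<and> lin R (cmod E n) Y j \<and> inj_on j (carrier (cmod E n)) \<and>
    (\<forall>x \<in> carrier (cmod E n). cdiff E n x = \<zero>\<^bsub>cmod E (n - 1)\<^esub> \<longrightarrow> l (i n x) = j x) \<and>
    (\<forall>x \<in> carrier (cmod E n). \<pi> (j x) = i (n - 1) (cdiff E n x))" for n Y l \<pi> j
  have "\<forall>n. \<exists>Y l \<pi> j. extn n Y l \<pi> j"
  proof
    fix n
    \<comment> \<open>By exactness the boundaries coming from degree \<open>n\<close> are the cycles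
      of degree \<open>n - 1\<close>; this is why the third term of the extension in degree
      \<open>n\<close> is \<open>L (n - 1)\<close>.\<close>
    have i': "lin_on R (cmod E (n - 1)) (cdiff E n ` carrier (cmod E n)) (L (n - 1)) (i (n - 1))"
      unfolding im by (rule i)
    have ext': "\<exists>\<gamma>. lin R (L (n - 1)) G \<gamma> \<and> (\<forall>z \<in> cdiff E n ` carrier (cmod E n). \<gamma> (i (n - 1) z) = g z)"
      if "G \<in> \<L>" "lin_on R (cmod E (n - 1)) (cdiff E n ` carrier (cmod E n)) G g" for G g
      using ext[OF that(1), of "n - 1" g] that(2) unfolding im .
    show "\<exists>Y l \<pi> j. extn n Y l \<pi> j"
      unfolding extn_def
      by (rule ex_extension_along[OF EO L LO class_Obj emb class_coker dE i iinj i' ext']) assumption+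
  qed
  from choice[OF this] obtain Y where "\<forall>n. \<exists>l \<pi> j. extn n (Y n) l \<pi> j" ..
  from choice[OF this] obtain l where "\<forall>n. \<exists>\<pi> j. extn n (Y n) (l n) \<pi> j" ..
  from choice[OF this] obtain \<pi> where "\<forall>n. \<exists>j. extn n (Y n) (l n) (\<pi> n) j" ..
  from choice[OF this] obtain j where "\<forall>n. extn n (Y n) (l n) (\<pi> n) (j n)" ..
  then have YO: "Y n \<in> Obj (R_Mod R)" and l: "lin R (L n) (Y n) (l n)" and linj: "inj_on (l n) (carrier (L n))"
    and \<pi>: "lin R (Y n) (L (n - 1)) (\<pi> n)" and \<pi>surj: "\<pi> n ` carrier (Y n) = carrier (L (n - 1))"
    and \<pi>ker: "\<forall>y \<in> carrier (Y n). \<pi> n y = \<zero>\<^bsub>L (n - 1)\<^esub> \<longleftrightarrow> y \<in> l n ` carrier (L n)"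
    and j: "lin R (cmod E n) (Y n) (j n)" and jinj: "inj_on (j n) (carrier (cmod E n))"
    and li: "\<forall>x \<in> carrier (cmod E n). cdiff E n x = \<zero>\<^bsub>cmod E (n - 1)\<^esub> \<longrightarrow> l n (i n x) = j n x"
    and \<pi>j: "\<forall>x \<in> carrier (cmod E n). \<pi> n (j n x) = i (n - 1) (cdiff E n x)" for n unfolding extn_def by blast+
  note lc = lin_on_simps(1)[OF l] and \<pi>c = lin_on_simps(1)[OF \<pi>] and jc = lin_on_simps(1)[OF j]
  have \<pi>l: "\<pi> n (l n x) = \<zero>\<^bsub>L (n - 1)\<^esub>" if "x \<in> carrier (L n)" for n x using \<pi>ker lc[OF that] that by blast
  have l0: "x = \<zero>\<^bsub>L n\<^esub>" if "x \<in> carrier (L n)" "l n x = \<zero>\<^bsub>Y n\<^esub>" for n x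
    by (rule inj_onD[OF linj _ that(1) left_module_simps(2)[OF ObjD(1)[OF LO]]])
      (simp only: that(2) lin_on_simps(4)[OF l])
  \<comment> \<open>The extensions are spliced along
    \<open>Y n \<rightarrow> L (n - 1) \<rightarrow> Y (n - 1)\<close>. The second map is injective,
    so the cycles are the kernel of \<open>\<pi> n\<close>, the copy of \<open>L n\<close>.\<close>
  let ?d = "\<lambda>n y. l (n - 1) (\<pi> n y)"
  have d: "lin R (Y n) (Y (n - 1)) (?d n)" for n by (rule lin_on_comp[OF \<pi> l]) (use \<pi>c in blast)
  let ?Y = "\<lparr>cmod = Y, cdiff = \<lambda>n. restrict (?d n) (carrier (Y n))\<rparr>"
  have Y: "is_complex R ?Y"
  proof (rule is_complexI[of Y ?d])
    fix n y assume "y \<in> carrier (Y n)"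
    then have "?d (n - 1) (?d n y) = l (n - 1 - 1) \<zero>\<^bsub>L (n - 1 - 1)\<^esub>" using \<pi>l \<pi>c by simp
    also have "\<dots> = \<zero>\<^bsub>Y (n - 1 - 1)\<^esub>" by (rule lin_on_simps(4)[OF l])
    finally show "?d (n - 1) (?d n y) = \<zero>\<^bsub>Y (n - 2)\<^esub>" by simp
  qed (rule YO, rule d)
  have dY0: "cdiff ?Y n y = \<zero>\<^bsub>Y (n - 1)\<^esub> \<longleftrightarrow> y \<in> l n ` carrier (L n)" if y: "y \<in> carrier (Y n)" for n y
  proof -
    have "cdiff ?Y n y = \<zero>\<^bsub>Y (n - 1)\<^esub> \<longleftrightarrow> \<pi> n y = \<zero>\<^bsub>L (n - 1)\<^esub>"
      using l0[OF \<pi>c[OF y]] lin_on_simps(4)[OF l] y by auto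
    then show ?thesis using \<pi>ker y by blast
  qed
  have lsub: "l n ` carrier (L n) \<subseteq> carrier (Y n)" for n using lc by blast
  have Lim: "\<exists>y \<in> carrier (Y (n + 1)). l n x = cdiff ?Y (n + 1) y" if "x \<in> carrier (L n)" for n x
  proof -
    have "x \<in> \<pi> (n + 1) ` carrier (Y (n + 1))" using \<pi>surj[of "n + 1"] that by simp
    then obtain y where "y \<in> carrier (Y (n + 1))" "x = \<pi> (n + 1) y" by blast
    then show ?thesis by (intro bexI[of _ y]) simp_all
  qed
  have Yex: "exact_complex ?Y"
  proof (rule exact_complexI[OF Y])
    fix n y assume y: "y \<in> carrier (cmod ?Y n)" "cdiff ?Y n y = \<zero>\<^bsub>cmod ?Y (n - 1)\<^esub>"
    then obtain x where "x \<in> carrier (L n)" "y = l n x" using dY0[of y n] by auto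
    then show "\<exists>z \<in> carrier (cmod ?Y (n + 1)). y = cdiff ?Y (n + 1) z" using Lim by simp
  qed
  have Ycyc: "carrier (cycles ?Y n) = l n ` carrier (L n)" for n
    using dY0[of _ n] lsub[of n] by (auto simp: cycles_def)
  have Ycyc\<L>: "cycles ?Y n \<in> \<L>" for n
  proof (rule class_iso[OF L])
    have S: "submod R (Y n) (l n ` carrier (L n))"
      by (rule submod_image[OF l submod_carrier[OF ObjD(1)[OF LO]]]) simp
    have c: "cycles ?Y n = (Y n)\<lparr>carrier := l n ` carrier (L n)\<rparr>"
      using Ycyc[of n] by (simp add: cycles_def)
    show "cycles ?Y n \<in> Obj (R_Mod R)" unfolding c by (rule Obj_submod[OF YO S])
    show "lin R (L n) (cycles ?Y n) (l n)" unfolding c using l by (simp add: lin_on_submod_target[OF ObjD(1)[OF YO] S])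
    show "bij_betw (l n) (carrier (L n)) (carrier (cycles ?Y n))" using linj Ycyc by (simp add: bij_betw_def)
  qed
  have dZ: "cdiff E n x \<in> ?Z (n - 1)" if "x \<in> carrier (cmod E n)" for n x using im[of n] that by blast
  have jch: "chain_lin R E ?Y j"
    unfolding chain_lin_def
  proof (intro conjI allI ballI)
    show "lin R (cmod E n) (cmod ?Y n) (j n)" for n using j by simp
    fix n x assume x: "x \<in> carrier (cmod E n)"
    have "l (n - 1) (i (n - 1) (cdiff E n x)) = j (n - 1) (cdiff E n x)" using li dZ[OF x] by blast
    then show "cdiff ?Y n (j n x) = j (n - 1) (cdiff E n x)" using \<pi>j jc[OF x] x by simp
  qed
  \<comment> \<open>Inside \<open>Y n\<close> the submodules \<open>L n\<close> and
    \<open>E n\<close> meet exactly in the cycles of \<open>E\<close>. Hence the map from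
    \<open>L n\<close> to the quotient of \<open>Y\<close> by \<open>E\<close> has the same kernel
    as \<open>a n\<close>.\<close>
  have jl: "l n x \<in> j n ` carrier (cmod E n) \<longleftrightarrow> x \<in> i n ` ?Z n" if x: "x \<in> carrier (L n)" for n x
  proof
    assume "l n x \<in> j n ` carrier (cmod E n)"
    then obtain e where e: "e \<in> carrier (cmod E n)" "l n x = j n e" by blast
    have "i (n - 1) (cdiff E n e) = \<zero>\<^bsub>L (n - 1)\<^esub>" using \<pi>j \<pi>l[OF x] e by metis
    then have "cdiff E n e = \<zero>\<^bsub>cmod E (n - 1)\<^esub>"
      by (intro inj_onD[OF iinj _ dZ[OF e(1)] submod_simps(2)[OF lmE Z]]) (simp only: lin_on_simps(4)[OF i])
    then have eZ: "e \<in> ?Z n" using e(1) by simp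
    then have "l n (i n e) = l n x" using li e by simp
    then have "i n e = x" using inj_onD[OF linj _ ic[OF eZ] x] by blast
    then show "x \<in> i n ` ?Z n" using eZ by blast
  next
    assume "x \<in> i n ` ?Z n"
    then obtain e where "e \<in> ?Z n" "x = i n e" by blast
    then show "l n x \<in> j n ` carrier (cmod E n)" using li by auto
  qed
  have ext_coker: "complex_extends R Q B"
    if Q: "is_complex R Q" and b: "chain_lin R ?Y Q b" and bsurj: "\<forall>n. b n ` carrier (cmod ?Y n) = carrier (cmod Q n)"
      and bker: "\<forall>n. \<forall>y \<in> carrier (cmod ?Y n). b n y = \<zero>\<^bsub>cmod Q n\<^esub> \<longleftrightarrow> y \<in> j n ` carrier (cmod E n)"
      and B: "is_complex R B" "exact_complex B" "\<forall>n. cycles B n \<in> \<L>"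
    for Q B :: "('r, 'm) mod_complex" and b
  proof -
    have bl: "lin R (Y n) (cmod Q n) (b n)" for n using chain_linD(1)[OF b, of n] by simp
    have bd: "cdiff Q n (b n y) = b (n - 1) (cdiff ?Y n y)" if "y \<in> carrier (Y n)" for n y
      using chain_linD(2)[OF b, of y n] that by simp
    have bker': "b n y = \<zero>\<^bsub>cmod Q n\<^esub> \<longleftrightarrow> y \<in> j n ` carrier (cmod E n)" if "y \<in> carrier (Y n)" for n y
      using bker[THEN spec, of n] that by simp
    have dYc: "cdiff ?Y n y \<in> carrier (Y (n - 1))" if "y \<in> carrier (Y n)" for n y
      using lin_on_simps(1)[OF is_complexD(2)[OF Y], of y n] that by simp
    \<comment> \<open>A cycle \<open>q\<close> of the quotient lifts to some \<open>y\<close> whose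
      differential lies in \<open>E\<close>. By \<open>jl\<close> it comes from a cycle of
      \<open>E\<close>, and by exactness from the differential of some \<open>e\<close>. Then
      \<open>y - j e\<close> lies in the copy of \<open>L n\<close> and still maps to
      \<open>q\<close>.\<close>
    have Qcyc: "\<exists>x \<in> carrier (L n). q = b n (l n x)"
      if q: "q \<in> carrier (cmod Q n)" "cdiff Q n q = \<zero>\<^bsub>cmod Q (n - 1)\<^esub>" for n q
    proof -
      have "q \<in> b n ` carrier (Y n)" using bsurj[THEN spec, of n] q(1) by simp
      then obtain y where y: "y \<in> carrier (Y n)" "q = b n y" by blast
      have "cdiff ?Y n y \<in> j (n - 1) ` carrier (cmod E (n - 1))"
        using bker'[OF dYc[OF y(1)]] bd[OF y(1)] q(2) y(2) by simp
      then have "l (n - 1) (\<pi> n y) \<in> j (n - 1) ` carrier (cmod E (n - 1))" using y(1) by simp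
      then have "\<pi> n y \<in> i (n - 1) ` ?Z (n - 1)" using jl[OF \<pi>c[OF y(1)]] by blast
      then obtain e where e: "e \<in> carrier (cmod E n)" "\<pi> n y = i (n - 1) (cdiff E n e)"
        unfolding im[symmetric] by blast
      let ?y = "y \<ominus>\<^bsub>Y n\<^esub> j n e"
      have c: "?y \<in> carrier (Y n)" using left_module_simps(4)[OF ObjD(1)[OF YO] y(1) jc[OF e(1)]] .
      have "\<pi> n ?y = \<zero>\<^bsub>L (n - 1)\<^esub>"
        using lin_on_simps(6)[OF \<pi> y(1) jc[OF e(1)]] \<pi>j e
          left_module_minus_eq_zero[OF ObjD(1)[OF LO] \<pi>c[OF y(1)] \<pi>c[OF jc[OF e(1)]]] by simp
      then obtain x where x: "x \<in> carrier (L n)" "?y = l n x" using \<pi>ker c by blast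
      have bj: "b n (j n e) = \<zero>\<^bsub>cmod Q n\<^esub>" using bker'[OF jc[OF e(1)]] e(1) by blast
      have "b n ?y = q \<ominus>\<^bsub>cmod Q n\<^esub> \<zero>\<^bsub>cmod Q n\<^esub>"
        using lin_on_simps(6)[OF bl y(1) jc[OF e(1)]] bj y(2) by simp
      then have "b n ?y = q"
        using q(1) left_module_simps(8,15,16)[OF ObjD(1)[OF is_complexD(1)[OF Q]]] by simp
      then show ?thesis using x by metis
    qed
    have Qex: "exact_complex Q"
    proof (rule exact_complexI[OF Q])
      fix n q assume "q \<in> carrier (cmod Q n)" "cdiff Q n q = \<zero>\<^bsub>cmod Q (n - 1)\<^esub>"
      from Qcyc[OF this] obtain x where x: "x \<in> carrier (L n)" "q = b n (l n x)" by blast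
      obtain y where y: "y \<in> carrier (Y (n + 1))" "l n x = cdiff ?Y (n + 1) y" using Lim[OF x(1)] by blast
      have "q = b (n + 1 - 1) (cdiff ?Y (n + 1) y)" unfolding y(2)[symmetric] using x(2) by simp
      also have "\<dots> = cdiff Q (n + 1) (b (n + 1) y)" by (rule bd[OF y(1), symmetric])
      finally show "\<exists>z \<in> carrier (cmod Q (n + 1)). q = cdiff Q (n + 1) z"
        using lin_on_simps(1)[OF bl y(1)] by blast
    qed
    have "extends R (cycles Q n) L'" if L': "L' \<in> \<L>" for n L'
    proof -
      have S: "submod R (cmod Q n) {q \<in> carrier (cmod Q n). cdiff Q n q = \<zero>\<^bsub>cmod Q (n - 1)\<^esub>}"
        by (rule submod_kernel[OF is_complexD(2)[OF Q]])
      have bll: "lin R (L n) (cmod Q n) (\<lambda>x. b n (l n x))" by (rule lin_on_comp[OF l bl]) (use lc in blast)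
      have blker: "b n (l n x) = \<zero>\<^bsub>cmod Q n\<^esub> \<longleftrightarrow> a n x = \<zero>\<^bsub>A n\<^esub>" if x: "x \<in> carrier (L n)" for x
        using bker'[OF lc[OF x]] jl[OF x] aker x by blast
      have "b n (l n x) = \<zero>\<^bsub>cmod Q n\<^esub>" if "x \<in> carrier (L n)" "a n x = \<zero>\<^bsub>A n\<^esub>" for x
        using blker that by blast
      \<comment> \<open>\<open>k\<close> identifies \<open>A n\<close> with the cycles of
        \<open>Q\<close>: both are images of \<open>L n\<close> under maps with the same kernel, and
        \<open>Qcyc\<close> shows that every cycle is reached.\<close>
      from lin_on_factor[OF a bll this] obtain k where k: "lin R (A n) (cmod Q n) k"
        "\<forall>x \<in> carrier (L n). k (a n x) = b n (l n x)" using asurj by auto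
      have kim: "k ` carrier (A n) = {q \<in> carrier (cmod Q n). cdiff Q n q = \<zero>\<^bsub>cmod Q (n - 1)\<^esub>}"
      proof -
        have "k ` carrier (A n) = (\<lambda>x. b n (l n x)) ` carrier (L n)"
          unfolding asurj[symmetric] image_image using k(2) by simp
        also have "\<dots> = {q \<in> carrier (cmod Q n). cdiff Q n q = \<zero>\<^bsub>cmod Q (n - 1)\<^esub>}"
        proof (intro equalityI subsetI)
          fix q assume "q \<in> (\<lambda>x. b n (l n x)) ` carrier (L n)"
          then obtain x where x: "x \<in> carrier (L n)" "q = b n (l n x)" by blast
          have "cdiff ?Y n (l n x) = \<zero>\<^bsub>Y (n - 1)\<^esub>" using dY0[OF lc[OF x(1)]] x(1) by blast
          then have "cdiff Q n q = \<zero>\<^bsub>cmod Q (n - 1)\<^esub>"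
            using bd[OF lc[OF x(1)]] x(2) lin_on_simps(4)[OF bl, of "n - 1"] by simp
          then show "q \<in> {q \<in> carrier (cmod Q n). cdiff Q n q = \<zero>\<^bsub>cmod Q (n - 1)\<^esub>}"
            using lin_on_simps(1)[OF bl lc[OF x(1)]] x(2) by simp
        qed (use Qcyc in blast)
        finally show ?thesis .
      qed
      have kinj: "inj_on k (carrier (A n))"
      proof (rule lin_on_inj[OF k(1)])
        fix z assume z: "z \<in> carrier (A n)" "k z = \<zero>\<^bsub>cmod Q n\<^esub>"
        then have "z \<in> a n ` carrier (L n)" using asurj by simp
        then obtain x where x: "x \<in> carrier (L n)" "z = a n x" by blast
        then show "z = \<zero>\<^bsub>A n\<^esub>" using blker[OF x(1)] k(2) z(2) by simp
      qed
      show ?thesis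
      proof (rule extends_iso)
        show "extends R (A n) L'" using Aext L' by blast
        show "lin R (A n) (cycles Q n) k"
          using k(1) kim
          by (simp add: cycles_def lin_on_submod_target[OF ObjD(1)[OF is_complexD(1)[OF Q]] S])
        show "bij_betw k (carrier (A n)) (carrier (cycles Q n))"
          using kinj kim by (simp add: bij_betw_def cycles_def)
      qed
    qed
    then show ?thesis using complex_extends_exact[OF Q Qex B(1,2)] B(3) by blast
  qed
  show ?thesis
  proof (rule exI[of _ ?Y], rule exI[of _ j], intro conjI allI impI; (elim conjE)?)
    show "is_complex R ?Y" "exact_complex ?Y" "chain_lin R E ?Y j" by (fact Y Yex jch)+
    show "cycles ?Y n \<in> \<L>" "inj_on (j n) (carrier (cmod E n))" for n by (fact Ycyc\<L> jinj)+
  qed (rule ext_coker)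
qed

text \<open>The cokernel \<open>Q\<close> of \<open>C \<rightarrow> Y\<close> is handled through
  \<open>Q2\<close>, the quotient of \<open>Y\<close> by \<open>E\<close>: the extension problem for
  \<open>Q\<close> splits into one for the semifree complex and one for \<open>Q2\<close>.\<close>

theorem special_preenvelope_complex:
  fixes C :: "('r, 'm) mod_complex"
  assumes C: "is_complex R C"
  shows "\<exists>X f. special_preenvelope (Complexes R) (tilde R \<L>) C X f"
proof -
  from ex_exact_extension[OF C] obtain E :: "('r, 'm) mod_complex" and \<iota> \<kappa> where E: "is_complex R E" "exact_complex E"
    and \<iota>: "chain_lin R C E \<iota>" "\<forall>n. inj_on (\<iota> n) (carrier (cmod C n))"
    and \<kappa>: "chain_lin R E (semifree R C) \<kappa>" "\<forall>n. \<kappa> n ` carrier (cmod E n) = carrier (cmod (semifree R C) n)"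
    and \<kappa>ker: "\<forall>n. \<forall>x \<in> carrier (cmod E n). \<kappa> n x = \<zero>\<^bsub>cmod (semifree R C) n\<^esub> \<longleftrightarrow> x \<in> \<iota> n ` carrier (cmod C n)"
    by (elim exE conjE)
  from ex_exact_preenvelope[OF E] obtain Y :: "('r, 'm) mod_complex" and j where Y: "is_complex R Y" "exact_complex Y" "\<forall>n. cycles Y n \<in> \<L>"
    and j: "chain_lin R E Y j" "\<forall>n. inj_on (j n) (carrier (cmod E n))"
    and ext: "\<forall>(A :: ('r, 'm) mod_complex) b (B :: ('r, 'm) mod_complex). is_complex R A \<and> chain_lin R Y A b \<and> (\<forall>n. b n ` carrier (cmod Y n) = carrier (cmod A n)) \<and>
       (\<forall>n. \<forall>y \<in> carrier (cmod Y n). b n y = \<zero>\<^bsub>cmod A n\<^esub> \<longleftrightarrow> y \<in> j n ` carrier (cmod E n)) \<and>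
       is_complex R B \<and> exact_complex B \<and> (\<forall>n. cycles B n \<in> \<L>) \<longrightarrow> complex_extends R A B"
    by (elim exE conjE)
  let ?u = "\<lambda>n x. j n (\<iota> n x)"
  have u: "chain_lin R C Y ?u" by (rule chain_lin_comp[OF \<iota>(1) j(1)])
  note \<iota>c = lin_on_simps(1)[OF chain_linD(1)[OF \<iota>(1)]] and jc = lin_on_simps(1)[OF chain_linD(1)[OF j(1)]]
  from ex_quotient_is_complex[OF Y(1) subcomplex_image[OF C Y(1) u]] obtain Q :: "('r, 'm) mod_complex" and a where Q: "is_complex R Q"
    and a: "chain_lin R Y Q a" "\<forall>n. a n ` carrier (cmod Y n) = carrier (cmod Q n)"
    and aker: "\<forall>n. \<forall>y \<in> carrier (cmod Y n). a n y = \<zero>\<^bsub>cmod Q n\<^esub> \<longleftrightarrow> y \<in> ?u n ` carrier (cmod C n)"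
    by (elim exE conjE)
  from ex_quotient_is_complex[OF Y(1) subcomplex_image[OF E(1) Y(1) j(1)]] obtain Q2 :: "('r, 'm) mod_complex" and b where Q2: "is_complex R Q2"
    and b: "chain_lin R Y Q2 b" "\<forall>n. b n ` carrier (cmod Y n) = carrier (cmod Q2 n)"
    and bker: "\<forall>n. \<forall>y \<in> carrier (cmod Y n). b n y = \<zero>\<^bsub>cmod Q2 n\<^esub> \<longleftrightarrow> y \<in> j n ` carrier (cmod E n)"
    by (elim exE conjE)
  have Qext: "complex_extends R Q B" if B: "B \<in> tilde R \<L>" for B
  proof (rule complex_extends_comp[OF E(1) Y(1) Q Q2 j(1) \<kappa>(1) _ a(1) _ b(1)])
    have B': "is_complex R B" "exact_complex B" "\<forall>n. cycles B n \<in> \<L>" using B by (auto simp: tilde_def)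
    show "complex_extends R (semifree R C) B" by (rule complex_extends_semifree[OF B'(1,2)])
    show "complex_extends R Q2 B" using ext Q2 b bker B' by blast
    show "a n (j n x) = \<zero>\<^bsub>cmod Q n\<^esub> \<longleftrightarrow> \<kappa> n x = \<zero>\<^bsub>cmod (semifree R C) n\<^esub>" if x: "x \<in> carrier (cmod E n)" for n x
    proof -
      have "j n x \<in> ?u n ` carrier (cmod C n) \<longleftrightarrow> x \<in> \<iota> n ` carrier (cmod C n)"
      proof
        assume "j n x \<in> ?u n ` carrier (cmod C n)"
        then obtain c where c: "c \<in> carrier (cmod C n)" "j n x = j n (\<iota> n c)" by blast
        then have "x = \<iota> n c" using inj_onD[OF j(2)[THEN spec, of n] c(2) x \<iota>c[OF c(1)]] by simp
        then show "x \<in> \<iota> n ` carrier (cmod C n)" using c(1) by blast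
      qed auto
      then show ?thesis using aker jc[OF x] \<kappa>ker x by blast
    qed
    show "b n y = \<zero>\<^bsub>cmod Q2 n\<^esub>" if "y \<in> carrier (cmod Y n)" "a n y = \<zero>\<^bsub>cmod Q n\<^esub>" for n y
    proof -
      have "y \<in> ?u n ` carrier (cmod C n)" using aker that by blast
      then have "y \<in> j n ` carrier (cmod E n)" using \<iota>c by blast
      then show ?thesis using bker that(1) by blast
    qed
    show "\<kappa> n ` carrier (cmod E n) = carrier (cmod (semifree R C) n)" for n using \<kappa>(2) by blast
    show "a n ` carrier (cmod Y n) = carrier (cmod Q n)" for n using a(2) by blast
    show "b n ` carrier (cmod Y n) = carrier (cmod Q2 n)" for n using b(2) by blast
    show "b n y = \<zero>\<^bsub>cmod Q2 n\<^esub> \<longleftrightarrow> y \<in> j n ` carrier (cmod E n)" if "y \<in> carrier (cmod Y n)" for n y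
      using bker that by blast
  qed
  let ?f = "\<lambda>n. restrict (?u n) (carrier (cmod C n))" and ?q = "\<lambda>n. restrict (a n) (carrier (cmod Y n))"
  have f: "?f \<in> chain_map R C Y" by (rule chain_lin_map[OF u C])
  have q: "?q \<in> chain_map R Y Q" by (rule chain_lin_map[OF a(1) Y(1)])
  have "special_preenvelope (Complexes R) (tilde R \<L>) C Y ?f"
    unfolding special_preenvelope_def
  proof (intro conjI exI ballI)
    show "Y \<in> tilde R \<L>" using Y by (simp add: tilde_def)
    show "monic (Complexes R) C Y ?f"
    proof (rule Complexes_inj_monic[OF f])
      fix n
      show "inj_on (?f n) (carrier (cmod C n))"
      proof (rule inj_onI)
        fix x y assume xy: "x \<in> carrier (cmod C n)" "y \<in> carrier (cmod C n)" "?f n x = ?f n y"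
        have "\<iota> n x = \<iota> n y" by (rule inj_onD[OF j(2)[THEN spec, of n] _ \<iota>c \<iota>c]) (use xy in simp_all)
        then show "x = y" using inj_onD[OF \<iota>(2)[THEN spec, of n]] xy by blast
      qed
    qed
    show "is_cokernel (Complexes R) C Y ?f Q ?q"
    proof (rule Complexes_is_cokernel[OF C Y(1) Q f q])
      show "?q n ` carrier (cmod Y n) = carrier (cmod Q n)" for n using a(2) by simp
      show "?q n y = \<zero>\<^bsub>cmod Q n\<^esub> \<longleftrightarrow> y \<in> ?f n ` carrier (cmod C n)" if "y \<in> carrier (cmod Y n)" for n y
        using aker that by simp
    qed
    fix B assume B: "B \<in> tilde R \<L>"
    then have "is_complex R B" by (simp add: tilde_def)
    then show "trivial_group (Ext1 (Complexes R) Q B)" by (rule Ext1_of_complex_extends[OF Q _ Qext[OF B]])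
  qed
  then show ?thesis by blast
qed

end

text \<open>Translates the categorical hypotheses into statements on elements; in particular the
  vanishing of \<open>Ext1\<close> on the cokernel of a special preenvelope becomes
  \<open>extends\<close>.\<close>

lemma (in ring_universe) preenveloping_class:
  fixes \<L> :: "('r, 'm) module set"
  assumes cls: "module_class R \<L>" and cores: "injectively_coresolving (R_Mod R) \<L>"
    and pre: "special_preenveloping (R_Mod R) \<L>"
  shows "preenveloping_class R U \<L>"
proof (rule preenveloping_class.intro[OF ring_universe_axioms], rule preenveloping_class_axioms.intro)
  show \<L>: "\<L> \<subseteq> Obj (R_Mod R)" using cls by (simp add: module_class_def)
  show "N \<in> \<L>" if M: "M \<in> \<L>" and N: "N \<in> Obj (R_Mod R)" and \<theta>: "lin R M N \<theta>"
    and bij: "bij_betw \<theta> (carrier M) (carrier N)" for M N \<theta>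
  proof -
    have im: "\<theta> ` carrier M = carrier N" using bij by (simp add: bij_betw_def)
    have MO: "M \<in> Obj (R_Mod R)" using M \<L> by blast
    note lmM = ObjD(1)[OF MO]
    have ker: "x = \<zero>\<^bsub>M\<^esub>" if "x \<in> carrier M" "\<theta> x = \<zero>\<^bsub>N\<^esub>" for x
      by (rule inj_onD[OF bij_betw_imp_inj_on[OF bij] _ that(1) left_module_simps(2)[OF lmM]])
        (simp only: that(2) lin_on_simps(4)[OF \<theta>])
    from lin_on_factor[OF \<theta> lin_on_id[OF lmM submod_carrier[OF lmM]] ker] im
    obtain k where k: "lin R N M k" "\<forall>x \<in> carrier M. k (\<theta> x) = x" by auto
    have \<theta>k: "\<theta> (k y) = y" if "y \<in> carrier N" for y
    proof -
      have "y \<in> \<theta> ` carrier M" using im that by simp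
      then show ?thesis using k(2) by auto
    qed
    have "isomorphic (R_Mod R) M N"
      unfolding isomorphic_def
    proof (intro bexI conjI)
      show "restrict \<theta> (carrier M) \<in> Hom (R_Mod R) M N" using lin_mod_hom[OF \<theta>] by simp
      show "restrict k (carrier N) \<in> Hom (R_Mod R) N M" using lin_mod_hom[OF k(1)] by simp
      show "Comp (R_Mod R) M (restrict k (carrier N)) (restrict \<theta> (carrier M)) = preadditive.Id (R_Mod R) M"
        using k(2) lin_on_simps(1)[OF \<theta>] by (auto intro!: restrict_ext)
      show "Comp (R_Mod R) N (restrict \<theta> (carrier M)) (restrict k (carrier N)) = preadditive.Id (R_Mod R) N"
        using \<theta>k lin_on_simps(1)[OF k(1)] by (auto intro!: restrict_ext)
    qed
    then show ?thesis using cls M N unfolding module_class_def by blast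
  qed
  show "C \<in> \<L>" if A: "A \<in> \<L>" and B: "B \<in> \<L>" and v: "lin R A B v" "inj_on v (carrier A)"
    and C: "C \<in> Obj (R_Mod R)" and c: "lin R B C c" "c ` carrier B = carrier C"
    and ker: "\<forall>x \<in> carrier B. c x = \<zero>\<^bsub>C\<^esub> \<longleftrightarrow> x \<in> v ` carrier A" for A B v C c
  proof -
    have AO: "A \<in> Obj (R_Mod R)" and BO: "B \<in> Obj (R_Mod R)" using A B \<L> by auto
    have vH: "restrict v (carrier A) \<in> mod_hom R A B" and cH: "restrict c (carrier B) \<in> mod_hom R B C"
      using lin_mod_hom[OF v(1)] lin_mod_hom[OF c(1)] by auto
    have "monic (R_Mod R) A B (restrict v (carrier A))"
      by (rule R_Mod_inj_monic[OF vH]) (use v(2) in simp)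
    moreover have "is_cokernel (R_Mod R) A B (restrict v (carrier A)) C (restrict c (carrier B))"
      by (rule R_Mod_is_cokernel[OF AO BO C vH cH]) (use c(2) ker in simp_all)
    ultimately show ?thesis using cores A B unfolding injectively_coresolving_def by blast
  qed
  show "\<exists>L i A a. L \<in> \<L> \<and> lin R M L i \<and> inj_on i (carrier M) \<and>
      A \<in> Obj (R_Mod R) \<and> lin R L A a \<and> a ` carrier L = carrier A \<and>
      (\<forall>x \<in> carrier L. a x = \<zero>\<^bsub>A\<^esub> \<longleftrightarrow> x \<in> i ` carrier M) \<and> (\<forall>L' \<in> \<L>. extends R A L')"
    if M: "M \<in> Obj (R_Mod R)" for M :: "('r, 'm) module"
  proof -
    obtain L i where "special_preenvelope (R_Mod R) \<L> M L i"
      using pre M unfolding special_preenveloping_def by blast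
    then obtain A a where L: "L \<in> \<L>" and i: "monic (R_Mod R) M L i" and a: "is_cokernel (R_Mod R) M L i A a"
      and triv: "\<forall>L' \<in> \<L>. trivial_group (Ext1 (R_Mod R) A L')"
      unfolding special_preenvelope_def by blast
    have LO: "L \<in> Obj (R_Mod R)" using L \<L> by blast
    have iH: "i \<in> mod_hom R M L" using i by (simp add: monic_def)
    note cok = R_Mod_cokernel[OF M LO iH a]
    have "\<forall>L' \<in> \<L>. extends R A L'"
      using extends_of_Ext1[OF cok(1)] triv \<L> by blast
    then show ?thesis
      using L mod_hom_lin(1)[OF iH M LO] R_Mod_monic_inj[OF M LO i] cok by blast
  qed
qed

theorem theorem3p12:
  fixes R :: "('r, 'x) ring_scheme" and \<L> :: "('r, 'm) module set"
  assumes "ring R"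
    and "universe_for TYPE('m) R"
    and "module_class R \<L>"
    and "injectively_coresolving (R_Mod R) \<L>"
    and "special_preenveloping (R_Mod R) \<L>"
  shows "\<forall>C \<in> Obj (Complexes R). \<exists>X f. special_preenvelope (Complexes R) (tilde R \<L>) C X f"
proof -
  interpret ring_universe R "TYPE('m)"
    by (rule ring_universe.intro[OF assms(1)]) (rule ring_universe_axioms.intro[OF assms(2)])
  interpret preenveloping_class R "TYPE('m)" \<L>
    by (rule preenveloping_class[OF assms(3-5)])
  show ?thesis using special_preenvelope_complex by simp
qed

end
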